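(* Let $X$ be a non-empty set and let $N: X\times X\to \mathbb Z_+$ be a uniformly bounded function, i.e., there exists $M\in\mathbb Z_+$ such that $N(a,b)\le M$ for all $a,b\in X$. Then every homomorphic image $V$ of the free Novikov conformal algebra $\mathrm{NovConf}(X;N)$ is special.
   Context: Throughout, $\Bbbk$ is a field of characteristic zero, $\mathbb Z_+$ is the set of nonnegative integers, and "commutative" algebra means associative and commutative. Novikov algebra: a linear space over $\Bbbk$ with a bilinear operation $\circ$ such that $(x\circ y)\circ z - x\circ (y\circ z) = (x\circ z)\circ y - x\circ (z\circ y)$ and $x\circ (y\circ z) = y\circ (x\circ z)$. Conformal algebra: a linear space $C$ over $\Bbbk$ with a linear operator $\partial: C\to C$ and a bilinear operation $(\cdot\,{}_{(\lambda)}\,\cdot): C\times C\to C[\lambda]$ ($\lambda$ a formal variable) such that $(\partial a\,{}_{(\lambda)}\, b) = -\lambda (a\,{}_{(\lambda)}\, b)$ and $\partial(a\,{}_{(\lambda)}\, b) = (a\,{}_{(\lambda)}\,\partial b) - \lambda (a\,{}_{(\lambda)}\, b)$ for all $a,b\in C$. The $n$-products $(a\,{}_{(n)}\,b)\in C$ are defined by $(a\,{}_{(\lambda)}\, b)=\sum_{n\ge 0}\frac{\lambda^n}{n!}(a\,{}_{(n)}\,b)$. Homomorphisms of conformal algebras are linear maps commuting with $\partial$ and preserving all $n$-products; subalgebras are subspaces closed under $\partial$ and all $n$-products. In identities, $(a\,{}_{(-\partial-\lambda)}\,b)$ denotes the result of substituting the operator $-\partial-\lambda$ for the variable $\lambda$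 in $(a\,{}_{(\lambda)}\,b)=\sum_{n\ge 0} \frac{\lambda^n}{n!}(a\,{}_{(n)}\,b)$, i.e. $\sum_{n\ge 0}\frac{(-\partial-\lambda)^n}{n!}(a\,{}_{(n)}\,b)$. Commutative conformal algebra: a conformal algebra satisfying $a\,{}_{(\lambda)}\,(b\,{}_{(\mu)}\,c) = (a\,{}_{(\lambda)}\,b)\,{}_{(\lambda+\mu)}\,c$ and $(a\,{}_{(\lambda)}\,b)=(b\,{}_{(-\partial-\lambda)}\,a)$. Novikov conformal algebra: a conformal algebra satisfying $(a\,{}_{(\lambda)}\,b)\,{}_{(\lambda+\mu)}\,c - a\,{}_{(\lambda)}\,(b\,{}_{(\mu)}\,c) = (a\,{}_{(\lambda)}\,c)\,{}_{(-\partial-\mu)}\,b - a\,{}_{(\lambda)}\,(c\,{}_{(-\partial-\mu)}\,b)$ and $a\,{}_{(\lambda)}\,(b\,{}_{(\mu)}\,c)=b\,{}_{(\mu)}\,(a\,{}_{(\lambda)}\,c)$. A derivation of a conformal algebra $C$ is a linear map $D:C\to C$ with $D\partial=\partial D$ and $D(a\,{}_{(\lambda)}\,b)=(D(a)\,{}_{(\lambda)}\,b)+(a\,{}_{(\lambda)}\,D(b))$. If $C$ is a commutative conformal algebra with a derivation $D$, then $C^{(D)}$ denotes the Novikov conformal algebra on the same space $C$ with the same $\partial$ and the operation $(a\,{}_{\circ(\lambda)}\,b)=(Da\,{}_{(\lambda)}\,b)$. A Novikov conformal algebra $V$ is special if there exist a commutative conformal algebra $C$ and a derivation $D$ of $C$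 such that $V$ is isomorphic to a subalgebra of $C^{(D)}$. Free Novikov conformal algebra: given a nonempty set $X$ and $N:X\times X\to\mathbb Z_+$, let $B=X\times\mathbb Z=\{a(n)\mid a\in X,n\in\mathbb Z\}$, let $\mathrm{Nov}\langle B\rangle$ be the free Novikov algebra over $\Bbbk$ generated by $B$, and let $\mathcal N(X;N)=\mathrm{Nov}\langle B\rangle/J(N)$, where $J(N)$ is the ideal generated by all elements $\sum_{s\ge 0}(-1)^s\binom{N(a,b)}{s}a(n-s)\circ b(m+s)$, $a,b\in X$, $n,m\in\mathbb Z$. For $a\in X$ put $a(z)=\sum_{n\in\mathbb Z}a(n)z^{-n-1}\in\mathcal N(X;N)[[z,z^{-1}]]$ (two-sided infinite formal series). Then $\mathrm{NovConf}(X;N)$ is the smallest subspace of $\mathcal N(X;N)[[z,z^{-1}]]$ containing all $a(z)$, $a\in X$, and closed under $\partial=d/dz$ and all $n$-products $(f\,{}_{(n)}\,g)(z)=\mathrm{Res}_{w=0}\, f(w)\circ g(z)(w-z)^n$, $n\in\mathbb Z_+$, where $\mathrm{Res}_{w=0}$ is the coefficient of $w^{-1}$; with these operations it is a Novikov conformal algebra. *)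

theory Defs
  imports "HOL.Hull" "HOL-Algebra.Module" "HOL-Algebra.QuotRing"
begin

section \<open>Conformal algebras\<close>

text \<open>
  Linear spaces over a field \<open>R\<close> are \<open>HOL-Algebra\<close> modules over \<open>R\<close>.  The record
  \<open>module\<close> inherits the fields \<open>mult\<close> and \<open>one\<close>: nonassociative algebras use
  \<open>mult\<close> for their product and ignore \<open>one\<close>; conformal algebras ignore both.

  \<open>lam C a b n\<close> is the coefficient of \<open>\<lambda>\<^sup>n\<close> in the \<open>\<lambda>\<close>-product of \<open>a\<close> and \<open>b\<close>, so that an
  element of \<open>C[\<lambda>]\<close> is a finitely supported function \<open>nat \<Rightarrow> 'a\<close>.
\<close>

record ('k, 'a) conf_alg = "('k, 'a) module" +
  der :: "'a \<Rightarrow> 'a"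
  lam :: "'a \<Rightarrow> 'a \<Rightarrow> nat \<Rightarrow> 'a"

definition linear_map ::
  "('k, 'm) ring_scheme \<Rightarrow> ('k, 'a, 'n) module_scheme \<Rightarrow> ('k, 'b, 'p) module_scheme
    \<Rightarrow> ('a \<Rightarrow> 'b) \<Rightarrow> bool"
  where "linear_map R M M' f \<longleftrightarrow>
    f \<in> carrier M \<rightarrow> carrier M' \<and>
    (\<forall>x\<in>carrier M. \<forall>y\<in>carrier M. f (x \<oplus>\<^bsub>M\<^esub> y) = f x \<oplus>\<^bsub>M'\<^esub> f y) \<and>
    (\<forall>k\<in>carrier R. \<forall>x\<in>carrier M. f (k \<odot>\<^bsub>M\<^esub> x) = k \<odot>\<^bsub>M'\<^esub> f x)"

text \<open>Multiplication by \<open>\<lambda>\<close> on \<open>C[\<lambda>]\<close>.\<close>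

definition lam_shift :: "('k, 'a, 'm) module_scheme \<Rightarrow> (nat \<Rightarrow> 'a) \<Rightarrow> nat \<Rightarrow> 'a"
  where "lam_shift C p n = (case n of 0 \<Rightarrow> \<zero>\<^bsub>C\<^esub> | Suc m \<Rightarrow> p m)"

locale conformal_algebra = module R C
  for R :: "('k, 'm) ring_scheme" and C :: "('k, 'a, 'n) conf_alg_scheme" +
  assumes der_linear: "linear_map R C C (der C)"
    and lam_linear_left:
      "b \<in> carrier C \<Longrightarrow> linear_map R C C (\<lambda>a. lam C a b n)"
    and lam_linear_right:
      "a \<in> carrier C \<Longrightarrow> linear_map R C C (\<lambda>b. lam C a b n)"
    and lam_polynomial:
      "a \<in> carrier C \<Longrightarrow> b \<in> carrier C \<Longrightarrow> finite {n. lam C a b n \<noteq> \<zero>\<^bsub>C\<^esub>}"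
    and lam_der_left:
      "a \<in> carrier C \<Longrightarrow> b \<in> carrier C \<Longrightarrow>
        lam C (der C a) b n = \<ominus>\<^bsub>C\<^esub> lam_shift C (lam C a b) n"
    and der_lam:
      "a \<in> carrier C \<Longrightarrow> b \<in> carrier C \<Longrightarrow>
        der C (lam C a b n) = lam C a (der C b) n \<ominus>\<^bsub>C\<^esub> lam_shift C (lam C a b) n"

definition nprod :: "('k, 'a, 'n) conf_alg_scheme \<Rightarrow> nat \<Rightarrow> 'a \<Rightarrow> 'a \<Rightarrow> 'a"
  where "nprod C n a b = [(fact n :: nat)] \<cdot>\<^bsub>C\<^esub> lam C a b n"

definition conf_hom ::
  "('k, 'm) ring_scheme \<Rightarrow> ('k, 'a, 'n) conf_alg_scheme \<Rightarrow> ('k, 'b, 'p) conf_alg_scheme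
    \<Rightarrow> ('a \<Rightarrow> 'b) set"
  where "conf_hom R C C' = {f. linear_map R C C' f \<and>
    (\<forall>a\<in>carrier C. f (der C a) = der C' (f a)) \<and>
    (\<forall>a\<in>carrier C. \<forall>b\<in>carrier C. \<forall>n. f (nprod C n a b) = nprod C' n (f a) (f b))}"

definition conf_subalgebra ::
  "('k, 'm) ring_scheme \<Rightarrow> ('k, 'a, 'n) conf_alg_scheme \<Rightarrow> 'a set \<Rightarrow> bool"
  where "conf_subalgebra R C S \<longleftrightarrow> submodule S R C \<and>
    (\<forall>a\<in>S. der C a \<in> S) \<and> (\<forall>a\<in>S. \<forall>b\<in>S. \<forall>n. nprod C n a b \<in> S)"


section \<open>Identities with two formal variables\<close>

text \<open>
  An element of \<open>C[\<lambda>,\<mu>]\<close> is a finitely supported \<open>p :: nat \<Rightarrow> nat \<Rightarrow> 'a\<close>, where \<open>p i j\<close> is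
  the coefficient of \<open>\<lambda>\<^sup>i \<mu>\<^sup>j\<close>.
\<close>

type_synonym 'a poly2 = "nat \<Rightarrow> nat \<Rightarrow> 'a"

definition monom2 :: "('k, 'a, 'n) conf_alg_scheme \<Rightarrow> nat \<Rightarrow> nat \<Rightarrow> 'a \<Rightarrow> 'a poly2"
  where "monom2 C k l x = (\<lambda>i j. if i = k \<and> j = l then x else \<zero>\<^bsub>C\<^esub>)"

abbreviation const2 :: "('k, 'a, 'n) conf_alg_scheme \<Rightarrow> 'a \<Rightarrow> 'a poly2"
  where "const2 C \<equiv> monom2 C 0 0"

definition minus2 :: "('k, 'a, 'n) conf_alg_scheme \<Rightarrow> 'a poly2 \<Rightarrow> 'a poly2 \<Rightarrow> 'a poly2"
  where "minus2 C p q = (\<lambda>i j. p i j \<ominus>\<^bsub>C\<^esub> q i j)"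

text \<open>
  The operators on \<open>C[\<lambda>,\<mu>]\<close> that get substituted for the variable of a \<open>\<lambda>\<close>-product:
  multiplication by \<open>\<lambda>\<close>, by \<open>\<mu>\<close> and by \<open>\<lambda> + \<mu>\<close>, and the operators
  \<open>-\<partial>-\<lambda>\<close> and \<open>-\<partial>-\<mu>\<close> with \<open>\<partial>\<close> acting on coefficients.
\<close>

definition op_lam :: "('k, 'a, 'n) conf_alg_scheme \<Rightarrow> 'a poly2 \<Rightarrow> 'a poly2"
  where "op_lam C p = (\<lambda>i j. case i of 0 \<Rightarrow> \<zero>\<^bsub>C\<^esub> | Suc i' \<Rightarrow> p i' j)"

definition op_mu :: "('k, 'a, 'n) conf_alg_scheme \<Rightarrow> 'a poly2 \<Rightarrow> 'a poly2"
  where "op_mu C p = (\<lambda>i j. case j of 0 \<Rightarrow> \<zero>\<^bsub>C\<^esub> | Suc j' \<Rightarrow> p i j')"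

definition op_lam_plus_mu :: "('k, 'a, 'n) conf_alg_scheme \<Rightarrow> 'a poly2 \<Rightarrow> 'a poly2"
  where "op_lam_plus_mu C p = (\<lambda>i j. op_lam C p i j \<oplus>\<^bsub>C\<^esub> op_mu C p i j)"

definition op_neg_der_lam :: "('k, 'a, 'n) conf_alg_scheme \<Rightarrow> 'a poly2 \<Rightarrow> 'a poly2"
  where "op_neg_der_lam C p = (\<lambda>i j. \<ominus>\<^bsub>C\<^esub> der C (p i j) \<ominus>\<^bsub>C\<^esub> op_lam C p i j)"

definition op_neg_der_mu :: "('k, 'a, 'n) conf_alg_scheme \<Rightarrow> 'a poly2 \<Rightarrow> 'a poly2"
  where "op_neg_der_mu C p = (\<lambda>i j. \<ominus>\<^bsub>C\<^esub> der C (p i j) \<ominus>\<^bsub>C\<^esub> op_mu C p i j)"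

text \<open>
  \<open>subst_prod C T p q\<close> is the product of \<open>p\<close> and \<open>q\<close> (with \<open>T\<close> for the variable), extended
  to polynomials by linearity in \<open>\<lambda>\<close> and \<open>\<mu>\<close>: for \<open>p = \<lambda>\<^sup>k\<mu>\<^sup>r x\<close> and
  \<open>q = \<lambda>\<^sup>s\<mu>\<^sup>t y\<close> it is the sum over \<open>n\<close> of
  \<open>T\<^sup>n\<close> applied to \<open>\<lambda>\<^sup>k\<^sup>+\<^sup>s \<mu>\<^sup>r\<^sup>+\<^sup>t (lam C x y n)\<close>.  The index set is cut down to the
  nonzero terms because \<open>finsum\<close> over an infinite set is zero by convention.
\<close>

definition subst_prod ::
  "('k, 'a, 'n) conf_alg_scheme \<Rightarrow> ('a poly2 \<Rightarrow> 'a poly2) \<Rightarrow> 'a poly2 \<Rightarrow> 'a poly2 \<Rightarrow> 'a poly2"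
  where "subst_prod C T p q = (\<lambda>i j.
    finsum C
      (\<lambda>(k, r, s, t, n). (T ^^ n) (monom2 C (k + s) (r + t) (lam C (p k r) (q s t) n)) i j)
      {(k, r, s, t, n). lam C (p k r) (q s t) n \<noteq> \<zero>\<^bsub>C\<^esub>})"

locale commutative_conformal_algebra = conformal_algebra R C
  for R :: "('k, 'm) ring_scheme" and C :: "('k, 'a, 'n) conf_alg_scheme" +
  assumes conf_assoc:
    "a \<in> carrier C \<Longrightarrow> b \<in> carrier C \<Longrightarrow> c \<in> carrier C \<Longrightarrow>
      subst_prod C (op_lam C) (const2 C a) (subst_prod C (op_mu C) (const2 C b) (const2 C c)) =
      subst_prod C (op_lam_plus_mu C)
        (subst_prod C (op_lam C) (const2 C a) (const2 C b)) (const2 C c)"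
    and conf_comm:
    "a \<in> carrier C \<Longrightarrow> b \<in> carrier C \<Longrightarrow>
      subst_prod C (op_lam C) (const2 C a) (const2 C b) =
      subst_prod C (op_neg_der_lam C) (const2 C b) (const2 C a)"

locale novikov_conformal_algebra = conformal_algebra R C
  for R :: "('k, 'm) ring_scheme" and C :: "('k, 'a, 'n) conf_alg_scheme" +
  assumes conf_right_symmetric:
    "a \<in> carrier C \<Longrightarrow> b \<in> carrier C \<Longrightarrow> c \<in> carrier C \<Longrightarrow>
      minus2 C
        (subst_prod C (op_lam_plus_mu C)
          (subst_prod C (op_lam C) (const2 C a) (const2 C b)) (const2 C c))
        (subst_prod C (op_lam C) (const2 C a)
          (subst_prod C (op_mu C) (const2 C b) (const2 C c))) =
      minus2 C
        (subst_prod C (op_neg_der_mu C)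
          (subst_prod C (op_lam C) (const2 C a) (const2 C c)) (const2 C b))
        (subst_prod C (op_lam C) (const2 C a)
          (subst_prod C (op_neg_der_mu C) (const2 C c) (const2 C b)))"
    and conf_left_commutative:
    "a \<in> carrier C \<Longrightarrow> b \<in> carrier C \<Longrightarrow> c \<in> carrier C \<Longrightarrow>
      subst_prod C (op_lam C) (const2 C a) (subst_prod C (op_mu C) (const2 C b) (const2 C c)) =
      subst_prod C (op_mu C) (const2 C b) (subst_prod C (op_lam C) (const2 C a) (const2 C c))"


section \<open>Special Novikov conformal algebras\<close>

definition conf_derivation ::
  "('k, 'm) ring_scheme \<Rightarrow> ('k, 'a, 'n) conf_alg_scheme \<Rightarrow> ('a \<Rightarrow> 'a) \<Rightarrow> bool"
  where "conf_derivation R C D \<longleftrightarrow> linear_map R C C D \<and>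
    (\<forall>a\<in>carrier C. D (der C a) = der C (D a)) \<and>
    (\<forall>a\<in>carrier C. \<forall>b\<in>carrier C. \<forall>n.
      D (lam C a b n) = lam C (D a) b n \<oplus>\<^bsub>C\<^esub> lam C a (D b) n)"

definition derived_novikov ::
  "('k, 'a, 'n) conf_alg_scheme \<Rightarrow> ('a \<Rightarrow> 'a) \<Rightarrow> ('k, 'a, 'n) conf_alg_scheme"
  where "derived_novikov C D = C\<lparr>lam := \<lambda>a b. lam C (D a) b\<rparr>"

text \<open>
  HOL cannot quantify existentially over the type in which the carrier of \<open>C\<close> lies, so it is
  taken inside \<open>('v + 'k + nat) list\<close>.  This loses no generality: if \<open>V\<close> embeds into
  \<open>C\<^sup>(\<^sup>D\<^sup>)\<close>, one may replace \<open>C\<close> by the subalgebra closed under \<open>D\<close> that the image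
  of \<open>V\<close> generates.  Each of its elements is the value of a finite expression built from
  elements of \<open>V\<close>, scalars, and countably many operation symbols (\<open>+\<close>, scalar multiplication,
  \<open>\<partial>\<close>, \<open>D\<close>, and the \<open>n\<close>-products); written in prefix notation, such an expression is a word over
  \<open>'v + 'k + nat\<close>, so the whole structure can be transported to a set of such words.
\<close>

definition special :: "('k, 'm) ring_scheme \<Rightarrow> ('k, 'v) conf_alg \<Rightarrow> bool"
  where "special R V \<longleftrightarrow> novikov_conformal_algebra R V \<and>
    (\<exists>(C :: ('k, ('v + 'k + nat) list) conf_alg) D S f.
      commutative_conformal_algebra R C \<and> conf_derivation R C D \<and>
      conf_subalgebra R (derived_novikov C D) S \<and>
      f \<in> conf_hom R V ((derived_novikov C D)\<lparr>carrier := S\<rparr>) \<and>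
      bij_betw f (carrier V) S)"

definition homomorphic_image ::
  "('k, 'm) ring_scheme \<Rightarrow> ('k, 'v, 'n) conf_alg_scheme \<Rightarrow> ('k, 'a, 'p) conf_alg_scheme \<Rightarrow> bool"
  where "homomorphic_image R V W \<longleftrightarrow> conformal_algebra R V \<and>
    (\<exists>f \<in> conf_hom R W V. f ` carrier W = carrier V)"


section \<open>Free Novikov algebras and the algebra \<open>\<N>(X;N)\<close>\<close>

datatype (gens: 'b) magma = Gen 'b | Mul "'b magma" "'b magma"

text \<open>
  The free nonassociative algebra on \<open>B\<close>: finitely supported functions on the free magma.
  Every product in the magma decomposes uniquely, so no summation is needed in \<open>mult\<close>.
\<close>

definition free_nonassoc :: "('k, 'm) ring_scheme \<Rightarrow> 'b set \<Rightarrow> ('k, 'b magma \<Rightarrow> 'k) module"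
  where "free_nonassoc R B = \<lparr>
    carrier = {f. (\<forall>t. f t \<in> carrier R) \<and> finite {t. f t \<noteq> \<zero>\<^bsub>R\<^esub>} \<and>
                  (\<forall>t. f t \<noteq> \<zero>\<^bsub>R\<^esub> \<longrightarrow> gens t \<subseteq> B)},
    mult = (\<lambda>f g t. case t of Gen b \<Rightarrow> \<zero>\<^bsub>R\<^esub> | Mul l r \<Rightarrow> f l \<otimes>\<^bsub>R\<^esub> g r),
    one = undefined,
    zero = (\<lambda>t. \<zero>\<^bsub>R\<^esub>),
    add = (\<lambda>f g t. f t \<oplus>\<^bsub>R\<^esub> g t),
    smult = (\<lambda>k f t. k \<otimes>\<^bsub>R\<^esub> f t)\<rparr>"

definition nonassoc_gen :: "('k, 'm) ring_scheme \<Rightarrow> 'b \<Rightarrow> 'b magma \<Rightarrow> 'k"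
  where "nonassoc_gen R b = (\<lambda>t. if t = Gen b then \<one>\<^bsub>R\<^esub> else \<zero>\<^bsub>R\<^esub>)"

definition alg_ideal :: "('k, 'm) ring_scheme \<Rightarrow> ('k, 'a, 'n) module_scheme \<Rightarrow> 'a set \<Rightarrow> bool"
  where "alg_ideal R A I \<longleftrightarrow> submodule I R A \<and>
    (\<forall>a\<in>carrier A. \<forall>x\<in>I. a \<otimes>\<^bsub>A\<^esub> x \<in> I \<and> x \<otimes>\<^bsub>A\<^esub> a \<in> I)"

definition alg_quot :: "('k, 'a, 'n) module_scheme \<Rightarrow> 'a set \<Rightarrow> ('k, 'a set) module"
  where "alg_quot A I = \<lparr>
    carrier = a_rcosets\<^bsub>A\<^esub> I,
    mult = rcoset_mult A I,
    one = undefined,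
    zero = I,
    add = set_add A,
    smult = (\<lambda>k P. \<Union>x\<in>P. I +>\<^bsub>A\<^esub> (k \<odot>\<^bsub>A\<^esub> x))\<rparr>"

definition novikov_relators :: "('k, 'a, 'n) module_scheme \<Rightarrow> 'a set"
  where "novikov_relators A =
    {((x \<otimes>\<^bsub>A\<^esub> y) \<otimes>\<^bsub>A\<^esub> z \<ominus>\<^bsub>A\<^esub> x \<otimes>\<^bsub>A\<^esub> (y \<otimes>\<^bsub>A\<^esub> z)) \<ominus>\<^bsub>A\<^esub>
     ((x \<otimes>\<^bsub>A\<^esub> z) \<otimes>\<^bsub>A\<^esub> y \<ominus>\<^bsub>A\<^esub> x \<otimes>\<^bsub>A\<^esub> (z \<otimes>\<^bsub>A\<^esub> y))
      | x y z. x \<in> carrier A \<and> y \<in> carrier A \<and> z \<in> carrier A} \<union>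
    {x \<otimes>\<^bsub>A\<^esub> (y \<otimes>\<^bsub>A\<^esub> z) \<ominus>\<^bsub>A\<^esub> y \<otimes>\<^bsub>A\<^esub> (x \<otimes>\<^bsub>A\<^esub> z)
      | x y z. x \<in> carrier A \<and> y \<in> carrier A \<and> z \<in> carrier A}"

definition novikov_ideal :: "('k, 'm) ring_scheme \<Rightarrow> 'b set \<Rightarrow> ('b magma \<Rightarrow> 'k) set"
  where "novikov_ideal R B =
    alg_ideal R (free_nonassoc R B) hull novikov_relators (free_nonassoc R B)"

definition free_novikov :: "('k, 'm) ring_scheme \<Rightarrow> 'b set \<Rightarrow> ('k, ('b magma \<Rightarrow> 'k) set) module"
  where "free_novikov R B = alg_quot (free_nonassoc R B) (novikov_ideal R B)"

definition novikov_gen :: "('k, 'm) ring_scheme \<Rightarrow> 'b set \<Rightarrow> 'b \<Rightarrow> ('b magma \<Rightarrow> 'k) set"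
  where "novikov_gen R B b = novikov_ideal R B +>\<^bsub>free_nonassoc R B\<^esub> nonassoc_gen R b"

text \<open>The generator \<open>a(n)\<close> is the pair \<open>(a, n)\<close>.\<close>

abbreviation mode_set :: "'x set \<Rightarrow> ('x \<times> int) set"
  where "mode_set X \<equiv> X \<times> UNIV"

definition locality_ideal ::
  "('k, 'm) ring_scheme \<Rightarrow> 'x set \<Rightarrow> ('x \<Rightarrow> 'x \<Rightarrow> nat) \<Rightarrow> (('x \<times> int) magma \<Rightarrow> 'k) set set"
  where "locality_ideal R X N =
    (let F = free_novikov R (mode_set X); g = novikov_gen R (mode_set X) in
     alg_ideal R F hull
       {\<Oplus>\<^bsub>F\<^esub>s\<in>{..N a b}.
          [((-1) ^ s * int (N a b choose s))] \<cdot>\<^bsub>F\<^esub>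
            (g (a, n - int s) \<otimes>\<^bsub>F\<^esub> g (b, m + int s))
        | a b n m. a \<in> X \<and> b \<in> X})"

definition coeff_novikov ::
  "('k, 'm) ring_scheme \<Rightarrow> 'x set \<Rightarrow> ('x \<Rightarrow> 'x \<Rightarrow> nat)
    \<Rightarrow> ('k, (('x \<times> int) magma \<Rightarrow> 'k) set set) module"
  where "coeff_novikov R X N = alg_quot (free_novikov R (mode_set X)) (locality_ideal R X N)"

definition coeff_gen ::
  "('k, 'm) ring_scheme \<Rightarrow> 'x set \<Rightarrow> ('x \<Rightarrow> 'x \<Rightarrow> nat) \<Rightarrow> 'x \<Rightarrow> int
    \<Rightarrow> (('x \<times> int) magma \<Rightarrow> 'k) set set"
  where "coeff_gen R X N a n =
    locality_ideal R X N +>\<^bsub>free_novikov R (mode_set X)\<^esub> novikov_gen R (mode_set X) (a, n)"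


section \<open>Formal distributions and the free Novikov conformal algebra\<close>

text \<open>
  A distribution \<open>f \<in> A[[z,z\<^sup>-\<^sup>1]]\<close> is a function \<open>int \<Rightarrow> 'a\<close>, with \<open>f i\<close> the coefficient of
  \<open>z\<^sup>i\<close>.  Expanding \<open>(w - z)\<^sup>n\<close> by the binomial theorem, the coefficient of \<open>w\<^sup>-\<^sup>1 z\<^sup>i\<close> in
  \<open>f(w) g(z) (w - z)\<^sup>n\<close> is the sum over \<open>s \<le> n\<close> of
  \<open>(-1)\<^sup>s (n choose s) f\<^sub>s\<^sub>-\<^sub>n\<^sub>-\<^sub>1 g\<^sub>i\<^sub>-\<^sub>s\<close>.
\<close>

definition dist_prod ::
  "('k, 'a, 'n) module_scheme \<Rightarrow> nat \<Rightarrow> (int \<Rightarrow> 'a) \<Rightarrow> (int \<Rightarrow> 'a) \<Rightarrow> int \<Rightarrow> 'a"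
  where "dist_prod A n f g = (\<lambda>i. \<Oplus>\<^bsub>A\<^esub>s\<in>{..n}.
    [((-1) ^ s * int (n choose s))] \<cdot>\<^bsub>A\<^esub> (f (int s - int n - 1) \<otimes>\<^bsub>A\<^esub> g (i - int s)))"

text \<open>
  All distributions with \<open>\<partial> = d/dz\<close> and with \<open>\<lambda>\<close>-products defined so that the
  \<open>n\<close>-products are \<open>dist_prod A n\<close> (over a field of characteristic zero).  This is not a
  conformal algebra, as the \<open>\<lambda>\<close>-product of nonlocal distributions is an infinite series.
\<close>

definition distributions ::
  "('k, 'm) ring_scheme \<Rightarrow> ('k, 'a, 'n) module_scheme \<Rightarrow> ('k, int \<Rightarrow> 'a) conf_alg"
  where "distributions R A = \<lparr>
    carrier = {f. \<forall>i. f i \<in> carrier A},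
    mult = undefined,
    one = undefined,
    zero = (\<lambda>i. \<zero>\<^bsub>A\<^esub>),
    add = (\<lambda>f g i. f i \<oplus>\<^bsub>A\<^esub> g i),
    smult = (\<lambda>k f i. k \<odot>\<^bsub>A\<^esub> f i),
    der = (\<lambda>f i. [(i + 1)] \<cdot>\<^bsub>A\<^esub> f (i + 1)),
    lam = (\<lambda>f g n i.
      inv\<^bsub>R\<^esub> ([(fact n :: nat)] \<cdot>\<^bsub>R\<^esub> \<one>\<^bsub>R\<^esub>) \<odot>\<^bsub>A\<^esub> dist_prod A n f g i)\<rparr>"

text \<open>The series \<open>a(z)\<close> has \<open>a(n)\<close> as its coefficient of \<open>z\<^sup>-\<^sup>n\<^sup>-\<^sup>1\<close>.\<close>

definition gen_series ::
  "('k, 'm) ring_scheme \<Rightarrow> 'x set \<Rightarrow> ('x \<Rightarrow> 'x \<Rightarrow> nat) \<Rightarrow> 'x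
    \<Rightarrow> int \<Rightarrow> (('x \<times> int) magma \<Rightarrow> 'k) set set"
  where "gen_series R X N a = (\<lambda>i. coeff_gen R X N a (- i - 1))"

definition NovConf ::
  "('k, 'm) ring_scheme \<Rightarrow> 'x set \<Rightarrow> ('x \<Rightarrow> 'x \<Rightarrow> nat)
    \<Rightarrow> ('k, int \<Rightarrow> (('x \<times> int) magma \<Rightarrow> 'k) set set) conf_alg"
  where "NovConf R X N =
    (let E = distributions R (coeff_novikov R X N) in
     E\<lparr>carrier := conf_subalgebra R E hull (gen_series R X N ` X)\<rparr>)"

end

theory Submission
  imports Defs "HOL.Modules" "HOL-Library.Poly_Mapping" "HOL-Library.Multiset" "HOL-Library.Function_Algebras"
begin

text \<open>
  The model is the classical picture of Novikov algebras.  A commutative algebra with a derivation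
  \<open>D\<close> is a Novikov algebra under \<open>x \<circ> y = D(x) y\<close>, and the free Novikov algebra is the part of weight
  \<open>-1\<close> of the algebra of differential polynomials, where the \<open>i\<close>-th derivative of a generator has weight
  \<open>i - 1\<close>.  The proof turns this into a statement about distributions in three stages.

  First, let \<open>A\<close> be any Novikov algebra with chosen elements indexed by the generators.  Differential polynomials
  of weight \<open>-1\<close> can be evaluated in \<open>A\<close> so that \<open>D(p) q\<close> goes to the Novikov product of the values of
  \<open>p\<close> and \<open>q\<close> (\<open>eval_novikov\<close>).  The differential ideal \<open>null_ideal\<close> consists of all polynomials none of whose
  differential consequences evaluates to something nonzero.  A combinatorial argument on words in
  derivatives (\<open>balanced_words_absorbed\<close>) shows that a polynomial of weight \<open>-1\<close> lies in
  this ideal as soon as its own value vanishes (\<open>null_ideal_kernel\<close>).  So \<open>A\<close> sits inside a commutative differential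
  algebra, the quotient by \<open>null_ideal\<close>.

  Second, apply this to the algebra of coefficients of the free Novikov conformal algebra.  The relations there say that
  \<open>D(a(w)) b(z)\<close> is killed by \<open>(w - z)\<^sup>M\<close>, where \<open>M\<close> bounds all locality exponents.  In the quotient all
  series \<open>D\<^sup>i(a(z))\<close> are then mutually local (\<open>local_gdist\<close>).  This is where uniformity enters: a product
  \<open>a(w) b(z)\<close> is tested against every further series \<open>c(u)\<close>, and the exponent needed is the sum of
  the exponents for \<open>a, c\<close> and for \<open>b, c\<close>, which has to be bounded independently of \<open>c\<close>.
  By locality the series generate a commutative conformal algebra with a derivation, and its
  weight \<open>-1\<close> part is the free Novikov conformal algebra.

  Third, let \<open>V\<close> be a homomorphic image.  The series of weight \<open>-1\<close> that go to zero in \<open>V\<close>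
  generate an ideal, stable under the derivation, of this commutative conformal algebra.  The same word combinatorics, now for the
  operators of \<open>n\<close>-product with a generating series, shows that the ideal contains no other series of
  weight \<open>-1\<close> (\<open>eval_generated\<close>).  So \<open>V\<close> embeds into the quotient, with
  \<open>D\<close> supplying the Novikov product.  It remains to name the elements of the quotient by words
  over the carrier (\<open>wd\<close>) and to check the identities coefficientwise.

  Scalars are variables \<open>Sc k\<close> of weight zero in integer differential polynomials rather than coefficients.
  The relations between them, and division by factorials, hold modulo \<open>null_ideal\<close>.
\<close>

section \<open>Commuting operators on a Novikov algebra\<close>

text \<open>
  The scalars act by commuting operators that are compatible with the product; the relations of
  the field are imposed later, modulo an ideal.
\<close>

locale novikov_ops =
  fixes nop :: "'a::ab_group_add \<Rightarrow> 'a \<Rightarrow> 'a" (infixl \<open>\<circ>\<^sub>N\<close> 70)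
    and sm :: "'k \<Rightarrow> 'a \<Rightarrow> 'a"
  assumes nop_add_left: "(x + y) \<circ>\<^sub>N z = x \<circ>\<^sub>N z + y \<circ>\<^sub>N z"
    and nop_add_right: "z \<circ>\<^sub>N (x + y) = z \<circ>\<^sub>N x + z \<circ>\<^sub>N y"
    and sm_add: "sm k (x + y) = sm k x + sm k y"
    and sm_nop_left: "sm k x \<circ>\<^sub>N y = sm k (x \<circ>\<^sub>N y)"
    and sm_nop_right: "x \<circ>\<^sub>N sm k y = sm k (x \<circ>\<^sub>N y)"
    and sm_commute: "sm k (sm l x) = sm l (sm k x)"
    and right_symmetric: "(x \<circ>\<^sub>N y) \<circ>\<^sub>N z - x \<circ>\<^sub>N (y \<circ>\<^sub>N z) = (x \<circ>\<^sub>N z) \<circ>\<^sub>N y - x \<circ>\<^sub>N (z \<circ>\<^sub>N y)"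
    and left_commutative: "x \<circ>\<^sub>N (y \<circ>\<^sub>N z) = y \<circ>\<^sub>N (x \<circ>\<^sub>N z)"
begin

lemma additive_nop_right: "additive (\<lambda>y. x \<circ>\<^sub>N y)"
  by (simp add: additive_def nop_add_right)

lemma additive_nop_left: "additive (\<lambda>x. x \<circ>\<^sub>N y)"
  by (simp add: additive_def nop_add_left)

lemma additive_sm: "additive (sm k)"
  by (simp add: additive_def sm_add)

lemmas nop_simps [simp] =
  additive.zero[OF additive_nop_right] additive.zero[OF additive_nop_left] additive.zero[OF additive_sm]
  additive.minus[OF additive_nop_right] additive.minus[OF additive_nop_left] additive.minus[OF additive_sm]
  additive.diff[OF additive_nop_right] additive.diff[OF additive_nop_left] additive.diff[OF additive_sm]
  nop_add_left nop_add_right sm_add sm_nop_left sm_nop_right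

text \<open>
  By left commutativity all left multiplications commute.  These operators behave like multiplications by
  elements of weight zero in a differential algebra containing the Novikov algebra: left
  multiplication by \<open>x\<close> is multiplication by \<open>D(x)\<close>.
\<close>

inductive_set Lops :: "('a \<Rightarrow> 'a) set" where
  Lops_id: "(\<lambda>z. z) \<in> Lops"
| Lops_left: "(\<lambda>z. x \<circ>\<^sub>N z) \<in> Lops"
| Lops_sm: "sm k \<in> Lops"
| Lops_add: "F \<in> Lops \<Longrightarrow> G \<in> Lops \<Longrightarrow> (\<lambda>z. F z + G z) \<in> Lops"
| Lops_minus: "F \<in> Lops \<Longrightarrow> (\<lambda>z. - F z) \<in> Lops"
| Lops_comp: "F \<in> Lops \<Longrightarrow> G \<in> Lops \<Longrightarrow> (\<lambda>z. F (G z)) \<in> Lops"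

lemma Lops_diff: "F \<in> Lops \<Longrightarrow> G \<in> Lops \<Longrightarrow> (\<lambda>z. F z - G z) \<in> Lops"
  using Lops_add[OF _ Lops_minus, of F G] by simp

lemma Lops_zero: "(\<lambda>z. 0) \<in> Lops"
  using Lops_diff[OF Lops_id Lops_id] by simp

lemma Lops_sum_mset:
  "(\<And>w. w \<in># A \<Longrightarrow> F w \<in> Lops) \<Longrightarrow> (\<lambda>z. \<Sum>w\<in>#A. F w z) \<in> Lops"
  by (induction A) (auto intro: Lops_zero Lops_add)

lemma Lops_additive: "F \<in> Lops \<Longrightarrow> F (x + y) = F x + F y"
  by (induction arbitrary: x y rule: Lops.induct) (simp_all add: algebra_simps)

lemma Lops_additive': assumes "F \<in> Lops" shows "F 0 = 0" "F (x - y) = F x - F y" "F (- x) = - F x"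
proof -
  have "additive F" using Lops_additive[OF assms] by (simp add: additive_def)
  then show "F 0 = 0" "F (x - y) = F x - F y" "F (- x) = - F x"
    by (simp_all add: additive.zero additive.diff additive.minus)
qed

lemma Lops_nop: "F \<in> Lops \<Longrightarrow> F (x \<circ>\<^sub>N z) = x \<circ>\<^sub>N F z"
proof (induction arbitrary: z rule: Lops.induct)
  case (Lops_left y)
  then show ?case by (rule left_commutative)
qed simp_all

lemma Lops_sm_commute: "F \<in> Lops \<Longrightarrow> F (sm k z) = sm k (F z)"
  by (induction arbitrary: z rule: Lops.induct) (simp_all add: sm_commute)

lemma Lops_commute: "F \<in> Lops \<Longrightarrow> G \<in> Lops \<Longrightarrow> F (G z) = G (F z)"
proof (induction arbitrary: z rule: Lops.induct)
  case (Lops_left x)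
  show ?case using Lops_nop[OF Lops_left] by simp
next
  case (Lops_sm k)
  show ?case using Lops_sm_commute[OF Lops_sm] by simp
next
  case (Lops_add F1 F2)
  show ?case using Lops_additive[OF Lops_add.prems, of "F1 z" "F2 z"] Lops_add.IH[OF Lops_add.prems] by simp
next
  case (Lops_minus F1)
  show ?case using Lops_additive'(3)[OF Lops_minus.prems, of "F1 z"] Lops_minus.IH[OF Lops_minus.prems] by simp
qed simp_all

text \<open>
  If \<open>F\<close> is multiplication by \<open>e\<close>, then \<open>F x \<circ> y = D(e x) y = D(e) x y + e D(x) y\<close>, so this is
  the product \<open>D(e) x y\<close>.
\<close>

definition deriv_op :: "('a \<Rightarrow> 'a) \<Rightarrow> 'a \<Rightarrow> 'a \<Rightarrow> 'a"
  where "deriv_op F x y = F x \<circ>\<^sub>N y - F (x \<circ>\<^sub>N y)"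

lemma deriv_op_Lops: "F \<in> Lops \<Longrightarrow> deriv_op F x \<in> Lops"
  unfolding deriv_op_def [abs_def] by (rule Lops_diff[OF Lops_left Lops_comp[OF _ Lops_left]])

lemma deriv_op_comp:
  "F \<in> Lops \<Longrightarrow> deriv_op (\<lambda>z. F (G z)) x y = deriv_op F (G x) y + F (deriv_op G x y)"
  using Lops_additive'(2)[of F "G x \<circ>\<^sub>N y" "G (x \<circ>\<^sub>N y)"] by (simp add: deriv_op_def)

text \<open>
  For a left multiplication this is right symmetry of the product; since all operators commute, it
  propagates to compositions.
\<close>

lemma deriv_op_sym: "F \<in> Lops \<Longrightarrow> deriv_op F x y = deriv_op F y x"
proof (induction arbitrary: x y rule: Lops.induct)
  case (Lops_left c)
  then show ?case unfolding deriv_op_def by (rule right_symmetric)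
next
  case (Lops_add F G)
  have "deriv_op (\<lambda>z. F z + G z) u v = deriv_op F u v + deriv_op G u v" for u v
    by (simp add: deriv_op_def algebra_simps)
  then show ?case by (simp add: Lops_add.IH)
next
  case (Lops_minus F)
  have "deriv_op (\<lambda>z. - F z) u v = - deriv_op F u v" for u v by (simp add: deriv_op_def)
  then show ?case by (simp add: Lops_minus.IH)
next
  case (Lops_comp F G)
  have *: "deriv_op F (G u) v = G (deriv_op F u v)" for u v
    using Lops_comp.IH(1)[of "G u" v] Lops_comp.IH(1)[of u v]
      Lops_commute[OF deriv_op_Lops[OF Lops_comp.hyps(1)] Lops_comp.hyps(2), of v u] by simp
  show ?case
    using deriv_op_comp[OF Lops_comp.hyps(1), of G x y] deriv_op_comp[OF Lops_comp.hyps(1), of G y x]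
      *[of x y] *[of y x] Lops_comp.IH(1)[of x y] Lops_comp.IH(2)[of x y] by simp
qed (simp_all add: deriv_op_def)

lemma deriv_op_comp':
  "F \<in> Lops \<Longrightarrow> G \<in> Lops \<Longrightarrow> deriv_op (\<lambda>z. F (G z)) x y = G (deriv_op F x y) + F (deriv_op G x y)"
  using Lops_commute[OF deriv_op_Lops, of F G y x] deriv_op_sym[of F "G x" y] deriv_op_sym[of F x y]
    deriv_op_comp[of F G x y] by simp

text \<open>
  The value of the differential monomial \<open>c\<^sup>(\<^sup>n\<^sup>) x\<^sub>1 \<dots> x\<^sub>n\<close> of weight \<open>-1\<close>.  The recursion solves the
  Leibniz rule for \<open>D(c\<^sup>(\<^sup>n\<^sup>) x\<^sub>1 \<dots> x\<^sub>n) x\<close>, which must be a Novikov product, for its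
  term \<open>c\<^sup>(\<^sup>n\<^sup>+\<^sup>1\<^sup>) x\<^sub>1 \<dots> x\<^sub>n x\<close>.
\<close>

function brace :: "'a \<Rightarrow> 'a list \<Rightarrow> 'a" where
  "brace c [] = c"
| "brace c (x # xs) = brace c xs \<circ>\<^sub>N x - (\<Sum>i<length xs. xs ! i \<circ>\<^sub>N brace c (xs[i := x]))"
  by pat_completeness auto
termination by (relation "measure (\<lambda>(c, xs). length xs)") auto

declare brace.simps(2) [simp del]

end

lemma sum_nth_mset: "(\<Sum>i<length xs. f (xs ! i)) = (\<Sum>w\<in>#mset xs. f w)"
proof -
  have "(\<Sum>i<length xs. f (xs ! i)) = sum_list (map f xs)"
    by (simp add: sum_list_sum_nth atLeast0LessThan)
  then show ?thesis by (simp add: sum_mset_sum_list flip: mset_map)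
qed

context novikov_ops
begin

text \<open>
  Symmetry of the brace in its arguments and linearity in the first of them (through commuting operators)
  depend on each other for shorter braces, hence the joint induction.  Exchanging the first two
  arguments is the symmetry of \<open>deriv_op\<close>.
\<close>

lemma brace_aux:
  "\<forall>c. (\<forall>xs ys. length xs = n \<and> mset xs = mset ys \<longrightarrow> brace c xs = brace c ys) \<and>
    (\<forall>xs. length xs < n \<longrightarrow> (\<lambda>z. brace c (z # xs)) \<in> Lops)"
proof (induction n rule: less_induct)
  case (less n)
  have sym: "brace c xs = brace c ys" if "length xs < n" "mset xs = mset ys" for c xs ys
    using less that by blast
  have rem: "mset (xs[i := z]) = mset (z # remove1 (xs ! i) xs)" if "i < length xs" for i z and xs :: "'a list"
    using that by (simp add: mset_update)
  have E: "(\<lambda>z. brace c (z # xs)) \<in> Lops" if len: "length xs < n" for c xs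
  proof -
    have "(\<lambda>z. brace c (xs[i := z])) \<in> Lops" if i: "i < length xs" for i
    proof -
      have "brace c (xs[i := z]) = brace c (z # remove1 (xs ! i) xs)" for z
        by (rule sym) (use i len in \<open>simp_all add: rem\<close>)
      moreover have l: "length (remove1 (xs ! i) xs) = length xs - 1" using i by (simp add: length_remove1)
      have "(\<lambda>z. brace c (z # remove1 (xs ! i) xs)) \<in> Lops"
      proof -
        have "length (remove1 (xs ! i) xs) < length xs" using l i by simp
        then show ?thesis using less[of "length xs"] len by blast
      qed
      ultimately show ?thesis by simp
    qed
    then have "(\<lambda>z. \<Sum>i\<in>#mset_set {..<length xs}. xs ! i \<circ>\<^sub>N brace c (xs[i := z])) \<in> Lops"
      by (intro Lops_sum_mset) (auto intro: Lops_comp[OF Lops_left])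
    then have "(\<lambda>z. \<Sum>i<length xs. xs ! i \<circ>\<^sub>N brace c (xs[i := z])) \<in> Lops"
      by (simp only: sum_unfold_sum_mset)
    then have "(\<lambda>z. brace c xs \<circ>\<^sub>N z - (\<Sum>i<length xs. xs ! i \<circ>\<^sub>N brace c (xs[i := z]))) \<in> Lops"
      by (rule Lops_diff[OF Lops_left])
    then show ?thesis by (simp add: brace.simps(2))
  qed
  have fixed_head: "brace c (x # xs) = brace c (x # ys)"
    if len: "Suc (length xs) = n" and eq: "mset xs = mset ys" for c x xs ys
  proof -
    have aux: "(\<Sum>i<length zs. zs ! i \<circ>\<^sub>N brace c (zs[i := x])) = (\<Sum>w\<in>#mset zs. w \<circ>\<^sub>N brace c (x # remove1 w xs))"
      if zs: "mset zs = mset xs" for zs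
    proof -
      have l: "length zs = length xs" using zs by (metis size_mset)
      have "brace c (zs[i := x]) = brace c (x # remove1 (zs ! i) xs)" if "i < length zs" for i
        by (rule sym) (use that len zs l in \<open>simp_all add: rem\<close>)
      then have "(\<Sum>i<length zs. zs ! i \<circ>\<^sub>N brace c (zs[i := x])) =
          (\<Sum>i<length zs. zs ! i \<circ>\<^sub>N brace c (x # remove1 (zs ! i) xs))" by simp
      also have "\<dots> = (\<Sum>w\<in>#mset zs. w \<circ>\<^sub>N brace c (x # remove1 w xs))"
        by (rule sum_nth_mset[of "\<lambda>w. w \<circ>\<^sub>N brace c (x # remove1 w xs)"])
      finally show ?thesis .
    qed
    show ?thesis using aux[of xs] aux[of ys] sym[of xs ys c] len eq by (simp add: brace.simps(2))
  qed
  have swap: "brace c (z # y # xs) = brace c (y # z # xs)" if len: "Suc (Suc (length xs)) = n" for c y z xs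
  proof -
    have exp: "brace c (z # y # xs) = deriv_op (\<lambda>v. brace c (v # xs)) y z
        - (\<Sum>i<length xs. xs ! i \<circ>\<^sub>N brace c (y # xs[i := z]))" for y z
    proof -
      have 1: "brace c (z # y # xs) = brace c (y # xs) \<circ>\<^sub>N z - y \<circ>\<^sub>N brace c (z # xs)
          - (\<Sum>i<length xs. xs ! i \<circ>\<^sub>N brace c (y # xs[i := z]))"
        by (subst brace.simps(2)) (simp add: sum.lessThan_Suc_shift del: sum.lessThan_Suc)
      have 2: "brace c ((y \<circ>\<^sub>N z) # xs) = y \<circ>\<^sub>N brace c (z # xs)"
        using Lops_nop[OF E, of xs c y z] len by simp
      show ?thesis unfolding 1 deriv_op_def 2 ..
    qed
    have "brace c (y # xs[i := z]) = brace c (z # xs[i := y])" if "i < length xs" for i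
      by (rule sym) (use that len in \<open>simp_all add: rem\<close>)
    then have "(\<Sum>i<length xs. xs ! i \<circ>\<^sub>N brace c (y # xs[i := z])) = (\<Sum>i<length xs. xs ! i \<circ>\<^sub>N brace c (z # xs[i := y]))"
      by simp
    then show ?thesis unfolding exp using deriv_op_sym[OF E, of xs c y z] len by simp
  qed
  have "brace c xs = brace c ys" if len: "length xs = n" and eq: "mset xs = mset ys" for c xs ys
  proof (cases xs)
    case Nil
    then show ?thesis using eq by simp
  next
    case (Cons x xs')
    then obtain y ys' where ys: "ys = y # ys'" using eq by (cases ys) auto
    show ?thesis
    proof (cases "x = y")
      case True
      then show ?thesis using fixed_head[of xs' ys' c x] Cons ys eq len by simp
    next
      case False
      have eq': "add_mset x (mset xs') = add_mset y (mset ys')" using eq Cons ys by simp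
      then obtain R where R: "mset xs' = add_mset y R" "mset ys' = add_mset x R"
        using False by (metis add_eq_conv_ex)
      obtain rs where rs: "mset rs = R" by (metis ex_mset)
      have lr: "Suc (Suc (length rs)) = n" using len Cons R rs by (metis length_Cons size_add_mset size_mset)
      have "length ys' = length xs'" using eq' by (metis add_right_imp_eq length_Cons mset.simps(2) plus_1_eq_Suc size_mset list.size(4))
      then have "brace c (x # xs') = brace c (x # y # rs)" "brace c (y # ys') = brace c (y # x # rs)"
        using fixed_head[of xs' "y # rs" c x] fixed_head[of ys' "x # rs" c y] R rs len Cons by simp_all
      then show ?thesis using swap[OF lr] Cons ys by simp
    qed
  qed
  then show ?case using E by blast
qed

lemma brace_perm: "mset xs = mset ys \<Longrightarrow> brace c xs = brace c ys"
  using brace_aux by blast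

lemma brace_Lops: "(\<lambda>z. brace c (z # xs)) \<in> Lops"
  using brace_aux[of "Suc (length xs)"] by blast

text \<open>
  Multiplication by \<open>c\<^sup>(\<^sup>n\<^sup>+\<^sup>1\<^sup>) x\<^sub>1 \<dots> x\<^sub>n\<close> is the operator that puts its argument first in the brace; the two terms
  on the right are the terms of the Leibniz rule for this monomial.
\<close>

lemma deriv_op_brace:
  "deriv_op (\<lambda>z. brace c (z # xs)) x z =
    brace c (z # x # xs) + (\<Sum>w\<in>#mset xs. w \<circ>\<^sub>N brace c (z # x # remove1 w xs))"
proof -
  have "brace c (x # xs[i := z]) = brace c (z # x # remove1 (xs ! i) xs)" if "i < length xs" for i
    by (rule brace_perm) (use that in \<open>simp add: mset_update\<close>)
  then have "(\<Sum>i<length xs. xs ! i \<circ>\<^sub>N brace c (x # xs[i := z])) =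
      (\<Sum>i<length xs. xs ! i \<circ>\<^sub>N brace c (z # x # remove1 (xs ! i) xs))" by simp
  also have "\<dots> = (\<Sum>w\<in>#mset xs. w \<circ>\<^sub>N brace c (z # x # remove1 w xs))"
    by (rule sum_nth_mset[of "\<lambda>w. w \<circ>\<^sub>N brace c (z # x # remove1 w xs)"])
  finally have *: "(\<Sum>i<length xs. xs ! i \<circ>\<^sub>N brace c (x # xs[i := z])) = \<dots>" .
  have "brace c (z # x # xs) = brace c (x # xs) \<circ>\<^sub>N z - x \<circ>\<^sub>N brace c (z # xs)
      - (\<Sum>i<length xs. xs ! i \<circ>\<^sub>N brace c (x # xs[i := z]))"
    by (subst brace.simps(2)) (simp add: sum.lessThan_Suc_shift del: sum.lessThan_Suc)
  then show ?thesis using * Lops_nop[OF brace_Lops[of c xs], of x z] by (simp add: deriv_op_def)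
qed

end

text \<open>
  Used for functions that are only known to be symmetric on lists of one fixed length.
\<close>

lemma adjacent_swaps_invariant:
  assumes swap: "\<And>as a b bs. length as + length bs + 2 = n \<Longrightarrow> f (as @ a # b # bs) = f (as @ b # a # bs)"
  shows "mset xs = mset ys \<Longrightarrow> length as + length xs = n \<Longrightarrow> f (as @ xs) = f (as @ ys)"
proof (induction xs arbitrary: as ys)
  case (Cons x xs)
  have "x \<in> set ys" using Cons.prems(1) by (metis list.set_intros(1) set_mset_mset)
  then obtain p q where ys: "ys = p @ x # q" by (meson split_list)
  have len: "length xs = length p + length q" using Cons.prems(1) ys
    by (metis add_Suc_right length_Cons length_append mset_eq_length nat.inject)
  have "length as + length p + length q + 1 = n \<Longrightarrow> f (as @ p @ x # q) = f (as @ x # p @ q)" for p q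
  proof (induction p arbitrary: q rule: rev_induct)
    case (snoc y p)
    have "f (as @ (p @ [y]) @ x # q) = f ((as @ p) @ y # x # q)" by simp
    also have "\<dots> = f ((as @ p) @ x # y # q)" by (rule swap) (use snoc.prems in simp)
    also have "\<dots> = f (as @ x # p @ y # q)" using snoc.IH[of "y # q"] snoc.prems by simp
    finally show ?case by simp
  qed simp
  then have "f (as @ ys) = f (as @ x # p @ q)" using ys len Cons.prems(2) by simp
  moreover have "f ((as @ [x]) @ xs) = f ((as @ [x]) @ p @ q)"
    by (rule Cons.IH) (use Cons.prems ys in auto)
  ultimately show ?case by simp
qed simp

context novikov_ops
begin

text \<open>
  The value of a product of blocks \<open>c\<^sup>(\<^sup>j\<^sup>+\<^sup>1\<^sup>)\<close>, given as pairs \<open>(c, j)\<close>, and undifferentiated factors: each block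
  takes \<open>j\<close> of the factors and acts as a weight zero operator on the value of the rest.
  The next lemmas show that the distribution of the factors over the blocks is immaterial.
\<close>

fun monval :: "('a \<times> nat) list \<Rightarrow> 'a list \<Rightarrow> 'a" where
  "monval [] xs = hd xs"
| "monval ((c, j) # cs) xs = brace c (monval cs (drop j xs) # take j xs)"

lemma monval_Lops: "length xs = sum_list (map snd cs) \<Longrightarrow> (\<lambda>z. monval cs (xs @ [z])) \<in> Lops"
proof (induction cs arbitrary: xs)
  case Nil
  then show ?case by (simp add: Lops_id)
next
  case (Cons cj cs)
  obtain c j where cj: "cj = (c, j)" by fastforce
  have "(\<lambda>z. monval cs (drop j xs @ [z])) \<in> Lops" using Cons cj by simp
  from Lops_comp[OF brace_Lops this] show ?case using Cons.prems cj by simp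
qed

lemma monval_perm:
  "mset xs = mset ys \<Longrightarrow> length xs = Suc (sum_list (map snd cs)) \<Longrightarrow> monval cs xs = monval cs ys"
proof (induction cs arbitrary: xs ys)
  case Nil
  then show ?case by (cases xs) auto
next
  case (Cons cj cs)
  obtain c j where cj: "cj = (c, j)" by fastforce
  let ?s = "sum_list (map snd cs)"
  have "monval ((c, j) # cs) (as @ a # b # bs) = monval ((c, j) # cs) (as @ b # a # bs)"
    if len: "length as + length bs + 2 = Suc (j + ?s)" for as a b bs
  proof -
    consider "length as + 2 \<le> j" | "j \<le> length as" | "j = Suc (length as)" by linarith
    then show ?thesis
    proof cases
      case 1
      then obtain t where "j = length as + 2 + t" using le_Suc_ex by blast
      then show ?thesis by (auto intro!: brace_perm)
    next
      case 2
      have "monval cs (drop j as @ a # b # bs) = monval cs (drop j as @ b # a # bs)"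
        by (rule Cons.IH) (use 2 len in auto)
      then show ?thesis using 2 by simp
    next
      case 3
      \<comment> \<open>The two arguments belong to different blocks: the second is fed into the operator \<open>?F\<close>,
        which commutes with the brace, so that symmetry of the brace applies.\<close>
      let ?F = "\<lambda>z. monval cs (bs @ [z])"
      have F: "?F \<in> Lops" by (rule monval_Lops) (use 3 len in simp)
      have last: "monval cs (z # bs) = ?F z" for z
        by (rule Cons.IH) (use 3 len in auto)
      have front: "brace c (?F u # as @ [v]) = ?F (brace c (u # v # as))" for u v
      proof -
        have "brace c (?F u # as @ [v]) = brace c (?F u # v # as)" by (rule brace_perm) simp
        then show ?thesis using Lops_commute[OF brace_Lops[of c "v # as"] F, of u] by simp
      qed
      show ?thesis using 3 brace_perm[of "a # b # as" "b # a # as" c] by (simp add: last front)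
    qed
  qed
  from adjacent_swaps_invariant[where as = "[]" and f = "monval ((c, j) # cs)" and n = "Suc (j + ?s)", OF this Cons.prems(1)]
  show ?case using Cons.prems(2) cj by simp
qed

lemma monval_perm_left:
  assumes "mset cs = mset ds" and len: "length xs = Suc (sum_list (map snd cs))"
  shows "monval cs xs = monval ds xs"
proof -
  define n where "n = sum_list (map snd cs)"
  define f where "f cs = (if sum_list (map snd cs) = n then monval cs xs else undefined)" for cs
  have "f (as @ a # b # bs) = f (as @ b # a # bs)" for as a b bs
  proof (cases "sum_list (map snd (as @ a # b # bs)) = n")
    case True
    have "monval (as @ a # b # bs) xs = monval (as @ b # a # bs) xs"
      if "length xs = Suc (sum_list (map snd (as @ a # b # bs)))" for xs
      using that
    proof (induction as arbitrary: xs)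
      case Nil
      obtain c j d k where ab: "a = (c, j)" "b = (d, k)" by fastforce
      let ?A = "take j xs" and ?B = "take k (drop j xs)" and ?R = "drop (j + k) xs"
      have xs: "xs = ?A @ ?B @ ?R" by (metis append_take_drop_id drop_drop add.commute)
      have lA: "length ?A = j" and lB: "length ?B = k" using Nil ab by auto
      have "monval (b # a # bs) xs = monval (b # a # bs) (?B @ ?A @ ?R)"
        by (rule monval_perm, subst xs, unfold mset_append) (use Nil ab in \<open>simp_all add: ac_simps\<close>)
      also have "\<dots> = brace d (brace c (monval bs ?R # ?A) # ?B)"
        using lA lB ab by simp
      also have "\<dots> = brace c (brace d (monval bs ?R # ?B) # ?A)"
        using Lops_commute[OF brace_Lops brace_Lops] by simp
      also have "\<dots> = monval (a # b # bs) xs"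
        using ab by (simp add: add.commute)
      finally show ?case by simp
    next
      case (Cons cj as)
      obtain c j where cj: "cj = (c, j)" by fastforce
      show ?case using Cons cj by simp
    qed
    then show ?thesis using True len unfolding f_def n_def by (simp add: add.left_commute)
  next
    case False
    then show ?thesis by (simp add: f_def add.left_commute)
  qed
  from adjacent_swaps_invariant[where as = "[]" and f = f and n = "length cs", OF this assms(1)]
  have "f cs = f ds" by simp
  moreover have "sum_list (map snd ds) = n"
    using assms(1) unfolding n_def by (metis mset_map sum_mset_sum_list)
  ultimately show ?thesis by (simp add: f_def n_def)
qed

end

section \<open>Additive extension\<close>

text \<open>
  Integer multiples in an arbitrary additive group, needed to extend functions on monomials to integer
  polynomials.
\<close>

primrec natmul :: "nat \<Rightarrow> 'a::ab_group_add \<Rightarrow> 'a" where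
  "natmul 0 x = 0"
| "natmul (Suc n) x = natmul n x + x"

definition intmul :: "int \<Rightarrow> 'a::ab_group_add \<Rightarrow> 'a"
  where "intmul n x = natmul (nat n) x - natmul (nat (- n)) x"

lemma natmul_add: "natmul (m + n) x = natmul m x + natmul n x"
  by (induction m) (simp_all add: algebra_simps)

lemma intmul_diff_of_nat: "intmul (int m - int n) x = natmul m x - natmul n x"
proof (cases "n \<le> m")
  case True
  then have "nat (int m - int n) = m - n" "nat (- (int m - int n)) = 0" by auto
  then have "intmul (int m - int n) x = natmul (m - n) x" by (simp only: intmul_def) simp
  then show ?thesis using natmul_add[of "m - n" n x] True by simp
next
  case False
  then have "nat (int m - int n) = 0" "nat (- (int m - int n)) = n - m" by auto
  then have "intmul (int m - int n) x = - natmul (n - m) x" by (simp only: intmul_def) simp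
  then show ?thesis using natmul_add[of "n - m" m x] False by simp
qed

lemma intmul_simps [simp]: "intmul 0 x = 0" "intmul 1 x = x"
  by (simp_all add: intmul_def)

lemma intmul_diff: "intmul (m - n) x = intmul m x - intmul n x"
proof -
  obtain a b where m: "m = int a - int b" by (meson int_diff_cases)
  obtain c d where n: "n = int c - int d" by (meson int_diff_cases)
  have "m - n = int (a + d) - int (b + c)" using m n by simp
  then have "intmul (m - n) x = natmul (a + d) x - natmul (b + c) x" by (simp only: intmul_diff_of_nat)
  moreover have "intmul m x = natmul a x - natmul b x" "intmul n x = natmul c x - natmul d x"
    unfolding m n by (simp_all only: intmul_diff_of_nat)
  ultimately show ?thesis by (simp add: natmul_add)
qed

definition frag_ext :: "('m \<Rightarrow> 'a::ab_group_add) \<Rightarrow> ('m \<Rightarrow>\<^sub>0 int) \<Rightarrow> 'a"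
  where "frag_ext f p = (\<Sum>m\<in>Poly_Mapping.keys p. intmul (Poly_Mapping.lookup p m) (f m))"

lemma frag_ext_superset:
  assumes "finite S" "Poly_Mapping.keys p \<subseteq> S"
  shows "frag_ext f p = (\<Sum>m\<in>S. intmul (Poly_Mapping.lookup p m) (f m))"
  unfolding frag_ext_def by (rule sum.mono_neutral_left) (use assms in \<open>auto simp: in_keys_iff\<close>)

lemma frag_ext_diff: "frag_ext f (p - q) = frag_ext f p - frag_ext f q"
proof -
  let ?S = "Poly_Mapping.keys p \<union> Poly_Mapping.keys q"
  have "Poly_Mapping.keys (p - q) \<subseteq> ?S" by (rule keys_diff)
  then show ?thesis
    by (simp add: frag_ext_superset[of ?S] lookup_minus intmul_diff sum_subtractf)
qed

lemma frag_ext_frag_of [simp]: "frag_ext f (frag_of m) = f m"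
  by (simp add: frag_ext_def)

lemma frag_ext_0 [simp]: "frag_ext f 0 = 0"
  by (simp add: frag_ext_def)

lemma frag_ext_minus: "frag_ext f (- p) = - frag_ext f p"
  using frag_ext_diff[of f 0 p] by simp

lemma frag_ext_add: "frag_ext f (p + q) = frag_ext f p + frag_ext f q"
  using frag_ext_diff[of f p "- q"] by (simp add: frag_ext_minus)

section \<open>Differential polynomials\<close>

text \<open>
  \<open>Dv b i\<close> stands for the \<open>i\<close>-th derivative of the generator \<open>b\<close>.
\<close>

datatype ('k, 'b) dvar = Sc 'k | Dv 'b nat

type_synonym ('k, 'b) dmon = "('k, 'b) dvar multiset"
type_synonym ('k, 'b) dpoly = "('k, 'b) dvar multiset \<Rightarrow>\<^sub>0 int"

abbreviation var :: "('k, 'b) dvar \<Rightarrow> ('k, 'b) dpoly"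
  where "var v \<equiv> frag_of {#v#}"

lemma frag_of_mult [simp]: "frag_of m * frag_of n = frag_of (m + n :: 'm::monoid_add)"
  by (simp add: mult_single)

lemma frag_of_one: "frag_of (0 :: 'm::monoid_add) = 1"
  by simp

fun dvar_deriv :: "('k, 'b) dvar \<Rightarrow> ('k, 'b) dpoly" where
  "dvar_deriv (Sc k) = 0"
| "dvar_deriv (Dv b i) = var (Dv b (Suc i))"

definition dmon_deriv :: "('k, 'b) dmon \<Rightarrow> ('k, 'b) dpoly"
  where "dmon_deriv m = (\<Sum>v\<in>#m. dvar_deriv v * frag_of (m - {#v#}))"

definition dpoly_deriv :: "('k, 'b) dpoly \<Rightarrow> ('k, 'b) dpoly" (\<open>\<D>\<close>)
  where "\<D> p = frag_extend dmon_deriv p"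

lemma dpoly_deriv_frag_of: "\<D> (frag_of m) = dmon_deriv m"
  by (simp add: dpoly_deriv_def)

lemma dpoly_deriv_additive [simp]:
  "\<D> (p + q) = \<D> p + \<D> q" "\<D> (p - q) = \<D> p - \<D> q" "\<D> (- p) = - \<D> p" "\<D> 0 = 0"
  by (simp_all add: dpoly_deriv_def frag_extend_add frag_extend_diff frag_extend_minus)

lemma dpoly_deriv_var [simp]: "\<D> (var (Sc k)) = 0" "\<D> (var (Dv b i)) = var (Dv b (Suc i))"
  by (simp_all add: dpoly_deriv_frag_of dmon_deriv_def)

lemma dpoly_deriv_one [simp]: "\<D> 1 = 0"
  using dpoly_deriv_frag_of[of "{#}"] by (simp add: dmon_deriv_def)

lemma dmon_deriv_add: "dmon_deriv (m + n) = dmon_deriv m * frag_of n + frag_of m * dmon_deriv n"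
proof -
  have "(\<Sum>v\<in>#m. dvar_deriv v * frag_of (m + n - {#v#})) = (\<Sum>v\<in>#m. dvar_deriv v * frag_of (m - {#v#}) * frag_of n)"
  proof (rule arg_cong[of _ _ sum_mset], rule image_mset_cong)
    fix v assume "v \<in># m"
    then have "m + n - {#v#} = (m - {#v#}) + n" by simp
    then show "dvar_deriv v * frag_of (m + n - {#v#}) = dvar_deriv v * frag_of (m - {#v#}) * frag_of n"
      by (simp only: frag_of_mult mult.assoc)
  qed
  moreover have "(\<Sum>v\<in>#n. dvar_deriv v * frag_of (m + n - {#v#})) = (\<Sum>v\<in>#n. frag_of m * (dvar_deriv v * frag_of (n - {#v#})))"
  proof (rule arg_cong[of _ _ sum_mset], rule image_mset_cong)
    fix v assume "v \<in># n"
    then have "m + n - {#v#} = m + (n - {#v#})" by simp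
    then show "dvar_deriv v * frag_of (m + n - {#v#}) = frag_of m * (dvar_deriv v * frag_of (n - {#v#}))"
      by (simp only: frag_of_mult[symmetric] mult.left_commute)
  qed
  ultimately show ?thesis
    unfolding dmon_deriv_def by (simp only: image_mset_union sum_mset.union sum_mset_distrib_left sum_mset_distrib_right)
qed

lemma dpoly_induct [case_names zero frag diff]:
  fixes p :: "'m \<Rightarrow>\<^sub>0 int"
  assumes "P 0" "\<And>m. P (frag_of m)" "\<And>a b. P a \<Longrightarrow> P b \<Longrightarrow> P (a - b)"
  shows "P p"
  using frag_induction[of p UNIV P] assms by blast

lemma dpoly_deriv_mult: "\<D> (p * q) = \<D> p * q + p * \<D> q"
proof (induction p rule: dpoly_induct)
  case (frag m)
  show ?case
  proof (induction q rule: dpoly_induct)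
    case (frag n)
    show ?case by (simp add: dpoly_deriv_frag_of dmon_deriv_add)
  next
    case (diff a b)
    then show ?case by (simp add: right_diff_distrib)
  qed simp
next
  case (diff a b)
  then show ?case by (simp add: left_diff_distrib)
qed simp

text \<open>
  In the part of weight \<open>-1\<close> the product \<open>D(p) q\<close> is defined, because \<open>D\<close> raises the weight by one.
\<close>

fun vwt :: "('k, 'b) dvar \<Rightarrow> int" where
  "vwt (Sc k) = 0"
| "vwt (Dv b i) = int i - 1"

definition mwt :: "('k, 'b) dmon \<Rightarrow> int"
  where "mwt m = (\<Sum>v\<in>#m. vwt v)"

lemma mwt_simps [simp]: "mwt {#} = 0" "mwt (add_mset v m) = vwt v + mwt m" "mwt (m + n) = mwt m + mwt n"
  by (simp_all add: mwt_def)

definition homog :: "int \<Rightarrow> ('k, 'b) dpoly \<Rightarrow> bool"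
  where "homog w p \<longleftrightarrow> Poly_Mapping.keys p \<subseteq> {m. mwt m = w}"

lemma homog_0 [simp]: "homog w 0"
  by (simp add: homog_def)

lemma homog_frag_of [simp]: "homog w (frag_of m) \<longleftrightarrow> mwt m = w"
  by (simp add: homog_def)

lemma homog_add: "homog w p \<Longrightarrow> homog w q \<Longrightarrow> homog w (p + q)"
  unfolding homog_def using keys_add[of p q] by blast

lemma homog_diff: "homog w p \<Longrightarrow> homog w q \<Longrightarrow> homog w (p - q)"
  unfolding homog_def using keys_diff[of p q] by blast

lemma homog_minus: "homog w p \<Longrightarrow> homog w (- p)"
  unfolding homog_def by simp

lemma homog_mult: "homog v p \<Longrightarrow> homog w q \<Longrightarrow> homog (v + w) (p * q)"
  unfolding homog_def using keys_mult[of p q] by fastforce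

lemma homog_induct [consumes 1, case_names zero frag diff]:
  assumes "homog w p" "P 0" "\<And>m. mwt m = w \<Longrightarrow> P (frag_of m)" "\<And>a b. P a \<Longrightarrow> P b \<Longrightarrow> P (a - b)"
  shows "P p"
  using frag_induction[OF assms(1)[unfolded homog_def], of P] assms(2-4) by blast

lemma homog_sum_mset: "(\<And>i. i \<in># S \<Longrightarrow> homog w (f i)) \<Longrightarrow> homog w (\<Sum>i\<in>#S. f i)"
  by (induction S) (auto intro: homog_add)

lemma homog_deriv: "homog w p \<Longrightarrow> homog (w + 1) (\<D> p)"
proof (induction rule: homog_induct)
  case (frag m)
  have "homog (w + 1) (dvar_deriv v * frag_of (m - {#v#}))" if "v \<in># m" for v
  proof (cases v)
    case (Dv b i)
    from that obtain n where "m = add_mset v n" by (meson mset_add)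
    then show ?thesis using frag Dv by simp
  qed simp
  then show ?case unfolding dpoly_deriv_frag_of dmon_deriv_def by (rule homog_sum_mset)
qed (auto intro: homog_diff)

section \<open>Evaluation\<close>

definition scalars_of :: "('k, 'b) dvar list \<Rightarrow> 'k list"
  where "scalars_of l = concat (map (\<lambda>v. case v of Sc k \<Rightarrow> [k] | _ \<Rightarrow> []) l)"

definition derivs_of :: "('b \<Rightarrow> 'a) \<Rightarrow> ('k, 'b) dvar list \<Rightarrow> ('a \<times> nat) list"
  where "derivs_of g l = concat (map (\<lambda>v. case v of Dv b (Suc i) \<Rightarrow> [(g b, i)] | _ \<Rightarrow> []) l)"

definition gens_of :: "('b \<Rightarrow> 'a) \<Rightarrow> ('k, 'b) dvar list \<Rightarrow> 'a list"
  where "gens_of g l = concat (map (\<lambda>v. case v of Dv b 0 \<Rightarrow> [g b] | _ \<Rightarrow> []) l)"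

lemma mset_concat_map_cong:
  assumes "mset l = mset l'"
  shows "mset (concat (map f l)) = mset (concat (map f l'))"
proof -
  have "mset (concat (map f l)) = (\<Sum>v\<in>#mset l. mset (f v))" for l
    by (induction l) auto
  then show ?thesis using assms by simp
qed

lemma mwt_list: "mwt (mset l) = int (sum_list (map snd (derivs_of g l))) - int (length (gens_of g l))"
proof (induction l)
  case (Cons v l)
  then show ?case by (cases v; auto simp: derivs_of_def gens_of_def split: nat.split)
qed (simp add: derivs_of_def gens_of_def)

text \<open>
  A monomial of weight \<open>-1\<close> is evaluated by listing its variables.  As the sum of the orders minus the number of
  undifferentiated generators is then fixed, the blocks leave over exactly one factor.
\<close>

locale novikov_eval = novikov_ops nop sm
  for nop :: "'a::ab_group_add \<Rightarrow> 'a \<Rightarrow> 'a" (infixl \<open>\<circ>\<^sub>N\<close> 70) and sm :: "'k \<Rightarrow> 'a \<Rightarrow> 'a" +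
  fixes gen :: "'b \<Rightarrow> 'a"
begin

definition list_eval :: "('k, 'b) dvar list \<Rightarrow> 'a"
  where "list_eval l = foldr sm (scalars_of l) (monval (derivs_of gen l) (gens_of gen l))"

lemma list_eval_perm:
  assumes "mset l = mset l'" "mwt (mset l) = - 1"
  shows "list_eval l = list_eval l'"
proof -
  have s: "mset (scalars_of l) = mset (scalars_of l')" and d: "mset (derivs_of gen l) = mset (derivs_of gen l')"
    and g: "mset (gens_of gen l) = mset (gens_of gen l')"
    unfolding scalars_of_def derivs_of_def gens_of_def using assms(1) by (rule mset_concat_map_cong)+
  have len: "length (gens_of gen l) = Suc (sum_list (map snd (derivs_of gen l)))"
    using mwt_list[of l gen] assms(2) by simp
  have "monval (derivs_of gen l) (gens_of gen l) = monval (derivs_of gen l') (gens_of gen l')"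
    using monval_perm_left[OF d len] monval_perm[OF g, of "derivs_of gen l'"] len d
    by (metis mset_map sum_mset_sum_list)
  moreover have "foldr sm (scalars_of l) z = foldr sm (scalars_of l') z" for z
    using adjacent_swaps_invariant[where as = "[]" and f = "\<lambda>ks. foldr sm ks z", OF _ s] by (simp add: sm_commute)
  ultimately show ?thesis by (simp add: list_eval_def)
qed

definition mon_eval :: "('k, 'b) dmon \<Rightarrow> 'a"
  where "mon_eval m = (if mwt m = - 1 then list_eval (SOME l. mset l = m) else 0)"

lemma mon_eval_mset: "mwt (mset l) = - 1 \<Longrightarrow> mon_eval (mset l) = list_eval l"
  unfolding mon_eval_def by (metis (mono_tags) list_eval_perm someI_ex)

text \<open>
  Monomials of weight zero together with the operator that multiplication by them induces on values.
\<close>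

inductive_set opmons :: "(('k, 'b) dmon \<times> ('a \<Rightarrow> 'a)) set" where
  one: "({#}, \<lambda>z. z) \<in> opmons"
| scalar: "({#Sc k#}, sm k) \<in> opmons"
| block: "(add_mset (Dv c (Suc (length xs))) (mset (map (\<lambda>b. Dv b 0) xs)),
     \<lambda>z. brace (gen c) (z # map gen xs)) \<in> opmons"
| mult: "(e, F) \<in> opmons \<Longrightarrow> (d, G) \<in> opmons \<Longrightarrow> (e + d, \<lambda>z. F (G z)) \<in> opmons"

lemma opmons_Lops: "(e, F) \<in> opmons \<Longrightarrow> F \<in> Lops"
proof (induction rule: opmons.induct)
  case (mult e F d G)
  show ?case by (rule Lops_comp[OF mult.IH])
qed (simp_all add: Lops_id Lops_sm brace_Lops)

lemma opmons_mwt: "(e, F) \<in> opmons \<Longrightarrow> mwt e = 0"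
proof (induction rule: opmons.induct)
  case (block c xs)
  have "mwt (mset (map (\<lambda>b. Dv b 0) xs) :: ('k, 'b) dmon) = - int (length xs)" by (induction xs) auto
  then show ?case by simp
qed auto

lemma foldr_sm_Lops: "foldr sm ks \<in> Lops"
proof (induction ks)
  case Nil
  then show ?case using Lops_id by (simp add: id_def)
next
  case (Cons k ks)
  then show ?case using Lops_comp[OF Lops_sm Cons, of k] by (simp add: comp_def)
qed

lemma mon_eval_opmons: "(e, F) \<in> opmons \<Longrightarrow> mon_eval (e + q) = F (mon_eval q)"
proof (induction arbitrary: q rule: opmons.induct)
  case (scalar k)
  show ?case
  proof (cases "mwt q = - 1")
    case True
    obtain l where l: "mset l = q" by (metis ex_mset)
    have "mon_eval (mset (Sc k # l)) = list_eval (Sc k # l)"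
      by (rule mon_eval_mset) (simp add: l True)
    also have "\<dots> = sm k (list_eval l)"
      by (simp add: list_eval_def scalars_of_def derivs_of_def gens_of_def)
    also have "\<dots> = sm k (mon_eval q)" using mon_eval_mset[of l] l True by simp
    finally show ?thesis using l by simp
  next
    case False
    then show ?thesis by (simp add: mon_eval_def)
  qed
next
  case (block c xs)
  let ?e = "Dv c (Suc (length xs)) # map (\<lambda>b. Dv b 0) xs :: ('k, 'b) dvar list" and ?F = "\<lambda>z. brace (gen c) (z # map gen xs)"
  have w: "mwt (mset ?e) = 0" using opmons_mwt[OF opmons.block] by simp
  show ?case
  proof (cases "mwt q = - 1")
    case True
    obtain l where l: "mset l = q" by (metis ex_mset)
    have g: "gens_of gen (?e @ l) = map gen xs @ gens_of gen l"
      by (induction xs) (simp_all add: gens_of_def)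
    have "concat (map (\<lambda>v. case v of Dv b (Suc i) \<Rightarrow> [(gen b, i)] | _ \<Rightarrow> []) (map (\<lambda>b. Dv b 0) xs)) = []"
      "concat (map (\<lambda>v. case v of Sc k \<Rightarrow> [k] | _ \<Rightarrow> []) (map (\<lambda>b. Dv b 0) xs)) = []"
      by (simp_all add: comp_def)
    then have d: "derivs_of gen (?e @ l) = (gen c, length xs) # derivs_of gen l"
      and s: "scalars_of (?e @ l) = scalars_of l"
      unfolding derivs_of_def scalars_of_def map_append concat_append by simp_all
    have "mon_eval (mset (?e @ l)) = list_eval (?e @ l)"
      by (rule mon_eval_mset) (use l True w in simp)
    also have "\<dots> = foldr sm (scalars_of l) (?F (monval (derivs_of gen l) (gens_of gen l)))"
      unfolding list_eval_def g d s by simp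
    also have "\<dots> = ?F (list_eval l)"
      unfolding list_eval_def by (rule Lops_commute[OF foldr_sm_Lops brace_Lops])
    also have "\<dots> = ?F (mon_eval q)" using mon_eval_mset[of l] l True by simp
    finally show ?thesis using l by simp
  next
    case False
    then show ?thesis using w Lops_additive'(1)[OF brace_Lops] by (simp add: mon_eval_def)
  qed
next
  case (mult e F d G)
  then show ?case by (simp add: add.assoc)
qed simp

end

lemma vwt_minus_one: "vwt v = - 1 \<longleftrightarrow> (\<exists>b. v = Dv b 0)"
  by (cases v) auto

lemma mset_undifferentiated:
  "(\<And>v. v \<in># K \<Longrightarrow> vwt v = - 1) \<Longrightarrow> \<exists>xs. K = mset (map (\<lambda>b. Dv b 0) xs)"
proof (induction K)
  case (add v K)
  from add.IH add.prems obtain xs where "K = mset (map (\<lambda>b. Dv b 0) xs)" by fastforce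
  moreover from add.prems[of v] obtain b where "v = Dv b 0" by (auto simp: vwt_minus_one)
  ultimately have "add_mset v K = mset (map (\<lambda>b. Dv b 0) (b # xs))" by simp
  then show ?case by blast
qed simp

lemma mwt_ge: "- int (size (filter_mset (\<lambda>v. vwt v = - 1) q)) \<le> mwt q"
proof (induction q)
  case (add v q)
  moreover have "- 1 \<le> vwt v" by (cases v) auto
  ultimately show ?case by auto
qed simp

text \<open>
  Only undifferentiated generators have negative weight, so a monomial of weight at most \<open>-i\<close> has at least
  \<open>i\<close> of them.
\<close>

lemma mset_undifferentiated_subset:
  assumes "mwt m \<le> - int i"
  obtains xs where "length xs = i" "mset (map (\<lambda>b. Dv b 0) xs) \<subseteq># m"
proof -
  let ?H = "filter_mset (\<lambda>v. vwt v = - 1) m"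
  have "i \<le> size ?H" using assms mwt_ge[of m] by linarith
  moreover obtain l where l: "mset l = ?H" by (metis ex_mset)
  ultimately have "i \<le> length l" by (metis size_mset)
  then have K: "mset (take i l) \<subseteq># ?H" "size (mset (take i l)) = i" unfolding l[symmetric]
    using mset_subset_eq_add_left[of "mset (take i l)" "mset (drop i l)"] by (simp_all flip: mset_append)
  define K where "K = mset (take i l)"
  note K = K[folded K_def]
  have "vwt v = - 1" if "v \<in># K" for v
    using mset_subset_eqD[OF K(1) that] by simp
  then obtain xs where xs: "K = mset (map (\<lambda>b. Dv b 0) xs)" using mset_undifferentiated by blast
  have "K \<subseteq># m" by (rule subset_mset.order_trans[OF K(1) multiset_filter_subset])
  moreover have "length xs = i" using xs K(2) by simp
  ultimately show ?thesis using that xs by blast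
qed

context novikov_eval
begin

text \<open>
  Split off a scalar, or a differentiated generator together with as many undifferentiated ones as its weight requires,
  until a single undifferentiated generator is left.
\<close>

lemma opmons_exhaust:
  "mwt m = - 1 \<Longrightarrow> \<exists>e F x. (e, F) \<in> opmons \<and> m = add_mset (Dv x 0) e"
proof (induction "size m" arbitrary: m rule: less_induct)
  case less
  show ?case
  proof (cases "\<forall>v\<in>#m. vwt v = - 1")
    case True
    then obtain xs where xs: "m = mset (map (\<lambda>b. Dv b 0) xs)" using mset_undifferentiated by blast
    have "mwt (mset (map (\<lambda>b. Dv b 0) xs) :: ('k, 'b) dmon) = - int (length xs)" by (induction xs) auto
    then have "length xs = 1" using xs less(2) by simp
    then obtain x where "xs = [x]" by (auto simp: length_Suc_conv)
    then show ?thesis using xs opmons.one by fastforce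
  next
    case False
    then obtain v n where v: "m = add_mset v n" "vwt v \<noteq> - 1" by (meson mset_add)
    have "\<exists>e F n'. (e, F) \<in> opmons \<and> m = e + n' \<and> size n' < size m"
    proof (cases v)
      case (Sc k)
      then have "m = {#Sc k#} + n" "size n < size m" using v by auto
      then show ?thesis using opmons.scalar[of k] by blast
    next
      case (Dv b j)
      then obtain i where j: "j = Suc i" using v by (cases j) auto
      then have "mwt n \<le> - int i" using v less(2) Dv by simp
      then obtain xs where xs: "length xs = i" "mset (map (\<lambda>b. Dv b 0) xs) \<subseteq># n"
        by (rule mset_undifferentiated_subset)
      let ?e = "add_mset (Dv b (Suc (length xs))) (mset (map (\<lambda>b. Dv b 0) xs)) :: ('k, 'b) dmon"
      have "m = ?e + (n - mset (map (\<lambda>b. Dv b 0) xs))" using v Dv j xs by simp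
      moreover have "size (n - mset (map (\<lambda>b. Dv b 0) xs)) < size m"
        using v(1) diff_size_le_size_Diff size_Diff_submset[OF xs(2)] by simp
      ultimately show ?thesis using opmons.block[of b xs] by blast
    qed
    then obtain d G n' where d: "(d, G) \<in> opmons" "m = d + n'" "size n' < size m" by blast
    then have "mwt n' = - 1" using less(2) opmons_mwt[OF d(1)] by simp
    then obtain e F x where "(e, F) \<in> opmons" "n' = add_mset (Dv x 0) e"
      using less(1) d(3) by blast
    then show ?thesis using opmons.mult[OF d(1)] d(2) by fastforce
  qed
qed

definition eval :: "('k, 'b) dpoly \<Rightarrow> 'a"
  where "eval = frag_ext mon_eval"

lemma eval_additive [simp]:
  "eval (p + q) = eval p + eval q" "eval (p - q) = eval p - eval q" "eval (- p) = - eval p" "eval 0 = 0"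
  by (simp_all add: eval_def frag_ext_add frag_ext_diff frag_ext_minus)

lemma eval_sum_mset: "eval (\<Sum>i\<in>#S. f i) = (\<Sum>i\<in>#S. eval (f i))"
  by (induction S) auto

lemma eval_frag_of [simp]: "eval (frag_of m) = mon_eval m"
  by (simp add: eval_def)

lemma eval_homog: "homog w p \<Longrightarrow> w \<noteq> - 1 \<Longrightarrow> eval p = 0"
  by (induction rule: homog_induct) (simp_all add: mon_eval_def)

lemma eval_opmons: "(e, F) \<in> opmons \<Longrightarrow> eval (frag_of e * q) = F (eval q)"
proof (induction q rule: dpoly_induct)
  case zero
  then show ?case using opmons_Lops Lops_additive'(1) by simp
next
  case (frag m)
  then show ?case by (simp add: mon_eval_opmons)
next
  case (diff a b)
  then show ?case using Lops_additive'(2)[OF opmons_Lops] by (simp add: right_diff_distrib)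
qed

lemma eval_scalar: "eval (var (Sc k) * q) = sm k (eval q)"
  by (rule eval_opmons[OF opmons.scalar])

lemma brace_single: "brace c [z] = c \<circ>\<^sub>N z"
  by (simp add: brace.simps(2))

text \<open>
  By induction over the factorization into blocks: on a block it is the Leibniz rule encoded in the
  brace, and on products it is the Leibniz rule for \<open>deriv_op\<close>.
\<close>

lemma eval_deriv_opmons:
  "(e, F) \<in> opmons \<Longrightarrow> eval (\<D> (frag_of e) * var (Dv x 0) * q) = deriv_op F (gen x) (eval q)"
proof (induction arbitrary: q rule: opmons.induct)
  case one
  then show ?case by (simp add: deriv_op_def)
next
  case (scalar k)
  then show ?case by (simp add: deriv_op_def)
next
  case (block c xs)
  let ?M = "mset (map (\<lambda>b. Dv b 0) xs) :: ('k, 'b) dmon"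
  let ?e = "add_mset (Dv c (Suc (length xs))) ?M"
  let ?A = "var (Dv c (Suc (Suc (length xs)))) * frag_of ?M"
  let ?B = "\<lambda>w. var (Dv w 1) * frag_of (?e - {#Dv w 0#})"
  have "\<D> (frag_of ?e) = ?A + (\<Sum>w\<in>#mset xs. ?B w)"
    unfolding dpoly_deriv_frag_of dmon_deriv_def
    by (simp del: frag_of_mult add: image_mset.compositionality comp_def)
  then have "\<D> (frag_of ?e) * var (Dv x 0) * q = ?A * var (Dv x 0) * q + (\<Sum>w\<in>#mset xs. ?B w * var (Dv x 0) * q)"
    by (simp only: distrib_right sum_mset_distrib_right)
  then have "eval (\<D> (frag_of ?e) * var (Dv x 0) * q) =
      eval (?A * var (Dv x 0) * q) + (\<Sum>w\<in>#mset xs. eval (?B w * var (Dv x 0) * q))"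
    by (simp only: eval_additive eval_sum_mset)
  also have "eval (?A * var (Dv x 0) * q) = brace (gen c) (eval q # gen x # map gen xs)"
  proof -
    have "?A * var (Dv x 0) = frag_of (add_mset (Dv c (Suc (length (x # xs)))) (mset (map (\<lambda>b. Dv b 0) (x # xs))))"
      by (simp add: add_mset_commute)
    then show ?thesis using eval_opmons[OF opmons.block[of c "x # xs"], of q] by (simp only: list.map)
  qed
  also have "(\<Sum>w\<in>#mset xs. eval (?B w * var (Dv x 0) * q)) =
    (\<Sum>w\<in>#mset xs. gen w \<circ>\<^sub>N brace (gen c) (eval q # gen x # remove1 (gen w) (map gen xs)))"
  proof (rule arg_cong[of _ _ sum_mset], rule image_mset_cong)
    fix w assume w: "w \<in># mset xs"
    then have len: "length xs = Suc (length (remove1 w xs))"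
      using length_pos_if_in_set[of w xs] by (simp add: length_remove1)
    let ?N = "add_mset (Dv w 1) {#} + add_mset (Dv c (Suc (length xs))) (mset (map (\<lambda>b. Dv b 0) (x # remove1 w xs)))"
    obtain R where R: "mset xs = add_mset w R" using w by (meson mset_add)
    then have "?e - {#Dv w 0#} = add_mset (Dv c (Suc (length xs))) (mset (map (\<lambda>b. Dv b 0) (remove1 w xs)))"
      by simp
    then have N: "?B w * var (Dv x 0) = frag_of ?N"
      by (simp add: add_mset_commute)
    have "(?N, \<lambda>z. brace (gen w) [brace (gen c) (z # gen x # map gen (remove1 w xs))]) \<in> opmons"
      using opmons.mult[OF opmons.block[of w "[]"] opmons.block[of c "x # remove1 w xs"]] len by simp
    then have "eval (?B w * var (Dv x 0) * q) = brace (gen w) [brace (gen c) (eval q # gen x # map gen (remove1 w xs))]"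
      unfolding N by (rule eval_opmons)
    then have "eval (?B w * var (Dv x 0) * q) = gen w \<circ>\<^sub>N brace (gen c) (eval q # gen x # map gen (remove1 w xs))"
      by (simp only: brace_single)
    also have "brace (gen c) (eval q # gen x # map gen (remove1 w xs)) = brace (gen c) (eval q # gen x # remove1 (gen w) (map gen xs))"
      by (rule brace_perm) (simp add: R)
    finally show "eval (?B w * var (Dv x 0) * q) =
        gen w \<circ>\<^sub>N brace (gen c) (eval q # gen x # remove1 (gen w) (map gen xs))" .
  qed
  finally show ?case
    by (simp add: deriv_op_brace image_mset.compositionality comp_def)
next
  case (mult e F d G)
  have "\<D> (frag_of (e + d)) * var (Dv x 0) * q = \<D> (frag_of e) * var (Dv x 0) * (frag_of d * q)
      + \<D> (frag_of d) * var (Dv x 0) * (frag_of e * q)"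
    by (simp only: frag_of_mult[symmetric] dpoly_deriv_mult) (simp only: algebra_simps)
  then have "eval (\<D> (frag_of (e + d)) * var (Dv x 0) * q) =
      deriv_op F (gen x) (G (eval q)) + deriv_op G (gen x) (F (eval q))"
    using mult.IH eval_opmons[OF mult.hyps(1)] eval_opmons[OF mult.hyps(2)] by simp
  then show ?case
    using deriv_op_comp'[OF opmons_Lops[OF mult.hyps(1)] opmons_Lops[OF mult.hyps(2)], of "gen x" "eval q"]
      Lops_commute[OF deriv_op_Lops[OF opmons_Lops[OF mult.hyps(1)]] opmons_Lops[OF mult.hyps(2)], of "gen x" "eval q"]
      Lops_commute[OF deriv_op_Lops[OF opmons_Lops[OF mult.hyps(2)]] opmons_Lops[OF mult.hyps(1)], of "gen x" "eval q"]
    by simp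
qed

lemma mon_eval_single: "mon_eval {#Dv x 0#} = gen x"
  using mon_eval_mset[of "[Dv x 0]"] by (simp add: list_eval_def scalars_of_def derivs_of_def gens_of_def)

lemma eval_gen: "eval (var (Dv x 0)) = gen x"
  by (simp add: mon_eval_single)

text \<open>
  A monomial of weight \<open>-1\<close> is \<open>e x\<close> with \<open>e\<close> of weight zero, and \<open>D(e x) q = D(e) x q + e D(x) q\<close>; the
  operator \<open>deriv_op\<close> was designed as the value of the first term.
\<close>

theorem eval_novikov: "homog (- 1) p \<Longrightarrow> eval (\<D> p * q) = eval p \<circ>\<^sub>N eval q"
proof (induction rule: homog_induct)
  case (frag m)
  then obtain e F x where e: "(e, F) \<in> opmons" and m: "m = add_mset (Dv x 0) e"
    using opmons_exhaust by blast
  have "frag_of m = frag_of e * var (Dv x 0)" using m by simp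
  then have "\<D> (frag_of m) * q = \<D> (frag_of e) * var (Dv x 0) * q + frag_of e * (var (Dv x 1) * q)"
    by (simp add: dpoly_deriv_mult algebra_simps del: frag_of_mult)
  moreover have "eval (var (Dv x 1) * q) = gen x \<circ>\<^sub>N eval q"
    using eval_opmons[OF opmons.block[of x "[]"], of q] by (simp add: brace.simps(2))
  ultimately have "eval (\<D> (frag_of m) * q) = deriv_op F (gen x) (eval q) + F (gen x \<circ>\<^sub>N eval q)"
    using eval_deriv_opmons[OF e] eval_opmons[OF e] by simp
  also have "\<dots> = F (gen x) \<circ>\<^sub>N eval q" by (simp add: deriv_op_def)
  also have "F (gen x) = eval (frag_of m)" using mon_eval_opmons[OF e, of "{#Dv x 0#}"] m by (simp add: mon_eval_single)
  finally show ?case .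
qed (simp_all add: left_diff_distrib)

end

section \<open>Absorption of balanced words\<close>

text \<open>
  Commuting operators \<open>L g i\<close> of weight \<open>i - 1\<close> on a module with derivation, indexed by derivatives of letters.
  Two instances occur: multiplication by the variables on differential polynomials, and \<open>n\<close>-products
  with generating series on distributions.
\<close>

locale graded_operators =
  fixes L :: "'g \<Rightarrow> nat \<Rightarrow> 'm::ab_group_add \<Rightarrow> 'm" and D :: "'m \<Rightarrow> 'm"
  assumes L_add: "L g i (c + d) = L g i c + L g i d"
    and D_add: "D (c + d) = D c + D d"
    and L_commute: "L g i (L h j c) = L h j (L g i c)"
    and D_L: "D (L g i c) = L g (Suc i) c + L g i (D c)"
begin

lemma additive_L: "additive (L g i)"
  by (simp add: additive_def L_add)

lemma additive_D: "additive D"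
  by (simp add: additive_def D_add)

lemmas L_D_additive =
  additive.zero[OF additive_L] additive.minus[OF additive_L] additive.diff[OF additive_L]
  additive.zero[OF additive_D] additive.minus[OF additive_D] additive.diff[OF additive_D]

definition word_op :: "('g \<times> nat) list \<Rightarrow> 'm \<Rightarrow> 'm"
  where "word_op ws = foldr (\<lambda>(g, i). L g i) ws"

definition word_weight :: "('g \<times> nat) list \<Rightarrow> int"
  where "word_weight ws = (\<Sum>(g, i)\<leftarrow>ws. int i - 1)"

lemma word_op_simps [simp]:
  "word_op [] c = c" "word_op ((g, i) # ws) c = L g i (word_op ws c)"
  "word_op (vs @ ws) c = word_op vs (word_op ws c)"
  by (simp_all add: word_op_def)

lemma word_weight_simps [simp]:
  "word_weight [] = 0" "word_weight ((g, i) # ws) = int i - 1 + word_weight ws"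
  "word_weight (vs @ ws) = word_weight vs + word_weight ws"
  by (simp_all add: word_weight_def)

lemma word_op_add: "word_op ws (c + d) = word_op ws c + word_op ws d"
  by (induction ws) (auto simp: L_add)

lemma additive_word_op: "additive (word_op ws)"
  by (simp add: additive_def word_op_add)

lemma word_op_L: "word_op ws (L g i c) = L g i (word_op ws c)"
  by (induction ws) (auto intro: L_commute)

lemma word_op_perm: "mset vs = mset ws \<Longrightarrow> word_op vs c = word_op ws c"
proof -
  assume eq: "mset vs = mset ws"
  have "word_op (as @ a # b # bs) c = word_op (as @ b # a # bs) c" for as a b bs
  proof -
    obtain g i h j where "a = (g, i)" "b = (h, j)" by fastforce
    then show ?thesis using L_commute[of g i h j "word_op bs c"] by simp
  qed
  from adjacent_swaps_invariant[where as = "[]" and f = "\<lambda>ws. word_op ws c", OF this eq]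
  show ?thesis by simp
qed

lemma word_weight_perm: "mset vs = mset ws \<Longrightarrow> word_weight vs = word_weight ws"
  unfolding word_weight_def by (simp flip: sum_mset_sum_list)

fun word_derivs :: "('g \<times> nat) list \<Rightarrow> ('g \<times> nat) list list" where
  "word_derivs [] = []"
| "word_derivs ((g, i) # ws) = ((g, Suc i) # ws) # map ((#) (g, i)) (word_derivs ws)"

lemma D_word_op:
  "D (word_op ws c) = word_op ws (D c) + (\<Sum>v\<leftarrow>word_derivs ws. word_op v c)"
proof (induction ws)
  case (Cons gi ws)
  obtain g i where gi: "gi = (g, i)" by fastforce
  have "L g i (\<Sum>v\<leftarrow>vs. word_op v c) = (\<Sum>v\<leftarrow>map ((#) (g, i)) vs. word_op v c)" for vs
    by (induction vs) (simp_all add: L_add L_D_additive)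
  then show ?case using Cons by (simp add: gi D_L L_add algebra_simps)
qed simp

lemma word_derivs_split:
  "v \<in> set (word_derivs ws) \<Longrightarrow> \<exists>p g i q. ws = p @ (g, i) # q \<and> v = p @ (g, Suc i) # q"
proof (induction ws arbitrary: v)
  case (Cons gi ws)
  obtain g i where gi: "gi = (g, i)" by fastforce
  from Cons.prems consider "v = (g, Suc i) # ws" | u where "u \<in> set (word_derivs ws)" "v = (g, i) # u"
    unfolding gi by auto
  then show ?case
  proof cases
    case 1
    then show ?thesis using gi by (metis append_Nil)
  next
    case 2
    then show ?thesis using Cons.IH[OF 2(1)] gi by (metis append_Cons)
  qed
qed simp

lemma undifferentiated_letters:
  assumes "word_weight ws \<le> - int k"
  shows "\<exists>zs rest. mset ws = mset (zs @ rest) \<and> length zs = k \<and> (\<forall>z\<in>set zs. snd z = 0)"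
proof -
  let ?Z = "filter (\<lambda>z. snd z = 0) ws" and ?R = "filter (\<lambda>z. snd z \<noteq> 0) ws"
  have "- int (length (filter (\<lambda>z. snd z = 0) ws)) \<le> word_weight ws" by (induction ws) auto
  then have "k \<le> length ?Z" using assms by simp
  then have "length (take k ?Z) = k" by simp
  moreover have "mset ws = mset (take k ?Z @ drop k ?Z @ ?R)"
    by (metis append_assoc append_take_drop_id mset_append mset_filter multiset_partition)
  moreover have "\<forall>z\<in>set (take k ?Z). snd z = 0" by (auto dest: in_set_takeD)
  ultimately show ?thesis by blast
qed

text \<open>
  The element \<open>D\<^sup>k c\<close> has weight \<open>k\<close> more than \<open>c\<close>, so the words in the conclusion bring it back
  to the weight of \<open>c\<close>.  They are reduced to the three basic operations of that kind under which \<open>K\<close> is closed.  A letter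
  of order one acts by the first of them and can be split off.  A letter of order \<open>i + 2\<close> is accompanied by \<open>i + 1\<close>
  letters of order zero; lowering its order by one gives a word of weight \<open>-1\<close>, whose commutator with \<open>D\<close> is the original word
  up to words that contain a letter of order one.  If all letters have order zero, the Leibniz
  rule moves one derivative from \<open>c\<close> to the outside, where the second operation applies.

  The length bound \<open>n\<close> is part of the statement because the third closure property is
  itself going to be proved by induction on the length of words.
\<close>

theorem balanced_words_absorbed:
  assumes K_add: "\<And>c d. c \<in> K \<Longrightarrow> d \<in> K \<Longrightarrow> c + d \<in> K" and K_0: "0 \<in> K" and K_minus: "\<And>c. c \<in> K \<Longrightarrow> - c \<in> K"
    and K1: "\<And>g c. c \<in> K \<Longrightarrow> L g 1 c \<in> K"
    and K2: "\<And>g c. c \<in> K \<Longrightarrow> L g 0 (D c) \<in> K"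
    and K3: "\<And>vs c. length vs \<le> n \<Longrightarrow> word_weight vs = - 1 \<Longrightarrow> c \<in> K \<Longrightarrow> D (word_op vs c) - word_op vs (D c) \<in> K"
  shows "length ws \<le> n \<Longrightarrow> word_weight ws = - int k \<Longrightarrow> c \<in> K \<Longrightarrow> word_op ws ((D ^^ k) c) \<in> K"
proof (induction "length ws" arbitrary: ws k c rule: less_induct)
  case less
  note IH = less(1) and len = less(2) and wt = less(3) and c = less(4)
  have K_diff: "a \<in> K \<Longrightarrow> b \<in> K \<Longrightarrow> a - b \<in> K" for a b
    using K_add[of a "- b"] K_minus by simp
  have K_sum: "(\<And>v. v \<in> set vs \<Longrightarrow> f v \<in> K) \<Longrightarrow> (\<Sum>v\<leftarrow>vs. f v) \<in> K" for vs and f :: "('g \<times> nat) list \<Rightarrow> 'm"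
    by (induction vs) (auto intro: K_0 K_add)
  consider (one) g where "(g, 1) \<in> set ws" | (high) g i where "(g, Suc (Suc i)) \<in> set ws" | (low) "\<forall>z\<in>set ws. snd z = 0"
    by (metis One_nat_def not0_implies_Suc prod.collapse)
  then show ?case
  proof cases
    case one
    then obtain p q where ws: "ws = p @ (g, 1) # q" by (meson split_list)
    have "word_op (p @ q) ((D ^^ k) c) \<in> K"
      by (rule IH) (use ws len wt c in auto)
    then show ?thesis using K1 by (simp add: ws word_op_L)
  next
    case high
    then obtain p q where ws: "ws = p @ (g, Suc (Suc i)) # q" by (meson split_list)
    have "word_weight (p @ q) \<le> - int (Suc i)" using ws wt by simp
    then obtain zs rest where zr: "mset (p @ q) = mset (zs @ rest)" "length zs = Suc i" "\<forall>z\<in>set zs. snd z = 0"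
      using undifferentiated_letters by blast
    have zs_wt: "(\<forall>z\<in>set zs. snd z = 0) \<Longrightarrow> word_weight zs = - int (length zs)" for zs by (induction zs) auto
    have perm: "mset ws = mset ((g, Suc (Suc i)) # zs @ rest)" using zr ws by simp
    let ?e = "word_op rest ((D ^^ k) c)"
    have wr: "word_weight rest = - int k"
      using word_weight_perm[OF perm] wt zs_wt[OF zr(3)] zr(2) by simp
    have lr: "length ws = Suc (Suc i) + length rest" using mset_eq_length[OF perm] zr(2) by simp
    have e: "?e \<in> K" by (rule IH) (use lr len wr c in auto)
    have 1: "D (word_op ((g, Suc i) # zs) ?e) - word_op ((g, Suc i) # zs) (D ?e) \<in> K"
      by (rule K3) (use zs_wt[OF zr(3)] zr(2) lr len e in auto)
    \<comment> \<open>Differentiating one of the letters \<open>zs\<close> of order zero produces a letter of order one.\<close>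
    have 2: "word_op ((g, Suc i) # v) ?e \<in> K" if "v \<in> set (word_derivs zs)" for v
    proof -
      from word_derivs_split[OF that] obtain p h j q where v: "zs = p @ (h, j) # q" "v = p @ (h, Suc j) # q" by blast
      then have j: "j = 0" and pq: "word_weight (p @ q) = - int i" "length (p @ q) = i"
        using zr zs_wt[of p] zs_wt[of q] by auto
      have "word_op ((g, Suc i) # p @ q) ((D ^^ 0) ?e) \<in> K"
        by (rule IH) (use lr len pq e in auto)
      then show ?thesis using K1[of _ h] by (simp add: v j word_op_L L_commute[of g "Suc i" h])
    qed
    have "L g (Suc i) (\<Sum>v\<leftarrow>vs. word_op v ?e) = (\<Sum>v\<leftarrow>vs. word_op ((g, Suc i) # v) ?e)" for vs
      by (induction vs) (simp_all add: L_add L_D_additive)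
    then have "word_op ((g, Suc (Suc i)) # zs) ?e =
        (D (word_op ((g, Suc i) # zs) ?e) - word_op ((g, Suc i) # zs) (D ?e)) - (\<Sum>v\<leftarrow>word_derivs zs. word_op ((g, Suc i) # v) ?e)"
      by (simp add: D_L D_word_op L_add)
    also have "\<dots> \<in> K" by (rule K_diff[OF 1 K_sum[OF 2]])
    finally show ?thesis using word_op_perm[OF perm] by simp
  next
    case low
    have zs_wt: "(\<forall>z\<in>set zs. snd z = 0) \<Longrightarrow> word_weight zs = - int (length zs)" for zs :: "('g \<times> nat) list" by (induction zs) auto
    from low have k: "length ws = k" using wt zs_wt[of ws] by simp
    show ?thesis
    proof (cases ws)
      case Nil
      then show ?thesis using k c by simp
    next
      case (Cons z zs)
      then obtain g where z: "z = (g, 0)" using low by (cases z) auto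
      obtain k' where k': "k = Suc k'" using k Cons by auto
      have lz: "length zs = k'" and lowz: "\<forall>z\<in>set zs. snd z = 0" using k k' Cons low by auto
      let ?e = "(D ^^ k') c"
      have e: "word_op zs ?e \<in> K" by (rule IH) (use Cons len lz zs_wt[OF lowz] c in auto)
      have 2: "word_op ((g, 0) # v) ?e \<in> K" if "v \<in> set (word_derivs zs)" for v
      proof -
        from word_derivs_split[OF that] obtain p h j q where v: "zs = p @ (h, j) # q" "v = p @ (h, Suc j) # q" by blast
        then have j: "j = 0" using lowz by auto
        have pq: "word_weight (p @ q) = - int (length (p @ q))" by (rule zs_wt) (use v lowz in auto)
        have "word_op ((g, 0) # p @ q) ?e \<in> K"
          by (rule IH) (use Cons len v lz pq c in auto)
        then show ?thesis using K1[of _ h] by (simp add: v j word_op_L L_commute[of g 0 h])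
      qed
      have "L g 0 (\<Sum>v\<leftarrow>vs. word_op v ?e) = (\<Sum>v\<leftarrow>vs. word_op ((g, 0) # v) ?e)" for vs
        by (induction vs) (simp_all add: L_add L_D_additive)
      then have "L g 0 (D (word_op zs ?e)) - (\<Sum>v\<leftarrow>word_derivs zs. word_op ((g, 0) # v) ?e) = word_op ws ((D ^^ k) c)"
        by (simp add: Cons z k' D_word_op L_add)
      moreover have "L g 0 (D (word_op zs ?e)) - (\<Sum>v\<leftarrow>word_derivs zs. word_op ((g, 0) # v) ?e) \<in> K"
        by (rule K_diff[OF K2[OF e] K_sum[OF 2]])
      ultimately show ?thesis by simp
    qed
  qed
qed

end

section \<open>Formal distributions\<close>

text \<open>
  Multiplication by \<open>w - z\<close> on a series \<open>H(w, z)\<close>, when \<open>H m n\<close> is the coefficient of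
  \<open>w\<^sup>-\<^sup>m\<^sup>-\<^sup>1 z\<^sup>-\<^sup>n\<^sup>-\<^sup>1\<close>.
\<close>

definition nabla :: "(int \<Rightarrow> int \<Rightarrow> 'a::ab_group_add) \<Rightarrow> int \<Rightarrow> int \<Rightarrow> 'a"
  where "nabla H m n = H (m + 1) n - H m (n + 1)"

lemma nablas_Suc: "(nabla ^^ Suc k) H m n = (nabla ^^ k) H (m + 1) n - (nabla ^^ k) H m (n + 1)"
  by (simp add: nabla_def)

lemma nablas_hom:
  assumes "\<And>x y. f (x - y) = f x - f y"
  shows "f ((nabla ^^ k) H m n) = (nabla ^^ k) (\<lambda>m n. f (H m n)) m n"
proof (induction k arbitrary: m n)
  case (Suc k)
  show ?case unfolding nablas_Suc assms Suc ..
qed simp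

lemma nablas_diff: "(nabla ^^ k) (\<lambda>m n. G m n - H m n) m n = (nabla ^^ k) G m n - (nabla ^^ k) H m n"
  by (induction k arbitrary: m n) (simp_all add: nablas_Suc del: funpow.simps)

lemma nablas_add: "(nabla ^^ k) (\<lambda>m n. G m n + H m n) m n = (nabla ^^ k) G m n + (nabla ^^ k) H m n"
  by (induction k arbitrary: m n) (simp_all add: nablas_Suc del: funpow.simps(2))

lemma nablas_shift_left: "(nabla ^^ k) (\<lambda>m n. H (m + a) n) m n = (nabla ^^ k) H (m + a) n"
  by (induction k arbitrary: m n) (simp_all add: nablas_Suc ac_simps del: funpow.simps(2))

lemma nablas_shift_right: "(nabla ^^ k) (\<lambda>m n. H m (n + a)) m n = (nabla ^^ k) H m (n + a)"
  by (induction k arbitrary: m n) (simp_all add: nablas_Suc ac_simps del: funpow.simps(2))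

lemma nablas_flip: "(nabla ^^ k) (\<lambda>m n. H n m) m n = (if even k then (nabla ^^ k) H n m else - (nabla ^^ k) H n m)"
  by (induction k arbitrary: m n) (simp_all add: nablas_Suc del: funpow.simps(2))

lemma nablas_add_exp: "(nabla ^^ k) ((nabla ^^ l) H) = (nabla ^^ (k + l)) H"
  by (simp add: funpow_add)

lemma nablas_closed:
  assumes "\<And>x y. x \<in> A \<Longrightarrow> y \<in> A \<Longrightarrow> x - y \<in> A" "\<And>m n. H m n \<in> A"
  shows "(nabla ^^ k) H m n \<in> A"
  by (induction k arbitrary: m n) (simp_all add: nablas_Suc assms del: funpow.simps(2))

text \<open>
  Distributions are indexed by modes: \<open>f m\<close> is the coefficient of \<open>z\<^sup>-\<^sup>m\<^sup>-\<^sup>1\<close>.  This is the \<open>n\<close>-product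
  for a commutative ring of coefficients, the residue being the mode \<open>0\<close> in \<open>w\<close>.
\<close>

definition dprod :: "nat \<Rightarrow> (int \<Rightarrow> 'a::comm_ring_1) \<Rightarrow> (int \<Rightarrow> 'a) \<Rightarrow> int \<Rightarrow> 'a"
  where "dprod n f g m = (nabla ^^ n) (\<lambda>x y. f x * g y) 0 m"

definition dshift :: "(int \<Rightarrow> 'a) \<Rightarrow> int \<Rightarrow> 'a"
  where "dshift f m = f (m + 1)"

definition dderiv :: "(int \<Rightarrow> 'a::comm_ring_1) \<Rightarrow> int \<Rightarrow> 'a" (\<open>\<partial>\<close>)
  where "\<partial> f m = - (of_int m * f (m - 1))"

lemma dprod_0: "dprod 0 f g m = f 0 * g m"
  by (simp add: dprod_def)

lemma dprod_Suc: "dprod (Suc n) f g m = dprod n (dshift f) g m - dprod n f (dshift g) m"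
  unfolding dprod_def funpow_Suc_right comp_def nablas_diff[symmetric]
  by (simp add: nabla_def[abs_def] dshift_def)

lemma dprod_diff_left: "dprod n (\<lambda>m. f m - f' m) g m = dprod n f g m - dprod n f' g m"
  unfolding dprod_def nablas_diff[symmetric] by (simp add: left_diff_distrib)

lemma dprod_add_left: "dprod n (\<lambda>m. f m + f' m) g m = dprod n f g m + dprod n f' g m"
  unfolding dprod_def nablas_add[symmetric] by (simp add: distrib_right)

lemma dprod_diff_right: "dprod n f (\<lambda>m. g m - g' m) m = dprod n f g m - dprod n f g' m"
  unfolding dprod_def nablas_diff[symmetric] by (simp add: right_diff_distrib)

lemma dprod_add_right: "dprod n f (\<lambda>m. g m + g' m) m = dprod n f g m + dprod n f g' m"
  unfolding dprod_def nablas_add[symmetric] by (simp add: distrib_left)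

lemma dprod_scale_left: "dprod n (\<lambda>m. r * f m) g m = r * dprod n f g m"
  unfolding dprod_def by (subst nablas_hom[of "(*) r"]) (simp_all add: right_diff_distrib mult.assoc)

lemma dprod_scale_right: "dprod n f (\<lambda>m. r * g m) m = r * dprod n f g m"
  unfolding dprod_def by (subst nablas_hom[of "(*) r"]) (simp_all add: right_diff_distrib mult.left_commute)

lemma dprod_zero_left: "dprod n (\<lambda>m. 0) g m = 0"
  using dprod_scale_left[of n 0 "\<lambda>m. 0" g m] by simp

lemma dprod_zero_right: "dprod n f (\<lambda>m. 0) m = 0"
  using dprod_scale_right[of n f 0 "\<lambda>m. 0" m] by simp

lemma dshift_dprod: "dshift (dprod n f g) = dprod n f (dshift g)"
  by (rule ext) (simp add: dshift_def[abs_def] dprod_def nablas_shift_right[where H = "\<lambda>x y. f x * g y"])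

lemma dprod_commute: "dprod m a (dprod n b c) = dprod n b (dprod m a c)"
proof (induction m arbitrary: a c)
  case 0
  have *: "dprod n b (dprod 0 a c) i = a 0 * dprod n b c i" for i
    by (simp add: dprod_0[abs_def] dprod_scale_right)
  show ?case by (rule ext) (metis * dprod_0)
next
  case (Suc m)
  show ?case
  proof
    fix i
    have "dprod n b (dprod (Suc m) a c) i = dprod n b (\<lambda>j. dprod m (dshift a) c j - dprod m a (dshift c) j) i"
      by (simp add: dprod_Suc[abs_def])
    also have "\<dots> = dprod m (dshift a) (dprod n b c) i - dprod m a (dprod n b (dshift c)) i"
      by (simp add: dprod_diff_right Suc)
    also have "\<dots> = dprod (Suc m) a (dprod n b c) i" by (simp add: dprod_Suc dshift_dprod)
    finally show "dprod (Suc m) a (dprod n b c) i = dprod n b (dprod (Suc m) a c) i" ..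
  qed
qed

lemma dprod_assoc_step:
  "dprod l (dprod k (dshift a) b) c i - dprod l (dprod k a b) (dshift c) i =
    dprod l (dprod (Suc k) a b) c i + dprod (Suc l) (dprod k a b) c i"
proof -
  have "dprod l (dprod (Suc k) a b) c i = dprod l (dprod k (dshift a) b) c i - dprod l (dprod k a (dshift b)) c i"
    by (simp add: dprod_Suc[abs_def] flip: dprod_diff_left)
  moreover have "dprod (Suc l) (dprod k a b) c i = dprod l (dprod k a (dshift b)) c i - dprod l (dprod k a b) (dshift c) i"
    by (simp add: dprod_Suc dshift_dprod)
  ultimately show ?thesis by simp
qed

text \<open>
  The coefficients of conformal associativity, where \<open>(\<lambda> + \<mu>)\<^sup>n\<close> contributes the binomial coefficients.  It holds for arbitrary
  distributions, without locality: \<open>w - z\<close> acts as the sum of \<open>w - u\<close> and \<open>u - z\<close>.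
\<close>

lemma dprod_assoc:
  "dprod m a (dprod n b c) i = (\<Sum>k\<le>m. of_nat (m choose k) * dprod (m + n - k) (dprod k a b) c i)"
proof (induction m arbitrary: a c)
  case 0
  have "dprod 0 a b = (\<lambda>m. a 0 * b m)" by (simp add: dprod_0[abs_def])
  then show ?case by (simp add: dprod_0 dprod_scale_left)
next
  case (Suc m)
  let ?X = "\<lambda>k. dprod (Suc m + n - k) (dprod k a b) c i"
  have "dprod (Suc m) a (dprod n b c) i = dprod m (dshift a) (dprod n b c) i - dprod m a (dprod n b (dshift c)) i"
    by (simp add: dprod_Suc dshift_dprod)
  also have "\<dots> = (\<Sum>k\<le>m. of_nat (m choose k) *
      (dprod (m + n - k) (dprod k (dshift a) b) c i - dprod (m + n - k) (dprod k a b) (dshift c) i))"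
    by (simp add: Suc sum_subtractf right_diff_distrib)
  also have "\<dots> = (\<Sum>k\<le>m. of_nat (m choose k) * (?X (Suc k) + ?X k))"
    by (rule sum.cong) (simp_all add: dprod_assoc_step Suc_diff_le)
  also have "\<dots> = (\<Sum>k\<le>m. of_nat (m choose k) * ?X (Suc k)) + (\<Sum>k\<le>m. of_nat (m choose k) * ?X k)"
    by (simp only: distrib_left sum.distrib)
  also have "(\<Sum>k\<le>m. of_nat (m choose k) * ?X k) = (\<Sum>k\<le>Suc m. of_nat (m choose k) * ?X k)"
    by (simp add: binomial_eq_0)
  also have "\<dots> = ?X 0 + (\<Sum>k\<le>m. of_nat (m choose Suc k) * ?X (Suc k))"
    by (simp only: sum.atMost_Suc_shift) simp
  also have "(\<Sum>k\<le>m. of_nat (m choose k) * ?X (Suc k)) + \<dots> =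
      ?X 0 + (\<Sum>k\<le>m. of_nat (Suc m choose Suc k) * ?X (Suc k))"
    by (simp add: distrib_right sum.distrib del: diff_Suc_Suc)
  also have "\<dots> = (\<Sum>k\<le>Suc m. of_nat (Suc m choose k) * ?X k)"
    by (simp only: sum.atMost_Suc_shift) simp
  finally show ?case .
qed

lemma dderiv_dshift: "\<partial> (dshift f) m = dshift (\<partial> f) m + f m"
  by (simp add: dderiv_def dshift_def algebra_simps)

lemma dderiv_simps:
  "\<partial> (\<lambda>m. f m + g m) m = \<partial> f m + \<partial> g m" "\<partial> (\<lambda>m. f m - g m) m = \<partial> f m - \<partial> g m"
  "\<partial> (\<lambda>m. r * f m) m = r * \<partial> f m" "\<partial> (\<lambda>m. - f m) m = - \<partial> f m" "\<partial> (\<lambda>m. 0) m = 0"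
  by (simp_all add: dderiv_def algebra_simps)

lemma dprod_dderiv_left: "dprod n (\<partial> f) g m = - (of_nat n * dprod (n - 1) f g m)"
proof (induction n arbitrary: f g)
  case 0
  then show ?case by (simp add: dprod_0 dderiv_def)
next
  case (Suc n)
  have s: "dshift (\<partial> f) = (\<lambda>m. \<partial> (dshift f) m - f m)" by (simp add: dderiv_dshift)
  have "dprod (Suc n) (\<partial> f) g m = dprod n (\<partial> (dshift f)) g m - dprod n f g m - dprod n (\<partial> f) (dshift g) m"
    by (simp add: dprod_Suc s dprod_diff_left)
  also have "\<dots> = - (of_nat n * (dprod (n - 1) (dshift f) g m - dprod (n - 1) f (dshift g) m)) - dprod n f g m"
    by (simp add: Suc algebra_simps)
  also have "\<dots> = - (of_nat (Suc n) * dprod n f g m)"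
  proof (cases n)
    case (Suc k)
    then have "dprod (n - 1) (dshift f) g m - dprod (n - 1) f (dshift g) m = dprod n f g m" by (simp add: dprod_Suc)
    then show ?thesis by (simp add: algebra_simps)
  qed simp
  finally show ?case by simp
qed

lemma dderiv_dprod: "\<partial> (dprod n f g) m = dprod n (\<partial> f) g m + dprod n f (\<partial> g) m"
proof (induction n arbitrary: f g m)
  case 0
  have "dprod 0 f g = (\<lambda>m. f 0 * g m)" by (simp add: dprod_0[abs_def])
  then show ?case by (simp add: dderiv_simps dprod_0) (simp add: dderiv_def)
next
  case (Suc n)
  have s: "dshift (\<partial> f) = (\<lambda>m. \<partial> (dshift f) m - f m)" for f :: "int \<Rightarrow> 'a" by (simp add: dderiv_dshift)
  have "dprod (Suc n) f g = (\<lambda>m. dprod n (dshift f) g m - dprod n f (dshift g) m)" by (simp add: dprod_Suc[abs_def])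
  then show ?case by (simp add: dderiv_simps dprod_Suc s dprod_diff_left dprod_diff_right Suc)
qed

lemma dprod_derivation:
  assumes add: "\<And>p q. \<delta> (p - q) = \<delta> p - \<delta> q" and mult: "\<And>p q. \<delta> (p * q) = \<delta> p * q + p * \<delta> q"
  shows "\<delta> (dprod n f g m) = dprod n (\<lambda>i. \<delta> (f i)) g m + dprod n f (\<lambda>i. \<delta> (g i)) m"
  unfolding dprod_def nablas_add[symmetric] by (subst nablas_hom[of \<delta>]) (simp_all add: add mult)

section \<open>Integer binomial coefficients\<close>

text \<open>
  Falling factorials and binomial coefficients with an upper argument that may be negative, as it runs over the
  modes of a distribution.
\<close>

primrec ffact :: "int \<Rightarrow> nat \<Rightarrow> int" where
  "ffact m 0 = 1"
| "ffact m (Suc k) = ffact m k * (m - int k)"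

lemma ffact_Suc_left: "ffact m (Suc k) = m * ffact (m - 1) k"
  by (induction k) (simp_all add: algebra_simps)

lemma ffact_pascal: "ffact (m + 1) (Suc k) = ffact m (Suc k) + (int k + 1) * ffact m k"
  by (subst ffact_Suc_left) (simp add: algebra_simps)

lemma fact_dvd_ffact: "fact k dvd ffact m k"
proof (induction k arbitrary: m)
  case (Suc k)
  have step: "fact (Suc k) dvd ffact (m + 1) (Suc k) \<longleftrightarrow> fact (Suc k) dvd ffact m (Suc k)" for m
  proof -
    have "(fact (Suc k) :: int) dvd (int k + 1) * ffact m k"
      using Suc[of m] by (simp add: mult_dvd_mono add.commute)
    then show ?thesis unfolding ffact_pascal by (simp only: dvd_add_left_iff)
  qed
  show ?case
  proof (induction m rule: int_induct[where k = 0])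
    case base
    then show ?case by (simp only: ffact_Suc_left) simp
  next
    case (step1 i)
    then show ?case using step[of i] by blast
  next
    case (step2 i)
    then show ?case using step[of "i - 1"] by simp
  qed
qed simp

definition ibinomial :: "int \<Rightarrow> nat \<Rightarrow> int"
  where "ibinomial m k = ffact m k div fact k"

lemma ffact_ibinomial: "ffact m k = fact k * ibinomial m k"
  using fact_dvd_ffact[of k m] by (simp add: ibinomial_def)

lemma ibinomial_pascal: "ibinomial (m + 1) (Suc k) = ibinomial m (Suc k) + ibinomial m k"
proof -
  have "fact (Suc k) * ibinomial (m + 1) (Suc k) = fact (Suc k) * (ibinomial m (Suc k) + ibinomial m k)"
    using ffact_pascal[of m k] unfolding ffact_ibinomial by (simp add: algebra_simps)
  then show ?thesis by simp
qed

lemma ibinomial_0 [simp]: "ibinomial m 0 = 1" "ibinomial 0 (Suc k) = 0"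
  using ffact_ibinomial[of m 0] ffact_ibinomial[of 0 "Suc k"] by (simp_all add: ffact_Suc_left del: ffact.simps(2))

text \<open>
  The divided power \<open>\<partial>\<^sup>k / k!\<close>, which has integer coefficients on modes.
\<close>

definition ddpow :: "nat \<Rightarrow> (int \<Rightarrow> 'a::comm_ring_1) \<Rightarrow> int \<Rightarrow> 'a"
  where "ddpow k f m = (- 1) ^ k * of_int (ibinomial m k) * f (m - int k)"

lemma dderiv_funpow: "(\<partial> ^^ k) f m = of_nat (fact k) * ddpow k f m"
proof -
  have "(\<partial> ^^ k) f m = (- 1) ^ k * of_int (ffact m k) * f (m - int k)"
  proof (induction k arbitrary: m)
    case (Suc k)
    then show ?case unfolding ffact_Suc_left by (simp add: dderiv_def algebra_simps)
  qed simp
  moreover have "ffact m k = int (fact k) * ibinomial m k" by (simp add: ffact_ibinomial of_nat_fact)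
  ultimately show ?thesis by (simp only: ddpow_def of_int_mult of_int_of_nat_eq mult.assoc mult.left_commute)
qed

section \<open>Locality modulo an ideal\<close>

definition ring_ideal :: "'a::comm_ring_1 set \<Rightarrow> bool"
  where "ring_ideal I \<longleftrightarrow> 0 \<in> I \<and> (\<forall>a\<in>I. \<forall>b\<in>I. a - b \<in> I) \<and> (\<forall>r. \<forall>a\<in>I. r * a \<in> I)"

lemma ring_idealD:
  assumes "ring_ideal I"
  shows "0 \<in> I" "a \<in> I \<Longrightarrow> b \<in> I \<Longrightarrow> a - b \<in> I" "a \<in> I \<Longrightarrow> r * a \<in> I" "a \<in> I \<Longrightarrow> a * r \<in> I"
    "a \<in> I \<Longrightarrow> - a \<in> I" "a \<in> I \<Longrightarrow> b \<in> I \<Longrightarrow> a + b \<in> I"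
proof -
  show *: "0 \<in> I" "a \<in> I \<Longrightarrow> b \<in> I \<Longrightarrow> a - b \<in> I" "a \<in> I \<Longrightarrow> r * a \<in> I" for a b r
    using assms by (auto simp: ring_ideal_def)
  show "a \<in> I \<Longrightarrow> a * r \<in> I" using *(3)[of a r] by (simp add: mult.commute)
  show n: "a \<in> I \<Longrightarrow> - a \<in> I" for a using *(3)[of a "- 1"] by simp
  show "a \<in> I \<Longrightarrow> b \<in> I \<Longrightarrow> a + b \<in> I" using *(2)[of a "- b"] n[of b] by simp
qed

lemma ring_ideal_add_iff: "ring_ideal I \<Longrightarrow> b \<in> I \<Longrightarrow> b + c \<in> I \<longleftrightarrow> c \<in> I"
  using ring_idealD(2)[of I "b + c" b] ring_idealD(6)[of I b c] by auto

lemma ring_ideal_sum: "ring_ideal I \<Longrightarrow> (\<And>i. i \<in> A \<Longrightarrow> f i \<in> I) \<Longrightarrow> sum f A \<in> I"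
  by (induction A rule: infinite_finite_induct) (auto intro: ring_idealD)

text \<open>
  Mutual locality over the quotient of the ring of coefficients by \<open>I\<close>.
\<close>

definition local_mod :: "'a::comm_ring_1 set \<Rightarrow> nat \<Rightarrow> (int \<Rightarrow> 'a) \<Rightarrow> (int \<Rightarrow> 'a) \<Rightarrow> bool"
  where "local_mod I N f g \<longleftrightarrow> (\<forall>m n. (nabla ^^ N) (\<lambda>x y. f x * g y) m n \<in> I)"

lemma nablas_ideal_mono:
  assumes I: "ring_ideal I" and H: "\<And>m n. (nabla ^^ N) H m n \<in> I" and le: "N \<le> N'"
  shows "(nabla ^^ N') H m n \<in> I"
proof -
  have "(nabla ^^ N') H = (nabla ^^ (N' - N)) ((nabla ^^ N) H)"
    using le by (simp add: nablas_add_exp)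
  then show ?thesis using nablas_closed[where A = I and H = "(nabla ^^ N) H"] H ring_idealD(2)[OF I] by simp
qed

lemma local_mod_mono: "ring_ideal I \<Longrightarrow> local_mod I N f g \<Longrightarrow> N \<le> N' \<Longrightarrow> local_mod I N' f g"
  unfolding local_mod_def using nablas_ideal_mono by blast

lemma local_mod_sym: "ring_ideal I \<Longrightarrow> local_mod I N f g \<Longrightarrow> local_mod I N g f"
  unfolding local_mod_def
  using nablas_flip[of N "\<lambda>x y. f x * g y"] ring_idealD(5)[of I] by (simp add: mult.commute[of "g _"])

lemma local_mod_add: "ring_ideal I \<Longrightarrow> local_mod I N f h \<Longrightarrow> local_mod I N g h \<Longrightarrow> local_mod I N (\<lambda>m. f m + g m) h"
  unfolding local_mod_def by (simp add: distrib_right nablas_add ring_idealD)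

lemma local_mod_scale: "ring_ideal I \<Longrightarrow> local_mod I N f h \<Longrightarrow> local_mod I N (\<lambda>m. r * f m) h"
  unfolding local_mod_def mult.assoc by (simp add: ring_idealD right_diff_distrib flip: nablas_hom[of "(*) r"])

text \<open>
  Dong's lemma is immediate over a commutative ring: \<open>f\<close> is a spectator for the locality of
  \<open>g\<close> and \<open>h\<close>.
\<close>

lemma local_mod_dprod:
  assumes I: "ring_ideal I" and loc: "local_mod I N g h"
  shows "local_mod I N (dprod n f g) h"
proof -
  have "local_mod I N (\<lambda>m. (nabla ^^ n) (\<lambda>x y. f x * g y) k m) h" for k
  proof (induction n arbitrary: k)
    case 0
    then show ?case using local_mod_scale[OF I loc] by simp
  next
    case (Suc n)
    let ?F = "\<lambda>k m. (nabla ^^ n) (\<lambda>x y. f x * g y) k m"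
    have "local_mod I N (\<lambda>m. ?F k (m + 1)) h"
      using Suc[of k] nablas_shift_left[where k = N and a = 1 and H = "\<lambda>x y. ?F k x * h y"]
      unfolding local_mod_def by simp
    from local_mod_add[OF I Suc[of "k + 1"] local_mod_scale[OF I this, of "- 1"]]
    have "local_mod I N (\<lambda>m. ?F (k + 1) m - ?F k (m + 1)) h" by simp
    then show ?case by (simp only: nablas_Suc)
  qed
  then show ?thesis by (simp add: dprod_def[abs_def])
qed

lemma local_mod_dderiv:
  assumes I: "ring_ideal I" and loc: "local_mod I N f g"
  shows "local_mod I (Suc N) (\<partial> f) g"
proof -
  have *: "(nabla ^^ k) (\<lambda>x y. of_int x * H x y) m n = of_int m * (nabla ^^ k) H m n + of_nat k * (nabla ^^ (k - 1)) H (m + 1) n"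
    for k m n and H :: "int \<Rightarrow> int \<Rightarrow> 'a"
  proof (induction k arbitrary: m n)
    case (Suc k)
    have e: "of_nat k * (nabla ^^ k) H (m + 1) n =
        of_nat k * (nabla ^^ (k - 1)) H (m + 1 + 1) n - of_nat k * (nabla ^^ (k - 1)) H (m + 1) (n + 1)"
      by (cases k) (simp_all add: nablas_Suc right_diff_distrib del: funpow.simps of_nat_Suc)
    have "(nabla ^^ Suc k) (\<lambda>x y. of_int x * H x y) m n =
        (of_int (m + 1) * (nabla ^^ k) H (m + 1) n + of_nat k * (nabla ^^ (k - 1)) H (m + 1 + 1) n)
        - (of_int m * (nabla ^^ k) H m (n + 1) + of_nat k * (nabla ^^ (k - 1)) H (m + 1) (n + 1))"
      by (simp only: nablas_Suc Suc.IH)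
    also have "\<dots> = of_int m * ((nabla ^^ k) H (m + 1) n - (nabla ^^ k) H m (n + 1))
        + ((nabla ^^ k) H (m + 1) n + of_nat k * (nabla ^^ k) H (m + 1) n)"
      unfolding e by (simp add: algebra_simps)
    also have "\<dots> = of_int m * (nabla ^^ Suc k) H m n + of_nat (Suc k) * (nabla ^^ (Suc k - 1)) H (m + 1) n"
      by (simp add: nablas_Suc distrib_right del: funpow.simps)
    finally show ?case .
  qed simp
  let ?H = "\<lambda>x y. f (x - 1) * g y"
  have H: "(nabla ^^ N) ?H m n \<in> I" for m n
    using loc nablas_shift_left[where k = N and a = "- 1" and H = "\<lambda>x y. f x * g y" and m = m and n = n]
    unfolding local_mod_def by simp
  have X: "(nabla ^^ Suc N) (\<lambda>x y. of_int x * ?H x y) m n \<in> I" for m n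
    unfolding * using H nablas_ideal_mono[OF I H, of "Suc N"] by (intro ring_idealD[OF I]) auto
  have "(nabla ^^ Suc N) (\<lambda>x y. - (of_int x * ?H x y)) m n = - (nabla ^^ Suc N) (\<lambda>x y. of_int x * ?H x y) m n" for m n
    by (rule nablas_hom[symmetric]) simp
  then show ?thesis
    using ring_idealD(5)[OF I X] unfolding local_mod_def dderiv_def
    by (simp add: mult.assoc del: funpow.simps)
qed

lemma dprod_local_zero: "ring_ideal I \<Longrightarrow> local_mod I N f g \<Longrightarrow> N \<le> n \<Longrightarrow> dprod n f g m \<in> I"
  using local_mod_mono[of I N f g n] by (auto simp: local_mod_def dprod_def)

text \<open>
  A function annihilated by \<open>nabla\<^sup>N\<close> is, along each antidiagonal, a polynomial of degree less than \<open>N\<close>, so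
  Newton's forward difference formula at \<open>0\<close> recovers it.
\<close>

lemma newton_interpolation:
  assumes I: "ring_ideal I"
  shows "(\<And>m n. (nabla ^^ N) G m n \<in> I) \<Longrightarrow>
    G m t - (\<Sum>k<N. of_int (ibinomial m k) * (nabla ^^ k) G 0 (m + t - int k)) \<in> I"
proof (induction N arbitrary: G m t)
  case 0
  then show ?case by simp
next
  case (Suc N)
  let ?P = "\<lambda>G N m t. G m t - (\<Sum>k<N. of_int (ibinomial m k) * (nabla ^^ k) G 0 (m + t - int k))"
  have "?P (nabla G) N m t \<in> I" for m t
    using Suc by (simp only: funpow_Suc_right comp_def)
  moreover have "?P G (Suc N) (m + 1) t = ?P (nabla G) N m t + ?P G (Suc N) m (t + 1)" for m t
  proof -
    have "(\<Sum>k<Suc N. of_int (ibinomial (m + 1) k) * (nabla ^^ k) G 0 (m + 1 + t - int k)) =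
        (\<Sum>k<N. of_int (ibinomial m k) * (nabla ^^ k) (nabla G) 0 (m + t - int k)) +
        (\<Sum>k<Suc N. of_int (ibinomial m k) * (nabla ^^ k) G 0 (m + (t + 1) - int k))"
    proof -
      have "(\<Sum>k<N. of_int (ibinomial (m + 1) (Suc k)) * (nabla ^^ Suc k) G 0 (m + 1 + t - int (Suc k))) =
        (\<Sum>k<N. of_int (ibinomial m k) * (nabla ^^ k) (nabla G) 0 (m + t - int k)) +
        (\<Sum>k<N. of_int (ibinomial m (Suc k)) * (nabla ^^ Suc k) G 0 (m + (t + 1) - int (Suc k)))"
        unfolding sum.distrib[symmetric] ibinomial_pascal
        by (rule sum.cong) (simp_all add: funpow_Suc_right distrib_right add.commute add.left_commute del: funpow.simps(2))
      then show ?thesis by (simp add: sum.lessThan_Suc_shift add.assoc del: sum.lessThan_Suc funpow.simps(2)) (simp add: add.commute add.left_commute)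
    qed
    then show ?thesis by (simp add: nabla_def[of G] del: sum.lessThan_Suc)
  qed
  ultimately have step: "?P G (Suc N) (m + 1) t \<in> I \<longleftrightarrow> ?P G (Suc N) m (t + 1) \<in> I" for m t
    by (simp only: ring_ideal_add_iff[OF I])
  have "\<forall>t. ?P G (Suc N) m t \<in> I"
  proof (induction m rule: int_induct[where k = 0])
    case base
    then show ?case by (simp add: sum.lessThan_Suc_shift ring_idealD(1)[OF I] del: sum.lessThan_Suc)
  next
    case (step1 i)
    then show ?case using step[of i] by blast
  next
    case (step2 i)
    show ?case
    proof
      fix t
      show "?P G (Suc N) (i - 1) t \<in> I" using step2 step[of "i - 1" "t - 1"] by simp
    qed
  qed
  then show ?case by blast
qed

text \<open>
  Conformal commutativity of local distributions, in coefficients: exchanging \<open>w\<close> and \<open>z\<close> in \<open>(w - z)\<^sup>i f(w) g(z)\<close>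
  costs a sign, and Newton interpolation expresses all modes through those with mode \<open>0\<close> in \<open>w\<close>.
\<close>

lemma dprod_skew:
  assumes I: "ring_ideal I" and loc: "local_mod I N f g"
  shows "dprod i g f m - (\<Sum>k<N. (- 1) ^ (i + k) * ddpow k (dprod (i + k) f g) m) \<in> I"
proof -
  let ?H = "\<lambda>x y. f x * g y"
  let ?G = "(nabla ^^ i) ?H"
  have G: "(nabla ^^ N) ?G m n \<in> I" for m n
    unfolding nablas_add_exp using nablas_ideal_mono[OF I, of N ?H "N + i"] loc by (simp add: local_mod_def)
  have k: "(nabla ^^ k) ?G 0 j = dprod (i + k) f g j" for k j
    by (simp add: nablas_add_exp dprod_def add.commute)
  have "?G m 0 - (\<Sum>k<N. of_int (ibinomial m k) * dprod (i + k) f g (m - int k)) \<in> I"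
    using newton_interpolation[OF I G, of m 0] by (simp add: k)
  from ring_idealD(3)[OF I this, of "(- 1) ^ i"]
  have "(- 1) ^ i * ?G m 0 - (\<Sum>k<N. (- 1) ^ i * (of_int (ibinomial m k) * dprod (i + k) f g (m - int k))) \<in> I"
    by (simp add: right_diff_distrib sum_distrib_left)
  moreover have "(- 1) ^ i * ?G m 0 = dprod i g f m"
    using nablas_flip[of i ?H 0 m] by (simp add: dprod_def mult.commute[of "g _"])
  moreover have "(- 1) ^ i * (of_int (ibinomial m k) * x) = (- 1) ^ (i + k) * ((- 1) ^ k * of_int (ibinomial m k) * x)"
    for k and x :: 'a
  proof -
    have "(- 1) ^ (i + k) * ((- 1) ^ k) = ((- 1) ^ i :: 'a)" by (simp add: power_add mult.assoc flip: power_mult_distrib)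
    then show ?thesis by (simp flip: mult.assoc)
  qed
  ultimately show ?thesis by (simp add: ddpow_def)
qed

section \<open>The ideal of null differential polynomials\<close>

text \<open>
  In the binomial expansion of \<open>(s - t)\<^sup>n\<close> every term contains \<open>s\<^sup>i\<close> or \<open>t\<^sup>j\<close> as a factor.
\<close>

lemma commuting_difference_power:
  fixes s t :: "'f::ab_group_add \<Rightarrow> 'f"
  assumes s: "\<And>F G. s (F - G) = s F - s G" and t: "\<And>F G. t (F - G) = t F - t G"
    and comm: "\<And>F. s (t F) = t (s F)"
    and A: "\<And>F G. F \<in> A \<Longrightarrow> G \<in> A \<Longrightarrow> F - G \<in> A" "\<And>F. F \<in> A \<Longrightarrow> s F \<in> A" "\<And>F. F \<in> A \<Longrightarrow> t F \<in> A"
  shows "(s ^^ i) F \<in> A \<Longrightarrow> (t ^^ j) F \<in> A \<Longrightarrow> i + j \<le> Suc n \<Longrightarrow> ((\<lambda>F. s F - t F) ^^ n) F \<in> A"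
proof (induction n arbitrary: F i j)
  let ?u = "\<lambda>F. s F - t F"
  have closed: "F \<in> A \<Longrightarrow> (?u ^^ n) F \<in> A" for F n
    by (induction n) (auto intro: A)
  {
    case 0
    then have "i = 0 \<or> j = 0" by auto
    then show ?case using 0 by auto
  next
    case (Suc n)
    have u: "(?u ^^ n) (F - G) = (?u ^^ n) F - (?u ^^ n) G" for F G
    proof (induction n)
      case (Suc n)
      show ?case unfolding funpow.simps comp_apply Suc s t by simp
    qed simp
    have st: "(t ^^ j) (s F) = s ((t ^^ j) F)" for j by (induction j) (simp_all add: comm)
    have ts: "(s ^^ i) (t F) = t ((s ^^ i) F)" for i by (induction i) (simp_all add: comm)
    show ?case
    proof (cases i)
      case 0
      then show ?thesis using closed[of F "Suc n"] Suc.prems(1) by (simp del: funpow.simps(2))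
    next
      case i: (Suc i')
      show ?thesis
      proof (cases j)
        case 0
        then show ?thesis using closed[of F "Suc n"] Suc.prems(2) by (simp del: funpow.simps(2))
      next
        case j: (Suc j')
        have "(?u ^^ n) (s F) \<in> A"
          by (rule Suc.IH[of i' _ j]) (use Suc.prems i A(2) in \<open>simp_all add: st funpow_swap1[symmetric] del: funpow.simps(2) add: funpow_Suc_right\<close>)
        moreover have "(?u ^^ n) (t F) \<in> A"
          by (rule Suc.IH[of i _ j']) (use Suc.prems j A(3) in \<open>simp_all add: ts funpow_swap1[symmetric] del: funpow.simps(2) add: funpow_Suc_right\<close>)
        ultimately show ?thesis by (simp add: funpow_Suc_right u A(1) del: funpow.simps(2))
      qed
    qed
  }
qed

text \<open>
  If \<open>(x - z)\<^sup>M\<close> and \<open>(y - z)\<^sup>N\<close> kill \<open>f(x) g(y) h(z)\<close>, so does a sufficiently high power of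
  \<open>x - y = (x - z) - (y - z)\<close>.
\<close>

lemma local_mod_transitive:
  assumes I: "ring_ideal I" and fh: "local_mod I M f h" and gh: "local_mod I N g h"
  shows "h z * (nabla ^^ (M + N)) (\<lambda>x y. f x * g y) x y \<in> I"
proof -
  define s :: "(int \<Rightarrow> int \<Rightarrow> int \<Rightarrow> 'a) \<Rightarrow> int \<Rightarrow> int \<Rightarrow> int \<Rightarrow> 'a"
    where "s F = (\<lambda>x y z. F (x + 1) y z - F x y (z + 1))" for F
  define t :: "(int \<Rightarrow> int \<Rightarrow> int \<Rightarrow> 'a) \<Rightarrow> int \<Rightarrow> int \<Rightarrow> int \<Rightarrow> 'a"
    where "t F = (\<lambda>x y z. F x (y + 1) z - F x y (z + 1))" for F
  define A where "A = {F :: int \<Rightarrow> int \<Rightarrow> int \<Rightarrow> 'a. \<forall>x y z. F x y z \<in> I}"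
  define F where "F = (\<lambda>x y z. f x * g y * h z)"
  have s: "(s ^^ k) F x y z = g y * (nabla ^^ k) (\<lambda>x z. f x * h z) x z" for k x y z
    by (induction k arbitrary: x z) (simp_all add: F_def s_def nabla_def algebra_simps)
  have t: "(t ^^ k) F x y z = f x * (nabla ^^ k) (\<lambda>y z. g y * h z) y z" for k x y z
    by (induction k arbitrary: y z) (simp_all add: F_def t_def nabla_def algebra_simps)
  have u: "((\<lambda>F. s F - t F) ^^ k) F x y z = h z * (nabla ^^ k) (\<lambda>x y. f x * g y) x y" for k x y z
    by (induction k arbitrary: x y) (simp_all add: F_def t_def s_def nabla_def algebra_simps)
  have "((\<lambda>F. s F - t F) ^^ (M + N)) F \<in> A"
  proof (rule commuting_difference_power[where i = M and j = N])
    show "(s ^^ M) F \<in> A" using fh by (auto simp: A_def s local_mod_def intro: ring_idealD(3)[OF I])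
    show "(t ^^ N) F \<in> A" using gh by (auto simp: A_def t local_mod_def intro: ring_idealD(3)[OF I])
  qed (auto simp: s_def t_def A_def fun_eq_iff algebra_simps intro: ring_idealD(2)[OF I])
  then show ?thesis by (simp add: A_def u)
qed

text \<open>
  \<open>J\<close> is an ideal of the Novikov algebra modulo which the generating series are local with the common
  exponent \<open>M\<close>.  Working modulo \<open>J\<close> replaces passing to a quotient type.
\<close>

locale local_novikov_eval = novikov_eval nop sm gen
  for nop :: "'a::ab_group_add \<Rightarrow> 'a \<Rightarrow> 'a" (infixl \<open>\<circ>\<^sub>N\<close> 70) and sm :: "'k \<Rightarrow> 'a \<Rightarrow> 'a"
    and gen :: "'x \<times> int \<Rightarrow> 'a" +
  fixes J :: "'a set" and M :: nat
  assumes J_0: "0 \<in> J" and J_diff: "x \<in> J \<Longrightarrow> y \<in> J \<Longrightarrow> x - y \<in> J"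
    and J_left: "y \<in> J \<Longrightarrow> x \<circ>\<^sub>N y \<in> J" and J_right: "x \<in> J \<Longrightarrow> x \<circ>\<^sub>N y \<in> J"
    and J_sm: "x \<in> J \<Longrightarrow> sm k x \<in> J"
    and J_local: "(nabla ^^ M) (\<lambda>m n. gen (a, m) \<circ>\<^sub>N gen (b, n)) m n \<in> J"
begin

lemma J_minus: "x \<in> J \<Longrightarrow> - x \<in> J"
  using J_diff[OF J_0] by simp

lemma J_add: "x \<in> J \<Longrightarrow> y \<in> J \<Longrightarrow> x + y \<in> J"
  using J_diff[OF _ J_minus, of x y] by simp

text \<open>
  The largest differential ideal whose elements all evaluate into \<open>J\<close>.
\<close>

definition null_ideal :: "('k, 'x \<times> int) dpoly set"
  where "null_ideal = {p. \<forall>k q. eval ((\<D> ^^ k) p * q) \<in> J}"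

lemma deriv_funpow_simps [simp]:
  "(\<D> ^^ k) (p + q) = (\<D> ^^ k) p + (\<D> ^^ k) q" "(\<D> ^^ k) (p - q) = (\<D> ^^ k) p - (\<D> ^^ k) q" "(\<D> ^^ k) 0 = 0"
  by (induction k) simp_all

lemma homog_deriv_funpow: "homog w p \<Longrightarrow> homog (w + int k) ((\<D> ^^ k) p)"
proof (induction k)
  case (Suc k)
  then show ?case using homog_deriv[of "w + int k" "(\<D> ^^ k) p"] by (simp add: ac_simps)
qed simp

lemma null_ideal_deriv: "p \<in> null_ideal \<Longrightarrow> \<D> p \<in> null_ideal"
  unfolding null_ideal_def by (auto simp: funpow_swap1 simp flip: funpow.simps(2)[THEN fun_cong, unfolded comp_def])
    (metis comp_apply funpow.simps(2) funpow_swap1)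

lemma null_ideal_eval: "p \<in> null_ideal \<Longrightarrow> eval (p * q) \<in> J" "p \<in> null_ideal \<Longrightarrow> eval p \<in> J"
proof -
  show *: "p \<in> null_ideal \<Longrightarrow> eval (p * q) \<in> J" for q
    unfolding null_ideal_def by (metis (mono_tags, lifting) funpow_0 mem_Collect_eq)
  show "p \<in> null_ideal \<Longrightarrow> eval p \<in> J" using *[of 1] by simp
qed

lemma null_ideal_ideal: "ring_ideal null_ideal"
proof -
  have "p \<in> null_ideal \<Longrightarrow> eval ((\<D> ^^ k) (r * p) * q) \<in> J" for p r k q
  proof (induction k arbitrary: p r)
    case 0
    then show ?case using null_ideal_eval(1)[of p "r * q"] by (simp add: ac_simps)
  next
    case (Suc k)
    then show ?case
      using J_add[OF Suc.IH[of p "\<D> r"] Suc.IH[of "\<D> p" r]] null_ideal_deriv[of p]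
      by (simp add: funpow_Suc_right dpoly_deriv_mult distrib_right del: funpow.simps(2))
  qed
  then show ?thesis
    unfolding ring_ideal_def by (auto simp: null_ideal_def J_0 left_diff_distrib J_diff)
qed

sublocale mult_ops: graded_operators "\<lambda>b i p. var (Dv b i) * p" "\<D> :: ('k, 'x \<times> int) dpoly \<Rightarrow> _"
  by unfold_locales (simp_all add: distrib_left mult.left_commute dpoly_deriv_mult)

lemma word_op_mult: "mult_ops.word_op ws p = mult_ops.word_op ws 1 * p"
  by (induction ws) (auto simp: mult.assoc)

lemma homog_word_op: "homog w p \<Longrightarrow> homog (mult_ops.word_weight ws + w) (mult_ops.word_op ws p)"
proof (induction ws)
  case (Cons bi ws)
  obtain b i where "bi = (b, i)" by fastforce
  then show ?case
    using homog_mult[of "int i - 1" "var (Dv b i)", OF _ Cons.IH[OF Cons.prems]] by (simp add: add.assoc)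
qed simp

lemma homog_1: "homog 0 1"
  by (simp add: homog_def)

text \<open>
  The Novikov algebra modulo \<open>J\<close> embeds into the differential polynomials modulo \<open>null_ideal\<close>.  For
  a multiple of \<open>D\<^sup>k p\<close> by a monomial to have a value at all, the monomial must have weight \<open>-k\<close>; it is then a
  balanced word, and absorption applies to the polynomials of weight \<open>-1\<close> with values in \<open>J\<close>,
  because \<open>J\<close> is an ideal.
\<close>

lemma null_ideal_kernel:
  assumes p: "homog (- 1) p" "eval p \<in> J"
  shows "p \<in> null_ideal"
proof -
  let ?K = "{p. homog (- 1) p \<and> eval p \<in> J}"
  have words: "mult_ops.word_op ws ((\<D> ^^ k) p) \<in> ?K" if "mult_ops.word_weight ws = - int k" for ws k
  proof (rule mult_ops.balanced_words_absorbed[where n = "length ws"])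
    show "c + d \<in> ?K" if "c \<in> ?K" "d \<in> ?K" for c d using that by (auto intro: homog_add J_add)
    show "0 \<in> ?K" by (simp add: J_0)
    show "- c \<in> ?K" if "c \<in> ?K" for c using that by (auto intro: homog_minus J_minus)
    show "var (Dv g 1) * c \<in> ?K" if "c \<in> ?K" for g c
      using that homog_mult[of 0 "var (Dv g 1)" "- 1" c] eval_novikov[of "var (Dv g 0)" c] J_left by simp
    show "var (Dv g 0) * \<D> c \<in> ?K" if "c \<in> ?K" for g c
      using that homog_mult[of "- 1" "var (Dv g 0)" 0 "\<D> c"] homog_deriv[of "- 1" c]
        eval_novikov[of c "var (Dv g 0)"] J_right by (simp add: mult.commute)
    show "\<D> (mult_ops.word_op vs c) - mult_ops.word_op vs (\<D> c) \<in> ?K"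
      if "mult_ops.word_weight vs = - 1" "c \<in> ?K" for vs c
    proof -
      let ?w = "mult_ops.word_op vs 1"
      have w: "homog (- 1) ?w" using homog_word_op[OF homog_1, of vs] that by simp
      have "\<D> (mult_ops.word_op vs c) - mult_ops.word_op vs (\<D> c) = \<D> ?w * c"
        by (subst (1 2) word_op_mult) (simp add: dpoly_deriv_mult)
      moreover have "homog (- 1) (\<D> ?w * c)" using homog_mult[OF homog_deriv[OF w], of "- 1" c] that by simp
      ultimately show ?thesis using eval_novikov[OF w, of c] J_left that by simp
    qed
    show "p \<in> ?K" using p by simp
  qed (use that in simp_all)
  have mon: "eval (mult_ops.word_op ws ((\<D> ^^ k) p) * frag_of m) \<in> J"
    if "mult_ops.word_weight ws + mwt m = - int k" for ws k m
    using that
  proof (induction m arbitrary: ws)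
    case empty
    then show ?case using words[of ws k] by simp
  next
    case (add v m)
    have split: "c * frag_of (add_mset v m) = var v * (c * frag_of m)" for c :: "('k, 'x \<times> int) dpoly" and v
      by (simp add: mult.left_commute[of _ c])
    show ?case
    proof (cases v)
      case (Sc k)
      then show ?thesis using add J_sm by (simp add: split eval_scalar)
    next
      case (Dv b i)
      have "eval (mult_ops.word_op ((b, i) # ws) ((\<D> ^^ k) p) * frag_of m) \<in> J"
        by (rule add.IH) (use add.prems Dv in simp)
      then show ?thesis by (simp add: split Dv mult.assoc)
    qed
  qed
  have "eval ((\<D> ^^ k) p * q) \<in> J" for k q
  proof (induction q rule: dpoly_induct)
    case (frag m)
    show ?case
    proof (cases "mwt m = - int k")
      case True
      then show ?thesis using mon[of "[]" m k] by simp
    next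
      case False
      have "homog (- 1 + int k + mwt m) ((\<D> ^^ k) p * frag_of m)"
        by (intro homog_mult homog_deriv_funpow p) simp
      then show ?thesis using eval_homog False J_0 by simp
    qed
  qed (simp_all add: J_0 J_diff right_diff_distrib)
  then show ?thesis by (simp add: null_ideal_def)
qed

text \<open>
  If \<open>p\<close> has nonnegative weight, a monomial that brings \<open>D\<^sup>k p\<close> to weight \<open>-1\<close> contains at
  least \<open>k + 1\<close> undifferentiated generators.  One of them annihilates \<open>p\<close>, and the \<open>k\<close> others absorb the derivatives.
\<close>

lemma null_ideal_test:
  assumes w: "homog w p" "0 \<le> w" and test: "\<And>b. var (Dv b 0) * p \<in> null_ideal"
  shows "p \<in> null_ideal"
proof -
  have words: "mult_ops.word_op zs ((\<D> ^^ k) p) \<in> null_ideal" if "length zs = Suc k" "\<forall>z\<in>set zs. snd z = 0" for zs k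
    using that
  proof (induction k arbitrary: zs)
    case 0
    then obtain b where "zs = [(b, 0)]" by (cases zs) auto
    then show ?case using test by simp
  next
    case (Suc k)
    then obtain b zs' where zs: "zs = (b, 0) # zs'" by (cases zs) auto
    let ?e = "(\<D> ^^ k) p"
    have "mult_ops.word_op zs' ?e \<in> null_ideal" by (rule Suc.IH) (use zs Suc.prems in auto)
    from ring_idealD(3)[OF null_ideal_ideal null_ideal_deriv[OF this], of "var (Dv b 0)"]
    have 1: "var (Dv b 0) * mult_ops.word_op zs' (\<D> ?e) + (\<Sum>v\<leftarrow>mult_ops.word_derivs zs'. var (Dv b 0) * mult_ops.word_op v ?e) \<in> null_ideal"
      by (simp add: mult_ops.D_word_op distrib_left sum_list_const_mult)
    have 2: "var (Dv b 0) * mult_ops.word_op v ?e \<in> null_ideal" if "v \<in> set (mult_ops.word_derivs zs')" for v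
    proof -
      from mult_ops.word_derivs_split[OF that] obtain q h j r where v: "zs' = q @ (h, j) # r" "v = q @ (h, Suc j) # r" by blast
      have "mult_ops.word_op ((b, 0) # q @ r) ?e \<in> null_ideal" by (rule Suc.IH) (use Suc.prems zs v in auto)
      then have "var (Dv h (Suc j)) * mult_ops.word_op ((b, 0) # q @ r) ?e \<in> null_ideal"
        by (rule ring_idealD(3)[OF null_ideal_ideal])
      then show ?thesis unfolding v mult_ops.word_op_simps mult_ops.word_op_L by (simp only: mult.left_commute)
    qed
    have "(\<Sum>v\<leftarrow>vs. var (Dv b 0) * mult_ops.word_op v ?e) \<in> null_ideal"
      if "set vs \<subseteq> set (mult_ops.word_derivs zs')" for vs
      using that by (induction vs) (auto intro: ring_idealD[OF null_ideal_ideal] 2)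
    from ring_idealD(2)[OF null_ideal_ideal 1 this[OF order.refl]]
    show ?case by (simp add: zs)
  qed
  have "eval ((\<D> ^^ k) p * q) \<in> J" for k q
  proof (induction q rule: dpoly_induct)
    case (frag m)
    show ?case
    proof (cases "w + int k + mwt m = - 1")
      case True
      then have "mwt m \<le> - int (Suc k)" using w by simp
      then obtain xs where xs: "length xs = Suc k" "mset (map (\<lambda>b. Dv b 0) xs) \<subseteq># m"
        by (rule mset_undifferentiated_subset)
      have wd: "mult_ops.word_op (map (\<lambda>b. (b, 0)) xs) c = frag_of (mset (map (\<lambda>b. Dv b 0) xs)) * c" for c
        by (induction xs) (simp_all add: frag_of_one mult.assoc[symmetric])
      have "(\<D> ^^ k) p * frag_of m = mult_ops.word_op (map (\<lambda>b. (b, 0)) xs) ((\<D> ^^ k) p)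
          * frag_of (m - mset (map (\<lambda>b. Dv b 0) xs))"
      proof -
        have "frag_of m = frag_of (mset (map (\<lambda>b. Dv b 0) xs)) * frag_of (m - mset (map (\<lambda>b. Dv b 0) xs))"
          using xs(2) by (simp only: frag_of_mult subset_mset.add_diff_inverse)
        then show ?thesis unfolding wd by (simp only: mult.assoc mult.left_commute)
      qed
      then show ?thesis using null_ideal_eval(1)[OF words[of "map (\<lambda>b. (b, 0)) xs" k]] xs(1) by simp
    next
      case False
      have "homog (w + int k + mwt m) ((\<D> ^^ k) p * frag_of m)"
        by (intro homog_mult homog_deriv_funpow w) simp
      then show ?thesis using eval_homog False J_0 by simp
    qed
  qed (simp_all add: J_0 J_diff right_diff_distrib)
  then show ?thesis by (simp add: null_ideal_def)
qed

section \<open>Locality of the generating distributions\<close>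

definition gdist :: "'x \<Rightarrow> nat \<Rightarrow> int \<Rightarrow> ('k, 'x \<times> int) dpoly"
  where "gdist a i n = var (Dv (a, n) i)"

lemma homog_nablas: "(\<And>m n. homog w (H m n)) \<Longrightarrow> homog w ((nabla ^^ k) H m n)"
  using nablas_closed[of "{p. homog w p}" H k m n] by (auto intro: homog_diff)

lemma homog_gdist_pair: "homog (int i + int j - 2) ((nabla ^^ k) (\<lambda>m n. gdist a i m * gdist b j n) m n)"
  by (rule homog_nablas) (simp add: gdist_def)

lemma deriv_gdist_pair:
  "\<D> ((nabla ^^ k) (\<lambda>m n. gdist a i m * gdist b j n) m n) =
    (nabla ^^ k) (\<lambda>m n. gdist a (Suc i) m * gdist b j n) m n + (nabla ^^ k) (\<lambda>m n. gdist a i m * gdist b (Suc j) n) m n"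
proof -
  have *: "\<D> (gdist a i m * gdist b j n) = gdist a (Suc i) m * gdist b j n + gdist a i m * gdist b (Suc j) n" for m n
    by (simp only: gdist_def dpoly_deriv_mult dpoly_deriv_var)
  show ?thesis by (subst nablas_hom) (simp_all only: * dpoly_deriv_additive nablas_add)
qed

text \<open>
  The value of \<open>D(a(w)) b(z)\<close> is the Novikov product of \<open>a(w)\<close> and \<open>b(z)\<close>.
\<close>

lemma local_gdist_1_0: "local_mod null_ideal M (gdist a 1) (gdist b 0)"
  unfolding local_mod_def
proof (intro allI null_ideal_kernel)
  fix m n
  show "homog (- 1) ((nabla ^^ M) (\<lambda>x y. gdist a 1 x * gdist b 0 y) m n)"
    using homog_gdist_pair[of 1 0 M a b m n] by simp
  have "eval (gdist a 1 x * gdist b 0 y) = gen (a, x) \<circ>\<^sub>N gen (b, y)" for x y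
    using eval_novikov[of "var (Dv (a, x) 0)" "var (Dv (b, y) 0)"] by (simp add: gdist_def mon_eval_single)
  then show "eval ((nabla ^^ M) (\<lambda>x y. gdist a 1 x * gdist b 0 y) m n) \<in> J"
    by (subst nablas_hom) (simp_all add: J_local)
qed

text \<open>
  A product of two differentiated generators has nonnegative weight, so it may be tested against
  undifferentiated series \<open>c(z)\<close>, to which both factors are local.  The exponents \<open>A\<close> and \<open>B\<close> must not depend on \<open>c\<close>.
\<close>

lemma local_gdist_differentiated:
  assumes "\<And>c. local_mod null_ideal A (gdist a (Suc i)) (gdist c 0)" "\<And>c. local_mod null_ideal B (gdist b (Suc j)) (gdist c 0)"
  shows "local_mod null_ideal (A + B) (gdist a (Suc i)) (gdist b (Suc j))"
  unfolding local_mod_def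
proof (intro allI)
  fix m n
  show "(nabla ^^ (A + B)) (\<lambda>x y. gdist a (Suc i) x * gdist b (Suc j) y) m n \<in> null_ideal"
  proof (rule null_ideal_test[OF homog_gdist_pair])
    fix c :: "'x \<times> int"
    obtain c' z where "c = (c', z)" by fastforce
    then show "var (Dv c 0) * (nabla ^^ (A + B)) (\<lambda>x y. gdist a (Suc i) x * gdist b (Suc j) y) m n \<in> null_ideal"
      using local_mod_transitive[OF null_ideal_ideal assms, of c' z m n] by (simp add: gdist_def)
  qed simp
qed

text \<open>
  Differentiating the locality of \<open>D\<^sup>i\<^sup>+\<^sup>1 a\<close> and \<open>b\<close> yields that of \<open>D\<^sup>i\<^sup>+\<^sup>2 a\<close> and \<open>b\<close>, up to
  the product of \<open>D\<^sup>i\<^sup>+\<^sup>1 a\<close> and \<open>D b\<close>, which is covered by the preceding lemma.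
\<close>

lemma local_gdist_0: "local_mod null_ideal (Suc i * M) (gdist a (Suc i)) (gdist b 0)"
proof (induction i arbitrary: a b)
  case 0
  then show ?case using local_gdist_1_0 by simp
next
  case (Suc i)
  have "local_mod null_ideal (Suc i * M + M) (gdist a (Suc i)) (gdist b 1)"
    using local_gdist_differentiated[of "Suc i * M" a i M b 0] Suc.IH local_gdist_1_0 by simp
  moreover have "local_mod null_ideal (Suc i * M + M) (gdist a (Suc i)) (gdist b 0)"
    by (rule local_mod_mono[OF null_ideal_ideal Suc.IH]) simp
  ultimately have Q: "(nabla ^^ (Suc i * M + M)) (\<lambda>m n. gdist a (Suc i) m * gdist b (Suc 0) n) m n \<in> null_ideal"
    and P: "(nabla ^^ (Suc i * M + M)) (\<lambda>m n. gdist a (Suc i) m * gdist b 0 n) m n \<in> null_ideal" for m n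
    by (simp_all only: local_mod_def One_nat_def)
  have "(nabla ^^ (Suc i * M + M)) (\<lambda>m n. gdist a (Suc (Suc i)) m * gdist b 0 n) m n \<in> null_ideal" for m n
    using ring_idealD(2)[OF null_ideal_ideal null_ideal_deriv[OF P[of m n]] Q[of m n]]
    unfolding deriv_gdist_pair by simp
  then show ?case by (simp add: local_mod_def add.commute)
qed

text \<open>
  Here the weight is \<open>-2\<close> and the test by undifferentiated generators is not available.  But the derivative of
  \<open>p\<close> is null, so only multiples of \<open>p\<close> itself matter; those with a value have a factor
  of weight \<open>1\<close>, hence one with a variable of order at least two.  For order two,
  both \<open>a\<close> and \<open>b\<close> are local to \<open>D\<^sup>2 c\<close> with exponent \<open>2 M\<close>; this gives \<open>4 M\<close>.
\<close>

lemma local_gdist_0_0: "local_mod null_ideal (4 * M) (gdist a 0) (gdist b 0)"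
  unfolding local_mod_def
proof (intro allI)
  fix m n
  let ?p = "(nabla ^^ (4 * M)) (\<lambda>x y. gdist a 0 x * gdist b 0 y) m n"
  have Dp: "\<D> ?p \<in> null_ideal"
  proof -
    have "local_mod null_ideal (4 * M) (gdist a 1) (gdist b 0)" "local_mod null_ideal (4 * M) (gdist a 0) (gdist b 1)"
      using local_mod_mono[OF null_ideal_ideal local_gdist_1_0]
        local_mod_mono[OF null_ideal_ideal local_mod_sym[OF null_ideal_ideal local_gdist_1_0]] by simp_all
    then show ?thesis
      unfolding deriv_gdist_pair local_mod_def One_nat_def by (intro ring_idealD(6)[OF null_ideal_ideal]) auto
  qed
  have high: "var (Dv c (k + 2)) * ?p \<in> null_ideal" for c k
  proof (induction k)
    case 0
    obtain c' z where c: "c = (c', z)" by fastforce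
    have "local_mod null_ideal (2 * M) (gdist a 0) (gdist c' 2)" for a
      using local_mod_sym[OF null_ideal_ideal local_gdist_0[of 1 c' a]] by (simp add: numeral_2_eq_2)
    moreover have "2 * M + 2 * M = 4 * M" by simp
    ultimately have "gdist c' 2 z * ?p \<in> null_ideal"
      using local_mod_transitive[OF null_ideal_ideal, of "2 * M" "gdist a 0" "gdist c' 2" "2 * M" "gdist b 0" z m n]
      by metis
    then show ?case by (simp add: c gdist_def numeral_2_eq_2)
  next
    case (Suc k)
    have "\<D> (var (Dv c (k + 2)) * ?p) = var (Dv c (Suc k + 2)) * ?p + var (Dv c (k + 2)) * \<D> ?p"
      by (simp add: dpoly_deriv_mult)
    then have "var (Dv c (Suc k + 2)) * ?p = \<D> (var (Dv c (k + 2)) * ?p) - var (Dv c (k + 2)) * \<D> ?p" by simp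
    then show ?case
      using ring_idealD(2)[OF null_ideal_ideal null_ideal_deriv[OF Suc] ring_idealD(3)[OF null_ideal_ideal Dp]] by simp
  qed
  have "eval (?p * q) \<in> J" for q
  proof (induction q rule: dpoly_induct)
    case (frag q)
    show ?case
    proof (cases "mwt q = 1")
      case True
      have "\<exists>v\<in>#q. 1 \<le> vwt v"
      proof (rule ccontr)
        assume "\<not> ?thesis"
        then have "\<forall>v\<in>#q. vwt v \<le> 0" by auto
        then have "mwt q \<le> 0" by (induction q) auto
        then show False using True by simp
      qed
      then obtain v where v: "v \<in># q" "1 \<le> vwt v" by blast
      then obtain c k where "v = Dv c (k + 2)"
      proof (cases v)
        case (Dv c i)
        then have "2 \<le> i" using v by simp
        then have "v = Dv c (i - 2 + 2)" using Dv by simp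
        then show ?thesis using that by blast
      qed (use v in simp)
      then obtain r where q: "q = add_mset (Dv c (k + 2)) r" using v by (meson mset_add)
      have "?p * frag_of q = var (Dv c (k + 2)) * ?p * frag_of r"
      proof -
        have "frag_of q = var (Dv c (k + 2)) * frag_of r" using q by simp
        then show ?thesis by (simp only: mult.assoc mult.left_commute)
      qed
      then show ?thesis using null_ideal_eval(1)[OF high] by simp
    next
      case False
      have "homog (- 2 + mwt q) (?p * frag_of q)"
        using homog_mult[OF homog_gdist_pair[of 0 0], of "mwt q" "frag_of q"] by simp
      then show ?thesis using eval_homog False J_0 by simp
    qed
  qed (simp_all add: J_0 J_diff right_diff_distrib)
  moreover have "eval ((\<D> ^^ Suc k) ?p * q) \<in> J" for k q
    using Dp by (simp only: funpow_Suc_right comp_def null_ideal_def mem_Collect_eq)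
  ultimately have "eval ((\<D> ^^ k) ?p * q) \<in> J" for k q
    by (cases k) auto
  then show "?p \<in> null_ideal" by (simp add: null_ideal_def)
qed

lemma local_gdist: "\<exists>N. local_mod null_ideal N (gdist a i) (gdist b j)"
proof (cases i)
  case 0
  show ?thesis
  proof (cases j)
    case 0
    then show ?thesis using \<open>i = 0\<close> local_gdist_0_0 by blast
  next
    case (Suc j')
    then show ?thesis using \<open>i = 0\<close> local_gdist_0[of j' b a] local_mod_sym[OF null_ideal_ideal] by blast
  qed
next
  case i: (Suc i')
  show ?thesis
  proof (cases j)
    case 0
    then show ?thesis using i local_gdist_0[of i' a b] by blast
  next
    case (Suc j')
    then show ?thesis using i local_gdist_differentiated[OF local_gdist_0 local_gdist_0] by blast
  qed
qed

end

section \<open>The conformal algebra generated by the distributions\<close>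

context novikov_ops
begin

definition nprod_dist :: "nat \<Rightarrow> (int \<Rightarrow> 'a) \<Rightarrow> (int \<Rightarrow> 'a) \<Rightarrow> int \<Rightarrow> 'a"
  where "nprod_dist n f g m = (nabla ^^ n) (\<lambda>x y. f x \<circ>\<^sub>N g y) 0 m"

definition nderiv_dist :: "(int \<Rightarrow> 'a) \<Rightarrow> int \<Rightarrow> 'a"
  where "nderiv_dist f m = - intmul m (f (m - 1))"

end

lemma intmul_add: "intmul (m + n) x = intmul m x + intmul n x"
  using intmul_diff[of m "- n" x] intmul_diff[of 0 n x] by simp

lemma intmul_unique:
  assumes "f 0 = 0" "\<And>m. f (m + 1) = f m + x"
  shows "f m = intmul m x"
proof (induction m rule: int_induct[where k = 0])
  case (step1 i)
  then show ?case by (simp add: assms(2) intmul_add)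
next
  case (step2 i)
  then show ?case using assms(2)[of "i - 1"] intmul_diff[of i 1 x] by simp
qed (simp add: assms)

context novikov_eval
begin

lemma eval_of_int_mult: "eval (of_int m * p) = intmul m (eval p)"
  by (rule intmul_unique) (simp_all add: distrib_right)

lemma eval_dderiv: "eval (\<partial> c m) = nderiv_dist (\<lambda>i. eval (c i)) m"
  by (simp add: dderiv_def nderiv_dist_def eval_of_int_mult)

text \<open>
  The \<open>n\<close>-products of the Novikov conformal algebra are those of the commutative one after applying
  \<open>D\<close> to the left factor.
\<close>

lemma eval_dprod:
  assumes "\<And>m. homog (- 1) (f m)"
  shows "eval (dprod n (\<lambda>i. \<D> (f i)) g m) = nprod_dist n (\<lambda>i. eval (f i)) (\<lambda>i. eval (g i)) m"
  unfolding dprod_def nprod_dist_def by (subst nablas_hom) (simp_all add: eval_novikov assms)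

end

lemma dprod_derivation':
  "(\<lambda>m. \<D> (dprod n f g m)) = (\<lambda>m. dprod n (\<lambda>i. \<D> (f i)) g m + dprod n f (\<lambda>i. \<D> (g i)) m)"
  by (rule ext) (rule dprod_derivation, simp_all add: dpoly_deriv_mult)

text \<open>
  \<open>W\<close> is a set of distributions that contains the generating series and is closed under the conformal operations; its
  ideals below are the kernels of homomorphisms of Novikov conformal algebras.  The scalar \<open>inv_fact n\<close>
  acts as the inverse of \<open>n!\<close> modulo \<open>J\<close>.
\<close>

locale conformal_eval = local_novikov_eval nop sm gen J M
  for nop :: "'a::ab_group_add \<Rightarrow> 'a \<Rightarrow> 'a" (infixl \<open>\<circ>\<^sub>N\<close> 70) and sm :: "'k \<Rightarrow> 'a \<Rightarrow> 'a"
    and gen :: "'x \<times> int \<Rightarrow> 'a" and J :: "'a set" and M :: nat +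
  fixes inv_fact :: "nat \<Rightarrow> 'k" and W :: "(int \<Rightarrow> 'a) set"
  assumes J_inv_fact: "sm (inv_fact n) (intmul (fact n) x) - x \<in> J"
    and W_gen: "(\<lambda>n. gen (a, n)) \<in> W"
    and W_diff: "f \<in> W \<Longrightarrow> g \<in> W \<Longrightarrow> (\<lambda>m. f m - g m) \<in> W"
    and W_sm: "f \<in> W \<Longrightarrow> (\<lambda>m. sm k (f m)) \<in> W"
    and W_deriv: "f \<in> W \<Longrightarrow> nderiv_dist f \<in> W"
    and W_cong: "f \<in> W \<Longrightarrow> (\<And>m. f m - g m \<in> J) \<Longrightarrow> g \<in> W"
    and W_prod: "f \<in> W \<Longrightarrow> g \<in> W \<Longrightarrow> nprod_dist n f g \<in> W"
begin

definition dist_ideal :: "(int \<Rightarrow> 'a) set \<Rightarrow> bool"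
  where "dist_ideal V \<longleftrightarrow> (\<lambda>m. 0) \<in> V \<and> (\<forall>f\<in>V. \<forall>g\<in>V. (\<lambda>m. f m - g m) \<in> V)
    \<and> (\<forall>f\<in>V. \<forall>k. (\<lambda>m. sm k (f m)) \<in> V) \<and> (\<forall>f\<in>V. nderiv_dist f \<in> V)
    \<and> (\<forall>f\<in>V. \<forall>g. (\<forall>m. f m - g m \<in> J) \<longrightarrow> g \<in> V)
    \<and> (\<forall>f\<in>W. \<forall>g\<in>V. \<forall>n. nprod_dist n f g \<in> V \<and> nprod_dist n g f \<in> V)"

lemma dist_idealD:
  assumes "dist_ideal V"
  shows "(\<lambda>m. 0) \<in> V" "f \<in> V \<Longrightarrow> g \<in> V \<Longrightarrow> (\<lambda>m. f m - g m) \<in> V"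
    "f \<in> V \<Longrightarrow> (\<lambda>m. sm k (f m)) \<in> V" "f \<in> V \<Longrightarrow> nderiv_dist f \<in> V"
    "f \<in> V \<Longrightarrow> (\<And>m. f m - g m \<in> J) \<Longrightarrow> g \<in> V"
    "f \<in> W \<Longrightarrow> g \<in> V \<Longrightarrow> nprod_dist n f g \<in> V" "f \<in> W \<Longrightarrow> g \<in> V \<Longrightarrow> nprod_dist n g f \<in> V"
    "f \<in> V \<Longrightarrow> (\<lambda>m. - f m) \<in> V" "f \<in> V \<Longrightarrow> g \<in> V \<Longrightarrow> (\<lambda>m. f m + g m) \<in> V"
proof -
  show *: "(\<lambda>m. 0) \<in> V" "\<And>f g. f \<in> V \<Longrightarrow> g \<in> V \<Longrightarrow> (\<lambda>m. f m - g m) \<in> V"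
    "f \<in> V \<Longrightarrow> (\<lambda>m. sm k (f m)) \<in> V" "f \<in> V \<Longrightarrow> nderiv_dist f \<in> V"
    "f \<in> V \<Longrightarrow> (\<And>m. f m - g m \<in> J) \<Longrightarrow> g \<in> V"
    "f \<in> W \<Longrightarrow> g \<in> V \<Longrightarrow> nprod_dist n f g \<in> V" "f \<in> W \<Longrightarrow> g \<in> V \<Longrightarrow> nprod_dist n g f \<in> V"
    using assms unfolding dist_ideal_def by blast+
  show **: "\<And>f. f \<in> V \<Longrightarrow> (\<lambda>m. - f m) \<in> V" using *(2)[OF *(1)] by simp
  show "f \<in> V \<Longrightarrow> g \<in> V \<Longrightarrow> (\<lambda>m. f m + g m) \<in> V" using *(2)[OF _ **, of f g] by simp
qed

lemma dist_ideal_W: "dist_ideal W"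
proof -
  have "(\<lambda>m. gen (a, m) - gen (a, m)) \<in> W" for a using W_diff[OF W_gen W_gen] by blast
  then have "(\<lambda>m. 0) \<in> W" by simp
  then show ?thesis
    unfolding dist_ideal_def by (auto simp: W_sm W_deriv W_prod intro: W_diff) (metis W_cong)
qed

lemma null_constant:
  assumes "\<D> r = 0" "\<And>q. eval (r * q) \<in> J"
  shows "r \<in> null_ideal"
proof -
  have "(\<D> ^^ k) r = (if k = 0 then r else 0)" for k
    by (induction k) (simp_all add: assms(1))
  then show ?thesis using assms(2) by (simp add: null_ideal_def J_0)
qed

lemma inv_fact_null: "var (Sc (inv_fact n)) * of_nat (fact n) - 1 \<in> null_ideal"
proof (rule null_constant)
  have *: "\<D> (of_nat i) = 0" for i by (induction i) simp_all
  show "\<D> (var (Sc (inv_fact n)) * of_nat (fact n) - 1) = 0"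
    by (simp add: dpoly_deriv_mult * del: of_nat_fact)
  have "eval (var (Sc (inv_fact n)) * of_nat (fact n) * q) = sm (inv_fact n) (intmul (fact n) (eval q))" for q
    using eval_of_int_mult[of "int (fact n)" q] by (simp add: mult.assoc eval_scalar)
  then show "eval ((var (Sc (inv_fact n)) * of_nat (fact n) - 1) * q) \<in> J" for q
    using J_inv_fact[of n "eval q"] by (simp add: left_diff_distrib)
qed

lemma ddpow_null: "ddpow k f m - var (Sc (inv_fact k)) * (\<partial> ^^ k) f m \<in> null_ideal"
proof -
  have "ddpow k f m - var (Sc (inv_fact k)) * (\<partial> ^^ k) f m = - ((var (Sc (inv_fact k)) * of_nat (fact k) - 1) * ddpow k f m)"
    by (simp add: dderiv_funpow algebra_simps)
  then show ?thesis using ring_idealD[OF null_ideal_ideal] inv_fact_null by simp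
qed

text \<open>
  The commutative conformal algebra generated by all derivatives of the generating series, before
  dividing by \<open>null_ideal\<close>.
\<close>

inductive_set dists :: "(int \<Rightarrow> ('k, 'x \<times> int) dpoly) set" where
  gen: "gdist a i \<in> dists"
| zero: "(\<lambda>m. 0) \<in> dists"
| add: "f \<in> dists \<Longrightarrow> g \<in> dists \<Longrightarrow> (\<lambda>m. f m + g m) \<in> dists"
| minus: "f \<in> dists \<Longrightarrow> (\<lambda>m. - f m) \<in> dists"
| scale: "f \<in> dists \<Longrightarrow> (\<lambda>m. var (Sc k) * f m) \<in> dists"
| deriv: "f \<in> dists \<Longrightarrow> \<partial> f \<in> dists"
| prod: "f \<in> dists \<Longrightarrow> g \<in> dists \<Longrightarrow> dprod n f g \<in> dists"

lemma dists_diff: "f \<in> dists \<Longrightarrow> g \<in> dists \<Longrightarrow> (\<lambda>m. f m - g m) \<in> dists"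
  using dists.add[OF _ dists.minus, of f g] by simp

abbreviation dD :: "(int \<Rightarrow> ('k, 'x \<times> int) dpoly) \<Rightarrow> int \<Rightarrow> ('k, 'x \<times> int) dpoly"
  where "dD f \<equiv> \<lambda>m. \<D> (f m)"

lemma dD_dderiv: "dD (\<partial> f) = \<partial> (dD f)"
proof -
  have *: "\<D> (of_int i * p) = of_int i * \<D> p" for i and p :: "('k, 'x \<times> int) dpoly"
  proof (cases i rule: int_diff_cases)
    case (diff m n)
    have "\<D> (of_nat i :: ('k, 'x \<times> int) dpoly) = 0" for i by (induction i) simp_all
    then show ?thesis by (simp add: diff dpoly_deriv_mult)
  qed
  show ?thesis by (rule ext) (simp add: dderiv_def *)
qed

lemma dists_dD: "f \<in> dists \<Longrightarrow> dD f \<in> dists"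
proof (induction rule: dists.induct)
  case (gen a i)
  have "dD (gdist a i) = gdist a (Suc i)" by (simp add: gdist_def fun_eq_iff)
  then show ?case using dists.gen by simp
next
  case (deriv f)
  then show ?case by (simp only: dD_dderiv dists.deriv)
next
  case (prod f g n)
  then show ?case unfolding dprod_derivation' by (intro dists.add dists.prod)
qed (simp_all add: dists.zero dists.add dists.minus dists.scale dpoly_deriv_mult)

lemma dists_local: "f \<in> dists \<Longrightarrow> g \<in> dists \<Longrightarrow> \<exists>N. local_mod null_ideal N f g"
proof -
  note I = null_ideal_ideal
  have *: "\<exists>N. local_mod null_ideal N f h" if gens: "\<And>a i. \<exists>N. local_mod null_ideal N (gdist a i) h" and f: "f \<in> dists" for f h
    using f
  proof (induction rule: dists.induct)
    case zero
    have "local_mod null_ideal 0 (\<lambda>m. 0) h" by (simp add: local_mod_def ring_idealD(1)[OF I])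
    then show ?case by blast
  next
    case (add f g)
    then obtain N K where "local_mod null_ideal N f h" "local_mod null_ideal K g h" by blast
    then have "local_mod null_ideal (max N K) f h" "local_mod null_ideal (max N K) g h"
      using local_mod_mono[OF I] by (metis max.cobounded1, metis max.cobounded2)
    then show ?case using local_mod_add[OF I] by blast
  next
    case (minus f)
    then show ?case using local_mod_scale[OF I, of _ f h "- 1"] by auto
  next
    case (scale f k)
    then show ?case using local_mod_scale[OF I] by blast
  next
    case (deriv f)
    then show ?case using local_mod_dderiv[OF I] by blast
  next
    case (prod f g n)
    then show ?case using local_mod_dprod[OF I] by blast
  qed (rule gens)
  assume f: "f \<in> dists" and g: "g \<in> dists"
  have "\<exists>N. local_mod null_ideal N (gdist a i) g" for a i
    using *[OF local_gdist g] local_mod_sym[OF I] by blast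
  from *[OF this f] show ?thesis .
qed

lemma fun_plus: "f + g = (\<lambda>m. f m + g m)"
  by (rule ext) simp

sublocale dist_ops: graded_operators "\<lambda>(a, n) i c. dprod n (gdist a i) c" dD
proof unfold_locales
  fix g h :: "'x \<times> nat" and i j and c d :: "int \<Rightarrow> ('k, 'x \<times> int) dpoly"
  obtain a n b k where g: "g = (a, n)" "h = (b, k)" by fastforce
  show "(case g of (a, n) \<Rightarrow> \<lambda>i c. dprod n (gdist a i) c) i (c + d) =
      (case g of (a, n) \<Rightarrow> \<lambda>i c. dprod n (gdist a i) c) i c + (case g of (a, n) \<Rightarrow> \<lambda>i c. dprod n (gdist a i) c) i d"
    by (rule ext) (simp add: g fun_plus dprod_add_right)
  show "dD (c + d) = dD c + dD d" by (rule ext) simp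
  show "(case g of (a, n) \<Rightarrow> \<lambda>i c. dprod n (gdist a i) c) i ((case h of (a, n) \<Rightarrow> \<lambda>i c. dprod n (gdist a i) c) j c) =
    (case h of (a, n) \<Rightarrow> \<lambda>i c. dprod n (gdist a i) c) j ((case g of (a, n) \<Rightarrow> \<lambda>i c. dprod n (gdist a i) c) i c)"
    by (simp add: g dprod_commute)
  have "dD (gdist a i) = gdist a (Suc i)" by (simp add: gdist_def fun_eq_iff)
  then show "dD ((case g of (a, n) \<Rightarrow> \<lambda>i c. dprod n (gdist a i) c) i c) =
     (case g of (a, n) \<Rightarrow> \<lambda>i c. dprod n (gdist a i) c) (Suc i) c + (case g of (a, n) \<Rightarrow> \<lambda>i c. dprod n (gdist a i) c) i (dD c)"
    by (simp only: g prod.case dprod_derivation' fun_plus)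
qed

definition kernel :: "(int \<Rightarrow> 'a) set \<Rightarrow> (int \<Rightarrow> ('k, 'x \<times> int) dpoly) set"
  where "kernel V = {c \<in> dists. (\<forall>m. homog (- 1) (c m)) \<and> (\<lambda>m. eval (c m)) \<in> V}"

lemma kernel_add: "dist_ideal V \<Longrightarrow> c \<in> kernel V \<Longrightarrow> d \<in> kernel V \<Longrightarrow> c + d \<in> kernel V"
  unfolding kernel_def fun_plus by (auto intro: dists.add homog_add dist_idealD)

lemma kernel_zero: "dist_ideal V \<Longrightarrow> 0 \<in> kernel V"
  unfolding kernel_def zero_fun_def by (auto intro: dists.zero dist_idealD)

lemma kernel_minus: "dist_ideal V \<Longrightarrow> c \<in> kernel V \<Longrightarrow> - c \<in> kernel V"
  unfolding kernel_def fun_Compl_def by (auto intro: dists.minus homog_minus dist_idealD)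

lemma homog_of_int: "homog w p \<Longrightarrow> homog w (of_int i * p)"
proof (induction i rule: int_induct[where k = 0])
  case (step1 i)
  then show ?case by (simp add: distrib_right homog_add)
next
  case (step2 i)
  then show ?case by (simp add: left_diff_distrib homog_diff)
qed simp

lemma homog_dprod:
  "(\<And>m. homog v (f m)) \<Longrightarrow> (\<And>m. homog w (g m)) \<Longrightarrow> homog (v + w) (dprod n f g m)"
  unfolding dprod_def by (intro homog_nablas homog_mult)

lemma homog_dderiv: "(\<And>m. homog v (f m)) \<Longrightarrow> homog v (\<partial> f m)"
  unfolding dderiv_def by (intro homog_minus homog_of_int)

lemma kernel_deriv: "dist_ideal V \<Longrightarrow> c \<in> kernel V \<Longrightarrow> \<partial> c \<in> kernel V"
  unfolding kernel_def by (auto intro: dists.deriv homog_dderiv dist_idealD simp: eval_dderiv[abs_def])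

lemma kernel_scale: "dist_ideal V \<Longrightarrow> c \<in> kernel V \<Longrightarrow> (\<lambda>m. var (Sc k) * c m) \<in> kernel V"
  unfolding kernel_def using homog_mult[of 0 "var (Sc k)" "- 1"]
  by (auto intro: dists.scale dist_idealD simp: eval_scalar)

lemma homog_gdist: "homog (int i - 1) (gdist a i m)"
  by (simp add: gdist_def)

lemma kernel_prod:
  assumes V: "dist_ideal V" and "h \<in> kernel W" "c \<in> kernel V"
  shows "dprod n (dD h) c \<in> kernel V" "dprod n (dD c) h \<in> kernel V"
proof -
  have hom: "homog 0 (\<D> (f m))" if "f \<in> kernel U" for f U m
    using that homog_deriv[of "- 1" "f m"] by (simp add: kernel_def)
  have ev: "(\<lambda>m. eval (dprod n (dD f) g m)) = nprod_dist n (\<lambda>m. eval (f m)) (\<lambda>m. eval (g m))"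
    if "f \<in> kernel U" for f g U
    by (rule ext, rule eval_dprod) (use that in \<open>simp add: kernel_def\<close>)
  show "dprod n (dD h) c \<in> kernel V" "dprod n (dD c) h \<in> kernel V"
    using ev[OF assms(2)] ev[OF assms(3)] assms(2,3) homog_dprod[OF hom[OF assms(2)], of "- 1" c n] homog_dprod[OF hom[OF assms(3)], of "- 1" h n]
      dist_idealD(6,7)[OF V] by (auto simp: kernel_def dists_dD dists.prod)
qed

lemma gdist_kernel: "gdist a 0 \<in> kernel W"
  using homog_gdist[of 0 a] W_gen by (simp add: kernel_def dists.gen gdist_def mon_eval_single)

lemma kernel_cong:
  assumes V: "dist_ideal V" and c: "c \<in> dists" "\<And>m. homog (- 1) (c m)" and d: "(\<lambda>m. eval (d m)) \<in> V"
    and cd: "\<And>m. c m - d m \<in> null_ideal"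
  shows "c \<in> kernel V"
proof -
  have "eval (d m) - eval (c m) \<in> J" for m
    using J_minus[OF null_ideal_eval(2)[OF cd[of m]]] by simp
  then show ?thesis using dist_idealD(5)[OF V d] c by (simp add: kernel_def)
qed

lemma eval_ddpow_ideal:
  assumes V: "dist_ideal V" and c: "(\<lambda>m. eval (c m)) \<in> V"
  shows "(\<lambda>m. eval (ddpow k c m)) \<in> V"
proof -
  have "(\<lambda>m. eval ((\<partial> ^^ j) c m)) \<in> V" for j
  proof (induction j)
    case (Suc j)
    from dist_idealD(4)[OF V this] show ?case by (simp add: eval_dderiv[abs_def])
  qed (simp add: c)
  from dist_idealD(3)[OF V this[of k], of "inv_fact k"]
  have "(\<lambda>m. eval (var (Sc (inv_fact k)) * (\<partial> ^^ k) c m)) \<in> V" by (simp add: eval_scalar)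
  then show ?thesis
    by (rule dist_idealD(5)[OF V]) (use J_minus[OF null_ideal_eval(2)[OF ddpow_null[of k c]]] in simp)
qed

lemma eval_sum_ideal:
  assumes V: "dist_ideal V" and c: "\<And>k. k \<in> A \<Longrightarrow> (\<lambda>m. eval (c k m)) \<in> V"
  shows "(\<lambda>m. eval (\<Sum>k\<in>A. c k m)) \<in> V"
  using c by (induction A rule: infinite_finite_induct) (auto intro: dist_idealD[OF V])

text \<open>
  Skew-symmetry rewrites the product as a combination of derivatives of \<open>n\<close>-products of \<open>D c\<close> with the
  series \<open>a(z)\<close>, and these have Novikov products as values.
\<close>

lemma kernel_undifferentiated:
  assumes V: "dist_ideal V" and c: "c \<in> kernel V"
  shows "dprod n (gdist a 0) (dD c) \<in> kernel V"
proof -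
  have cd: "dD c \<in> dists" using c by (simp add: kernel_def dists_dD)
  obtain N where N: "local_mod null_ideal N (dD c) (gdist a 0)" using dists_local[OF cd dists.gen] by blast
  show ?thesis
  proof (rule kernel_cong[OF V])
    show "dprod n (gdist a 0) (dD c) \<in> dists" by (rule dists.prod[OF dists.gen cd])
    have "homog (- 1) (gdist a 0 m)" for m using homog_gdist[of 0 a m] by simp
    moreover have "homog 0 (\<D> (c m))" for m using c homog_deriv[of "- 1" "c m"] by (simp add: kernel_def)
    ultimately show "homog (- 1) (dprod n (gdist a 0) (dD c) m)" for m
      using homog_dprod[of "- 1" "gdist a 0" 0 "dD c" n m] by simp
    show "dprod n (gdist a 0) (dD c) m - (\<Sum>k<N. (- 1) ^ (n + k) * ddpow k (dprod (n + k) (dD c) (gdist a 0)) m) \<in> null_ideal" for m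
      by (rule dprod_skew[OF null_ideal_ideal N])
    show "(\<lambda>m. eval (\<Sum>k<N. (- 1) ^ (n + k) * ddpow k (dprod (n + k) (dD c) (gdist a 0)) m)) \<in> V"
    proof (rule eval_sum_ideal[OF V])
      fix k
      have "(\<lambda>m. eval (ddpow k (dprod (n + k) (dD c) (gdist a 0)) m)) \<in> V"
        by (rule eval_ddpow_ideal[OF V]) (use kernel_prod(2)[OF V gdist_kernel c, of "n + k" a] in \<open>simp add: kernel_def\<close>)
      then show "(\<lambda>m. eval ((- 1) ^ (n + k) * ddpow k (dprod (n + k) (dD c) (gdist a 0)) m)) \<in> V"
        using dist_idealD(8)[OF V] by (cases "even (n + k)") simp_all
    qed
  qed
qed

text \<open>
  The weight of a word depends only on its shape, whereas rewriting by associativity changes the indices of the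
  products.
\<close>

definition shape :: "(('x \<times> nat) \<times> nat) list \<Rightarrow> ('x \<times> nat) list"
  where "shape ws = map (\<lambda>((a, n), i). (a, i)) ws"

lemma shape_weight: "shape vs = shape ws \<Longrightarrow> dist_ops.word_weight vs = dist_ops.word_weight ws"
proof -
  have "dist_ops.word_weight ws = (\<Sum>(a, i)\<leftarrow>shape ws. int i - 1)" for ws
    by (induction ws) (auto simp: shape_def)
  then show "shape vs = shape ws \<Longrightarrow> ?thesis" by simp
qed

text \<open>
  By conformal associativity, an iterated product applied to \<open>c\<close> is a combination of \<open>n\<close>-products of \<open>c\<close> with single
  distributions, which are iterated products of the letters alone.  The set \<open>A\<close> serves
  to state that a property of operators is preserved in this passage.
\<close>

lemma word_op_as_products:
  assumes zero: "(\<lambda>c m. 0) \<in> A" and add: "\<And>F G. F \<in> A \<Longrightarrow> G \<in> A \<Longrightarrow> (\<lambda>c m. F c m + G c m) \<in> A"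
    and prods: "\<And>vs m. shape vs = shape ws \<Longrightarrow> dprod m (dist_ops.word_op vs (gdist a i)) \<in> A"
  shows "dist_ops.word_op (ws @ [((a, n), i)]) \<in> A"
  using assms
proof (induction ws arbitrary: A)
  case Nil
  then show ?case using Nil.prems(3)[of "[]" n] by (simp add: dist_ops.word_op_def comp_def)
next
  case (Cons w ws)
  obtain b k j where w: "w = ((b, k), j)" by (metis prod.collapse)
  let ?B = "{F. (\<lambda>c. dprod k (gdist b j) (F c)) \<in> A}"
  have "dist_ops.word_op (ws @ [((a, n), i)]) \<in> ?B"
  proof (rule Cons.IH)
    show "(\<lambda>c m. 0) \<in> ?B" using Cons.prems(1) by (simp add: dprod_zero_right[abs_def])
    show "(\<lambda>c m. F c m + G c m) \<in> ?B" if "F \<in> ?B" "G \<in> ?B" for F G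
      using Cons.prems(2)[of "\<lambda>c. dprod k (gdist b j) (F c)" "\<lambda>c. dprod k (gdist b j) (G c)"] that
      by (simp add: dprod_add_right[abs_def])
    show "dprod m (dist_ops.word_op vs (gdist a i)) \<in> ?B" if "shape vs = shape ws" for vs m
    proof -
      let ?F = "\<lambda>l c. dprod (k + m - l) (dist_ops.word_op (((b, l), j) # vs) (gdist a i)) c"
      have F: "?F l \<in> A" for l by (rule Cons.prems(3)) (use that w in \<open>simp add: shape_def\<close>)
      have mul: "(\<lambda>c m. of_nat r * ?F l c m) \<in> A" for r l
      proof (induction r)
        case (Suc r)
        from Cons.prems(2)[OF F this] show ?case by (simp add: distrib_right)
      qed (use Cons.prems(1) in simp)
      have "(\<lambda>c m. \<Sum>l\<in>S. of_nat (k choose l) * ?F l c m) \<in> A" if "finite S" for S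
        using that
      proof induction
        case (insert l S)
        then show ?case using Cons.prems(2)[OF mul[of "k choose l" l] insert.IH] by simp
      qed (use Cons.prems(1) in simp)
      from this[of "{..k}"] show ?thesis
        by (simp add: dprod_assoc[abs_def])
    qed
  qed
  then show ?case by (simp add: w dist_ops.word_op_def comp_def)
qed

lemma homog_dist_word: "(\<And>m. homog w (c m)) \<Longrightarrow> homog (dist_ops.word_weight ws + w) (dist_ops.word_op ws c m)"
proof (induction ws arbitrary: m)
  case (Cons v ws)
  obtain b k j where v: "v = ((b, k), j)" by (metis prod.collapse)
  show ?case using homog_dprod[OF homog_gdist[of j b] Cons.IH[OF Cons.prems], where n = k and m = m] by (simp add: v add.assoc)
qed simp

lemma gdist_eq_dD_funpow: "gdist a i = (dD ^^ i) (gdist a 0)"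
proof (induction i)
  case (Suc i)
  have "gdist a (Suc i) = dD (gdist a i)" by (simp add: gdist_def fun_eq_iff)
  then show ?case using Suc by simp
qed simp

text \<open>
  For the commutator with \<open>D\<close> that absorption requires, rewrite a word of weight \<open>-1\<close> as a combination of products by
  distributions \<open>h\<close> of weight \<open>-1\<close>; the commutator of \<open>D\<close> with such a product is the product by \<open>D h\<close>, whose values are
  Novikov products with the value of \<open>h\<close>.  That this value belongs to \<open>W\<close> is the
  same assertion for the ideal \<open>W\<close> and for shorter words.
\<close>

lemma kernel_words_bounded:
  assumes V: "dist_ideal V"
    and shorter: "\<And>vs a i. length vs < n \<Longrightarrow> dist_ops.word_weight vs = - int i \<Longrightarrow> dist_ops.word_op vs (gdist a i) \<in> kernel W"
    and len: "length ws \<le> n" and wt: "dist_ops.word_weight ws = - int k" and c: "c \<in> kernel V"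
  shows "dist_ops.word_op ws ((dD ^^ k) c) \<in> kernel V"
proof (rule dist_ops.balanced_words_absorbed[where n = n, OF _ _ _ _ _ _ len wt c])
  note add = kernel_add[OF V] and minus = kernel_minus[OF V]
  show "d + e \<in> kernel V" if "d \<in> kernel V" "e \<in> kernel V" for d e by (rule add[OF that])
  show "0 \<in> kernel V" by (rule kernel_zero[OF V])
  show "- d \<in> kernel V" if "d \<in> kernel V" for d by (rule minus[OF that])
  show "(case g of (a, n) \<Rightarrow> \<lambda>i c. dprod n (gdist a i) c) 1 d \<in> kernel V" if "d \<in> kernel V" for g d
  proof -
    obtain a m where g: "g = (a, m)" by fastforce
    have "dD (gdist a 0) = gdist a 1" by (simp add: gdist_def fun_eq_iff)
    then show ?thesis using kernel_prod(1)[OF V gdist_kernel that, of m a] by (simp add: g)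
  qed
  show "(case g of (a, n) \<Rightarrow> \<lambda>i c. dprod n (gdist a i) c) 0 (dD d) \<in> kernel V" if "d \<in> kernel V" for g d
    using kernel_undifferentiated[OF V that] by (cases g) simp
  show "dD (dist_ops.word_op vs d) - dist_ops.word_op vs (dD d) \<in> kernel V"
    if vs: "length vs \<le> n" "dist_ops.word_weight vs = - 1" and d: "d \<in> kernel V" for vs d
  proof -
    from vs(2) obtain us z where us: "vs = us @ [z]" by (cases vs rule: rev_cases) auto
    obtain a m i where z: "z = ((a, m), i)" by (metis prod.collapse)
    \<comment> \<open>Operators whose commutator with \<open>D\<close> preserves the kernel.\<close>
    let ?A = "{F. \<forall>d\<in>kernel V. (\<lambda>m. \<D> (F d m) - F (dD d) m) \<in> kernel V}"
    have "dist_ops.word_op (us @ [((a, m), i)]) \<in> ?A"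
    proof (rule word_op_as_products)
      show "(\<lambda>c m. 0) \<in> ?A" using kernel_zero[OF V] by (simp add: zero_fun_def)
      show "(\<lambda>c m. F c m + G c m) \<in> ?A" if "F \<in> ?A" "G \<in> ?A" for F G
      proof safe
        fix d assume "d \<in> kernel V"
        then have "(\<lambda>m. \<D> (F d m) - F (dD d) m) + (\<lambda>m. \<D> (G d m) - G (dD d) m) \<in> kernel V"
          using that by (intro add) auto
        moreover have "(\<lambda>m. \<D> (F d m) - F (dD d) m) + (\<lambda>m. \<D> (G d m) - G (dD d) m)
            = (\<lambda>m. \<D> (F d m + G d m) - (F (dD d) m + G (dD d) m))"
          by (rule ext) simp
        ultimately show "(\<lambda>m. \<D> (F d m + G d m) - (F (dD d) m + G (dD d) m)) \<in> kernel V" by simp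
      qed
      show "dprod l (dist_ops.word_op ts (gdist a i)) \<in> ?A" if ts: "shape ts = shape us" for ts l
      proof -
        let ?h = "dist_ops.word_op ts (gdist a i)"
        have "length ts = length us" using ts unfolding shape_def by (rule map_eq_imp_length_eq)
        then have h: "?h \<in> kernel W"
          by (intro shorter) (use vs us z shape_weight[OF ts] in auto)
        have "(\<lambda>m. \<D> (dprod l ?h d m) - dprod l ?h (dD d) m) = dprod l (dD ?h) d" for d
          using fun_cong[OF dprod_derivation'[of l ?h d]] by (auto simp: fun_eq_iff)
        then show ?thesis using kernel_prod(1)[OF V h] by simp
      qed
    qed
    then show ?thesis using d us z by (simp add: fun_diff_def)
  qed
qed

lemma kernel_words_W: "dist_ops.word_weight ws = - int k \<Longrightarrow> c \<in> kernel W \<Longrightarrow> dist_ops.word_op ws ((dD ^^ k) c) \<in> kernel W"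
proof (induction "length ws" arbitrary: ws k c rule: less_induct)
  case less
  show ?case
  proof (rule kernel_words_bounded[OF dist_ideal_W _ order.refl less.prems])
    fix vs a i assume "length vs < length ws" "dist_ops.word_weight vs = - int i"
    from less.hyps[OF this gdist_kernel, of a] show "dist_ops.word_op vs (gdist a i) \<in> kernel W"
      by (simp add: gdist_eq_dD_funpow[of a i])
  qed
qed

lemma kernel_words:
  assumes V: "dist_ideal V" and "dist_ops.word_weight ws = - int k" "c \<in> kernel V"
  shows "dist_ops.word_op ws ((dD ^^ k) c) \<in> kernel V"
proof (rule kernel_words_bounded[OF V _ order.refl assms(2,3)])
  fix vs a i assume "dist_ops.word_weight vs = - int i"
  from kernel_words_W[OF this gdist_kernel, of a] show "dist_ops.word_op vs (gdist a i) \<in> kernel W"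
    by (simp add: gdist_eq_dD_funpow[of a i])
qed

section \<open>The differential conformal ideal generated by a kernel\<close>

text \<open>
  The left ideal generated by the kernel and its derivatives.  The following lemmas show that it is stable under all conformal
  operations and \<open>D\<close>; being an ideal from the right follows by skew-symmetry, modulo \<open>null_ideal\<close>.
\<close>

inductive_set generated :: "(int \<Rightarrow> 'a) set \<Rightarrow> (int \<Rightarrow> ('k, 'x \<times> int) dpoly) set" for V where
  word: "c \<in> kernel V \<Longrightarrow> dist_ops.word_op ws ((dD ^^ k) c) \<in> generated V"
| zero: "(\<lambda>m. 0) \<in> generated V"
| add: "c \<in> generated V \<Longrightarrow> d \<in> generated V \<Longrightarrow> (\<lambda>m. c m + d m) \<in> generated V"

text \<open>
  The ideal meets the part of weight \<open>-1\<close> only in the kernel: words that return to weight \<open>-1\<close> are balanced, and all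
  other words have no value.
\<close>

lemma eval_generated:
  assumes V: "dist_ideal V"
  shows "c \<in> generated V \<Longrightarrow> (\<lambda>m. eval (c m)) \<in> V"
proof (induction rule: generated.induct)
  case (word c ws k)
  show ?case
  proof (cases "dist_ops.word_weight ws = - int k")
    case True
    then show ?thesis using kernel_words[OF V True word] by (simp add: kernel_def)
  next
    case False
    have "homog (- 1 + int k) ((dD ^^ k) c m)" for m
    proof -
      have "(dD ^^ k) c m = (\<D> ^^ k) (c m)" by (induction k arbitrary: m) auto
      then show ?thesis using homog_deriv_funpow[of "- 1" "c m" k] word by (simp add: kernel_def)
    qed
    then have "homog (dist_ops.word_weight ws + (- 1 + int k)) (dist_ops.word_op ws ((dD ^^ k) c) m)" for m
      by (rule homog_dist_word)
    then have "eval (dist_ops.word_op ws ((dD ^^ k) c) m) = 0" for m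
      by (rule eval_homog) (use False in auto)
    then show ?thesis using dist_idealD(1)[OF V] by simp
  qed
qed (auto intro: dist_idealD[OF V])

lemma kernel_cminus: "dist_ideal V \<Longrightarrow> c \<in> kernel V \<Longrightarrow> (\<lambda>m. - c m) \<in> kernel V"
  using kernel_minus by (simp add: fun_Compl_def)

lemma dist_word_cminus: "dist_ops.word_op ws (\<lambda>m. - c m) = (\<lambda>m. - dist_ops.word_op ws c m)"
  using additive.minus[OF dist_ops.additive_word_op, of ws c] by (simp add: fun_Compl_def)

lemma dD_funpow_apply: "(dD ^^ k) c m = (\<D> ^^ k) (c m)"
  by (induction k arbitrary: m) auto

lemma generated_minus:
  assumes V: "dist_ideal V"
  shows "c \<in> generated V \<Longrightarrow> (\<lambda>m. - c m) \<in> generated V"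
proof (induction rule: generated.induct)
  case (word c ws k)
  have "(\<lambda>m. - (dD ^^ k) c m) = (dD ^^ k) (\<lambda>m. - c m)"
    using deriv_funpow_simps(2)[of k "0 :: ('k, 'x \<times> int) dpoly"] by (simp add: dD_funpow_apply fun_eq_iff)
  then have "(\<lambda>m. - dist_ops.word_op ws ((dD ^^ k) c) m) = dist_ops.word_op ws ((dD ^^ k) (\<lambda>m. - c m))"
    by (simp flip: dist_word_cminus)
  then show ?case using generated.word[OF kernel_cminus[OF V word]] by simp
next
  case (add c d)
  then show ?case using generated.add[of "\<lambda>m. - c m" V "\<lambda>m. - d m"] by simp
qed (simp add: generated.zero)

lemma generated_diff: "dist_ideal V \<Longrightarrow> c \<in> generated V \<Longrightarrow> d \<in> generated V \<Longrightarrow> (\<lambda>m. c m - d m) \<in> generated V"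
  using generated.add[OF _ generated_minus, of c V d] by simp

lemma generated_of_nat: "c \<in> generated V \<Longrightarrow> (\<lambda>m. of_nat n * c m) \<in> generated V"
  by (induction n) (auto simp: generated.zero distrib_right dest: generated.add)

lemma generated_sum:
  "(\<And>i. i \<in> A \<Longrightarrow> c i \<in> generated V) \<Longrightarrow> (\<lambda>m. \<Sum>i\<in>A. c i m) \<in> generated V"
  by (induction A rule: infinite_finite_induct) (auto simp: generated.zero dest: generated.add)

lemma generated_gdist: "c \<in> generated V \<Longrightarrow> dprod n (gdist a i) c \<in> generated V"
proof (induction rule: generated.induct)
  case (word c ws k)
  from generated.word[OF word, of "((a, n), i) # ws" k] show ?case by simp
next
  case zero
  then show ?case using generated.zero by (simp add: dprod_zero_right[abs_def])
next
  case (add c d)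
  then show ?case using generated.add by (simp add: dprod_add_right[abs_def])
qed

lemma generated_dD: "c \<in> generated V \<Longrightarrow> dD c \<in> generated V"
proof (induction rule: generated.induct)
  case (word c ws k)
  have "dist_ops.word_op ws ((dD ^^ Suc k) c) \<in> generated V" by (rule generated.word[OF word])
  moreover have "(\<Sum>v\<leftarrow>vs. dist_ops.word_op v ((dD ^^ k) c)) \<in> generated V" for vs
    by (induction vs) (auto simp: fun_plus zero_fun_def generated.zero intro: generated.add generated.word[OF word])
  ultimately show ?case
    unfolding dist_ops.D_word_op fun_plus by (intro generated.add) simp_all
qed (simp_all add: generated.zero generated.add)

lemma generated_scale:
  assumes V: "dist_ideal V"
  shows "c \<in> generated V \<Longrightarrow> (\<lambda>m. var (Sc s) * c m) \<in> generated V"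
proof (induction rule: generated.induct)
  case (word c ws k)
  have 1: "(\<lambda>m. var (Sc s) * dist_ops.word_op ws e m) = dist_ops.word_op ws (\<lambda>m. var (Sc s) * e m)" for e
  proof (induction ws)
    case (Cons v ws)
    obtain b k j where v: "v = ((b, k), j)" by (metis prod.collapse)
    show ?case using Cons.IH[symmetric] by (simp add: v dprod_scale_right[abs_def])
  qed simp
  have "(\<D> ^^ k) (var (Sc s) * p) = var (Sc s) * (\<D> ^^ k) p" for p :: "('k, 'x \<times> int) dpoly"
    by (induction k) (simp_all add: dpoly_deriv_mult)
  then have 2: "(\<lambda>m. var (Sc s) * (dD ^^ k) c m) = (dD ^^ k) (\<lambda>m. var (Sc s) * c m)"
    by (simp add: fun_eq_iff dD_funpow_apply)
  show ?case unfolding 1 2 by (rule generated.word[OF kernel_scale[OF V word]])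
next
  case (add c d)
  then show ?case using generated.add by (simp add: distrib_left)
qed (simp add: generated.zero)

lemma generated_deriv:
  assumes V: "dist_ideal V"
  shows "c \<in> generated V \<Longrightarrow> \<partial> c \<in> generated V"
proof (induction rule: generated.induct)
  case (word c ws k)
  show ?case
  proof (induction ws)
    case Nil
    have "\<partial> ((dD ^^ k) c) = (dD ^^ k) (\<partial> c)" by (induction k) (simp_all flip: dD_dderiv)
    then show ?case using generated.word[OF kernel_deriv[OF V word], of "[]" k] by simp
  next
    case (Cons v ws)
    obtain b n j where v: "v = ((b, n), j)" by (metis prod.collapse)
    let ?e = "dist_ops.word_op ws ((dD ^^ k) c)"
    have "\<partial> (dprod n (gdist b j) ?e) = (\<lambda>m. dprod n (gdist b j) (\<partial> ?e) m - of_nat n * dprod (n - 1) (gdist b j) ?e m)"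
      by (rule ext) (simp add: dderiv_dprod dprod_dderiv_left)
    also have "\<dots> \<in> generated V"
      by (intro generated_diff[OF V] generated_of_nat generated_gdist Cons generated.word word)
    finally show ?case by (simp add: v)
  qed
next
  case (add c d)
  then show ?case using generated.add by (simp add: dderiv_simps[abs_def])
qed (simp add: dderiv_simps[abs_def] generated.zero)

text \<open>
  For a product \<open>u = f\<^sub>(\<^sub>k\<^sub>) g\<close>, associativity expresses the product by \<open>u\<close> through iterated products by \<open>f\<close> and \<open>g\<close>
  and products by \<open>f\<^sub>(\<^sub>i\<^sub>) g\<close> with \<open>i < k\<close>.
\<close>

lemma generated_dprod:
  assumes V: "dist_ideal V" and u: "u \<in> dists"
  shows "c \<in> generated V \<Longrightarrow> dprod n u c \<in> generated V"
  using u
proof (induction arbitrary: c n rule: dists.induct)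
  case (gen a i)
  then show ?case by (rule generated_gdist)
next
  case zero
  then show ?case by (simp add: dprod_zero_left[abs_def] generated.zero)
next
  case (add f g)
  then show ?case by (simp add: dprod_add_left[abs_def] generated.add)
next
  case (minus f)
  have "dprod n (\<lambda>m. - f m) c = (\<lambda>m. - dprod n f c m)"
    using dprod_scale_left[of n "- 1" f c] by (simp add: fun_eq_iff)
  then show ?case using generated_minus[OF V minus.IH[OF minus.prems]] by simp
next
  case (scale f k)
  then show ?case by (simp add: dprod_scale_left[abs_def] generated_scale[OF V])
next
  case (deriv f)
  have "dprod n (\<partial> f) c = (\<lambda>m. - (of_nat n * dprod (n - 1) f c m))"
    by (rule ext) (rule dprod_dderiv_left)
  then show ?case using generated_minus[OF V generated_of_nat[OF deriv.IH[OF deriv.prems]]] by simp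
next
  case (prod f g k)
  have "dprod n (dprod k f g) c \<in> generated V" for n
  proof (induction k arbitrary: n rule: less_induct)
    case (less k)
    have "dprod n (dprod k f g) c m = dprod k f (dprod n g c) m
        - (\<Sum>i<k. of_nat (k choose i) * dprod (k + n - i) (dprod i f g) c m)" for m
      unfolding dprod_assoc by (simp flip: lessThan_Suc_atMost)
    then have "dprod n (dprod k f g) c = (\<lambda>m. dprod k f (dprod n g c) m
        - (\<Sum>i<k. of_nat (k choose i) * dprod (k + n - i) (dprod i f g) c m))" by (rule ext)
    also have "\<dots> \<in> generated V"
      by (intro generated_diff[OF V] generated_sum generated_of_nat prod.IH prod.prems less) simp
    finally show ?case .
  qed
  then show ?case .
qed

lemma dists_generated: "c \<in> dists \<Longrightarrow> c \<in> generated W"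
proof (induction rule: dists.induct)
  case (gen a i)
  show ?case using generated.word[OF gdist_kernel[of a], of "[]" i] by (simp add: gdist_eq_dD_funpow[of a i])
qed (simp_all add: generated.zero generated.add generated_minus[OF dist_ideal_W] generated_scale[OF dist_ideal_W]
      generated_deriv[OF dist_ideal_W] generated_dprod[OF dist_ideal_W])

lemma eval_dists: "c \<in> dists \<Longrightarrow> (\<lambda>m. eval (c m)) \<in> W"
  by (rule eval_generated[OF dist_ideal_W dists_generated])

definition null_dists :: "(int \<Rightarrow> 'a) set \<Rightarrow> (int \<Rightarrow> ('k, 'x \<times> int) dpoly) set"
  where "null_dists V = {c. \<exists>d\<in>generated V. \<forall>m. c m - d m \<in> null_ideal}"

lemma null_distsI: "d \<in> generated V \<Longrightarrow> (\<And>m. c m - d m \<in> null_ideal) \<Longrightarrow> c \<in> null_dists V"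
  by (auto simp: null_dists_def)

lemma null_dists_ideal: "(\<And>m. c m \<in> null_ideal) \<Longrightarrow> c \<in> null_dists V"
  by (rule null_distsI[OF generated.zero]) simp

lemma null_dists_kernel: "c \<in> kernel V \<Longrightarrow> c \<in> null_dists V"
  using generated.word[of c V "[]" 0] ring_idealD(1)[OF null_ideal_ideal] by (auto intro: null_distsI)

lemma null_dists_eval: "dist_ideal V \<Longrightarrow> c \<in> null_dists V \<Longrightarrow> (\<lambda>m. eval (c m)) \<in> V"
proof -
  assume V: "dist_ideal V" and "c \<in> null_dists V"
  then obtain d where d: "d \<in> generated V" "\<And>m. c m - d m \<in> null_ideal" by (auto simp: null_dists_def)
  show ?thesis
    by (rule dist_idealD(5)[OF V eval_generated[OF V d(1)]]) (use J_minus[OF null_ideal_eval(2)[OF d(2)]] in simp)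
qed

lemma null_dists_diff:
  assumes V: "dist_ideal V" and "c \<in> null_dists V" "d \<in> null_dists V"
  shows "(\<lambda>m. c m - d m) \<in> null_dists V"
proof -
  from assms obtain c' d' where c: "c' \<in> generated V" "\<And>m. c m - c' m \<in> null_ideal"
    and d: "d' \<in> generated V" "\<And>m. d m - d' m \<in> null_ideal" by (auto simp: null_dists_def)
  show ?thesis
  proof (rule null_distsI[OF generated_diff[OF V c(1) d(1)]])
    fix m
    have *: "c m - d m - (c' m - d' m) = (c m - c' m) - (d m - d' m)" by simp
    show "c m - d m - (c' m - d' m) \<in> null_ideal"
      unfolding * by (rule ring_idealD(2)[OF null_ideal_ideal c(2) d(2)])
  qed
qed

lemma null_dists_zero: "(\<lambda>m. 0) \<in> null_dists V"
  by (rule null_dists_ideal) (rule ring_idealD(1)[OF null_ideal_ideal])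

lemma null_dists_minus: "dist_ideal V \<Longrightarrow> c \<in> null_dists V \<Longrightarrow> (\<lambda>m. - c m) \<in> null_dists V"
  using null_dists_diff[OF _ null_dists_zero] by simp

lemma null_dists_add: "dist_ideal V \<Longrightarrow> c \<in> null_dists V \<Longrightarrow> d \<in> null_dists V \<Longrightarrow> (\<lambda>m. c m + d m) \<in> null_dists V"
  using null_dists_diff[OF _ _ null_dists_minus, of V c d] by simp

lemma null_dists_sum:
  "dist_ideal V \<Longrightarrow> (\<And>i. i \<in> A \<Longrightarrow> c i \<in> null_dists V) \<Longrightarrow> (\<lambda>m. \<Sum>i\<in>A. c i m) \<in> null_dists V"
  by (induction A rule: infinite_finite_induct) (auto simp: null_dists_zero dest: null_dists_add)

lemma null_dists_cong: "c \<in> null_dists V \<Longrightarrow> (\<And>m. d m - c m \<in> null_ideal) \<Longrightarrow> dist_ideal V \<Longrightarrow> d \<in> null_dists V"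
  using null_dists_add[of V c "\<lambda>m. d m - c m"] null_dists_ideal[of "\<lambda>m. d m - c m"] by simp

lemma null_dists_scale: "dist_ideal V \<Longrightarrow> c \<in> null_dists V \<Longrightarrow> (\<lambda>m. var (Sc s) * c m) \<in> null_dists V"
proof -
  assume V: "dist_ideal V" and "c \<in> null_dists V"
  then obtain d where d: "d \<in> generated V" "\<And>m. c m - d m \<in> null_ideal" by (auto simp: null_dists_def)
  show ?thesis
    by (rule null_distsI[OF generated_scale[OF V d(1), of s]])
      (use ring_idealD(3)[OF null_ideal_ideal d(2)] in \<open>simp flip: right_diff_distrib\<close>)
qed

lemma null_dists_dD: "c \<in> null_dists V \<Longrightarrow> dD c \<in> null_dists V"
proof -
  assume "c \<in> null_dists V"
  then obtain d where d: "d \<in> generated V" "\<And>m. c m - d m \<in> null_ideal" by (auto simp: null_dists_def)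
  show ?thesis
    by (rule null_distsI[OF generated_dD[OF d(1)]]) (use null_ideal_deriv[OF d(2)] in simp)
qed

lemma null_dists_deriv: "dist_ideal V \<Longrightarrow> c \<in> null_dists V \<Longrightarrow> \<partial> c \<in> null_dists V"
proof -
  assume V: "dist_ideal V" and "c \<in> null_dists V"
  then obtain d where d: "d \<in> generated V" "\<And>m. c m - d m \<in> null_ideal" by (auto simp: null_dists_def)
  show ?thesis
  proof (rule null_distsI[OF generated_deriv[OF V d(1)]])
    fix m
    have "\<partial> c m - \<partial> d m = - of_int m * (c (m - 1) - d (m - 1))" by (simp add: dderiv_def algebra_simps)
    then show "\<partial> c m - \<partial> d m \<in> null_ideal"
      using ring_idealD(3)[OF null_ideal_ideal d(2)[of "m - 1"], of "- of_int m"] by simp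
  qed
qed

lemma null_ideal_dprod_right: "(\<And>m. c m \<in> null_ideal) \<Longrightarrow> dprod n u c m \<in> null_ideal"
  unfolding dprod_def by (rule nablas_closed) (auto intro: ring_idealD[OF null_ideal_ideal])

lemma null_dists_dprod:
  assumes V: "dist_ideal V" and u: "u \<in> dists" and "c \<in> null_dists V"
  shows "dprod n u c \<in> null_dists V"
proof -
  from assms obtain d where d: "d \<in> generated V" "\<And>m. c m - d m \<in> null_ideal" by (auto simp: null_dists_def)
  show ?thesis
    by (rule null_distsI[OF generated_dprod[OF V u d(1)]])
      (use null_ideal_dprod_right[of "\<lambda>m. c m - d m" n u] d(2) in \<open>simp add: dprod_diff_right\<close>)
qed

lemma null_dists_dprod_right:
  assumes V: "dist_ideal V" and u: "u \<in> dists" and c: "c \<in> dists" "c \<in> null_dists V"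
  shows "dprod n c u \<in> null_dists V"
proof -
  obtain N where N: "local_mod null_ideal N u c" using dists_local[OF u c(1)] by blast
  have "(\<lambda>m. (- 1) ^ (n + k) * ddpow k (dprod (n + k) u c) m) \<in> null_dists V" for k
  proof -
    let ?e = "dprod (n + k) u c"
    have "(\<partial> ^^ j) ?e \<in> null_dists V" for j by (induction j) (auto intro: null_dists_dprod[OF V u c(2)] null_dists_deriv[OF V])
    from null_dists_cong[OF null_dists_scale[OF V this] ddpow_null V]
    have "ddpow k ?e \<in> null_dists V" .
    then show ?thesis using null_dists_minus[OF V, of "ddpow k ?e"] by (cases "even (n + k)") simp_all
  qed
  then have "(\<lambda>m. \<Sum>k<N. (- 1) ^ (n + k) * ddpow k (dprod (n + k) u c) m) \<in> null_dists V"
    by (rule null_dists_sum[OF V])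
  then show ?thesis
    by (rule null_dists_cong[OF _ _ V]) (rule dprod_skew[OF null_ideal_ideal N])
qed

end

section \<open>Free Novikov rings with operators\<close>

text \<open>
  Differential polynomials are evaluated in a type with additive group structure.  The Novikov algebras of interest
  live on carrier sets, so the evaluation takes place in a free object that
  maps to all of them; its kernel is the ideal \<open>J\<close>.
\<close>

datatype ('k, 'b) nterm = NGen 'b | NZero | NAdd "('k, 'b) nterm" "('k, 'b) nterm" | NNeg "('k, 'b) nterm"
  | NMul "('k, 'b) nterm" "('k, 'b) nterm" | NSm 'k "('k, 'b) nterm"

inductive ncong :: "('k, 'b) nterm \<Rightarrow> ('k, 'b) nterm \<Rightarrow> bool" where
  refl: "ncong s s"
| sym: "ncong s t \<Longrightarrow> ncong t s"
| trans: "ncong s t \<Longrightarrow> ncong t u \<Longrightarrow> ncong s u"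
| add: "ncong s s' \<Longrightarrow> ncong t t' \<Longrightarrow> ncong (NAdd s t) (NAdd s' t')"
| neg: "ncong s s' \<Longrightarrow> ncong (NNeg s) (NNeg s')"
| mul: "ncong s s' \<Longrightarrow> ncong t t' \<Longrightarrow> ncong (NMul s t) (NMul s' t')"
| sm: "ncong s s' \<Longrightarrow> ncong (NSm k s) (NSm k s')"
| add_assoc: "ncong (NAdd (NAdd s t) u) (NAdd s (NAdd t u))"
| add_comm: "ncong (NAdd s t) (NAdd t s)"
| add_zero: "ncong (NAdd NZero s) s"
| add_neg: "ncong (NAdd (NNeg s) s) NZero"
| mul_add_left: "ncong (NMul (NAdd s t) u) (NAdd (NMul s u) (NMul t u))"
| mul_add_right: "ncong (NMul u (NAdd s t)) (NAdd (NMul u s) (NMul u t))"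
| sm_add: "ncong (NSm k (NAdd s t)) (NAdd (NSm k s) (NSm k t))"
| sm_mul_left: "ncong (NMul (NSm k s) t) (NSm k (NMul s t))"
| sm_mul_right: "ncong (NMul s (NSm k t)) (NSm k (NMul s t))"
| sm_comm: "ncong (NSm k (NSm l s)) (NSm l (NSm k s))"
| right_sym: "ncong (NAdd (NMul (NMul s t) u) (NNeg (NMul s (NMul t u)))) (NAdd (NMul (NMul s u) t) (NNeg (NMul s (NMul u t))))"
| left_comm: "ncong (NMul s (NMul t u)) (NMul t (NMul s u))"

quotient_type ('k, 'b) free_nov = "('k, 'b) nterm" / ncong
  by (intro equivpI reflpI sympI transpI) (fact ncong.refl, fact ncong.sym, fact ncong.trans)

instantiation free_nov :: (type, type) ab_group_add
begin

lift_definition zero_free_nov :: "('k, 'b) free_nov" is NZero .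
lift_definition plus_free_nov :: "('k, 'b) free_nov \<Rightarrow> ('k, 'b) free_nov \<Rightarrow> ('k, 'b) free_nov" is NAdd
  by (rule ncong.add)
lift_definition uminus_free_nov :: "('k, 'b) free_nov \<Rightarrow> ('k, 'b) free_nov" is NNeg
  by (rule ncong.neg)
definition minus_free_nov :: "('k, 'b) free_nov \<Rightarrow> ('k, 'b) free_nov \<Rightarrow> ('k, 'b) free_nov"
  where "minus_free_nov a b = a + - b"

instance
proof
  fix a b c :: "('k, 'b) free_nov"
  show "a + b + c = a + (b + c)" by transfer (rule ncong.add_assoc)
  show "a + b = b + a" by transfer (rule ncong.add_comm)
  show "0 + a = a" by transfer (rule ncong.add_zero)
  show "- a + a = 0" by transfer (rule ncong.add_neg)
  show "a - b = a + - b" by (rule minus_free_nov_def)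
qed

end

lift_definition fn_mul :: "('k, 'b) free_nov \<Rightarrow> ('k, 'b) free_nov \<Rightarrow> ('k, 'b) free_nov" is NMul
  by (rule ncong.mul)
lift_definition fn_sm :: "'k \<Rightarrow> ('k, 'b) free_nov \<Rightarrow> ('k, 'b) free_nov" is NSm
  by (rule ncong.sm)
lift_definition fn_gen :: "'b \<Rightarrow> ('k, 'b) free_nov" is NGen .

lemma fn_novikov: "novikov_ops fn_mul fn_sm"
proof
  fix x y z :: "('k, 'b) free_nov" and k l :: 'k
  show "fn_mul (x + y) z = fn_mul x z + fn_mul y z" by transfer (rule ncong.mul_add_left)
  show "fn_mul z (x + y) = fn_mul z x + fn_mul z y" by transfer (rule ncong.mul_add_right)
  show "fn_sm k (x + y) = fn_sm k x + fn_sm k y" by transfer (rule ncong.sm_add)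
  show "fn_mul (fn_sm k x) y = fn_sm k (fn_mul x y)" by transfer (rule ncong.sm_mul_left)
  show "fn_mul x (fn_sm k y) = fn_sm k (fn_mul x y)" by transfer (rule ncong.sm_mul_right)
  show "fn_sm k (fn_sm l x) = fn_sm l (fn_sm k x)" by transfer (rule ncong.sm_comm)
  show "fn_mul (fn_mul x y) z - fn_mul x (fn_mul y z) = fn_mul (fn_mul x z) y - fn_mul x (fn_mul z y)"
    unfolding minus_free_nov_def by transfer (rule ncong.right_sym)
  show "fn_mul x (fn_mul y z) = fn_mul y (fn_mul x z)" by transfer (rule ncong.left_comm)
qed

section \<open>Algebras over a field with an explicit carrier\<close>

locale nonassoc_algebra = Module.module R A
  for R :: "('k, 'm) ring_scheme" and A :: "('k, 'a, 'n) module_scheme" (structure) +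
  assumes mult_closed: "x \<in> carrier A \<Longrightarrow> y \<in> carrier A \<Longrightarrow> x \<otimes> y \<in> carrier A"
    and mult_add_left: "x \<in> carrier A \<Longrightarrow> y \<in> carrier A \<Longrightarrow> z \<in> carrier A \<Longrightarrow> (x \<oplus> y) \<otimes> z = x \<otimes> z \<oplus> y \<otimes> z"
    and mult_add_right: "x \<in> carrier A \<Longrightarrow> y \<in> carrier A \<Longrightarrow> z \<in> carrier A \<Longrightarrow> z \<otimes> (x \<oplus> y) = z \<otimes> x \<oplus> z \<otimes> y"
    and mult_smult_left: "k \<in> carrier R \<Longrightarrow> x \<in> carrier A \<Longrightarrow> y \<in> carrier A \<Longrightarrow> (k \<odot> x) \<otimes> y = k \<odot> (x \<otimes> y)"
    and mult_smult_right: "k \<in> carrier R \<Longrightarrow> x \<in> carrier A \<Longrightarrow> y \<in> carrier A \<Longrightarrow> x \<otimes> (k \<odot> y) = k \<odot> (x \<otimes> y)"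

locale novikov_algebra = nonassoc_algebra R A
  for R :: "('k, 'm) ring_scheme" and A :: "('k, 'a, 'n) module_scheme" (structure) +
  assumes alg_right_symmetric: "x \<in> carrier A \<Longrightarrow> y \<in> carrier A \<Longrightarrow> z \<in> carrier A \<Longrightarrow>
      (x \<otimes> y) \<otimes> z \<ominus> x \<otimes> (y \<otimes> z) = (x \<otimes> z) \<otimes> y \<ominus> x \<otimes> (z \<otimes> y)"
    and alg_left_commutative: "x \<in> carrier A \<Longrightarrow> y \<in> carrier A \<Longrightarrow> z \<in> carrier A \<Longrightarrow>
      x \<otimes> (y \<otimes> z) = y \<otimes> (x \<otimes> z)"
begin

text \<open>
  Every element of the type of scalars has to act, so those outside the field act by zero.
\<close>

definition scal :: "'k \<Rightarrow> 'a \<Rightarrow> 'a"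
  where "scal k x = (if k \<in> carrier R then k \<odot> x else \<zero>)"

primrec term_value :: "('b \<Rightarrow> 'a) \<Rightarrow> ('k, 'b) nterm \<Rightarrow> 'a" where
  "term_value g (NGen b) = g b"
| "term_value g NZero = \<zero>"
| "term_value g (NAdd s t) = term_value g s \<oplus> term_value g t"
| "term_value g (NNeg s) = \<ominus> term_value g s"
| "term_value g (NMul s t) = term_value g s \<otimes> term_value g t"
| "term_value g (NSm k s) = scal k (term_value g s)"

lemma scal_closed: "x \<in> carrier A \<Longrightarrow> scal k x \<in> carrier A"
  by (simp add: scal_def)

lemma mult_zero: "x \<in> carrier A \<Longrightarrow> \<zero> \<otimes> x = \<zero>" "x \<in> carrier A \<Longrightarrow> x \<otimes> \<zero> = \<zero>"
  using mult_smult_left[of "\<zero>\<^bsub>R\<^esub>" "\<zero>" x] mult_smult_right[of "\<zero>\<^bsub>R\<^esub>" x "\<zero>"]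
  by (simp_all add: mult_closed)

lemma term_value_closed: "(\<And>b. g b \<in> carrier A) \<Longrightarrow> term_value g t \<in> carrier A"
  by (induction t) (simp_all add: mult_closed scal_closed)

lemma scal_simps:
  "x \<in> carrier A \<Longrightarrow> y \<in> carrier A \<Longrightarrow> scal k (x \<oplus> y) = scal k x \<oplus> scal k y"
  "x \<in> carrier A \<Longrightarrow> y \<in> carrier A \<Longrightarrow> scal k x \<otimes> y = scal k (x \<otimes> y)"
  "x \<in> carrier A \<Longrightarrow> y \<in> carrier A \<Longrightarrow> x \<otimes> scal k y = scal k (x \<otimes> y)"
  "x \<in> carrier A \<Longrightarrow> scal k (scal l x) = scal l (scal k x)"
  by (simp_all add: scal_def smult_r_distr mult_smult_left mult_smult_right mult_zero R.m_comm flip: smult_assoc1)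

lemma term_value_cong:
  assumes g: "\<And>b. g b \<in> carrier A"
  shows "ncong s t \<Longrightarrow> term_value g s = term_value g t"
proof (induction rule: ncong.induct)
  case (add_neg s)
  then show ?case by (simp add: l_neg term_value_closed g)
next
  case (right_sym s t u)
  then show ?case using alg_right_symmetric[of "term_value g s" "term_value g t" "term_value g u"]
    by (simp add: minus_eq term_value_closed g)
next
  case (left_comm s t u)
  then show ?case by (simp add: alg_left_commutative[of "term_value g s"] term_value_closed g)
qed (simp_all add: term_value_closed g a_ac mult_closed scal_closed mult_add_left mult_add_right scal_simps)

definition ev :: "('b \<Rightarrow> 'a) \<Rightarrow> ('k, 'b) free_nov \<Rightarrow> 'a"
  where "ev g x = term_value g (rep_free_nov x)"

lemma ev_simps:
  assumes g: "\<And>b. g b \<in> carrier A"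
  shows "ev g x \<in> carrier A" "ev g 0 = \<zero>" "ev g (x + y) = ev g x \<oplus> ev g y" "ev g (- x) = \<ominus> ev g x"
    "ev g (fn_mul x y) = ev g x \<otimes> ev g y" "ev g (fn_sm k x) = scal k (ev g x)" "ev g (fn_gen b) = g b"
    "ev g (x - y) = ev g x \<ominus> ev g y"
proof -
  have ev: "ev g (abs_free_nov t) = term_value g t" for t
    unfolding ev_def by (rule term_value_cong[OF g Quotient3_rep_abs[OF Quotient3_free_nov ncong.refl]])
  have ex: "\<exists>t. x = abs_free_nov t" for x :: "('k, 'b) free_nov"
    using Quotient3_abs_rep[OF Quotient3_free_nov, of x] by metis
  show "ev g x \<in> carrier A" by (simp add: ev_def term_value_closed g)
  show "ev g 0 = \<zero>" by (simp add: zero_free_nov.abs_eq ev)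
  show *: "ev g (x + y) = ev g x \<oplus> ev g y" for x y
    using ex[of x] ex[of y] by (auto simp: plus_free_nov.abs_eq ev)
  show **: "ev g (- x) = \<ominus> ev g x" for x
    using ex[of x] by (auto simp: uminus_free_nov.abs_eq ev)
  show "ev g (fn_mul x y) = ev g x \<otimes> ev g y"
    using ex[of x] ex[of y] by (auto simp: fn_mul.abs_eq ev)
  show "ev g (fn_sm k x) = scal k (ev g x)"
    using ex[of x] by (auto simp: fn_sm.abs_eq ev)
  show "ev g (fn_gen b) = g b" by (simp add: fn_gen.abs_eq ev)
  show "ev g (x - y) = ev g x \<ominus> ev g y" by (simp only: minus_free_nov_def * ** minus_eq)
qed

end

section \<open>Quotient algebras\<close>

lemma (in abelian_group) eq_minusI:
  "x \<oplus> y = z \<Longrightarrow> x \<in> carrier G \<Longrightarrow> y \<in> carrier G \<Longrightarrow> x = z \<ominus> y"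
  by (auto simp: minus_eq a_assoc r_neg)

context nonassoc_algebra
begin

lemma mult_minus_left:
  assumes "x \<in> carrier A" "y \<in> carrier A" "z \<in> carrier A"
  shows "(x \<ominus> y) \<otimes> z = x \<otimes> z \<ominus> y \<otimes> z"
proof -
  have "(x \<ominus> y) \<otimes> z \<oplus> y \<otimes> z = ((x \<ominus> y) \<oplus> y) \<otimes> z" using assms by (simp add: mult_add_left)
  also have "(x \<ominus> y) \<oplus> y = x" using assms by (simp add: minus_eq a_assoc l_neg)
  finally show ?thesis using assms by (intro eq_minusI) (simp_all add: mult_closed)
qed

lemma mult_minus_right:
  assumes "x \<in> carrier A" "y \<in> carrier A" "z \<in> carrier A"
  shows "z \<otimes> (x \<ominus> y) = z \<otimes> x \<ominus> z \<otimes> y"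
proof -
  have "z \<otimes> (x \<ominus> y) \<oplus> z \<otimes> y = z \<otimes> ((x \<ominus> y) \<oplus> y)" using assms by (simp add: mult_add_right)
  also have "(x \<ominus> y) \<oplus> y = x" using assms by (simp add: minus_eq a_assoc l_neg)
  finally show ?thesis using assms by (intro eq_minusI) (simp_all add: mult_closed)
qed

lemma alg_idealD:
  assumes "alg_ideal R A I"
  shows "I \<subseteq> carrier A" "\<zero> \<in> I" "x \<in> I \<Longrightarrow> \<ominus> x \<in> I" "x \<in> I \<Longrightarrow> y \<in> I \<Longrightarrow> x \<oplus> y \<in> I"
    "k \<in> carrier R \<Longrightarrow> x \<in> I \<Longrightarrow> k \<odot> x \<in> I" "a \<in> carrier A \<Longrightarrow> x \<in> I \<Longrightarrow> a \<otimes> x \<in> I"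
    "a \<in> carrier A \<Longrightarrow> x \<in> I \<Longrightarrow> x \<otimes> a \<in> I"
proof -
  from assms have s: "submodule I R A" and m: "\<And>a x. a \<in> carrier A \<Longrightarrow> x \<in> I \<Longrightarrow> a \<otimes> x \<in> I \<and> x \<otimes> a \<in> I"
    by (auto simp: alg_ideal_def)
  note E = submoduleE[OF s]
  show "I \<subseteq> carrier A" by (rule E)
  show "x \<in> I \<Longrightarrow> \<ominus> x \<in> I" by (rule E)
  show "x \<in> I \<Longrightarrow> y \<in> I \<Longrightarrow> x \<oplus> y \<in> I" by (rule E)
  show "k \<in> carrier R \<Longrightarrow> x \<in> I \<Longrightarrow> k \<odot> x \<in> I" by (rule E)
  show "a \<in> carrier A \<Longrightarrow> x \<in> I \<Longrightarrow> a \<otimes> x \<in> I" "a \<in> carrier A \<Longrightarrow> x \<in> I \<Longrightarrow> x \<otimes> a \<in> I"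
    using m by simp_all
  show "\<zero> \<in> I" using subgroup.one_closed[OF submodule.axioms(1)[OF s]] by simp
qed

lemma alg_ideal_carrier: "alg_ideal R A (carrier A)"
  by (auto simp: alg_ideal_def carrier_is_submodule mult_closed)

lemma alg_ideal_hull:
  assumes "S \<subseteq> carrier A"
  shows "alg_ideal R A (alg_ideal R A hull S)"
proof -
  let ?T = "{t. alg_ideal R A t \<and> S \<subseteq> t}"
  have car: "carrier A \<in> ?T" using assms alg_ideal_carrier by simp
  have "submodule (\<Inter>?T) R A"
  proof (rule submoduleI)
    show "\<Inter>?T \<subseteq> carrier A" using car by blast
    show "\<zero> \<in> \<Inter>?T" by (simp add: alg_idealD(2))
    show "\<ominus> a \<in> \<Inter>?T" if "a \<in> \<Inter>?T" for a using that by (simp add: alg_idealD(3))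
    show "a \<oplus> b \<in> \<Inter>?T" if "a \<in> \<Inter>?T" "b \<in> \<Inter>?T" for a b using that by (simp add: alg_idealD(4))
    show "k \<odot> a \<in> \<Inter>?T" if "k \<in> carrier R" "a \<in> \<Inter>?T" for k a using that by (simp add: alg_idealD(5))
  qed
  moreover have "a \<otimes> x \<in> \<Inter>?T \<and> x \<otimes> a \<in> \<Inter>?T" if "a \<in> carrier A" "x \<in> \<Inter>?T" for a x
    using that by (simp add: alg_idealD(6,7))
  ultimately have "alg_ideal R A (\<Inter>?T)" unfolding alg_ideal_def[of R A "\<Inter>?T"] by blast
  then show ?thesis by (simp add: hull_def)
qed

end

locale alg_quotient = nonassoc_algebra R A
  for R :: "('k, 'm) ring_scheme" and A :: "('k, 'a, 'n) module_scheme" (structure) +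
  fixes I :: "'a set"
  assumes ideal: "alg_ideal R A I"
begin

lemmas I_facts = alg_idealD[OF ideal]

abbreviation quot :: "('k, 'a set) module" where "quot \<equiv> alg_quot A I"

abbreviation proj :: "'a \<Rightarrow> 'a set" where "proj x \<equiv> I +> x"

lemma mem_proj: "x \<in> carrier A \<Longrightarrow> y \<in> proj x \<longleftrightarrow> y \<in> carrier A \<and> y \<ominus> x \<in> I"
proof
  assume x: "x \<in> carrier A" and "y \<in> proj x"
  then obtain h where "h \<in> I" "y = h \<oplus> x" by (auto simp: a_r_coset_def')
  then show "y \<in> carrier A \<and> y \<ominus> x \<in> I" using x I_facts(1) by (auto simp: minus_eq a_assoc r_neg)
next
  assume x: "x \<in> carrier A" and "y \<in> carrier A \<and> y \<ominus> x \<in> I"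
  moreover from this have "y = (y \<ominus> x) \<oplus> x" by (simp add: minus_eq a_assoc l_neg)
  ultimately show "y \<in> proj x" by (auto simp: a_r_coset_def')
qed

lemma proj_eq:
  assumes "x \<in> carrier A" "y \<in> carrier A"
  shows "proj x = proj y \<longleftrightarrow> x \<ominus> y \<in> I"
proof
  assume "proj x = proj y"
  moreover have "x \<in> proj x" using assms I_facts(2) by (simp add: mem_proj minus_eq r_neg)
  ultimately show "x \<ominus> y \<in> I" using assms by (simp add: mem_proj)
next
  have aux: "z \<ominus> y \<in> I" if "x \<in> carrier A" "y \<in> carrier A" "z \<in> carrier A" "x \<ominus> y \<in> I" "z \<ominus> x \<in> I" for x y z
  proof -
    have "z \<ominus> y = (z \<ominus> x) \<oplus> (x \<ominus> y)" using that
      by (simp add: minus_eq a_assoc) (simp add: l_neg flip: a_assoc)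
    then show ?thesis using I_facts(4) that by simp
  qed
  assume xy: "x \<ominus> y \<in> I"
  have "y \<ominus> x = \<ominus> (x \<ominus> y)" using assms by (simp add: minus_eq minus_add a_comm)
  then have "y \<ominus> x \<in> I" using I_facts(3) xy by simp
  then show "proj x = proj y" using assms xy aux[of x y] aux[of y x] by (auto simp: mem_proj)
qed

lemma proj_self: "x \<in> carrier A \<Longrightarrow> x \<in> proj x"
  using I_facts(2) by (simp add: mem_proj minus_eq r_neg)

lemma quot_carrier: "carrier quot = proj ` carrier A"
  by (auto simp: alg_quot_def A_RCOSETS_def')

lemma quot_zero: "\<zero>\<^bsub>quot\<^esub> = proj \<zero>"
proof -
  have "h \<oplus> \<zero> = h" if "h \<in> I" for h using that I_facts(1) by auto
  then have "I = proj \<zero>" by (simp add: a_r_coset_def')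
  then show ?thesis by (simp add: alg_quot_def)
qed

lemma quot_add:
  assumes "x \<in> carrier A" "y \<in> carrier A"
  shows "proj x \<oplus>\<^bsub>quot\<^esub> proj y = proj (x \<oplus> y)"
proof -
  have "z \<in> proj (x \<oplus> y)" if "h \<in> proj x" "k \<in> proj y" "z = h \<oplus> k" for z h k
  proof -
    have "(h \<oplus> k) \<ominus> (x \<oplus> y) = (h \<ominus> x) \<oplus> (k \<ominus> y)"
      using that assms by (simp add: mem_proj minus_eq minus_add a_ac)
    then show ?thesis using that assms I_facts(4) by (simp add: mem_proj)
  qed
  moreover have "z = (z \<ominus> y) \<oplus> y \<and> z \<ominus> y \<in> proj x" if "z \<in> proj (x \<oplus> y)" for z
  proof -
    have z: "z \<in> carrier A" "z \<ominus> (x \<oplus> y) \<in> I" using that assms by (simp_all add: mem_proj)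
    moreover have "(z \<ominus> y) \<ominus> x = z \<ominus> (x \<oplus> y)" using z assms by (simp add: minus_eq minus_add a_ac)
    ultimately show ?thesis using assms by (simp add: mem_proj) (simp add: minus_eq a_assoc l_neg)
  qed
  ultimately have "proj x <+> proj y = proj (x \<oplus> y)"
    unfolding set_add_def' using proj_self[OF assms(2)] by (auto, blast)
  then show ?thesis by (simp add: alg_quot_def)
qed

lemma UN_proj_const:
  assumes "B \<noteq> {}" "\<And>b. b \<in> B \<Longrightarrow> f b = c"
  shows "(\<Union>b\<in>B. f b) = c"
  using assms by auto

lemma quot_smult:
  assumes k: "k \<in> carrier R" and x: "x \<in> carrier A"
  shows "k \<odot>\<^bsub>quot\<^esub> proj x = proj (k \<odot> x)"
proof -
  have *: "proj (k \<odot> y) = proj (k \<odot> x)" if "y \<in> proj x" for y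
  proof -
    have y: "y \<in> carrier A" "y \<ominus> x \<in> I" using that x by (simp_all add: mem_proj)
    then have "k \<odot> y \<ominus> k \<odot> x = k \<odot> (y \<ominus> x)" using k x by (simp add: minus_eq smult_r_distr smult_r_minus)
    then show ?thesis using k x y I_facts(5) by (simp add: proj_eq)
  qed
  have "(\<Union>y\<in>proj x. proj (k \<odot> y)) = proj (k \<odot> x)"
    by (rule UN_proj_const[OF _ *]) (use proj_self[OF x] in auto)
  then show ?thesis by (simp add: alg_quot_def)
qed

lemma quot_mult:
  assumes x: "x \<in> carrier A" and y: "y \<in> carrier A"
  shows "proj x \<otimes>\<^bsub>quot\<^esub> proj y = proj (x \<otimes> y)"
proof -
  have *: "proj (a \<otimes> b) = proj (x \<otimes> y)" if "a \<in> proj x" "b \<in> proj y" for a b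
  proof -
    have a: "a \<in> carrier A" "a \<ominus> x \<in> I" and b: "b \<in> carrier A" "b \<ominus> y \<in> I"
      using that x y by (simp_all add: mem_proj)
    have "(a \<ominus> x) \<otimes> b \<oplus> x \<otimes> (b \<ominus> y) = (a \<otimes> b \<ominus> x \<otimes> b) \<oplus> (x \<otimes> b \<ominus> x \<otimes> y)"
      using a b x y by (simp add: mult_minus_left mult_minus_right)
    also have "\<dots> = a \<otimes> b \<ominus> x \<otimes> y"
      using a b x y by (simp add: minus_eq mult_closed a_assoc) (simp add: mult_closed l_neg flip: a_assoc)
    finally have "a \<otimes> b \<ominus> x \<otimes> y \<in> I" using a b x y I_facts(4,6,7) by metis
    then show ?thesis using a b x y by (simp add: proj_eq mult_closed)
  qed
  have "(\<Union>b\<in>proj y. proj (a \<otimes> b)) = proj (x \<otimes> y)" if "a \<in> proj x" for a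
    by (rule UN_proj_const[OF _ *[OF that]]) (use proj_self[OF y] in auto)
  then have "(\<Union>a\<in>proj x. \<Union>b\<in>proj y. proj (a \<otimes> b)) = proj (x \<otimes> y)"
    by (rule UN_proj_const[rotated]) (use proj_self[OF x] in auto)
  then show ?thesis by (simp add: alg_quot_def rcoset_mult_def)
qed

lemma quot_algebra: "nonassoc_algebra R quot"
proof -
  note simps = quot_carrier quot_add quot_smult quot_mult quot_zero
  have ag: "abelian_group quot"
  proof (rule abelian_groupI)
    fix x assume "x \<in> carrier quot"
    then obtain x' where "x' \<in> carrier A" "x = proj x'" by (auto simp: simps)
    then have "proj (\<ominus> x') \<oplus>\<^bsub>quot\<^esub> x = \<zero>\<^bsub>quot\<^esub>" by (simp add: simps l_neg)
    then show "\<exists>y\<in>carrier quot. y \<oplus>\<^bsub>quot\<^esub> x = \<zero>\<^bsub>quot\<^esub>" using \<open>x' \<in> carrier A\<close> by (auto simp: simps)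
  qed (auto simp: simps a_ac)
  have "Module.module R quot"
    by (rule Module.moduleI[OF R.is_cring ag]) (auto simp: simps smult_l_distr smult_r_distr smult_assoc1)
  then show ?thesis
    by (rule nonassoc_algebra.intro, unfold_locales)
      (auto simp: simps mult_closed mult_add_left mult_add_right mult_smult_left mult_smult_right)
qed

lemma quot_minus:
  assumes "x \<in> carrier A" "y \<in> carrier A"
  shows "\<ominus>\<^bsub>quot\<^esub> proj x = proj (\<ominus> x)" "proj x \<ominus>\<^bsub>quot\<^esub> proj y = proj (x \<ominus> y)"
proof -
  interpret Q: nonassoc_algebra R quot by (rule quot_algebra)
  have 1: "\<ominus>\<^bsub>quot\<^esub> proj x = proj (\<ominus> x)" if "x \<in> carrier A" for x
    by (rule Q.minus_equality) (use that in \<open>auto simp: quot_add quot_carrier quot_zero l_neg\<close>)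
  show "\<ominus>\<^bsub>quot\<^esub> proj x = proj (\<ominus> x)" by (rule 1[OF assms(1)])
  show "proj x \<ominus>\<^bsub>quot\<^esub> proj y = proj (x \<ominus> y)"
    using assms by (simp add: Q.minus_eq minus_eq 1 quot_add)
qed

lemma quot_novikov:
  assumes "novikov_relators A \<subseteq> I"
  shows "novikov_algebra R quot"
proof -
  interpret Q: nonassoc_algebra R quot by (rule quot_algebra)
  show ?thesis
  proof
    fix x y z assume "x \<in> carrier quot" "y \<in> carrier quot" "z \<in> carrier quot"
    then obtain u v w where c: "u \<in> carrier A" "v \<in> carrier A" "w \<in> carrier A"
      and xyz: "x = proj u" "y = proj v" "z = proj w" by (auto simp: quot_carrier)
    have "((u \<otimes> v) \<otimes> w \<ominus> u \<otimes> (v \<otimes> w)) \<ominus> ((u \<otimes> w) \<otimes> v \<ominus> u \<otimes> (w \<otimes> v)) \<in> novikov_relators A"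
      "u \<otimes> (v \<otimes> w) \<ominus> v \<otimes> (u \<otimes> w) \<in> novikov_relators A"
      unfolding novikov_relators_def using c by blast+
    then have "proj ((u \<otimes> v) \<otimes> w \<ominus> u \<otimes> (v \<otimes> w)) = proj ((u \<otimes> w) \<otimes> v \<ominus> u \<otimes> (w \<otimes> v))"
      "proj (u \<otimes> (v \<otimes> w)) = proj (v \<otimes> (u \<otimes> w))"
      using assms c by (auto simp: proj_eq mult_closed)
    moreover have "x \<otimes>\<^bsub>quot\<^esub> y \<otimes>\<^bsub>quot\<^esub> z \<ominus>\<^bsub>quot\<^esub> x \<otimes>\<^bsub>quot\<^esub> (y \<otimes>\<^bsub>quot\<^esub> z) = proj ((u \<otimes> v) \<otimes> w \<ominus> u \<otimes> (v \<otimes> w))"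
      "x \<otimes>\<^bsub>quot\<^esub> z \<otimes>\<^bsub>quot\<^esub> y \<ominus>\<^bsub>quot\<^esub> x \<otimes>\<^bsub>quot\<^esub> (z \<otimes>\<^bsub>quot\<^esub> y) = proj ((u \<otimes> w) \<otimes> v \<ominus> u \<otimes> (w \<otimes> v))"
      "x \<otimes>\<^bsub>quot\<^esub> (y \<otimes>\<^bsub>quot\<^esub> z) = proj (u \<otimes> (v \<otimes> w))" "y \<otimes>\<^bsub>quot\<^esub> (x \<otimes>\<^bsub>quot\<^esub> z) = proj (v \<otimes> (u \<otimes> w))"
      using c by (simp_all only: xyz quot_mult quot_minus mult_closed)
    ultimately show "x \<otimes>\<^bsub>quot\<^esub> y \<otimes>\<^bsub>quot\<^esub> z \<ominus>\<^bsub>quot\<^esub> x \<otimes>\<^bsub>quot\<^esub> (y \<otimes>\<^bsub>quot\<^esub> z) =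
        x \<otimes>\<^bsub>quot\<^esub> z \<otimes>\<^bsub>quot\<^esub> y \<ominus>\<^bsub>quot\<^esub> x \<otimes>\<^bsub>quot\<^esub> (z \<otimes>\<^bsub>quot\<^esub> y)"
      "x \<otimes>\<^bsub>quot\<^esub> (y \<otimes>\<^bsub>quot\<^esub> z) = y \<otimes>\<^bsub>quot\<^esub> (x \<otimes>\<^bsub>quot\<^esub> z)"
      by simp_all
  qed
qed

end

section \<open>Transporting evaluations along homomorphisms\<close>

lemma (in alg_quotient) proj_ev:
  assumes "novikov_algebra R A" and Q: "novikov_algebra R quot" and g: "\<And>b. g b \<in> carrier A"
  shows "proj (novikov_algebra.ev R A g t) = novikov_algebra.ev R quot (\<lambda>b. proj (g b)) t"
proof -
  interpret N: novikov_algebra R A by fact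
  interpret Q: novikov_algebra R quot by fact
  have gq: "proj (g b) \<in> carrier quot" for b using g by (simp add: quot_carrier)
  have "proj (N.term_value g t) = Q.term_value (\<lambda>b. proj (g b)) t" for t
    by (induction t) (simp_all add: quot_zero quot_add[symmetric] quot_minus(1)[of _ \<zero>, symmetric] quot_mult[symmetric] quot_smult[symmetric]
        N.scal_def Q.scal_def N.term_value_closed g)
  then show ?thesis by (simp add: N.ev_def Q.ev_def)
qed

context novikov_algebra
begin

lemma ev_intmul:
  assumes g: "\<And>b. g b \<in> carrier A"
  shows "ev g (intmul k t) = [k] \<cdot> ev g t"
proof (induction k rule: int_induct[where k = 0])
  case base
  then show ?case by (simp add: ev_simps[OF g] add_pow_def)
next
  case (step1 i)
  then show ?case by (simp add: ev_simps[OF g] intmul_add add.int_pow_mult)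
next
  case (step2 i)
  then show ?case by (simp add: ev_simps[OF g] intmul_diff add.int_pow_diff minus_eq)
qed

lemma ev_sum:
  assumes g: "\<And>b. g b \<in> carrier A"
  shows "finite S \<Longrightarrow> ev g (sum f S) = (\<Oplus>s\<in>S. ev g (f s))"
  by (induction S rule: finite_induct) (simp_all add: ev_simps[OF g])

end

lemma nablas_binomial:
  "(nabla ^^ k) H m n = (\<Sum>s\<le>k. intmul ((- 1) ^ s * int (k choose s)) (H (m + int k - int s) (n + int s)))"
proof (induction k arbitrary: m n)
  case (Suc k)
  let ?f = "\<lambda>s. H (m + int (Suc k) - int s) (n + int s)"
  have 1: "(nabla ^^ k) H (m + 1) n = (\<Sum>s\<le>Suc k. intmul ((- 1) ^ s * int (k choose s)) (?f s))"
    by (simp add: Suc binomial_eq_0 ac_simps)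
  have 2: "(nabla ^^ k) H m (n + 1) = (\<Sum>s\<le>k. intmul ((- 1) ^ s * int (k choose s)) (?f (Suc s)))"
    by (simp add: Suc ac_simps)
  have "(nabla ^^ Suc k) H m n = ?f 0 + ((\<Sum>s\<le>k. intmul ((- 1) ^ Suc s * int (k choose Suc s)) (?f (Suc s)))
      - (\<Sum>s\<le>k. intmul ((- 1) ^ s * int (k choose s)) (?f (Suc s))))"
    unfolding nablas_Suc 1 2 by (simp only: sum.atMost_Suc_shift) simp
  also have "\<dots> = ?f 0 + (\<Sum>s\<le>k. intmul ((- 1) ^ Suc s * int (Suc k choose Suc s)) (?f (Suc s)))"
  proof -
    have "(- 1) ^ Suc s * int (k choose Suc s) - (- 1) ^ s * int (k choose s) = (- 1) ^ Suc s * int (Suc k choose Suc s)" for s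
      by (simp add: algebra_simps)
    then show ?thesis by (simp only: sum_subtractf[symmetric] intmul_diff[symmetric])
  qed
  also have "\<dots> = (\<Sum>s\<le>Suc k. intmul ((- 1) ^ s * int (Suc k choose s)) (?f s))"
    by (simp only: sum.atMost_Suc_shift) simp
  finally show ?case .
qed simp

section \<open>The coefficient algebra\<close>

context cring
begin

lemma free_nonassoc_abelian_group: "abelian_group (free_nonassoc R B)"
proof (rule abelian_groupI)
  fix f g assume f: "f \<in> carrier (free_nonassoc R B)" and g: "g \<in> carrier (free_nonassoc R B)"
  have "{t. f t \<oplus> g t \<noteq> \<zero>} \<subseteq> {t. f t \<noteq> \<zero>} \<union> {t. g t \<noteq> \<zero>}" by auto
  then have "finite {t. f t \<oplus> g t \<noteq> \<zero>}"
    by (rule finite_subset) (use f g in \<open>simp add: free_nonassoc_def\<close>)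
  moreover have "gens t \<subseteq> B" if "f t \<oplus> g t \<noteq> \<zero>" for t
  proof -
    have "f t \<noteq> \<zero> \<or> g t \<noteq> \<zero>" using that by auto
    then show ?thesis using f g by (auto simp: free_nonassoc_def)
  qed
  ultimately show "f \<oplus>\<^bsub>free_nonassoc R B\<^esub> g \<in> carrier (free_nonassoc R B)"
    using f g by (auto simp: free_nonassoc_def)
next
  fix f assume f: "f \<in> carrier (free_nonassoc R B)"
  have "{t. \<ominus> f t \<noteq> \<zero>} \<subseteq> {t. f t \<noteq> \<zero>}" by auto
  then have "finite {t. \<ominus> f t \<noteq> \<zero>}"
    by (rule finite_subset) (use f in \<open>simp add: free_nonassoc_def\<close>)
  moreover have "gens t \<subseteq> B" if "\<ominus> f t \<noteq> \<zero>" for t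
  proof -
    have "f t \<noteq> \<zero>" using that by auto
    then show ?thesis using f by (auto simp: free_nonassoc_def)
  qed
  ultimately have "(\<lambda>t. \<ominus> f t) \<in> carrier (free_nonassoc R B)"
    using f by (auto simp: free_nonassoc_def)
  moreover have "(\<lambda>t. \<ominus> f t) \<oplus>\<^bsub>free_nonassoc R B\<^esub> f = \<zero>\<^bsub>free_nonassoc R B\<^esub>"
    using f by (simp add: free_nonassoc_def l_neg)
  ultimately show "\<exists>g\<in>carrier (free_nonassoc R B). g \<oplus>\<^bsub>free_nonassoc R B\<^esub> f = \<zero>\<^bsub>free_nonassoc R B\<^esub>" by blast
qed (auto simp: free_nonassoc_def fun_eq_iff a_ac)

lemma free_nonassoc_smult_closed:
  assumes k: "k \<in> carrier R" and f: "f \<in> carrier (free_nonassoc R B)"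
  shows "k \<odot>\<^bsub>free_nonassoc R B\<^esub> f \<in> carrier (free_nonassoc R B)"
proof -
  have z: "k \<otimes> f t \<noteq> \<zero> \<Longrightarrow> f t \<noteq> \<zero>" for t using k by auto
  then have "{t. k \<otimes> f t \<noteq> \<zero>} \<subseteq> {t. f t \<noteq> \<zero>}" by auto
  then have "finite {t. k \<otimes> f t \<noteq> \<zero>}"
    by (rule finite_subset) (use f in \<open>simp add: free_nonassoc_def\<close>)
  then show ?thesis using f k z by (auto simp: free_nonassoc_def)
qed

lemma free_nonassoc_mult_closed:
  assumes f: "f \<in> carrier (free_nonassoc R B)" and g: "g \<in> carrier (free_nonassoc R B)"
  shows "f \<otimes>\<^bsub>free_nonassoc R B\<^esub> g \<in> carrier (free_nonassoc R B)"
proof -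
  let ?h = "\<lambda>t. case t of Gen b \<Rightarrow> \<zero> | Mul l r \<Rightarrow> f l \<otimes> g r"
  have nz: "\<exists>l r. t = Mul l r \<and> f l \<noteq> \<zero> \<and> g r \<noteq> \<zero>" if "?h t \<noteq> \<zero>" for t
  proof (cases t)
    case (Mul l r)
    then have "f l \<otimes> g r \<noteq> \<zero>" using that by simp
    moreover have "f l \<in> carrier R" "g r \<in> carrier R" using f g by (auto simp: free_nonassoc_def)
    ultimately show ?thesis using Mul by auto
  qed (use that in simp)
  then have "{t. ?h t \<noteq> \<zero>} \<subseteq> (\<lambda>(l, r). Mul l r) ` ({t. f t \<noteq> \<zero>} \<times> {t. g t \<noteq> \<zero>})" by fastforce
  moreover have "finite ((\<lambda>(l, r). Mul l r) ` ({t. f t \<noteq> \<zero>} \<times> {t. g t \<noteq> \<zero>}))"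
    using f g by (simp add: free_nonassoc_def)
  ultimately have "finite {t. ?h t \<noteq> \<zero>}" by (rule finite_subset)
  moreover have "gens t \<subseteq> B" if "?h t \<noteq> \<zero>" for t
  proof -
    from nz[OF that] obtain l r where t: "t = Mul l r" "f l \<noteq> \<zero>" "g r \<noteq> \<zero>" by blast
    then have "gens l \<subseteq> B" "gens r \<subseteq> B" using f g by (simp_all add: free_nonassoc_def)
    then show ?thesis by (simp add: t)
  qed
  moreover have "?h t \<in> carrier R" for t
    using f g by (cases t) (auto simp: free_nonassoc_def)
  ultimately show ?thesis by (simp add: free_nonassoc_def)
qed

lemma free_nonassoc_algebra:
  fixes B :: "'c set"
  shows "nonassoc_algebra R (free_nonassoc R B)"
proof -
  have car: "f t \<in> carrier R" if "f \<in> carrier (free_nonassoc R B)" for f :: "'c magma \<Rightarrow> 'a" and t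
    using that by (simp add: free_nonassoc_def)
  have "Module.module R (free_nonassoc R B)"
    by (rule Module.moduleI[OF is_cring free_nonassoc_abelian_group])
      (auto simp: free_nonassoc_smult_closed, auto simp: free_nonassoc_def fun_eq_iff l_distr r_distr m_assoc)
  then show ?thesis
    by (rule nonassoc_algebra.intro, unfold_locales)
      (auto simp: free_nonassoc_mult_closed,
       auto simp: free_nonassoc_def fun_eq_iff l_distr r_distr m_ac split: magma.split)
qed

lemma nonassoc_gen_closed: "b \<in> B \<Longrightarrow> nonassoc_gen R b \<in> carrier (free_nonassoc R B)"
  by (auto simp: free_nonassoc_def nonassoc_gen_def intro: finite_subset[of _ "{Gen b}"])

lemma novikov_relators_closed:
  assumes "nonassoc_algebra R A"
  shows "novikov_relators A \<subseteq> carrier A"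
proof -
  interpret A: nonassoc_algebra R A by fact
  show ?thesis unfolding novikov_relators_def by (auto intro!: A.minus_closed A.mult_closed)
qed

lemma novikov_ideal_quotient: "alg_quotient R (free_nonassoc R B) (novikov_ideal R B)"
proof -
  interpret A: nonassoc_algebra R "free_nonassoc R B" by (rule free_nonassoc_algebra)
  have "alg_ideal R (free_nonassoc R B) (novikov_ideal R B)"
    unfolding novikov_ideal_def by (intro A.alg_ideal_hull novikov_relators_closed free_nonassoc_algebra)
  then show ?thesis by (intro alg_quotient.intro alg_quotient_axioms.intro free_nonassoc_algebra)
qed

lemma free_novikov_algebra: "novikov_algebra R (free_novikov R B)"
proof -
  interpret Q: alg_quotient R "free_nonassoc R B" "novikov_ideal R B" by (rule novikov_ideal_quotient)
  show ?thesis unfolding free_novikov_def by (rule Q.quot_novikov) (simp add: novikov_ideal_def hull_subset)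
qed

lemma novikov_gen_closed: "b \<in> B \<Longrightarrow> novikov_gen R B b \<in> carrier (free_novikov R B)"
proof -
  interpret Q: alg_quotient R "free_nonassoc R B" "novikov_ideal R B" by (rule novikov_ideal_quotient)
  show "b \<in> B \<Longrightarrow> ?thesis"
    unfolding free_novikov_def novikov_gen_def by (simp add: Q.quot_carrier nonassoc_gen_closed)
qed

end

text \<open>Evaluating the formal expression of a locality relator yields the relator itself.\<close>

lemma (in novikov_algebra) ev_locality:
  assumes g: "\<And>b. g b \<in> carrier A"
  shows "ev g ((nabla ^^ k) (\<lambda>p q. fn_mul (fn_gen (a, p)) (fn_gen (b, q))) m n) =
    (\<Oplus>s\<in>{..k}. [((- 1) ^ s * int (k choose s))] \<cdot> (g (a, m + int k - int s) \<otimes> g (b, n + int s)))"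
  by (simp add: nablas_binomial ev_sum[OF g] ev_intmul[OF g] ev_simps[OF g])

text \<open>
  Generators are indexed by a whole type, so those outside \<open>X\<close> are sent to zero.  This preserves the uniform
  locality.
\<close>

definition total_gen ::
  "('k, 'm) ring_scheme \<Rightarrow> 'x set \<Rightarrow> ('x \<Rightarrow> 'x \<Rightarrow> nat) \<Rightarrow> 'x \<times> int \<Rightarrow> (('x \<times> int) magma \<Rightarrow> 'k) set set"
  where "total_gen R X N b = (if fst b \<in> X then coeff_gen R X N (fst b) (snd b) else \<zero>\<^bsub>coeff_novikov R X N\<^esub>)"

context cring
begin

context
  fixes X :: "'x set" and N :: "'x \<Rightarrow> 'x \<Rightarrow> nat"
begin

abbreviation (input) free_alg where "free_alg \<equiv> free_novikov R (mode_set X)"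

definition free_gen :: "'x \<times> int \<Rightarrow> (('x \<times> int) magma \<Rightarrow> 'a) set"
  where "free_gen b = (if fst b \<in> X then novikov_gen R (mode_set X) b else \<zero>\<^bsub>free_alg\<^esub>)"

definition locality_relator :: "'x \<Rightarrow> 'x \<Rightarrow> int \<Rightarrow> int \<Rightarrow> (('x \<times> int) magma \<Rightarrow> 'a) set"
  where "locality_relator a b n m = (\<Oplus>\<^bsub>free_alg\<^esub>s\<in>{..N a b}.
          [((-1) ^ s * int (N a b choose s))] \<cdot>\<^bsub>free_alg\<^esub>
            (novikov_gen R (mode_set X) (a, n - int s) \<otimes>\<^bsub>free_alg\<^esub> novikov_gen R (mode_set X) (b, m + int s)))"

lemma free_gen_closed: "free_gen b \<in> carrier free_alg"
proof -
  interpret F: novikov_algebra R free_alg by (rule free_novikov_algebra)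
  show ?thesis by (cases b) (simp add: free_gen_def novikov_gen_closed)
qed

lemma locality_relator_ev:
  assumes "a \<in> X" "b \<in> X"
  shows "locality_relator a b (m + int (N a b)) n = novikov_algebra.ev R free_alg free_gen
      ((nabla ^^ N a b) (\<lambda>p q. fn_mul (fn_gen (a, p)) (fn_gen (b, q))) m n)"
proof -
  interpret F: novikov_algebra R free_alg by (rule free_novikov_algebra)
  show ?thesis
    unfolding F.ev_locality[OF free_gen_closed] locality_relator_def using assms by (simp add: free_gen_def)
qed

lemma locality_ideal_hull:
  "locality_ideal R X N = alg_ideal R free_alg hull {locality_relator a b n m | a b n m. a \<in> X \<and> b \<in> X}"
  by (simp add: locality_ideal_def locality_relator_def Let_def)

lemma coeff_quotient: "alg_quotient R free_alg (locality_ideal R X N)"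
proof -
  interpret F: novikov_algebra R free_alg by (rule free_novikov_algebra)
  have "locality_relator a b n m \<in> carrier free_alg" if "a \<in> X" "b \<in> X" for a b n m
    using locality_relator_ev[OF that, of "n - int (N a b)" m] F.ev_simps(1)[OF free_gen_closed] by simp
  then show ?thesis
    by unfold_locales (auto simp: locality_ideal_hull intro!: F.alg_ideal_hull)
qed

lemma coeff_novikov_algebra: "novikov_algebra R (coeff_novikov R X N)"
proof -
  interpret F: novikov_algebra R free_alg by (rule free_novikov_algebra)
  interpret Q: alg_quotient R free_alg "locality_ideal R X N" by (rule coeff_quotient)
  interpret Qa: nonassoc_algebra R Q.quot by (rule Q.quot_algebra)
  show ?thesis unfolding coeff_novikov_def
  proof
    fix x y z assume "x \<in> carrier Q.quot" "y \<in> carrier Q.quot" "z \<in> carrier Q.quot"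
    then obtain u v w where c: "u \<in> carrier free_alg" "v \<in> carrier free_alg" "w \<in> carrier free_alg"
      and xyz: "x = Q.proj u" "y = Q.proj v" "z = Q.proj w" by (auto simp: Q.quot_carrier)
    show "x \<otimes>\<^bsub>Q.quot\<^esub> y \<otimes>\<^bsub>Q.quot\<^esub> z \<ominus>\<^bsub>Q.quot\<^esub> x \<otimes>\<^bsub>Q.quot\<^esub> (y \<otimes>\<^bsub>Q.quot\<^esub> z) =
        x \<otimes>\<^bsub>Q.quot\<^esub> z \<otimes>\<^bsub>Q.quot\<^esub> y \<ominus>\<^bsub>Q.quot\<^esub> x \<otimes>\<^bsub>Q.quot\<^esub> (z \<otimes>\<^bsub>Q.quot\<^esub> y)"
      using F.alg_right_symmetric[OF c] c by (simp add: xyz Q.quot_mult Q.quot_minus F.mult_closed)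
    show "x \<otimes>\<^bsub>Q.quot\<^esub> (y \<otimes>\<^bsub>Q.quot\<^esub> z) = y \<otimes>\<^bsub>Q.quot\<^esub> (x \<otimes>\<^bsub>Q.quot\<^esub> z)"
      using F.alg_left_commutative[OF c] c by (simp add: xyz Q.quot_mult F.mult_closed)
  qed
qed

lemma total_gen_proj: "total_gen R X N b = locality_ideal R X N +>\<^bsub>free_alg\<^esub> free_gen b"
proof -
  interpret Q: alg_quotient R free_alg "locality_ideal R X N" by (rule coeff_quotient)
  show ?thesis by (cases b) (simp add: total_gen_def coeff_gen_def free_gen_def coeff_novikov_def Q.quot_zero)
qed

lemma total_gen_closed: "total_gen R X N b \<in> carrier (coeff_novikov R X N)"
proof -
  interpret Q: alg_quotient R free_alg "locality_ideal R X N" by (rule coeff_quotient)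
  show ?thesis unfolding total_gen_proj coeff_novikov_def by (simp add: Q.quot_carrier free_gen_closed)
qed

text \<open>
  The relators provide locality with exponent \<open>N a b\<close>; applying the difference operator more often keeps the value zero.
\<close>

lemma coeff_local:
  assumes M: "\<And>a b. a \<in> X \<Longrightarrow> b \<in> X \<Longrightarrow> N a b \<le> M"
  shows "novikov_algebra.ev R (coeff_novikov R X N) (total_gen R X N)
    ((nabla ^^ M) (\<lambda>p q. fn_mul (fn_gen (a, p)) (fn_gen (b, q))) m n) = \<zero>\<^bsub>coeff_novikov R X N\<^esub>"
proof -
  interpret F: novikov_algebra R free_alg by (rule free_novikov_algebra)
  interpret Q: alg_quotient R free_alg "locality_ideal R X N" by (rule coeff_quotient)
  interpret C: novikov_algebra R "coeff_novikov R X N" by (rule coeff_novikov_algebra)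
  let ?H = "\<lambda>p q. fn_mul (fn_gen (a, p)) (fn_gen (b, q)) :: ('a, 'x \<times> int) free_nov"
  let ?J = "{t. C.ev (total_gen R X N) t = \<zero>\<^bsub>coeff_novikov R X N\<^esub>}"
  note ev = C.ev_simps[OF total_gen_closed]
  have J: "x - y \<in> ?J" if "x \<in> ?J" "y \<in> ?J" for x y
    using that by (simp add: ev(8) C.minus_eq C.r_neg)
  have "(nabla ^^ M) ?H m n \<in> ?J"
  proof (cases "a \<in> X \<and> b \<in> X")
    case True
    have 1: "(nabla ^^ N a b) ?H m n \<in> ?J" for m n
    proof -
      have "locality_relator a b (m + int (N a b)) n \<in> locality_ideal R X N"
        unfolding locality_ideal_hull using True by (intro subsetD[OF hull_subset]) blast
      moreover have "locality_relator a b (m + int (N a b)) n \<in> carrier free_alg"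
        using True locality_relator_ev F.ev_simps(1)[OF free_gen_closed] by simp
      ultimately have "Q.proj (locality_relator a b (m + int (N a b)) n) = Q.proj \<zero>\<^bsub>free_alg\<^esub>"
        by (subst Q.proj_eq) (auto simp only: F.minus_eq F.zero_closed intro: Q.I_facts)
      then have "Q.proj (F.ev free_gen ((nabla ^^ N a b) ?H m n)) = \<zero>\<^bsub>coeff_novikov R X N\<^esub>"
        using True locality_relator_ev by (simp add: coeff_novikov_def Q.quot_zero)
      then show ?thesis
        using Q.proj_ev[OF F.novikov_algebra_axioms coeff_novikov_algebra[unfolded coeff_novikov_def], of free_gen, OF free_gen_closed]
        by (simp add: coeff_novikov_def total_gen_proj[abs_def])
    qed
    have "(nabla ^^ M) ?H = (nabla ^^ (M - N a b)) ((nabla ^^ N a b) ?H)"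
      using M True by (simp add: nablas_add_exp)
    then show ?thesis using nablas_closed[where A = ?J and H = "(nabla ^^ N a b) ?H", OF J 1] by simp
  next
    case False
    have "?H p q \<in> ?J" for p q
    proof -
      have "C.ev (total_gen R X N) (?H p q) = total_gen R X N (a, p) \<otimes>\<^bsub>coeff_novikov R X N\<^esub> total_gen R X N (b, q)"
        by (simp add: ev)
      moreover have "total_gen R X N (a, p) = \<zero>\<^bsub>coeff_novikov R X N\<^esub> \<or> total_gen R X N (b, q) = \<zero>\<^bsub>coeff_novikov R X N\<^esub>"
        using False by (auto simp: total_gen_def)
      ultimately show ?thesis using C.mult_zero total_gen_closed by auto
    qed
    then show ?thesis using nablas_closed[where A = ?J and H = ?H, OF J] by blast
  qed
  then show ?thesis by simp
qed

end

end

section \<open>Linear maps\<close>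

locale linear_hom = M: Module.module R M + M': Module.module R M'
  for R :: "('k, 'm) ring_scheme" and M :: "('k, 'a, 'n) module_scheme" and M' :: "('k, 'b, 'p) module_scheme" +
  fixes f assumes linear: "linear_map R M M' f"
begin

lemma hom_closed: "x \<in> carrier M \<Longrightarrow> f x \<in> carrier M'"
  using linear by (auto simp: linear_map_def)

lemma hom_add: "x \<in> carrier M \<Longrightarrow> y \<in> carrier M \<Longrightarrow> f (x \<oplus>\<^bsub>M\<^esub> y) = f x \<oplus>\<^bsub>M'\<^esub> f y"
  using linear by (auto simp: linear_map_def)

lemma hom_smult: "k \<in> carrier R \<Longrightarrow> x \<in> carrier M \<Longrightarrow> f (k \<odot>\<^bsub>M\<^esub> x) = k \<odot>\<^bsub>M'\<^esub> f x"
  using linear by (auto simp: linear_map_def)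

lemma hom_zero: "f \<zero>\<^bsub>M\<^esub> = \<zero>\<^bsub>M'\<^esub>"
  using hom_smult[of "\<zero>\<^bsub>R\<^esub>" "\<zero>\<^bsub>M\<^esub>"] by (simp add: hom_closed)

lemma hom_neg: "x \<in> carrier M \<Longrightarrow> f (\<ominus>\<^bsub>M\<^esub> x) = \<ominus>\<^bsub>M'\<^esub> f x"
  by (rule M'.minus_equality[symmetric])
    (simp_all add: hom_closed M.l_neg hom_zero flip: hom_add)

lemma hom_minus: "x \<in> carrier M \<Longrightarrow> y \<in> carrier M \<Longrightarrow> f (x \<ominus>\<^bsub>M\<^esub> y) = f x \<ominus>\<^bsub>M'\<^esub> f y"
  by (simp add: M.minus_eq M'.minus_eq hom_add hom_neg)

lemma hom_finsum: "finite S \<Longrightarrow> (\<And>s. s \<in> S \<Longrightarrow> h s \<in> carrier M) \<Longrightarrow> f (finsum M h S) = finsum M' (\<lambda>s. f (h s)) S"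
proof (induction S rule: finite_induct)
  case (insert s S)
  then have "h \<in> S \<rightarrow> carrier M" by auto
  then show ?case using insert by (simp add: hom_add hom_closed Pi_def)
qed (simp add: hom_zero)

lemma hom_int_mult: "x \<in> carrier M \<Longrightarrow> f ([(k::int)] \<cdot>\<^bsub>M\<^esub> x) = [k] \<cdot>\<^bsub>M'\<^esub> f x"
proof (induction k rule: int_induct[where k = 0])
  case base
  then show ?case by (simp add: add_pow_def hom_zero)
next
  case (step1 i)
  then show ?case by (simp add: M.add.int_pow_mult M'.add.int_pow_mult hom_add hom_closed)
next
  case (step2 i)
  then show ?case
    by (simp add: M.add.int_pow_diff M'.add.int_pow_diff hom_closed hom_add hom_neg)
qed

end

section \<open>Coefficients of the products with two formal variables\<close>

context conformal_algebra
begin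

lemma lam_hom_left: "b \<in> carrier C \<Longrightarrow> linear_hom R C C (\<lambda>a. lam C a b n)"
  by (intro linear_hom.intro linear_hom_axioms.intro lam_linear_left) unfold_locales

lemma lam_hom_right: "a \<in> carrier C \<Longrightarrow> linear_hom R C C (\<lambda>b. lam C a b n)"
  by (intro linear_hom.intro linear_hom_axioms.intro lam_linear_right) unfold_locales

lemma der_hom: "linear_hom R C C (der C)"
  by (intro linear_hom.intro linear_hom_axioms.intro der_linear) unfold_locales

lemma lam_closed [simp]: "a \<in> carrier C \<Longrightarrow> b \<in> carrier C \<Longrightarrow> lam C a b n \<in> carrier C"
  using linear_hom.hom_closed[OF lam_hom_left] by blast

lemma lam_zero [simp]: "a \<in> carrier C \<Longrightarrow> lam C a \<zero>\<^bsub>C\<^esub> n = \<zero>\<^bsub>C\<^esub>" "b \<in> carrier C \<Longrightarrow> lam C \<zero>\<^bsub>C\<^esub> b n = \<zero>\<^bsub>C\<^esub>"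
  using linear_hom.hom_zero[OF lam_hom_left] linear_hom.hom_zero[OF lam_hom_right] by blast+

lemma der_closed [simp]: "a \<in> carrier C \<Longrightarrow> der C a \<in> carrier C"
  using linear_hom.hom_closed[OF der_hom] by blast

lemma der_zero [simp]: "der C \<zero>\<^bsub>C\<^esub> = \<zero>\<^bsub>C\<^esub>"
  by (rule linear_hom.hom_zero[OF der_hom])

lemma der_funpow_closed [simp]: "a \<in> carrier C \<Longrightarrow> (der C ^^ n) a \<in> carrier C"
  by (induction n) auto

lemma der_funpow_zero [simp]: "(der C ^^ n) \<zero>\<^bsub>C\<^esub> = \<zero>\<^bsub>C\<^esub>"
  by (induction n) auto

lemma neg_zero [simp]: "\<ominus>\<^bsub>C\<^esub> \<zero>\<^bsub>C\<^esub> = \<zero>\<^bsub>C\<^esub>"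
  by (rule minus_equality) simp_all

lemma int_mult_zero [simp]: "[(k::int)] \<cdot>\<^bsub>C\<^esub> \<zero>\<^bsub>C\<^esub> = \<zero>\<^bsub>C\<^esub>"
  using add.int_pow_one by simp

lemma int_mult_0 [simp]: "[(0::int)] \<cdot>\<^bsub>C\<^esub> x = \<zero>\<^bsub>C\<^esub>"
  by (simp add: add_pow_def)

lemma monom2_zero: "monom2 C k l \<zero>\<^bsub>C\<^esub> = (\<lambda>i j. \<zero>\<^bsub>C\<^esub>)"
  by (simp add: monom2_def)

lemma op_lam_funpow: "(op_lam C ^^ n) (monom2 C k l x) = monom2 C (k + n) l x"
proof (induction n)
  case (Suc n)
  have "op_lam C (monom2 C (k + n) l x) = monom2 C (k + Suc n) l x"
    by (auto simp: op_lam_def monom2_def fun_eq_iff split: nat.split)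
  then show ?case using Suc by simp
qed simp

lemma op_mu_funpow: "(op_mu C ^^ n) (monom2 C k l x) = monom2 C k (l + n) x"
proof (induction n)
  case (Suc n)
  have "op_mu C (monom2 C k (l + n) x) = monom2 C k (l + Suc n) x"
    by (auto simp: op_mu_def monom2_def fun_eq_iff split: nat.split)
  then show ?case using Suc by simp
qed simp

lemma op_lam_plus_mu_funpow:
  assumes x: "x \<in> carrier C"
  shows "(op_lam_plus_mu C ^^ n) (monom2 C k 0 x) i j =
    (if k \<le> i \<and> i - k + j = n then [(int (n choose j))] \<cdot>\<^bsub>C\<^esub> x else \<zero>\<^bsub>C\<^esub>)"
proof (induction n arbitrary: i j)
  case 0
  then show ?case using x by (auto simp: monom2_def)
next
  case (Suc n)
  have "(op_lam_plus_mu C ^^ Suc n) (monom2 C k 0 x) i j =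
      (case i of 0 \<Rightarrow> \<zero>\<^bsub>C\<^esub> | Suc i' \<Rightarrow> if k \<le> i' \<and> i' - k + j = n then [(int (n choose j))] \<cdot>\<^bsub>C\<^esub> x else \<zero>\<^bsub>C\<^esub>) \<oplus>\<^bsub>C\<^esub>
      (case j of 0 \<Rightarrow> \<zero>\<^bsub>C\<^esub> | Suc j' \<Rightarrow> if k \<le> i \<and> i - k + j' = n then [(int (n choose j'))] \<cdot>\<^bsub>C\<^esub> x else \<zero>\<^bsub>C\<^esub>)"
    by (simp add: op_lam_plus_mu_def op_lam_def op_mu_def Suc.IH cong: nat.case_cong)
  also have "\<dots> = (if k \<le> i \<and> i - k + j = Suc n then [(int (Suc n choose j))] \<cdot>\<^bsub>C\<^esub> x else \<zero>\<^bsub>C\<^esub>)"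
  proof (cases j)
    case 0
    then show ?thesis using x by (cases i) (auto simp: le_Suc_eq)
  next
    case j: (Suc j')
    show ?thesis
    proof (cases "k < i")
      case True
      then obtain i' where i: "i = Suc i'" "k \<le> i'" by (cases i) auto
      then show ?thesis using x j by (auto simp: Suc_diff_le add.int_pow_mult[symmetric] a_comm)
    next
      case False
      then have "k \<le> i \<longleftrightarrow> i = k" "\<And>i'. i = Suc i' \<Longrightarrow> \<not> k \<le> i'" by auto
      then show ?thesis using x j by (auto simp: binomial_eq_0 split: nat.split)
    qed
  qed
  finally show ?case .
qed

lemma op_neg_der_lam_funpow:
  assumes x: "x \<in> carrier C"
  shows "(op_neg_der_lam C ^^ n) (monom2 C k l x) i j =
    (if j = l \<and> k \<le> i \<and> i - k \<le> n then [((- 1) ^ n * int (n choose (i - k)))] \<cdot>\<^bsub>C\<^esub> (der C ^^ (n - (i - k))) x else \<zero>\<^bsub>C\<^esub>)"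
proof (induction n arbitrary: i j)
  case 0
  then show ?case using x by (auto simp: monom2_def)
next
  case (Suc n)
  interpret d: linear_hom R C C "der C" by (rule der_hom)
  let ?t = "\<lambda>n d. [((- 1) ^ n * int (n choose d))] \<cdot>\<^bsub>C\<^esub> (der C ^^ (n - d)) x"
  have "(op_neg_der_lam C ^^ Suc n) (monom2 C k l x) i j =
      \<ominus>\<^bsub>C\<^esub> der C (if j = l \<and> k \<le> i \<and> i - k \<le> n then ?t n (i - k) else \<zero>\<^bsub>C\<^esub>) \<ominus>\<^bsub>C\<^esub>
      (case i of 0 \<Rightarrow> \<zero>\<^bsub>C\<^esub> | Suc i' \<Rightarrow> if j = l \<and> k \<le> i' \<and> i' - k \<le> n then ?t n (i' - k) else \<zero>\<^bsub>C\<^esub>)"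
    by (simp add: op_neg_der_lam_def op_lam_def Suc.IH cong: nat.case_cong)
  also have "\<dots> = (if j = l \<and> k \<le> i \<and> i - k \<le> Suc n then ?t (Suc n) (i - k) else \<zero>\<^bsub>C\<^esub>)"
  proof (cases "j = l \<and> k \<le> i")
    case False
    then have "\<not> (j = l \<and> k \<le> i')" if "i = Suc i'" for i' using that by auto
    then show ?thesis using False by (auto simp: minus_eq split: nat.split)
  next
    case True
    then obtain d where i: "i = k + d" and j: "j = l" using le_Suc_ex by blast
    have neg: "\<ominus>\<^bsub>C\<^esub> ([a] \<cdot>\<^bsub>C\<^esub> y) = [(- a)] \<cdot>\<^bsub>C\<^esub> y" if "y \<in> carrier C" for y and a :: int
      using that by (simp add: add.int_pow_neg)
    have first: "\<ominus>\<^bsub>C\<^esub> der C (if d \<le> n then ?t n d else \<zero>\<^bsub>C\<^esub>) =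
        [((- 1) ^ Suc n * int (n choose d))] \<cdot>\<^bsub>C\<^esub> (der C ^^ (Suc n - d)) x"
      using x by (auto simp: d.hom_int_mult neg Suc_diff_le binomial_eq_0 not_le)
    show ?thesis
    proof (cases d)
      case 0
      have "(case i of 0 \<Rightarrow> \<zero>\<^bsub>C\<^esub> | Suc i' \<Rightarrow> if j = l \<and> k \<le> i' \<and> i' - k \<le> n then ?t n (i' - k) else \<zero>\<^bsub>C\<^esub>) = \<zero>\<^bsub>C\<^esub>"
        using i 0 by (auto split: nat.split)
      then show ?thesis using first i j 0 x by (simp add: minus_eq)
    next
      case (Suc d')
      have y: "der C ^^ (n - d') = der C ^^ (Suc n - d)" using Suc by simp
      have "\<ominus>\<^bsub>C\<^esub> (if d' \<le> n then ?t n d' else \<zero>\<^bsub>C\<^esub>) = [((- 1) ^ Suc n * int (n choose d'))] \<cdot>\<^bsub>C\<^esub> (der C ^^ (n - d')) x"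
        using x by (auto simp: neg binomial_eq_0 not_le)
      then have "\<ominus>\<^bsub>C\<^esub> der C (if d \<le> n then ?t n d else \<zero>\<^bsub>C\<^esub>) \<oplus>\<^bsub>C\<^esub> \<ominus>\<^bsub>C\<^esub> (if d' \<le> n then ?t n d' else \<zero>\<^bsub>C\<^esub>) =
          [((- 1) ^ Suc n * int (n choose d))] \<cdot>\<^bsub>C\<^esub> (der C ^^ (Suc n - d)) x \<oplus>\<^bsub>C\<^esub>
          [((- 1) ^ Suc n * int (n choose d'))] \<cdot>\<^bsub>C\<^esub> (der C ^^ (Suc n - d)) x"
        by (simp only: first y)
      also have "\<dots> = [((- 1) ^ Suc n * int (n choose d) + (- 1) ^ Suc n * int (n choose d'))] \<cdot>\<^bsub>C\<^esub> (der C ^^ (Suc n - d)) x"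
        by (rule add.int_pow_mult[symmetric]) (use x in simp)
      also have "(- 1) ^ Suc n * int (n choose d) + (- 1) ^ Suc n * int (n choose d') = (- 1) ^ Suc n * int (Suc n choose d)"
        using Suc by (simp add: algebra_simps)
      also have "[((- 1) ^ Suc n * int (Suc n choose d))] \<cdot>\<^bsub>C\<^esub> (der C ^^ (Suc n - d)) x = (if d \<le> Suc n then ?t (Suc n) d else \<zero>\<^bsub>C\<^esub>)"
        by (auto simp: binomial_eq_0 not_le)
      finally have sum: "\<ominus>\<^bsub>C\<^esub> der C (if d \<le> n then ?t n d else \<zero>\<^bsub>C\<^esub>) \<ominus>\<^bsub>C\<^esub> (if d' \<le> n then ?t n d' else \<zero>\<^bsub>C\<^esub>) =
          (if d \<le> Suc n then ?t (Suc n) d else \<zero>\<^bsub>C\<^esub>)"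
        by (simp only: minus_eq)
      have "(case i of 0 \<Rightarrow> \<zero>\<^bsub>C\<^esub> | Suc i' \<Rightarrow> if j = l \<and> k \<le> i' \<and> i' - k \<le> n then ?t n (i' - k) else \<zero>\<^bsub>C\<^esub>) =
          (if d' \<le> n then ?t n d' else \<zero>\<^bsub>C\<^esub>)"
        using i j Suc by simp
      moreover have "(j = l \<and> k \<le> i \<and> i - k \<le> m) = (d \<le> m)" "i - k = d" for m using i j by auto
      ultimately show ?thesis using sum by (simp only: cong: if_cong)
    qed
  qed
  finally show ?case .
qed

lemma op_neg_der_mu_swap: "(op_neg_der_mu C ^^ n) p i j = (op_neg_der_lam C ^^ n) (\<lambda>i j. p j i) j i"
  by (induction n arbitrary: i j) (simp_all add: op_neg_der_mu_def op_neg_der_lam_def op_lam_def op_mu_def cong: nat.case_cong)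

lemma op_neg_der_mu_funpow:
  assumes x: "x \<in> carrier C"
  shows "(op_neg_der_mu C ^^ n) (monom2 C k l x) i j =
    (if i = k \<and> l \<le> j \<and> j - l \<le> n then [((- 1) ^ n * int (n choose (j - l)))] \<cdot>\<^bsub>C\<^esub> (der C ^^ (n - (j - l))) x else \<zero>\<^bsub>C\<^esub>)"
proof -
  have "(\<lambda>i j. monom2 C k l x j i) = monom2 C l k x" by (intro ext) (auto simp: monom2_def)
  then show ?thesis by (simp add: op_neg_der_mu_swap op_neg_der_lam_funpow[OF x])
qed

text \<open>
  Replaces the support-dependent index set of the substitution products by a convenient finite one.
\<close>

lemma finsum_agree:
  assumes "finite S" "finite B" "\<And>e. F e \<in> carrier C" "\<And>e. e \<in> S - B \<Longrightarrow> F e = \<zero>\<^bsub>C\<^esub>" "\<And>e. e \<in> B - S \<Longrightarrow> F e = \<zero>\<^bsub>C\<^esub>"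
  shows "finsum C F S = finsum C F B"
proof -
  have "finsum C F (S \<inter> B) = finsum C F S"
    by (rule add.finprod_mono_neutral_cong_left) (use assms in auto)
  moreover have "finsum C F (S \<inter> B) = finsum C F B"
    by (rule add.finprod_mono_neutral_cong_left) (use assms in auto)
  ultimately show ?thesis by simp
qed

lemma subst_prod_finsum:
  assumes p: "\<And>k r. p k r \<in> carrier C" "finite {(k, r). p k r \<noteq> \<zero>\<^bsub>C\<^esub>}"
    and q: "\<And>s t. q s t \<in> carrier C" "finite {(s, t). q s t \<noteq> \<zero>\<^bsub>C\<^esub>}"
    and T: "\<And>n k l x i j. x \<in> carrier C \<Longrightarrow> (T ^^ n) (monom2 C k l x) i j \<in> carrier C"
      "\<And>n k l i j. (T ^^ n) (monom2 C k l \<zero>\<^bsub>C\<^esub>) i j = \<zero>\<^bsub>C\<^esub>"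
    and B: "finite B" "\<And>k r s t n. (k, r, s, t, n) \<notin> B \<Longrightarrow> (T ^^ n) (monom2 C (k + s) (r + t) (lam C (p k r) (q s t) n)) i j = \<zero>\<^bsub>C\<^esub>"
  shows "subst_prod C T p q i j = finsum C (\<lambda>(k, r, s, t, n). (T ^^ n) (monom2 C (k + s) (r + t) (lam C (p k r) (q s t) n)) i j) B"
proof -
  let ?S = "{(k, r, s, t, n). lam C (p k r) (q s t) n \<noteq> \<zero>\<^bsub>C\<^esub>}"
  let ?P = "{(k, r). p k r \<noteq> \<zero>\<^bsub>C\<^esub>}" and ?Q = "{(s, t). q s t \<noteq> \<zero>\<^bsub>C\<^esub>}"
  let ?U = "\<lambda>((k, r), (s, t)). (\<lambda>n. (k, r, s, t, n)) ` {n. lam C (p k r) (q s t) n \<noteq> \<zero>\<^bsub>C\<^esub>}"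
  have "?S \<subseteq> (\<Union>x\<in>?P \<times> ?Q. ?U x)"
  proof safe
    fix k r s t n :: nat assume nz: "lam C (p k r) (q s t) n \<noteq> \<zero>\<^bsub>C\<^esub>"
    have "p k r \<noteq> \<zero>\<^bsub>C\<^esub>" using nz lam_zero(2)[OF q(1), of s t n] by metis
    moreover have "q s t \<noteq> \<zero>\<^bsub>C\<^esub>" using nz lam_zero(1)[OF p(1), of k r n] by metis
    ultimately have "((k, r), (s, t)) \<in> ?P \<times> ?Q" by simp
    moreover have "(k, r, s, t, n) \<in> ?U ((k, r), (s, t))" using nz by simp
    ultimately show "(k, r, s, t, n) \<in> (\<Union>x\<in>?P \<times> ?Q. ?U x)" by (rule UN_I)
  qed
  moreover have "finite (\<Union>x\<in>?P \<times> ?Q. ?U x)"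
    using p q lam_polynomial by (intro finite_UN_I finite_cartesian_product) (auto split: prod.split)
  ultimately have "finite ?S" by (rule finite_subset)
  then show ?thesis unfolding subst_prod_def
  proof (rule finsum_agree[OF _ B(1)])
    fix e :: "nat \<times> nat \<times> nat \<times> nat \<times> nat"
    obtain k r s t n where e: "e = (k, r, s, t, n)" by (metis prod.collapse)
    show "(case e of (k, r, s, t, n) \<Rightarrow> (T ^^ n) (monom2 C (k + s) (r + t) (lam C (p k r) (q s t) n)) i j) \<in> carrier C"
      unfolding e prod.case by (intro T(1) lam_closed p q)
    show "(case e of (k, r, s, t, n) \<Rightarrow> (T ^^ n) (monom2 C (k + s) (r + t) (lam C (p k r) (q s t) n)) i j) = \<zero>\<^bsub>C\<^esub>"
      if "e \<in> ?S - B" using that B(2) e by simp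
    show "(case e of (k, r, s, t, n) \<Rightarrow> (T ^^ n) (monom2 C (k + s) (r + t) (lam C (p k r) (q s t) n)) i j) = \<zero>\<^bsub>C\<^esub>"
      if "e \<in> B - ?S" using that e by (simp add: T(2))
  qed
qed

text \<open>
  Polynomials in \<open>\<lambda>\<close> alone and in \<open>\<mu>\<close> alone, which are the only arguments that occur in the identities.
\<close>

definition in_lam :: "(nat \<Rightarrow> 'a) \<Rightarrow> nat \<Rightarrow> nat \<Rightarrow> 'a"
  where "in_lam g = (\<lambda>i j. if j = 0 then g i else \<zero>\<^bsub>C\<^esub>)"

definition in_mu :: "(nat \<Rightarrow> 'a) \<Rightarrow> nat \<Rightarrow> nat \<Rightarrow> 'a"
  where "in_mu g = (\<lambda>i j. if i = 0 then g j else \<zero>\<^bsub>C\<^esub>)"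

definition at_zero :: "'a \<Rightarrow> nat \<Rightarrow> 'a"
  where "at_zero x = (\<lambda>i. if i = 0 then x else \<zero>\<^bsub>C\<^esub>)"

lemma const2_in_lam: "const2 C x = in_lam (at_zero x)"
  by (intro ext) (auto simp: monom2_def in_lam_def at_zero_def)

lemma const2_in_mu: "const2 C x = in_mu (at_zero x)"
  by (intro ext) (auto simp: monom2_def in_mu_def at_zero_def)

definition poly_coeffs :: "(nat \<Rightarrow> 'a) \<Rightarrow> bool"
  where "poly_coeffs g \<longleftrightarrow> (\<forall>i. g i \<in> carrier C) \<and> finite {i. g i \<noteq> \<zero>\<^bsub>C\<^esub>}"

lemma poly_coeffs_at_zero: "x \<in> carrier C \<Longrightarrow> poly_coeffs (at_zero x)"
proof -
  have "{i. at_zero x i \<noteq> \<zero>\<^bsub>C\<^esub>} \<subseteq> {0}" by (auto simp: at_zero_def)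
  then have "finite {i. at_zero x i \<noteq> \<zero>\<^bsub>C\<^esub>}" by (rule finite_subset) simp
  then show "x \<in> carrier C \<Longrightarrow> ?thesis" by (simp add: poly_coeffs_def at_zero_def)
qed

lemma poly_coeffs_lam: "a \<in> carrier C \<Longrightarrow> b \<in> carrier C \<Longrightarrow> poly_coeffs (lam C a b)"
  by (simp add: poly_coeffs_def lam_polynomial)

lemma in_lam_props:
  assumes "poly_coeffs g"
  shows "in_lam g i j \<in> carrier C" "finite {(i, j). in_lam g i j \<noteq> \<zero>\<^bsub>C\<^esub>}"
proof -
  show "in_lam g i j \<in> carrier C" using assms by (simp add: in_lam_def poly_coeffs_def)
  have "{(i, j). in_lam g i j \<noteq> \<zero>\<^bsub>C\<^esub>} \<subseteq> {i. g i \<noteq> \<zero>\<^bsub>C\<^esub>} \<times> {0}" by (auto simp: in_lam_def split: if_splits)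
  then show "finite {(i, j). in_lam g i j \<noteq> \<zero>\<^bsub>C\<^esub>}"
    by (rule finite_subset) (use assms in \<open>simp add: poly_coeffs_def\<close>)
qed

lemma in_mu_props:
  assumes "poly_coeffs g"
  shows "in_mu g i j \<in> carrier C" "finite {(i, j). in_mu g i j \<noteq> \<zero>\<^bsub>C\<^esub>}"
proof -
  show "in_mu g i j \<in> carrier C" using assms by (simp add: in_mu_def poly_coeffs_def)
  have "{(i, j). in_mu g i j \<noteq> \<zero>\<^bsub>C\<^esub>} \<subseteq> {0} \<times> {i. g i \<noteq> \<zero>\<^bsub>C\<^esub>}" by (auto simp: in_mu_def split: if_splits)
  then show "finite {(i, j). in_mu g i j \<noteq> \<zero>\<^bsub>C\<^esub>}"
    by (rule finite_subset) (use assms in \<open>simp add: poly_coeffs_def\<close>)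
qed

lemma funpow_monom2_zero:
  "(op_lam C ^^ n) (monom2 C k l \<zero>\<^bsub>C\<^esub>) i j = \<zero>\<^bsub>C\<^esub>" "(op_mu C ^^ n) (monom2 C k l \<zero>\<^bsub>C\<^esub>) i j = \<zero>\<^bsub>C\<^esub>"
  by (simp_all only: op_lam_funpow op_mu_funpow) (simp_all add: monom2_def)

lemma op_lam_closed: "x \<in> carrier C \<Longrightarrow> (op_lam C ^^ n) (monom2 C k l x) i j \<in> carrier C"
  "x \<in> carrier C \<Longrightarrow> (op_mu C ^^ n) (monom2 C k l x) i j \<in> carrier C"
  unfolding op_lam_funpow op_mu_funpow by (simp_all add: monom2_def)

lemma op_lam_plus_mu_closed:
  "x \<in> carrier C \<Longrightarrow> (op_lam_plus_mu C ^^ n) (monom2 C k l x) i j \<in> carrier C"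
proof (induction n arbitrary: i j)
  case (Suc n)
  then show ?case by (auto simp: op_lam_plus_mu_def op_lam_def op_mu_def split: nat.split)
qed (simp add: monom2_def)

lemma op_lam_plus_mu_zero: "(op_lam_plus_mu C ^^ n) (monom2 C k l \<zero>\<^bsub>C\<^esub>) i j = \<zero>\<^bsub>C\<^esub>"
  by (induction n arbitrary: i j) (auto simp: monom2_zero op_lam_plus_mu_def op_lam_def op_mu_def split: nat.split)

lemma subst_lam:
  assumes a: "a \<in> carrier C" and g: "poly_coeffs g"
  shows "subst_prod C (op_lam C) (const2 C a) (in_mu g) i j = lam C a (g j) i"
proof -
  note p = in_lam_props[OF poly_coeffs_at_zero[OF a], folded const2_in_lam] and q = in_mu_props[OF g]
  have "subst_prod C (op_lam C) (const2 C a) (in_mu g) i j = finsum C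
      (\<lambda>(k, r, s, t, n). (op_lam C ^^ n) (monom2 C (k + s) (r + t) (lam C (const2 C a k r) (in_mu g s t) n)) i j) {(0, 0, 0, j, i)}"
  proof (rule subst_prod_finsum[OF p q op_lam_closed(1) funpow_monom2_zero(1)])
    fix k r s t n :: nat assume "(k, r, s, t, n) \<notin> {(0, 0, 0, j, i)}"
    then show "(op_lam C ^^ n) (monom2 C (k + s) (r + t) (lam C (const2 C a k r) (in_mu g s t) n)) i j = \<zero>\<^bsub>C\<^esub>"
      unfolding op_lam_funpow using a g by (auto simp: monom2_def in_mu_def poly_coeffs_def)
  qed simp_all
  also have "\<dots> = lam C a (g j) i"
  proof -
    have "lam C (const2 C a 0 0) (in_mu g 0 j) i = lam C a (g j) i"
      by (simp add: monom2_def in_mu_def)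
    moreover have "lam C a (g j) i \<in> carrier C" using a g by (simp add: poly_coeffs_def)
    ultimately show ?thesis by (simp add: op_lam_funpow monom2_def[of C _ _ "lam C a _ _"])
  qed
  finally show ?thesis .
qed

lemma subst_mu:
  assumes a: "a \<in> carrier C" and g: "poly_coeffs g"
  shows "subst_prod C (op_mu C) (const2 C a) (in_lam g) i j = lam C a (g i) j"
proof -
  note p = in_lam_props[OF poly_coeffs_at_zero[OF a], folded const2_in_lam] and q = in_lam_props[OF g]
  have "subst_prod C (op_mu C) (const2 C a) (in_lam g) i j = finsum C
      (\<lambda>(k, r, s, t, n). (op_mu C ^^ n) (monom2 C (k + s) (r + t) (lam C (const2 C a k r) (in_lam g s t) n)) i j) {(0, 0, i, 0, j)}"
  proof (rule subst_prod_finsum[OF p q op_lam_closed(2) funpow_monom2_zero(2)])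
    fix k r s t n :: nat assume "(k, r, s, t, n) \<notin> {(0, 0, i, 0, j)}"
    then show "(op_mu C ^^ n) (monom2 C (k + s) (r + t) (lam C (const2 C a k r) (in_lam g s t) n)) i j = \<zero>\<^bsub>C\<^esub>"
      unfolding op_mu_funpow using a g by (auto simp: monom2_def in_lam_def poly_coeffs_def)
  qed simp_all
  also have "\<dots> = lam C a (g i) j"
  proof -
    have "lam C (const2 C a 0 0) (in_lam g i 0) j = lam C a (g i) j"
      by (simp add: monom2_def in_lam_def)
    moreover have "lam C a (g i) j \<in> carrier C" using a g by (simp add: poly_coeffs_def)
    ultimately show ?thesis by (simp add: op_mu_funpow monom2_def[of C _ _ "lam C a _ _"])
  qed
  finally show ?thesis .
qed

lemma subst_lam_const:
  "a \<in> carrier C \<Longrightarrow> b \<in> carrier C \<Longrightarrow> subst_prod C (op_lam C) (const2 C a) (const2 C b) = in_lam (lam C a b)"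
  by (intro ext) (simp add: const2_in_mu[of b] subst_lam poly_coeffs_at_zero in_lam_def, simp add: at_zero_def)

lemma subst_mu_const:
  "a \<in> carrier C \<Longrightarrow> b \<in> carrier C \<Longrightarrow> subst_prod C (op_mu C) (const2 C a) (const2 C b) = in_mu (lam C a b)"
  by (intro ext) (simp add: const2_in_lam[of b] subst_mu poly_coeffs_at_zero in_mu_def, simp add: at_zero_def)

lemma subst_lam_plus_mu:
  assumes g: "poly_coeffs g" and c: "c \<in> carrier C"
  shows "subst_prod C (op_lam_plus_mu C) (in_lam g) (const2 C c) i j =
    (\<Oplus>\<^bsub>C\<^esub>k\<in>{..i}. [(int ((i - k + j) choose j))] \<cdot>\<^bsub>C\<^esub> lam C (g k) c (i - k + j))"
proof -
  note p = in_lam_props[OF g] and q = in_lam_props[OF poly_coeffs_at_zero[OF c], folded const2_in_lam]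
  let ?e = "\<lambda>k. (k, 0, 0, 0, i - k + j)"
  let ?F = "\<lambda>(k, r, s, t, n). (op_lam_plus_mu C ^^ n) (monom2 C (k + s) (r + t) (lam C (in_lam g k r) (const2 C c s t) n)) i j"
  have gc: "g k \<in> carrier C" for k using g by (simp add: poly_coeffs_def)
  have "subst_prod C (op_lam_plus_mu C) (in_lam g) (const2 C c) i j = finsum C ?F (?e ` {..i})"
  proof (rule subst_prod_finsum[OF p q op_lam_plus_mu_closed op_lam_plus_mu_zero])
    fix k r s t n :: nat assume e: "(k, r, s, t, n) \<notin> ?e ` {..i}"
    show "(op_lam_plus_mu C ^^ n) (monom2 C (k + s) (r + t) (lam C (in_lam g k r) (const2 C c s t) n)) i j = \<zero>\<^bsub>C\<^esub>"
    proof (cases "r = 0 \<and> s = 0 \<and> t = 0")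
      case True
      then have "\<not> (k \<le> i \<and> i - k + j = n)" using e by auto
      then show ?thesis using True c gc
        by (simp only: op_lam_plus_mu_funpow[OF lam_closed[OF gc c]] in_lam_def monom2_def[of C 0 0 c] add_0_right simp_thms if_True if_False)
    next
      case False
      then have "lam C (in_lam g k r) (const2 C c s t) n = \<zero>\<^bsub>C\<^esub>" using c gc by (auto simp: in_lam_def monom2_def)
      then show ?thesis by (simp add: op_lam_plus_mu_zero)
    qed
  qed simp_all
  also have "\<dots> = (\<Oplus>\<^bsub>C\<^esub>k\<in>{..i}. ?F (?e k))"
    by (rule finsum_reindex) (auto simp: inj_on_def intro!: op_lam_plus_mu_closed lam_closed p q)
  also have "\<dots> = (\<Oplus>\<^bsub>C\<^esub>k\<in>{..i}. [(int ((i - k + j) choose j))] \<cdot>\<^bsub>C\<^esub> lam C (g k) c (i - k + j))"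
    by (rule finsum_cong') (use c gc in \<open>auto simp: op_lam_plus_mu_funpow in_lam_def monom2_def[of C 0 0 c]\<close>)
  finally show ?thesis .
qed

lemma op_neg_der_closed:
  "x \<in> carrier C \<Longrightarrow> (op_neg_der_lam C ^^ n) (monom2 C k l x) i j \<in> carrier C"
  "x \<in> carrier C \<Longrightarrow> (op_neg_der_mu C ^^ n) (monom2 C k l x) i j \<in> carrier C"
  by (simp_all add: op_neg_der_lam_funpow op_neg_der_mu_funpow)

lemma op_neg_der_zero:
  "(op_neg_der_lam C ^^ n) (monom2 C k l \<zero>\<^bsub>C\<^esub>) i j = \<zero>\<^bsub>C\<^esub>" "(op_neg_der_mu C ^^ n) (monom2 C k l \<zero>\<^bsub>C\<^esub>) i j = \<zero>\<^bsub>C\<^esub>"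
  by (simp_all add: op_neg_der_lam_funpow op_neg_der_mu_funpow)

text \<open>
  The coefficient of \<open>\<lambda>\<^sup>j\<close> in the product of \<open>a\<close> and \<open>b\<close> with \<open>-\<partial> - \<lambda>\<close> substituted, when the product has
  degree at most \<open>m\<close>.
\<close>

definition skew_sum :: "nat \<Rightarrow> 'a \<Rightarrow> 'a \<Rightarrow> nat \<Rightarrow> 'a"
  where "skew_sum m a b j = (\<Oplus>\<^bsub>C\<^esub>n\<in>{j..m}. [((- 1) ^ n * int (n choose j))] \<cdot>\<^bsub>C\<^esub> (der C ^^ (n - j)) (lam C a b n))"

lemma skew_sum_closed: "a \<in> carrier C \<Longrightarrow> b \<in> carrier C \<Longrightarrow> skew_sum m a b j \<in> carrier C"
  unfolding skew_sum_def by (rule finsum_closed) auto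

lemma poly_coeffs_skew_sum: "a \<in> carrier C \<Longrightarrow> b \<in> carrier C \<Longrightarrow> poly_coeffs (skew_sum m a b)"
proof -
  have "{j. skew_sum m a b j \<noteq> \<zero>\<^bsub>C\<^esub>} \<subseteq> {..m}"
  proof (rule subsetI, rule ccontr)
    fix j assume "j \<in> {j. skew_sum m a b j \<noteq> \<zero>\<^bsub>C\<^esub>}" "j \<notin> {..m}"
    then show False by (simp add: skew_sum_def)
  qed
  then have "finite {j. skew_sum m a b j \<noteq> \<zero>\<^bsub>C\<^esub>}" by (rule finite_subset) simp
  then show "a \<in> carrier C \<Longrightarrow> b \<in> carrier C \<Longrightarrow> ?thesis" by (simp add: poly_coeffs_def skew_sum_closed)
qed

lemma subst_neg_der_mu:
  assumes g: "poly_coeffs g" and c: "c \<in> carrier C" and m: "\<And>n. m < n \<Longrightarrow> lam C (g i) c n = \<zero>\<^bsub>C\<^esub>"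
  shows "subst_prod C (op_neg_der_mu C) (in_lam g) (const2 C c) i j = skew_sum m (g i) c j"
proof -
  note p = in_lam_props[OF g] and q = in_lam_props[OF poly_coeffs_at_zero[OF c], folded const2_in_lam]
  let ?e = "\<lambda>n. (i, 0, 0, 0, n)"
  let ?F = "\<lambda>(k, r, s, t, n). (op_neg_der_mu C ^^ n) (monom2 C (k + s) (r + t) (lam C (in_lam g k r) (const2 C c s t) n)) i j"
  have gc: "g k \<in> carrier C" for k using g by (simp add: poly_coeffs_def)
  have "subst_prod C (op_neg_der_mu C) (in_lam g) (const2 C c) i j = finsum C ?F (?e ` {j..m})"
  proof (rule subst_prod_finsum[OF p q op_neg_der_closed(2) op_neg_der_zero(2)])
    fix k r s t n :: nat assume e: "(k, r, s, t, n) \<notin> ?e ` {j..m}"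
    show "(op_neg_der_mu C ^^ n) (monom2 C (k + s) (r + t) (lam C (in_lam g k r) (const2 C c s t) n)) i j = \<zero>\<^bsub>C\<^esub>"
    proof (cases "r = 0 \<and> s = 0 \<and> t = 0")
      case True
      then have "k \<noteq> i \<or> \<not> j \<le> n \<or> m < n" using e by (auto simp: image_iff)
      then show ?thesis using True c gc m
        by (auto simp: op_neg_der_mu_funpow in_lam_def monom2_def[of C 0 0 c])
    next
      case False
      then have "lam C (in_lam g k r) (const2 C c s t) n = \<zero>\<^bsub>C\<^esub>" using c gc by (auto simp: in_lam_def monom2_def)
      then show ?thesis by (simp add: op_neg_der_zero)
    qed
  qed simp_all
  also have "\<dots> = (\<Oplus>\<^bsub>C\<^esub>n\<in>{j..m}. ?F (?e n))"
    by (rule finsum_reindex) (auto simp: inj_on_def intro!: op_neg_der_closed lam_closed p q)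
  also have "\<dots> = skew_sum m (g i) c j" unfolding skew_sum_def
    by (rule finsum_cong') (use c gc in \<open>auto simp: op_neg_der_mu_funpow in_lam_def monom2_def[of C 0 0 c]\<close>)
  finally show ?thesis .
qed

lemma subst_neg_der_mu_const:
  assumes a: "a \<in> carrier C" and b: "b \<in> carrier C" and m: "\<And>n. m < n \<Longrightarrow> lam C a b n = \<zero>\<^bsub>C\<^esub>"
  shows "subst_prod C (op_neg_der_mu C) (const2 C a) (const2 C b) = in_mu (skew_sum m a b)"
proof (intro ext)
  fix i j
  have z: "skew_sum m \<zero>\<^bsub>C\<^esub> b j = \<zero>\<^bsub>C\<^esub>" using b by (simp add: skew_sum_def)
  have "subst_prod C (op_neg_der_mu C) (const2 C a) (const2 C b) i j = skew_sum m (at_zero a i) b j"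
    unfolding const2_in_lam[of a]
    by (rule subst_neg_der_mu) (use a b m in \<open>simp_all add: poly_coeffs_at_zero, simp add: at_zero_def\<close>)
  then show "subst_prod C (op_neg_der_mu C) (const2 C a) (const2 C b) i j = in_mu (skew_sum m a b) i j"
    using z by (simp add: in_mu_def at_zero_def)
qed

lemma subst_neg_der_lam_const:
  assumes a: "a \<in> carrier C" and b: "b \<in> carrier C" and m: "\<And>n. m < n \<Longrightarrow> lam C a b n = \<zero>\<^bsub>C\<^esub>"
  shows "subst_prod C (op_neg_der_lam C) (const2 C a) (const2 C b) = in_lam (skew_sum m a b)"
proof (intro ext)
  fix i j
  note p = in_lam_props[OF poly_coeffs_at_zero[OF a], folded const2_in_lam]
    and q = in_lam_props[OF poly_coeffs_at_zero[OF b], folded const2_in_lam]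
  let ?e = "\<lambda>n. (0, 0, 0, 0, n)"
  let ?F = "\<lambda>(k, r, s, t, n). (op_neg_der_lam C ^^ n) (monom2 C (k + s) (r + t) (lam C (const2 C a k r) (const2 C b s t) n)) i j"
  have "subst_prod C (op_neg_der_lam C) (const2 C a) (const2 C b) i j = finsum C ?F (?e ` {i..m})"
  proof (rule subst_prod_finsum[OF p q op_neg_der_closed(1) op_neg_der_zero(1)])
    fix k r s t n :: nat assume e: "(k, r, s, t, n) \<notin> ?e ` {i..m}"
    show "(op_neg_der_lam C ^^ n) (monom2 C (k + s) (r + t) (lam C (const2 C a k r) (const2 C b s t) n)) i j = \<zero>\<^bsub>C\<^esub>"
    proof (cases "k = 0 \<and> r = 0 \<and> s = 0 \<and> t = 0")
      case True
      then have "\<not> i \<le> n \<or> m < n" using e by (auto simp: image_iff)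
      then show ?thesis using True a b m
        by (auto simp: op_neg_der_lam_funpow monom2_def[of C 0 0 a] monom2_def[of C 0 0 b])
    next
      case False
      then have "lam C (const2 C a k r) (const2 C b s t) n = \<zero>\<^bsub>C\<^esub>" using a b by (auto simp: monom2_def)
      then show ?thesis by (simp add: op_neg_der_zero)
    qed
  qed simp_all
  also have "\<dots> = (\<Oplus>\<^bsub>C\<^esub>n\<in>{i..m}. ?F (?e n))"
    by (rule finsum_reindex) (auto simp: inj_on_def intro!: op_neg_der_closed lam_closed p q)
  also have "\<dots> = in_lam (skew_sum m a b) i j"
  proof (cases "j = 0")
    case True
    have "(\<Oplus>\<^bsub>C\<^esub>n\<in>{i..m}. ?F (?e n)) = skew_sum m a b i" unfolding skew_sum_def
      by (rule finsum_cong') (use a b True in \<open>auto simp: op_neg_der_lam_funpow monom2_def[of C 0 0 a] monom2_def[of C 0 0 b]\<close>)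
    then show ?thesis using True by (simp add: in_lam_def)
  next
    case False
    have "(\<Oplus>\<^bsub>C\<^esub>n\<in>{i..m}. ?F (?e n)) = (\<Oplus>\<^bsub>C\<^esub>n\<in>{i..m}. \<zero>\<^bsub>C\<^esub>)"
      by (rule finsum_cong') (use a b False in \<open>auto simp: op_neg_der_lam_funpow monom2_def[of C 0 0 a] monom2_def[of C 0 0 b]\<close>)
    then show ?thesis using False by (simp add: in_lam_def)
  qed
  finally show "subst_prod C (op_neg_der_lam C) (const2 C a) (const2 C b) i j = in_lam (skew_sum m a b) i j" .
qed

lemma lam_bound:
  assumes "a \<in> carrier C" "b \<in> carrier C"
  obtains m where "\<And>n. m < n \<Longrightarrow> lam C a b n = \<zero>\<^bsub>C\<^esub>"
proof -
  have "\<exists>m. \<forall>n\<in>{n. lam C a b n \<noteq> \<zero>\<^bsub>C\<^esub>}. n \<le> m"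
    using lam_polynomial[OF assms] by (rule finite_nat_set_iff_bounded_le[THEN iffD1])
  then show ?thesis using that by (metis (mono_tags) mem_Collect_eq not_less)
qed

lemma skew_sum_mono:
  assumes "a \<in> carrier C" "b \<in> carrier C" "\<And>n. m < n \<Longrightarrow> lam C a b n = \<zero>\<^bsub>C\<^esub>" "m \<le> m'"
  shows "skew_sum m' a b j = skew_sum m a b j"
  unfolding skew_sum_def
  by (rule add.finprod_mono_neutral_cong_right) (use assms in auto)

section \<open>Identities in terms of coefficients\<close>

definition assoc_coeffs :: bool
  where "assoc_coeffs \<longleftrightarrow> (\<forall>a\<in>carrier C. \<forall>b\<in>carrier C. \<forall>c\<in>carrier C. \<forall>i j. lam C a (lam C b c j) i =
    (\<Oplus>\<^bsub>C\<^esub>k\<in>{..i}. [(int ((i - k + j) choose j))] \<cdot>\<^bsub>C\<^esub> lam C (lam C a b k) c (i - k + j)))"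

definition comm_coeffs :: bool
  where "comm_coeffs \<longleftrightarrow> (\<forall>a\<in>carrier C. \<forall>b\<in>carrier C. \<forall>m. (\<forall>n>m. lam C b a n = \<zero>\<^bsub>C\<^esub>) \<longrightarrow>
    (\<forall>i. lam C a b i = skew_sum m b a i))"

lemma commutative_from_coeffs:
  assumes assoc: assoc_coeffs and comm: comm_coeffs
  shows "commutative_conformal_algebra R C"
proof
  fix a b c assume abc: "a \<in> carrier C" "b \<in> carrier C" "c \<in> carrier C"
  show "subst_prod C (op_lam C) (const2 C a) (subst_prod C (op_mu C) (const2 C b) (const2 C c)) =
      subst_prod C (op_lam_plus_mu C) (subst_prod C (op_lam C) (const2 C a) (const2 C b)) (const2 C c)"
    by (intro ext) (use abc assoc in \<open>simp add: subst_mu_const subst_lam_const subst_lam subst_lam_plus_mu poly_coeffs_lam assoc_coeffs_def\<close>)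
next
  fix a b assume ab: "a \<in> carrier C" "b \<in> carrier C"
  then obtain m where m: "\<And>n. m < n \<Longrightarrow> lam C b a n = \<zero>\<^bsub>C\<^esub>" using lam_bound by blast
  have "lam C a b = skew_sum m b a" using comm ab m unfolding comm_coeffs_def by blast
  then show "subst_prod C (op_lam C) (const2 C a) (const2 C b) = subst_prod C (op_neg_der_lam C) (const2 C b) (const2 C a)"
    using ab by (simp add: subst_lam_const subst_neg_der_lam_const[OF ab(2,1) m])
qed

end

text \<open>
  Under the embedding both sides of right symmetry become \<open>(D\<^sup>2 a) b c\<close>, with the appropriate formal variables: the
  Leibniz rule splits \<open>D(D(a) b) c\<close> into this term and \<open>D(a) D(b) c\<close>, which the second product
  cancels.
\<close>

theorem novikov_of_derived_embedding:
  fixes V :: "('k, 'v, 'n) conf_alg_scheme" and C :: "('k, 'c, 'p) conf_alg_scheme"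
  assumes "conformal_algebra R V" and "conformal_algebra R C"
    and assoc: "conformal_algebra.assoc_coeffs C" and comm: "conformal_algebra.comm_coeffs C"
    and swap: "\<And>a b c i j. a \<in> carrier C \<Longrightarrow> b \<in> carrier C \<Longrightarrow> c \<in> carrier C \<Longrightarrow>
      lam C a (lam C b c j) i = lam C b (lam C a c i) j"
    and D: "conf_derivation R C D"
    and g: "linear_map R V C g" "inj_on g (carrier V)"
    and g_der: "\<And>a. a \<in> carrier V \<Longrightarrow> g (der V a) = der C (g a)"
    and g_lam: "\<And>a b n. a \<in> carrier V \<Longrightarrow> b \<in> carrier V \<Longrightarrow> g (lam V a b n) = lam C (D (g a)) (g b) n"
  shows "novikov_conformal_algebra R V"
proof -
  interpret V: conformal_algebra R V by fact
  interpret C: conformal_algebra R C by fact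
  interpret g: linear_hom R V C g by unfold_locales (rule g)
  interpret D: linear_hom R C C D by unfold_locales (use D in \<open>simp add: conf_derivation_def\<close>)
  have D_lam: "D (lam C a b n) = lam C (D a) b n \<oplus>\<^bsub>C\<^esub> lam C a (D b) n" if "a \<in> carrier C" "b \<in> carrier C" for a b n
    using D that by (simp add: conf_derivation_def)
  note cl = g.hom_closed D.hom_closed
  have g_funpow: "g ((der V ^^ n) a) = (der C ^^ n) (g a)" if "a \<in> carrier V" for n a
    by (induction n) (use that in \<open>simp_all add: g_der\<close>)
  have g_skew: "g (V.skew_sum m a b j) = C.skew_sum m (D (g a)) (g b) j" if "a \<in> carrier V" "b \<in> carrier V" for m a b j
    unfolding V.skew_sum_def C.skew_sum_def
    using that by (simp add: g.hom_finsum g.hom_int_mult g_funpow g_lam)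
  have skew: "C.skew_sum m (D (g a)) b j = lam C b (D (g a)) j"
    if "a \<in> carrier V" "b \<in> carrier C" "\<And>n. m < n \<Longrightarrow> lam C (D (g a)) b n = \<zero>\<^bsub>C\<^esub>" for m a b j
    by (rule comm[unfolded C.comm_coeffs_def, rule_format, symmetric]) (use that cl in auto)
  have lam_add: "lam C (a \<oplus>\<^bsub>C\<^esub> b) c n = lam C a c n \<oplus>\<^bsub>C\<^esub> lam C b c n" "lam C c (a \<oplus>\<^bsub>C\<^esub> b) n = lam C c a n \<oplus>\<^bsub>C\<^esub> lam C c b n"
    if "a \<in> carrier C" "b \<in> carrier C" "c \<in> carrier C" for a b c n
    using linear_hom.hom_add[OF C.lam_hom_left] linear_hom.hom_add[OF C.lam_hom_right] that by auto
  show ?thesis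
  proof
    fix a b c assume a: "a \<in> carrier V" and b: "b \<in> carrier V" and c: "c \<in> carrier V"
    let ?a = "D (g a)" and ?b = "D (g b)" and ?c = "D (g c)"
    have car: "g a \<in> carrier C" "g b \<in> carrier C" "g c \<in> carrier C" "?a \<in> carrier C" "?b \<in> carrier C" "?c \<in> carrier C" "D ?a \<in> carrier C"
      using a b c by (simp_all add: cl)
    show "subst_prod V (op_lam V) (const2 V a) (subst_prod V (op_mu V) (const2 V b) (const2 V c)) =
        subst_prod V (op_mu V) (const2 V b) (subst_prod V (op_lam V) (const2 V a) (const2 V c))"
    proof (intro ext)
      fix i j
      have "g (lam V a (lam V b c j) i) = g (lam V b (lam V a c i) j)"
        using a b c car by (simp add: g_lam swap[of ?a ?b])
      then have "lam V a (lam V b c j) i = lam V b (lam V a c i) j"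
        by (rule inj_onD[OF g(2)]) (use a b c in simp_all)
      then show "subst_prod V (op_lam V) (const2 V a) (subst_prod V (op_mu V) (const2 V b) (const2 V c)) i j =
          subst_prod V (op_mu V) (const2 V b) (subst_prod V (op_lam V) (const2 V a) (const2 V c)) i j"
        using a b c by (simp add: V.subst_mu_const V.subst_lam_const V.subst_lam V.subst_mu V.poly_coeffs_lam)
    qed
    obtain m2 where m2: "\<And>n. m2 < n \<Longrightarrow> lam V c b n = \<zero>\<^bsub>V\<^esub>" using V.lam_bound[OF c b] by blast
    show "minus2 V (subst_prod V (op_lam_plus_mu V) (subst_prod V (op_lam V) (const2 V a) (const2 V b)) (const2 V c))
          (subst_prod V (op_lam V) (const2 V a) (subst_prod V (op_mu V) (const2 V b) (const2 V c))) =
        minus2 V (subst_prod V (op_neg_der_mu V) (subst_prod V (op_lam V) (const2 V a) (const2 V c)) (const2 V b))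
          (subst_prod V (op_lam V) (const2 V a) (subst_prod V (op_neg_der_mu V) (const2 V c) (const2 V b)))"
    proof (intro ext)
      fix i j
      obtain m1 where m1: "\<And>n. m1 < n \<Longrightarrow> lam V (lam V a c i) b n = \<zero>\<^bsub>V\<^esub>"
        using V.lam_bound[of "lam V a c i" b] a b c by auto
      let ?X = "\<Oplus>\<^bsub>V\<^esub>k\<in>{..i}. [(int ((i - k + j) choose j))] \<cdot>\<^bsub>V\<^esub> lam V (lam V a b k) c (i - k + j)"
      let ?Y = "lam V a (lam V b c j) i"
      let ?Z = "V.skew_sum m1 (lam V a c i) b j"
      let ?U = "lam V a (V.skew_sum m2 c b j) i"
      have closed: "?X \<in> carrier V" "?Y \<in> carrier V" "?Z \<in> carrier V" "?U \<in> carrier V"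
        using a b c by (auto simp: V.skew_sum_closed intro!: V.finsum_closed)
      let ?t = "\<lambda>k x. [(int ((i - k + j) choose j))] \<cdot>\<^bsub>C\<^esub> lam C x (g c) (i - k + j)"
      have "g ?X = (\<Oplus>\<^bsub>C\<^esub>k\<in>{..i}. ?t k (D (lam C ?a (g b) k)))"
        using a b c by (simp add: g.hom_finsum g.hom_int_mult g_lam)
      also have "\<dots> = (\<Oplus>\<^bsub>C\<^esub>k\<in>{..i}. ?t k (lam C (D ?a) (g b) k) \<oplus>\<^bsub>C\<^esub> ?t k (lam C ?a ?b k))"
        by (rule C.finsum_cong') (use car in \<open>auto simp: D_lam lam_add C.add.int_pow_distrib\<close>)
      also have "\<dots> = (\<Oplus>\<^bsub>C\<^esub>k\<in>{..i}. ?t k (lam C (D ?a) (g b) k)) \<oplus>\<^bsub>C\<^esub> (\<Oplus>\<^bsub>C\<^esub>k\<in>{..i}. ?t k (lam C ?a ?b k))"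
        by (rule C.finsum_addf) (use car in auto)
      also have "\<dots> = lam C (D ?a) (lam C (g b) (g c) j) i \<oplus>\<^bsub>C\<^esub> lam C ?a (lam C ?b (g c) j) i"
        using assoc[unfolded C.assoc_coeffs_def, rule_format, of "D ?a" "g b" "g c" j i]
          assoc[unfolded C.assoc_coeffs_def, rule_format, of ?a ?b "g c" j i] car by simp
      finally have X: "g ?X = lam C (D ?a) (lam C (g b) (g c) j) i \<oplus>\<^bsub>C\<^esub> lam C ?a (lam C ?b (g c) j) i" .
      have Y: "g ?Y = lam C ?a (lam C ?b (g c) j) i" using a b c by (simp add: g_lam)
      have "g ?Z = C.skew_sum m1 (D (g (lam V a c i))) (g b) j"
        using a b c by (simp add: g_skew)
      also have "\<dots> = lam C (g b) (D (g (lam V a c i))) j"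
      proof (rule skew)
        show "lam C (D (g (lam V a c i))) (g b) n = \<zero>\<^bsub>C\<^esub>" if "m1 < n" for n
          using m1[OF that] g_lam[of "lam V a c i" b n] a b c by (simp add: g.hom_zero)
      qed (use a b c car in simp_all)
      also have "\<dots> = lam C (g b) (lam C (D ?a) (g c) i) j \<oplus>\<^bsub>C\<^esub> lam C (g b) (lam C ?a ?c i) j"
        using a c car by (simp add: g_lam D_lam lam_add)
      finally have Z: "g ?Z = lam C (D ?a) (lam C (g b) (g c) j) i \<oplus>\<^bsub>C\<^esub> lam C ?a (lam C (g b) ?c j) i"
        using swap[OF car(2) car(7) car(3), of i j] swap[OF car(2) car(4) car(6), of i j] by simp
      have "g ?U = lam C ?a (C.skew_sum m2 ?c (g b) j) i" using a b c by (simp add: g_lam V.skew_sum_closed g_skew)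
      also have "C.skew_sum m2 ?c (g b) j = lam C (g b) ?c j"
      proof (rule skew[OF c car(2)])
        show "lam C ?c (g b) n = \<zero>\<^bsub>C\<^esub>" if "m2 < n" for n
          using m2[OF that] g_lam[OF c b, of n] by (simp add: g.hom_zero)
      qed
      finally have U: "g ?U = lam C ?a (lam C (g b) ?c j) i" .
      have "g (?X \<ominus>\<^bsub>V\<^esub> ?Y) = lam C (D ?a) (lam C (g b) (g c) j) i"
        using closed car by (simp add: g.hom_minus X Y C.minus_eq C.a_assoc C.r_neg)
      moreover have "g (?Z \<ominus>\<^bsub>V\<^esub> ?U) = lam C (D ?a) (lam C (g b) (g c) j) i"
        using closed car by (simp add: g.hom_minus Z U C.minus_eq C.a_assoc C.r_neg)
      ultimately have "g (?X \<ominus>\<^bsub>V\<^esub> ?Y) = g (?Z \<ominus>\<^bsub>V\<^esub> ?U)" by (simp only:)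
      then have "?X \<ominus>\<^bsub>V\<^esub> ?Y = ?Z \<ominus>\<^bsub>V\<^esub> ?U"
        by (rule inj_onD[OF g(2)]) (intro V.minus_closed closed)+
      moreover have "subst_prod V (op_neg_der_mu V) (V.in_lam (lam V a c)) (const2 V b) i j = ?Z"
        by (rule V.subst_neg_der_mu[OF V.poly_coeffs_lam[OF a c] b]) (rule m1)
      ultimately show "minus2 V (subst_prod V (op_lam_plus_mu V) (subst_prod V (op_lam V) (const2 V a) (const2 V b)) (const2 V c))
          (subst_prod V (op_lam V) (const2 V a) (subst_prod V (op_mu V) (const2 V b) (const2 V c))) i j =
        minus2 V (subst_prod V (op_neg_der_mu V) (subst_prod V (op_lam V) (const2 V a) (const2 V c)) (const2 V b))
          (subst_prod V (op_lam V) (const2 V a) (subst_prod V (op_neg_der_mu V) (const2 V c) (const2 V b))) i j"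
        using a b c
        by (simp add: minus2_def V.subst_mu_const V.subst_lam_const V.subst_lam V.subst_lam_plus_mu V.poly_coeffs_lam
            V.subst_neg_der_mu_const[OF c b m2] V.poly_coeffs_skew_sum)
    qed
  qed
qed

section \<open>The enveloping commutative conformal algebra of an image\<close>

text \<open>
  \<open>F\<close> is the homomorphism onto \<open>V\<close>, extended to distributions with coefficients in the free object.  The conditions
  on \<open>J\<close> say that modulo \<open>J\<close> the scalars act as a ring.
\<close>

locale special_construction = conformal_eval nop sm gen J M inv_fact W + V: conformal_algebra R V
  for nop :: "'a::ab_group_add \<Rightarrow> 'a \<Rightarrow> 'a" (infixl \<open>\<circ>\<^sub>N\<close> 70) and sm :: "'k \<Rightarrow> 'a \<Rightarrow> 'a"
    and gen :: "'x \<times> int \<Rightarrow> 'a" and J :: "'a set" and M :: nat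
    and inv_fact :: "nat \<Rightarrow> 'k" and W :: "(int \<Rightarrow> 'a) set"
    and R :: "('k, 'm) ring_scheme" and V :: "('k, 'v) conf_alg" +
  fixes F :: "(int \<Rightarrow> 'a) \<Rightarrow> 'v"
  assumes F_closed: "f \<in> W \<Longrightarrow> F f \<in> carrier V"
    and F_add: "f \<in> W \<Longrightarrow> g \<in> W \<Longrightarrow> F (\<lambda>m. f m + g m) = F f \<oplus>\<^bsub>V\<^esub> F g"
    and F_sm: "k \<in> carrier R \<Longrightarrow> f \<in> W \<Longrightarrow> F (\<lambda>m. sm k (f m)) = k \<odot>\<^bsub>V\<^esub> F f"
    and F_deriv: "f \<in> W \<Longrightarrow> F (nderiv_dist f) = der V (F f)"
    and F_prod: "f \<in> W \<Longrightarrow> g \<in> W \<Longrightarrow> F (nprod_dist n f g) = nprod V n (F f) (F g)"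
    and F_cong: "f \<in> W \<Longrightarrow> (\<And>m. f m - g m \<in> J) \<Longrightarrow> F f = F g"
    and F_surj: "v \<in> carrier V \<Longrightarrow> \<exists>c\<in>dists. (\<forall>m. homog (- 1) (c m)) \<and> F (\<lambda>m. eval (c m)) = v"
    and J_sm_outside: "k \<notin> carrier R \<Longrightarrow> sm k x \<in> J"
    and J_sm_add: "k \<in> carrier R \<Longrightarrow> l \<in> carrier R \<Longrightarrow> sm (k \<oplus>\<^bsub>R\<^esub> l) x - (sm k x + sm l x) \<in> J"
    and J_sm_mult: "k \<in> carrier R \<Longrightarrow> l \<in> carrier R \<Longrightarrow> sm (k \<otimes>\<^bsub>R\<^esub> l) x - sm k (sm l x) \<in> J"
    and J_sm_one: "sm \<one>\<^bsub>R\<^esub> x - x \<in> J"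
    and inv_fact_closed: "inv_fact n \<in> carrier R"
    and inv_fact_smult: "v \<in> carrier V \<Longrightarrow> inv_fact n \<odot>\<^bsub>V\<^esub> ([(fact n :: nat)] \<cdot>\<^bsub>V\<^esub> v) = v"
begin

definition F_kernel :: "(int \<Rightarrow> 'a) set"
  where "F_kernel = {f \<in> W. F f = \<zero>\<^bsub>V\<^esub>}"

lemma W_zero: "(\<lambda>m. 0) \<in> W"
  by (rule dist_idealD(1)[OF dist_ideal_W])

lemma F_zero: "F (\<lambda>m. 0) = \<zero>\<^bsub>V\<^esub>"
proof -
  have "F (\<lambda>m. sm \<zero>\<^bsub>R\<^esub> 0) = \<zero>\<^bsub>R\<^esub> \<odot>\<^bsub>V\<^esub> F (\<lambda>m. 0)" by (rule F_sm) (simp_all add: W_zero)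
  then show ?thesis using F_closed[OF W_zero] by simp
qed

lemma F_diff:
  assumes "f \<in> W" "g \<in> W"
  shows "F (\<lambda>m. f m - g m) = F f \<ominus>\<^bsub>V\<^esub> F g"
proof (rule V.eq_minusI)
  show "F (\<lambda>m. f m - g m) \<oplus>\<^bsub>V\<^esub> F g = F f"
    using F_add[OF W_diff[OF assms] assms(2)] by simp
qed (use assms in \<open>auto intro: F_closed W_diff\<close>)

lemma nprod_zero: "v \<in> carrier V \<Longrightarrow> nprod V n v \<zero>\<^bsub>V\<^esub> = \<zero>\<^bsub>V\<^esub>" "v \<in> carrier V \<Longrightarrow> nprod V n \<zero>\<^bsub>V\<^esub> v = \<zero>\<^bsub>V\<^esub>"
  using V.add.nat_pow_one by (simp_all add: nprod_def)

lemma dist_ideal_F_kernel: "dist_ideal F_kernel"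
proof -
  have cong: "g \<in> F_kernel" if "f \<in> F_kernel" "\<And>m. f m - g m \<in> J" for f g
    using W_cong[of f g] F_cong[of f g] that by (simp add: F_kernel_def)
  have sm: "(\<lambda>m. sm k (f m)) \<in> F_kernel" if f: "f \<in> F_kernel" for k f
  proof (cases "k \<in> carrier R")
    case True
    then show ?thesis using f by (simp add: F_kernel_def W_sm F_sm)
  next
    case False
    have z: "(\<lambda>m. 0) \<in> F_kernel" by (simp add: F_kernel_def W_zero F_zero)
    show ?thesis by (rule cong[OF z]) (simp add: J_minus J_sm_outside[OF False])
  qed
  show ?thesis
    unfolding dist_ideal_def
  proof (intro conjI ballI allI impI)
    show "(\<lambda>m. 0) \<in> F_kernel" by (simp add: F_kernel_def W_zero F_zero)
    show "(\<lambda>m. f m - g m) \<in> F_kernel" if "f \<in> F_kernel" "g \<in> F_kernel" for f g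
      using that by (simp add: F_kernel_def W_diff F_diff V.minus_eq)
    show "(\<lambda>m. sm k (f m)) \<in> F_kernel" if "f \<in> F_kernel" for f k by (rule sm[OF that])
    show "nderiv_dist f \<in> F_kernel" if "f \<in> F_kernel" for f
      using that by (simp add: F_kernel_def W_deriv F_deriv)
    show "g \<in> F_kernel" if "f \<in> F_kernel" "\<forall>m. f m - g m \<in> J" for f g using cong that by blast
    show "nprod_dist n f g \<in> F_kernel" "nprod_dist n g f \<in> F_kernel" if "f \<in> W" "g \<in> F_kernel" for f g n
      using that by (simp_all add: F_kernel_def W_prod F_prod nprod_zero F_closed)
  qed
qed

abbreviation null where "null \<equiv> null_dists F_kernel"

text \<open>
  The elements of the enveloping algebra are the classes of this congruence.
\<close>

definition equiv_dist :: "(int \<Rightarrow> ('k, 'x \<times> int) dpoly) \<Rightarrow> (int \<Rightarrow> ('k, 'x \<times> int) dpoly) \<Rightarrow> bool" (infix \<open>\<approx>\<close> 50)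
  where "c \<approx> d \<longleftrightarrow> (\<lambda>m. c m - d m) \<in> null"

lemma equiv_refl: "c \<approx> c"
  using null_dists_zero by (simp add: equiv_dist_def)

lemma equiv_sym: "c \<approx> d \<Longrightarrow> d \<approx> c"
  using null_dists_minus[OF dist_ideal_F_kernel, of "\<lambda>m. c m - d m"] by (simp add: equiv_dist_def)

lemma equiv_trans: "c \<approx> d \<Longrightarrow> d \<approx> e \<Longrightarrow> c \<approx> e"
  using null_dists_add[OF dist_ideal_F_kernel, of "\<lambda>m. c m - d m" "\<lambda>m. d m - e m"] by (simp add: equiv_dist_def)

lemma equiv_add: "c \<approx> c' \<Longrightarrow> d \<approx> d' \<Longrightarrow> (\<lambda>m. c m + d m) \<approx> (\<lambda>m. c' m + d' m)"
proof -
  have "(\<lambda>m. c m + d m - (c' m + d' m)) = (\<lambda>m. (c m - c' m) + (d m - d' m))" by (simp add: fun_eq_iff)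
  then show "c \<approx> c' \<Longrightarrow> d \<approx> d' \<Longrightarrow> ?thesis"
    using null_dists_add[OF dist_ideal_F_kernel, of "\<lambda>m. c m - c' m" "\<lambda>m. d m - d' m"]
    by (simp add: equiv_dist_def)
qed

lemma equiv_scale: "c \<approx> c' \<Longrightarrow> (\<lambda>m. var (Sc k) * c m) \<approx> (\<lambda>m. var (Sc k) * c' m)"
  using null_dists_scale[OF dist_ideal_F_kernel, of "\<lambda>m. c m - c' m" k]
  by (simp add: equiv_dist_def right_diff_distrib)

lemma equiv_deriv: "c \<approx> c' \<Longrightarrow> \<partial> c \<approx> \<partial> c'"
  using null_dists_deriv[OF dist_ideal_F_kernel, of "\<lambda>m. c m - c' m"]
  by (simp add: equiv_dist_def dderiv_simps[abs_def])

lemma equiv_dD: "c \<approx> c' \<Longrightarrow> dD c \<approx> dD c'"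
  using null_dists_dD[of "\<lambda>m. c m - c' m"] by (simp add: equiv_dist_def)

lemma equiv_dprod:
  assumes "c \<approx> c'" "d \<approx> d'" "c \<in> dists" "c' \<in> dists" "d \<in> dists" "d' \<in> dists"
  shows "dprod n c d \<approx> dprod n c' d'"
proof -
  have "dprod n c (\<lambda>m. d m - d' m) \<in> null"
    by (rule null_dists_dprod[OF dist_ideal_F_kernel]) (use assms in \<open>simp_all add: equiv_dist_def\<close>)
  moreover have "dprod n (\<lambda>m. c m - c' m) d' \<in> null"
    by (rule null_dists_dprod_right[OF dist_ideal_F_kernel]) (use assms in \<open>auto simp: equiv_dist_def intro: dists_diff\<close>)
  ultimately have "(\<lambda>m. dprod n c (\<lambda>m. d m - d' m) m + dprod n (\<lambda>m. c m - c' m) d' m) \<in> null"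
    by (rule null_dists_add[OF dist_ideal_F_kernel])
  then show ?thesis by (simp add: equiv_dist_def dprod_diff_left dprod_diff_right)
qed

lemma equiv_null_ideal: "(\<And>m. c m - d m \<in> null_ideal) \<Longrightarrow> c \<approx> d"
  unfolding equiv_dist_def by (rule null_dists_ideal)

text \<open>
  Makes the map from \<open>V\<close> to the classes well defined.
\<close>

lemma equiv_homog:
  assumes "c \<in> dists" "d \<in> dists" "\<And>m. homog (- 1) (c m)" "\<And>m. homog (- 1) (d m)"
    and eq: "F (\<lambda>m. eval (c m)) = F (\<lambda>m. eval (d m))"
  shows "c \<approx> d"
proof -
  have "F (\<lambda>m. eval (c m) - eval (d m)) = \<zero>\<^bsub>V\<^esub>"
    using assms F_closed[OF eval_dists[of d]] by (simp add: F_diff eval_dists V.minus_eq V.r_neg)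
  then have "(\<lambda>m. c m - d m) \<in> kernel F_kernel"
    using assms by (simp add: kernel_def dists_diff homog_diff F_kernel_def W_diff eval_dists)
  then show ?thesis unfolding equiv_dist_def by (rule null_dists_kernel)
qed

section \<open>Words over the carrier\<close>

definition lift :: "'v \<Rightarrow> int \<Rightarrow> ('k, 'x \<times> int) dpoly"
  where "lift v = (SOME c. c \<in> dists \<and> (\<forall>m. homog (- 1) (c m)) \<and> F (\<lambda>m. eval (c m)) = v)"

lemma lift:
  assumes "v \<in> carrier V"
  shows "lift v \<in> dists" "homog (- 1) (lift v m)" "F (\<lambda>m. eval (lift v m)) = v"
proof -
  have "lift v \<in> dists \<and> (\<forall>m. homog (- 1) (lift v m)) \<and> F (\<lambda>m. eval (lift v m)) = v"
    unfolding lift_def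
    by (rule someI_ex[of "\<lambda>c. c \<in> dists \<and> (\<forall>m. homog (- 1) (c m)) \<and> F (\<lambda>m. eval (c m)) = v"])
      (use F_surj[OF assms] in blast)
  then show "lift v \<in> dists" "homog (- 1) (lift v m)" "F (\<lambda>m. eval (lift v m)) = v" by auto
qed

lemma lift_equiv:
  assumes "c \<in> dists" "\<And>m. homog (- 1) (c m)"
  shows "lift (F (\<lambda>m. eval (c m))) \<approx> c" "lift (F (\<lambda>m. eval (c m))) \<in> dists"
proof -
  have "F (\<lambda>m. eval (c m)) \<in> carrier V" by (rule F_closed[OF eval_dists[OF assms(1)]])
  note l = lift[OF this]
  show "lift (F (\<lambda>m. eval (c m))) \<approx> c" by (rule equiv_homog) (use assms l in auto)
  show "lift (F (\<lambda>m. eval (c m))) \<in> dists" by (rule l)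
qed

text \<open>
  Words are read as postfix expressions by a stack machine: elements of \<open>V\<close> push a representative, and the natural numbers
  encode addition, \<open>\<partial>\<close>, \<open>D\<close> and, from \<open>3\<close> on, the \<open>n\<close>-products.  The last clause only
  makes the function total.
\<close>

fun exec :: "'v + 'k + nat \<Rightarrow> (int \<Rightarrow> ('k, 'x \<times> int) dpoly) list \<Rightarrow> (int \<Rightarrow> ('k, 'x \<times> int) dpoly) list" where
  "exec (Inl v) st = lift v # st"
| "exec (Inr (Inl k)) (c # st) = (\<lambda>m. var (Sc k) * c m) # st"
| "exec (Inr (Inr 0)) (c # d # st) = (\<lambda>m. c m + d m) # st"
| "exec (Inr (Inr (Suc 0))) (c # st) = \<partial> c # st"
| "exec (Inr (Inr (Suc (Suc 0)))) (c # st) = dD c # st"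
| "exec (Inr (Inr (Suc (Suc (Suc n))))) (c # d # st) = dprod n c d # st"
| "exec _ st = st"

definition run :: "('v + 'k + nat) list \<Rightarrow> (int \<Rightarrow> ('k, 'x \<times> int) dpoly) list \<Rightarrow> (int \<Rightarrow> ('k, 'x \<times> int) dpoly) list"
  where "run w = fold exec w"

lemma run_simps: "run (u @ w) st = run w (run u st)" "run [x] st = exec x st"
  by (simp_all add: run_def)

definition word_for :: "('v + 'k + nat) list \<Rightarrow> (int \<Rightarrow> ('k, 'x \<times> int) dpoly) \<Rightarrow> bool"
  where "word_for w c \<longleftrightarrow> (\<exists>d. d \<in> dists \<and> d \<approx> c \<and> (\<forall>st. run w st = d # st))"

lemma word_for_cong: "word_for w c \<Longrightarrow> c \<approx> d \<Longrightarrow> word_for w d"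
  unfolding word_for_def using equiv_trans by blast

lemma word_for_lift: "v \<in> carrier V \<Longrightarrow> word_for [Inl v] (lift v)"
  unfolding word_for_def by (auto simp: run_simps lift equiv_refl)

lemma word_for_homog:
  assumes "c \<in> dists" "\<And>m. homog (- 1) (c m)"
  shows "\<exists>w. word_for w c"
  using word_for_cong[OF word_for_lift lift_equiv(1)[OF assms]] F_closed[OF eval_dists[OF assms(1)]] by blast

lemma word_for_scale: "word_for w c \<Longrightarrow> word_for (w @ [Inr (Inl k)]) (\<lambda>m. var (Sc k) * c m)"
  unfolding word_for_def by (auto simp: run_simps intro!: dists.scale equiv_scale)

lemma word_for_deriv: "word_for w c \<Longrightarrow> word_for (w @ [Inr (Inr 1)]) (\<partial> c)"
  unfolding word_for_def by (auto simp: run_simps intro!: dists.deriv equiv_deriv)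

lemma word_for_dD: "word_for w c \<Longrightarrow> word_for (w @ [Inr (Inr 2)]) (dD c)"
  unfolding word_for_def by (auto simp: run_simps numeral_2_eq_2 intro!: dists_dD equiv_dD)

lemma word_for_add: "word_for w c \<Longrightarrow> word_for u d \<Longrightarrow> word_for (u @ w @ [Inr (Inr 0)]) (\<lambda>m. c m + d m)"
proof -
  assume "word_for w c" "word_for u d"
  then obtain c' d' where "c' \<in> dists" "c' \<approx> c" "\<And>st. run w st = c' # st" "d' \<in> dists" "d' \<approx> d" "\<And>st. run u st = d' # st"
    unfolding word_for_def by blast
  then show ?thesis unfolding word_for_def
    by (intro exI[of _ "\<lambda>m. c' m + d' m"]) (auto simp: run_simps intro: dists.add equiv_add)
qed

lemma word_for_dprod:
  assumes "word_for w c" "word_for u d" "c \<in> dists" "d \<in> dists"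
  shows "word_for (u @ w @ [Inr (Inr (Suc (Suc (Suc n))))]) (dprod n c d)"
proof -
  obtain c' d' where "c' \<in> dists" "c' \<approx> c" "\<And>st. run w st = c' # st" "d' \<in> dists" "d' \<approx> d" "\<And>st. run u st = d' # st"
    using assms unfolding word_for_def by blast
  then show ?thesis unfolding word_for_def
    by (intro exI[of _ "dprod n c' d'"]) (auto simp: run_simps intro: dists.prod equiv_dprod assms)
qed

lemma null_scalar_add:
  assumes "k \<in> carrier R" "l \<in> carrier R"
  shows "var (Sc (k \<oplus>\<^bsub>R\<^esub> l)) - (var (Sc k) + var (Sc l)) \<in> null_ideal"
  by (rule null_constant) (use J_sm_add[OF assms] in \<open>simp_all add: left_diff_distrib distrib_right eval_scalar\<close>)

lemma null_scalar_mult: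
  assumes "k \<in> carrier R" "l \<in> carrier R"
  shows "var (Sc (k \<otimes>\<^bsub>R\<^esub> l)) - var (Sc k) * var (Sc l) \<in> null_ideal"
proof (rule null_constant)
  show "\<D> (var (Sc (k \<otimes>\<^bsub>R\<^esub> l)) - var (Sc k) * var (Sc l) :: ('k, 'x \<times> int) dpoly) = 0"
    by (simp only: dpoly_deriv_additive dpoly_deriv_mult dpoly_deriv_var) simp
  have "(var (Sc k) * var (Sc l)) * q = var (Sc k) * (var (Sc l) * q)" for q :: "('k, 'x \<times> int) dpoly"
    by (rule mult.assoc)
  then have "eval ((var (Sc k) * var (Sc l)) * q) = sm k (sm l (eval q))" for q
    by (simp only: eval_scalar)
  then show "eval ((var (Sc (k \<otimes>\<^bsub>R\<^esub> l)) - var (Sc k) * var (Sc l)) * q) \<in> J" for q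
    using J_sm_mult[OF assms] by (simp only: left_diff_distrib eval_additive eval_scalar)
qed

lemma null_scalar_one: "var (Sc \<one>\<^bsub>R\<^esub>) - 1 \<in> null_ideal"
  by (rule null_constant) (use J_sm_one in \<open>simp_all add: left_diff_distrib eval_scalar\<close>)

lemma null_scalar_minus_one: "var (Sc (\<ominus>\<^bsub>R\<^esub> \<one>\<^bsub>R\<^esub>)) + 1 \<in> null_ideal"
proof -
  note I = null_ideal_ideal
  have z: "var (Sc \<zero>\<^bsub>R\<^esub>) \<in> null_ideal"
    using null_scalar_add[of "\<zero>\<^bsub>R\<^esub>" "\<zero>\<^bsub>R\<^esub>"] ring_idealD(5)[OF I] by fastforce
  have "var (Sc (\<ominus>\<^bsub>R\<^esub> \<one>\<^bsub>R\<^esub> \<oplus>\<^bsub>R\<^esub> \<one>\<^bsub>R\<^esub>)) - (var (Sc (\<ominus>\<^bsub>R\<^esub> \<one>\<^bsub>R\<^esub>)) + var (Sc \<one>\<^bsub>R\<^esub>)) \<in> null_ideal"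
    by (rule null_scalar_add) simp_all
  then have "var (Sc \<zero>\<^bsub>R\<^esub>) - (var (Sc (\<ominus>\<^bsub>R\<^esub> \<one>\<^bsub>R\<^esub>)) + var (Sc \<one>\<^bsub>R\<^esub>)) \<in> null_ideal"
    by (simp add: V.R.l_neg)
  from ring_idealD(2)[OF I z ring_idealD(6)[OF I this null_scalar_one]]
  show ?thesis by (simp add: algebra_simps)
qed

text \<open>
  A derivative of a generating series is reached from the series itself, which has weight \<open>-1\<close> and thus comes
  from an element of \<open>V\<close>; negation is multiplication by the scalar \<open>-1\<close>.
\<close>

lemma word_for_exists: "c \<in> dists \<Longrightarrow> \<exists>w. word_for w c"
proof (induction rule: dists.induct)
  case (gen a i)
  have "homog (- 1) (gdist a 0 m)" for m using homog_gdist[of 0 a m] by simp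
  then have base: "\<exists>w. word_for w (gdist a 0)" by (rule word_for_homog[OF dists.gen])
  show ?case
  proof (induction i)
    case (Suc i)
    have "gdist a (Suc i) = dD (gdist a i)" by (simp add: gdist_def fun_eq_iff)
    then show ?case using Suc word_for_dD by auto
  qed (rule base)
next
  case zero
  show ?case by (rule word_for_homog[OF dists.zero]) simp
next
  case (minus f)
  then obtain w where "word_for w f" by blast
  from word_for_scale[OF this, of "\<ominus>\<^bsub>R\<^esub> \<one>\<^bsub>R\<^esub>"] have "word_for (w @ [Inr (Inl (\<ominus>\<^bsub>R\<^esub> \<one>\<^bsub>R\<^esub>))]) (\<lambda>m. - f m)"
  proof (rule word_for_cong, intro equiv_null_ideal)
    show "var (Sc (\<ominus>\<^bsub>R\<^esub> \<one>\<^bsub>R\<^esub>)) * f m - - f m \<in> null_ideal" for m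
      using ring_idealD(4)[OF null_ideal_ideal null_scalar_minus_one, of "f m"] by (simp add: distrib_right)
  qed
  then show ?case by blast
next
  case (add f g)
  then show ?case using word_for_add by blast
next
  case (scale f k)
  then show ?case using word_for_scale by blast
next
  case (deriv f)
  then show ?case using word_for_deriv by blast
next
  case (prod f g n)
  then show ?case using word_for_dprod by blast
qed

definition wd :: "(int \<Rightarrow> ('k, 'x \<times> int) dpoly) \<Rightarrow> ('v + 'k + nat) list"
  where "wd c = (SOME w. word_for w c)"

definition dw :: "('v + 'k + nat) list \<Rightarrow> int \<Rightarrow> ('k, 'x \<times> int) dpoly"
  where "dw w = (SOME c. c \<in> dists \<and> wd c = w)"

lemma wd_eq:
  assumes c: "c \<in> dists" and d: "d \<in> dists"
  shows "wd c = wd d \<longleftrightarrow> c \<approx> d"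
proof
  assume "c \<approx> d"
  then have "word_for w c \<longleftrightarrow> word_for w d" for w using word_for_cong equiv_sym by blast
  then show "wd c = wd d" by (simp add: wd_def)
next
  have "word_for (wd c) c" if "c \<in> dists" for c
    unfolding wd_def by (rule someI_ex[OF word_for_exists[OF that]])
  moreover assume "wd c = wd d"
  ultimately have 1: "word_for (wd c) c" and 2: "word_for (wd c) d" using c d by metis+
  obtain c' where c': "c' \<approx> c" "\<And>st. run (wd c) st = c' # st" using 1 unfolding word_for_def by blast
  obtain d' where d': "d' \<approx> d" "\<And>st. run (wd c) st = d' # st" using 2 unfolding word_for_def by blast
  have "c' = d'" using c'(2)[of "[]"] d'(2)[of "[]"] by simp
  then show "c \<approx> d" using c'(1) d'(1) equiv_sym equiv_trans by blast
qed

lemma dw_wd: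
  assumes "c \<in> dists"
  shows "dw (wd c) \<in> dists" "dw (wd c) \<approx> c"
proof -
  have "dw (wd c) \<in> dists \<and> wd (dw (wd c)) = wd c"
    unfolding dw_def by (rule someI_ex[of "\<lambda>d. d \<in> dists \<and> wd d = wd c"]) (use assms in blast)
  then show "dw (wd c) \<in> dists" "dw (wd c) \<approx> c" using wd_eq assms by blast+
qed

text \<open>
  The quotient by the congruence, transported to one chosen word for each class.
\<close>

definition walg :: "('k, ('v + 'k + nat) list) conf_alg"
  where "walg = undefined\<lparr>carrier := wd ` dists, zero := wd (\<lambda>m. 0),
    add := (\<lambda>u v. wd (\<lambda>m. dw u m + dw v m)), smult := (\<lambda>k u. wd (\<lambda>m. var (Sc k) * dw u m)),
    der := (\<lambda>u. wd (\<partial> (dw u))), lam := (\<lambda>u v n. wd (\<lambda>m. var (Sc (inv_fact n)) * dprod n (dw u) (dw v) m))\<rparr>"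

definition wD :: "('v + 'k + nat) list \<Rightarrow> ('v + 'k + nat) list"
  where "wD u = wd (dD (dw u))"

lemma wd_cong: "c \<in> dists \<Longrightarrow> d \<in> dists \<Longrightarrow> c \<approx> d \<Longrightarrow> wd c = wd d"
  by (simp add: wd_eq)

lemma walg_simps:
  "carrier walg = wd ` dists" "\<zero>\<^bsub>walg\<^esub> = wd (\<lambda>m. 0)"
  "c \<in> dists \<Longrightarrow> d \<in> dists \<Longrightarrow> wd c \<oplus>\<^bsub>walg\<^esub> wd d = wd (\<lambda>m. c m + d m)"
  "c \<in> dists \<Longrightarrow> k \<odot>\<^bsub>walg\<^esub> wd c = wd (\<lambda>m. var (Sc k) * c m)"
  "c \<in> dists \<Longrightarrow> der walg (wd c) = wd (\<partial> c)"
  "c \<in> dists \<Longrightarrow> d \<in> dists \<Longrightarrow> lam walg (wd c) (wd d) n = wd (\<lambda>m. var (Sc (inv_fact n)) * dprod n c d m)"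
  "c \<in> dists \<Longrightarrow> wD (wd c) = wd (dD c)"
  by (simp_all add: walg_def wD_def, auto intro!: wd_cong equiv_add equiv_scale equiv_deriv equiv_dD equiv_dprod
      dists.add dists.scale dists.deriv dists.prod dists_dD dw_wd)

text \<open>
  Congruence modulo \<open>null_ideal\<close> is used for the arithmetic with inverse factorials.
\<close>

definition cong_null :: "('k, 'x \<times> int) dpoly \<Rightarrow> ('k, 'x \<times> int) dpoly \<Rightarrow> bool" (infix \<open>\<cong>\<^sub>0\<close> 50)
  where "p \<cong>\<^sub>0 q \<longleftrightarrow> p - q \<in> null_ideal"

lemma cong_null_refl [simp]: "p \<cong>\<^sub>0 p"
  using ring_idealD(1)[OF null_ideal_ideal] by (simp add: cong_null_def)

lemma cong_null_sym: "p \<cong>\<^sub>0 q \<Longrightarrow> q \<cong>\<^sub>0 p"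
  using ring_idealD(5)[OF null_ideal_ideal, of "p - q"] by (simp add: cong_null_def)

lemma cong_null_trans [trans]: "p \<cong>\<^sub>0 q \<Longrightarrow> q \<cong>\<^sub>0 r \<Longrightarrow> p \<cong>\<^sub>0 r"
  using ring_idealD(6)[OF null_ideal_ideal, of "p - q" "q - r"] by (simp add: cong_null_def)

lemma cong_null_mult: "p \<cong>\<^sub>0 q \<Longrightarrow> r * p \<cong>\<^sub>0 r * q"
  using ring_idealD(3)[OF null_ideal_ideal, of "p - q" r] by (simp add: cong_null_def right_diff_distrib)

lemma cong_null_mult2: "p \<cong>\<^sub>0 q \<Longrightarrow> p' \<cong>\<^sub>0 q' \<Longrightarrow> p * p' \<cong>\<^sub>0 q * q'"
  using cong_null_mult[of p' q' p] cong_null_mult[of p q q'] cong_null_trans by (simp add: mult.commute)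

lemma cong_null_sum: "(\<And>i. i \<in> S \<Longrightarrow> f i \<cong>\<^sub>0 g i) \<Longrightarrow> sum f S \<cong>\<^sub>0 sum g S"
  unfolding cong_null_def by (simp add: ring_ideal_sum[OF null_ideal_ideal] flip: sum_subtractf)

abbreviation kap :: "nat \<Rightarrow> ('k, 'x \<times> int) dpoly" where "kap n \<equiv> var (Sc (inv_fact n))"

lemma kap_fact: "kap n * of_nat (fact n) \<cong>\<^sub>0 1"
  unfolding cong_null_def by (rule inv_fact_null)

lemma kap_ratio:
  assumes "fact n * a = (fact m :: nat)"
  shows "kap n \<cong>\<^sub>0 of_nat a * kap m"
proof -
  have f: "of_nat (fact n) * of_nat a = (of_nat (fact m) :: ('k, 'x \<times> int) dpoly)"
    using assms by (metis of_nat_mult)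
  have "kap n * 1 \<cong>\<^sub>0 kap n * (kap m * of_nat (fact m))"
    by (intro cong_null_mult cong_null_sym[OF kap_fact])
  also have "kap n * (kap m * of_nat (fact m)) = (of_nat a * kap m) * (kap n * of_nat (fact n))"
    unfolding f[symmetric] by (simp only: ac_simps)
  also have "\<dots> \<cong>\<^sub>0 (of_nat a * kap m) * 1"
    by (intro cong_null_mult kap_fact)
  finally show ?thesis by (simp only: mult_1_right)
qed

lemma wd_cong_null: "c \<in> dists \<Longrightarrow> d \<in> dists \<Longrightarrow> (\<And>m. c m \<cong>\<^sub>0 d m) \<Longrightarrow> wd c = wd d"
  by (rule wd_cong) (auto intro: equiv_null_ideal simp: cong_null_def)

lemma dists_of_int: "c \<in> dists \<Longrightarrow> (\<lambda>m. of_int k * c m) \<in> dists"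
proof (induction k rule: int_induct[where k = 0])
  case base
  then show ?case by (simp add: dists.zero)
next
  case (step1 i)
  then show ?case using dists.add[of "\<lambda>m. of_int i * c m" c] by (simp add: distrib_right)
next
  case (step2 i)
  then show ?case using dists_diff[of "\<lambda>m. of_int i * c m" c] by (simp add: left_diff_distrib)
qed

lemma dists_of_nat: "c \<in> dists \<Longrightarrow> (\<lambda>m. of_nat k * c m) \<in> dists"
  using dists_of_int[of c "int k"] by simp

lemma dists_sum: "(\<And>i. i \<in> S \<Longrightarrow> h i \<in> dists) \<Longrightarrow> (\<lambda>m. \<Sum>i\<in>S. h i m) \<in> dists"
  by (induction S rule: infinite_finite_induct) (auto intro: dists.zero dists.add)

lemma dists_deriv_funpow: "c \<in> dists \<Longrightarrow> (\<partial> ^^ k) c \<in> dists"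
  by (induction k) (auto intro: dists.deriv)

lemmas dists_closed [simp] = dists.zero dists.add dists.minus dists.scale dists.deriv dists.prod dists_diff dists_dD
  dists_of_int dists_of_nat dists_sum dists_deriv_funpow

lemma walg_abelian_group: "abelian_group walg"
proof (rule abelian_groupI)
  fix x assume "x \<in> carrier walg"
  then obtain c where "c \<in> dists" "x = wd c" by (auto simp: walg_simps)
  then have "wd (\<lambda>m. - c m) \<oplus>\<^bsub>walg\<^esub> x = \<zero>\<^bsub>walg\<^esub>" "wd (\<lambda>m. - c m) \<in> carrier walg" by (simp_all add: walg_simps)
  then show "\<exists>y\<in>carrier walg. y \<oplus>\<^bsub>walg\<^esub> x = \<zero>\<^bsub>walg\<^esub>" by blast
qed (auto simp: walg_simps ac_simps)

lemma walg_module: "Module.module R walg"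
proof (rule Module.moduleI[OF V.R.is_cring walg_abelian_group])
  fix k l x y assume kl: "k \<in> carrier R" "l \<in> carrier R" and "x \<in> carrier walg"
  then obtain c where c: "c \<in> dists" "x = wd c" by (auto simp: walg_simps)
  show "(k \<oplus>\<^bsub>R\<^esub> l) \<odot>\<^bsub>walg\<^esub> x = k \<odot>\<^bsub>walg\<^esub> x \<oplus>\<^bsub>walg\<^esub> l \<odot>\<^bsub>walg\<^esub> x"
  proof -
    have "var (Sc (k \<oplus>\<^bsub>R\<^esub> l)) * c m \<cong>\<^sub>0 var (Sc k) * c m + var (Sc l) * c m" for m
      using cong_null_mult2[OF null_scalar_add[OF kl, folded cong_null_def] cong_null_refl, of "c m"] by (simp only: distrib_right)
    then show ?thesis using c by (auto simp: walg_simps intro!: wd_cong_null)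
  qed
  show "(k \<otimes>\<^bsub>R\<^esub> l) \<odot>\<^bsub>walg\<^esub> x = k \<odot>\<^bsub>walg\<^esub> (l \<odot>\<^bsub>walg\<^esub> x)"
  proof -
    have "var (Sc (k \<otimes>\<^bsub>R\<^esub> l)) * c m \<cong>\<^sub>0 var (Sc k) * (var (Sc l) * c m)" for m
      using cong_null_mult2[OF null_scalar_mult[OF kl, folded cong_null_def] cong_null_refl, of "c m"] by (simp only: mult.assoc)
    then show ?thesis using c by (auto simp: walg_simps simp del: frag_of_mult intro!: wd_cong_null)
  qed
next
  fix x assume "x \<in> carrier walg"
  then obtain c where c: "c \<in> dists" "x = wd c" by (auto simp: walg_simps)
  show "\<one>\<^bsub>R\<^esub> \<odot>\<^bsub>walg\<^esub> x = x"
    using c cong_null_mult2[OF null_scalar_one[folded cong_null_def] cong_null_refl]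
    by (auto simp: walg_simps intro!: wd_cong_null)
qed (auto simp: walg_simps distrib_left)

interpretation walg: Module.module R walg
  by (rule walg_module)

lemma wd_minus: "c \<in> dists \<Longrightarrow> \<ominus>\<^bsub>walg\<^esub> wd c = wd (\<lambda>m. - c m)"
  by (rule walg.minus_equality) (simp_all add: walg_simps)

lemma wd_diff: "c \<in> dists \<Longrightarrow> d \<in> dists \<Longrightarrow> wd c \<ominus>\<^bsub>walg\<^esub> wd d = wd (\<lambda>m. c m - d m)"
  by (simp add: walg.minus_eq wd_minus walg_simps)

lemma wd_carrier: "c \<in> dists \<Longrightarrow> wd c \<in> carrier walg"
  by (simp add: walg_simps)

lemma wd_int_mult: "c \<in> dists \<Longrightarrow> [(k::int)] \<cdot>\<^bsub>walg\<^esub> wd c = wd (\<lambda>m. of_int k * c m)"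
proof (induction k rule: int_induct[where k = 0])
  case base
  then show ?case by (simp add: add_pow_def walg_simps)
next
  case (step1 i)
  then show ?case by (simp add: walg.add.int_pow_mult wd_carrier) (simp add: walg_simps distrib_right)
next
  case (step2 i)
  then show ?case by (simp add: walg.add.int_pow_diff wd_carrier wd_minus) (simp add: walg_simps left_diff_distrib)
qed

lemma wd_finsum: "finite S \<Longrightarrow> (\<And>i. i \<in> S \<Longrightarrow> h i \<in> dists) \<Longrightarrow> finsum walg (\<lambda>i. wd (h i)) S = wd (\<lambda>m. \<Sum>i\<in>S. h i m)"
proof (induction S rule: finite_induct)
  case (insert i S)
  then have "(\<lambda>i. wd (h i)) \<in> S \<rightarrow> carrier walg" by (auto simp: wd_carrier)
  then show ?case using insert by (simp add: wd_carrier) (simp add: walg_simps)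
qed (simp add: walg_simps)

lemma linear_map_walg:
  assumes "\<And>c. c \<in> dists \<Longrightarrow> f (wd c) = wd (G c)" "\<And>c. c \<in> dists \<Longrightarrow> G c \<in> dists"
    and "\<And>c d. G (\<lambda>m. c m + d m) = (\<lambda>m. G c m + G d m)" "\<And>c k. G (\<lambda>m. var (Sc k) * c m) = (\<lambda>m. var (Sc k) * G c m)"
  shows "linear_map R walg walg f"
  using assms by (auto simp: linear_map_def walg_simps)

lemma lam_shift_walg:
  assumes "c \<in> dists" "d \<in> dists"
  shows "lam_shift walg (lam walg (wd c) (wd d)) n = wd (\<lambda>m. of_nat n * (kap n * dprod (n - 1) c d m))"
proof (cases n)
  case 0
  then show ?thesis by (simp add: lam_shift_def walg_simps)
next
  case (Suc k)
  have f: "fact k * Suc k = (fact (Suc k) :: nat)" by simp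
  have "kap k * p \<cong>\<^sub>0 of_nat (Suc k) * (kap (Suc k) * p)" for p
    using cong_null_mult2[OF kap_ratio[OF f] cong_null_refl, of p] by (simp only: mult.assoc)
  then show ?thesis using Suc assms by (auto simp: lam_shift_def walg_simps simp del: of_nat_Suc intro!: wd_cong_null)
qed

lemma walg_conformal: "conformal_algebra R walg"
proof
  show "linear_map R walg walg (der walg)"
    by (rule linear_map_walg[of _ \<partial>]) (simp_all add: walg_simps dderiv_simps[abs_def])
  fix b n assume "b \<in> carrier walg"
  then obtain d where d: "d \<in> dists" "b = wd d" by (auto simp: walg_simps)
  show "linear_map R walg walg (\<lambda>a. lam walg a b n)"
    by (rule linear_map_walg[of _ "\<lambda>c m. kap n * dprod n c d m"])
      (use d in \<open>simp_all add: walg_simps dprod_add_left dprod_scale_left distrib_left mult.left_commute\<close>)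
  show "linear_map R walg walg (\<lambda>a. lam walg b a n)"
    by (rule linear_map_walg[of _ "\<lambda>c m. kap n * dprod n d c m"])
      (use d in \<open>simp_all add: walg_simps dprod_add_right dprod_scale_right distrib_left mult.left_commute\<close>)
next
  fix a b assume "a \<in> carrier walg" "b \<in> carrier walg"
  then obtain c d where c: "c \<in> dists" "a = wd c" and d: "d \<in> dists" "b = wd d" by (auto simp: walg_simps)
  obtain N where N: "local_mod null_ideal N c d" using dists_local c d by blast
  have vanish: "lam walg a b n = \<zero>\<^bsub>walg\<^esub>" if "N \<le> n" for n
  proof -
    have "kap n * dprod n c d m \<cong>\<^sub>0 0" for m
      using ring_idealD(3)[OF null_ideal_ideal dprod_local_zero[OF null_ideal_ideal N that]] by (simp add: cong_null_def)
    then show ?thesis using c d by (auto simp: walg_simps intro!: wd_cong_null)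
  qed
  have "{n. lam walg a b n \<noteq> \<zero>\<^bsub>walg\<^esub>} \<subseteq> {..<N}"
  proof
    fix n assume "n \<in> {n. lam walg a b n \<noteq> \<zero>\<^bsub>walg\<^esub>}"
    then have "\<not> N \<le> n" using vanish[of n] by (metis mem_Collect_eq)
    then show "n \<in> {..<N}" by simp
  qed
  then show "finite {n. lam walg a b n \<noteq> \<zero>\<^bsub>walg\<^esub>}" by (rule finite_subset) simp
  fix n
  show "lam walg (der walg a) b n = \<ominus>\<^bsub>walg\<^esub> lam_shift walg (lam walg a b) n"
    using c d by (simp add: lam_shift_walg wd_minus) (simp add: walg_simps dprod_dderiv_left mult.left_commute)
  show "der walg (lam walg a b n) = lam walg a (der walg b) n \<ominus>\<^bsub>walg\<^esub> lam_shift walg (lam walg a b) n"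
    using c d by (simp add: lam_shift_walg)
      (simp add: walg_simps wd_diff dderiv_simps[abs_def] dderiv_dprod dprod_dderiv_left distrib_left right_diff_distrib mult.left_commute add.commute)
qed

interpretation walg: conformal_algebra R walg
  by (rule walg_conformal)

lemma walg_lam_swap:
  assumes "a \<in> carrier walg" "b \<in> carrier walg" "c \<in> carrier walg"
  shows "lam walg a (lam walg b c j) i = lam walg b (lam walg a c i) j"
proof -
  obtain x y z where "x \<in> dists" "a = wd x" "y \<in> dists" "b = wd y" "z \<in> dists" "c = wd z"
    using assms by (auto simp: walg_simps)
  then show ?thesis
    by (simp add: walg_simps dprod_scale_right dprod_commute[of i x] mult.left_commute[of "kap i"] del: frag_of_mult)
qed

text \<open>
  Dividing the \<open>n\<close>-products by \<open>n!\<close> turns the coefficients of associativity for \<open>n\<close>-products into those for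
  \<open>\<lambda>\<close>-products: both sides are \<open>1 / (j! k! (i - k)!)\<close>.
\<close>

lemma assoc_scalars:
  assumes "k \<le> i"
  shows "kap i * (kap j * of_nat (i choose k)) \<cong>\<^sub>0 of_nat (i - k + j choose j) * (kap (i - k + j) * kap k)"
proof -
  obtain l where i: "i = k + l" using assms le_Suc_ex by blast
  have 1: "fact k * (fact l * (k + l choose k)) = (fact (k + l) :: nat)"
    using binomial_fact_lemma[of k "k + l"] by (simp add: ac_simps)
  have 2: "fact j * (fact l * (l + j choose j)) = (fact (l + j) :: nat)"
    using binomial_fact_lemma[of j "l + j"] by (simp add: ac_simps)
  have "kap j * (kap (k + l) * of_nat (k + l choose k)) \<cong>\<^sub>0
      of_nat (fact l * (l + j choose j)) * kap (l + j) * (kap (k + l) * of_nat (k + l choose k))"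
    by (intro cong_null_mult2 kap_ratio[OF 2] cong_null_refl)
  also have "\<dots> = (of_nat (fact l * (k + l choose k)) * kap (k + l)) * (of_nat (l + j choose j) * kap (l + j))"
    by (simp only: of_nat_mult ac_simps)
  also have "\<dots> \<cong>\<^sub>0 kap k * (of_nat (l + j choose j) * kap (l + j))"
    by (intro cong_null_mult2 cong_null_sym[OF kap_ratio[OF 1]] cong_null_refl)
  finally show ?thesis unfolding i by (simp only: ac_simps diff_add_inverse)
qed

lemma walg_assoc: "walg.assoc_coeffs"
  unfolding walg.assoc_coeffs_def
proof (intro ballI allI)
  fix a b c i j assume "a \<in> carrier walg" "b \<in> carrier walg" "c \<in> carrier walg"
  then obtain x y z where x: "x \<in> dists" "a = wd x" and y: "y \<in> dists" "b = wd y" and z: "z \<in> dists" "c = wd z"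
    by (auto simp: walg_simps)
  let ?X = "\<lambda>k. dprod (i + j - k) (dprod k x y) z"
  let ?h = "\<lambda>k m. of_int (int (i - k + j choose j)) * (kap (i - k + j) * (kap k * dprod (i - k + j) (dprod k x y) z m))"
  have h: "?h k \<in> dists" for k using x y z by simp
  have "(\<Oplus>\<^bsub>walg\<^esub>k\<in>{..i}. [(int (i - k + j choose j))] \<cdot>\<^bsub>walg\<^esub> lam walg (lam walg a b k) c (i - k + j)) =
      (\<Oplus>\<^bsub>walg\<^esub>k\<in>{..i}. wd (?h k))"
    using x y z by (simp add: walg_simps wd_int_mult dprod_scale_left del: frag_of_mult of_int_of_nat_eq)
  also have "\<dots> = wd (\<lambda>m. \<Sum>k\<le>i. ?h k m)" by (rule wd_finsum, simp, rule h)
  also have "\<dots> = wd (\<lambda>m. kap i * (kap j * dprod i x (dprod j y z) m))"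
  proof (rule wd_cong_null)
    show "(\<lambda>m. \<Sum>k\<le>i. ?h k m) \<in> dists" using h by (rule dists_sum)
    show "(\<lambda>m. kap i * (kap j * dprod i x (dprod j y z) m)) \<in> dists" using x y z by simp
    fix m
    have "?h k m \<cong>\<^sub>0 kap i * (kap j * (of_nat (i choose k) * ?X k m))" if "k \<le> i" for k
      using cong_null_mult2[OF cong_null_sym[OF assoc_scalars[OF that, of j]] cong_null_refl, of "?X k m"] that
      by (simp only: mult.assoc of_int_of_nat_eq Nat.diff_add_assoc2[OF that, of j] )
    then have "(\<Sum>k\<le>i. ?h k m) \<cong>\<^sub>0 (\<Sum>k\<le>i. kap i * (kap j * (of_nat (i choose k) * ?X k m)))"
      by (intro cong_null_sum) simp
    then show "(\<Sum>k\<le>i. ?h k m) \<cong>\<^sub>0 kap i * (kap j * dprod i x (dprod j y z) m)"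
      by (simp only: dprod_assoc[of i x j y z m] sum_distrib_left)
  qed
  also have "\<dots> = lam walg a (lam walg b c j) i"
    using x y z by (simp add: walg_simps dprod_scale_right del: frag_of_mult)
  finally show "lam walg a (lam walg b c j) i =
      (\<Oplus>\<^bsub>walg\<^esub>k\<in>{..i}. [(int (i - k + j choose j))] \<cdot>\<^bsub>walg\<^esub> lam walg (lam walg a b k) c (i - k + j))" ..
qed

lemma dderiv_scale_funpow: "(\<partial> ^^ k) (\<lambda>m. r * c m) = (\<lambda>m. r * (\<partial> ^^ k) c m)"
  by (induction k) (simp_all add: dderiv_simps[abs_def])

lemma walg_der_funpow: "c \<in> dists \<Longrightarrow> (der walg ^^ k) (wd c) = wd ((\<partial> ^^ k) c)"
  by (induction k) (simp_all add: walg_simps)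

lemma walg_comm: "walg.comm_coeffs"
  unfolding walg.comm_coeffs_def
proof (intro ballI allI impI)
  fix a b m i assume a: "a \<in> carrier walg" and b: "b \<in> carrier walg" and bound: "\<forall>n>m. lam walg b a n = \<zero>\<^bsub>walg\<^esub>"
  obtain c d where c: "c \<in> dists" "a = wd c" and d: "d \<in> dists" "b = wd d" using a b by (auto simp: walg_simps)
  obtain N where N: "local_mod null_ideal N d c" using dists_local c d by blast
  \<comment> \<open>The bound for the sum and the locality exponent are unrelated, so enlarge both.\<close>
  define K where "K = max m (i + N)"
  let ?h = "\<lambda>n p. of_int ((- 1) ^ n * int (n choose i)) * (kap n * (\<partial> ^^ (n - i)) (dprod n d c) p)"
  have h: "?h n \<in> dists" for n by (rule dists_of_int) (use c d in simp)
  have N': "local_mod null_ideal (Suc K - i) d c"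
    by (rule local_mod_mono[OF null_ideal_ideal N]) (simp add: K_def)
  have "walg.skew_sum m b a i = walg.skew_sum K b a i"
    by (rule walg.skew_sum_mono[symmetric]) (use a b bound in \<open>auto simp: K_def\<close>)
  also have "\<dots> = (\<Oplus>\<^bsub>walg\<^esub>n\<in>{i..K}. wd (?h n))"
    unfolding walg.skew_sum_def using c d
    by (simp add: walg_simps walg_der_funpow wd_int_mult dderiv_scale_funpow del: of_int_mult of_int_of_nat_eq)
  also have "\<dots> = wd (\<lambda>p. \<Sum>n\<in>{i..K}. ?h n p)" by (rule wd_finsum, simp, rule h)
  also have "\<dots> = wd (\<lambda>p. kap i * dprod i c d p)"
  proof (rule wd_cong_null)
    show "(\<lambda>p. \<Sum>n\<in>{i..K}. ?h n p) \<in> dists" using h by (rule dists_sum)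
    show "(\<lambda>p. kap i * dprod i c d p) \<in> dists" using c d by simp
    fix p
    let ?g = "\<lambda>n. kap i * ((- 1) ^ n * ddpow (n - i) (dprod n d c) p)"
    have hg: "?h n p \<cong>\<^sub>0 ?g n" if n: "n \<in> {i..K}" for n
    proof -
      have f: "fact i * ((n choose i) * fact (n - i)) = (fact n :: nat)"
        using binomial_fact_lemma[of i n] n by (simp add: ac_simps)
      have "?h n p = (of_nat ((n choose i) * fact (n - i)) * kap n) * ((- 1) ^ n * ddpow (n - i) (dprod n d c) p)"
        by (simp only: dderiv_funpow of_int_mult of_int_power of_int_minus of_int_1 of_int_of_nat_eq of_nat_mult ac_simps)
      also have "\<dots> \<cong>\<^sub>0 ?g n"
        by (intro cong_null_mult2 cong_null_sym[OF kap_ratio[OF f]] cong_null_refl)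
      finally show ?thesis .
    qed
    have "(\<Sum>n\<in>{i..K}. ?h n p) \<cong>\<^sub>0 (\<Sum>n\<in>{i..K}. ?g n)"
      by (rule cong_null_sum) (rule hg)
    also have "(\<Sum>n\<in>{i..K}. ?g n) = kap i * (\<Sum>k<Suc K - i. (- 1) ^ (i + k) * ddpow k (dprod (i + k) d c) p)"
    proof -
      have "{i..K} = (\<lambda>k. i + k) ` {..<Suc K - i}"
      proof (intro equalityI subsetI)
        fix n assume "n \<in> {i..K}"
        then have "n = i + (n - i)" "n - i \<in> {..<Suc K - i}" by auto
        then show "n \<in> (\<lambda>k. i + k) ` {..<Suc K - i}" by blast
      qed (auto simp: K_def)
      then show ?thesis by (simp add: sum.reindex sum_distrib_left)
    qed
    also have "\<dots> \<cong>\<^sub>0 kap i * dprod i c d p"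
      by (rule cong_null_mult, rule cong_null_sym) (use dprod_skew[OF null_ideal_ideal N'] in \<open>simp add: cong_null_def\<close>)
    finally show "(\<Sum>n\<in>{i..K}. ?h n p) \<cong>\<^sub>0 kap i * dprod i c d p" .
  qed
  also have "\<dots> = lam walg a b i" using c d by (simp add: walg_simps)
  finally show "lam walg a b i = walg.skew_sum m b a i" ..
qed

lemma walg_commutative: "commutative_conformal_algebra R walg"
  by (rule walg.commutative_from_coeffs[OF walg_assoc walg_comm])

lemma walg_derivation: "conf_derivation R walg wD"
  unfolding conf_derivation_def
proof (intro conjI ballI allI)
  show "linear_map R walg walg wD"
    by (rule linear_map_walg[of _ dD]) (simp_all add: walg_simps dpoly_deriv_mult)
  fix a assume "a \<in> carrier walg"
  then obtain c where c: "c \<in> dists" "a = wd c" by (auto simp: walg_simps)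
  then show "wD (der walg a) = der walg (wD a)" by (simp add: walg_simps dD_dderiv)
  fix b n assume "b \<in> carrier walg"
  then obtain d where d: "d \<in> dists" "b = wd d" by (auto simp: walg_simps)
  have "(\<lambda>m. \<D> (kap n * dprod n c d m)) = (\<lambda>m. kap n * (dprod n (dD c) d m + dprod n c (dD d) m))"
    using fun_cong[OF dprod_derivation'[of n c d]] by (simp add: dpoly_deriv_mult)
  then show "wD (lam walg a b n) = lam walg (wD a) b n \<oplus>\<^bsub>walg\<^esub> lam walg a (wD b) n"
    using c d by (simp add: walg_simps distrib_left)
qed

definition embed :: "'v \<Rightarrow> ('v + 'k + nat) list"
  where "embed v = wd (lift v)"

lemma embed_eqI:
  assumes "c \<in> dists" "\<And>m. homog (- 1) (c m)"
  shows "embed (F (\<lambda>m. eval (c m))) = wd c"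
  unfolding embed_def using lift_equiv[OF assms] assms(1) by (simp add: wd_eq)

lemma lift_W: "v \<in> carrier V \<Longrightarrow> (\<lambda>m. eval (lift v m)) \<in> W"
  by (rule eval_dists) (rule lift)

lemma embed_linear: "linear_map R V walg embed"
  unfolding linear_map_def
proof (intro conjI ballI)
  show "embed \<in> carrier V \<rightarrow> carrier walg" by (auto simp: embed_def lift wd_carrier)
  fix v assume v: "v \<in> carrier V"
  show "embed (v \<oplus>\<^bsub>V\<^esub> u) = embed v \<oplus>\<^bsub>walg\<^esub> embed u" if u: "u \<in> carrier V" for u
  proof -
    have "v \<oplus>\<^bsub>V\<^esub> u = F (\<lambda>m. eval (lift v m + lift u m))"
      using F_add[OF lift_W[OF v] lift_W[OF u]] u v by (simp add: lift)
    then show ?thesis using embed_eqI[of "\<lambda>m. lift v m + lift u m"] u v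
      by (simp add: lift homog_add) (simp add: embed_def walg_simps lift)
  qed
  show "embed (k \<odot>\<^bsub>V\<^esub> v) = k \<odot>\<^bsub>walg\<^esub> embed v" if k: "k \<in> carrier R" for k
  proof -
    have "k \<odot>\<^bsub>V\<^esub> v = F (\<lambda>m. eval (var (Sc k) * lift v m))"
      using F_sm[OF k lift_W[OF v]] v by (simp add: lift eval_scalar)
    moreover have "homog (- 1) (var (Sc k) * lift v m)" for m
      using homog_mult[of 0 "var (Sc k)" "- 1" "lift v m"] lift(2)[OF v] by simp
    ultimately have "embed (k \<odot>\<^bsub>V\<^esub> v) = wd (\<lambda>m. var (Sc k) * lift v m)"
      using embed_eqI[of "\<lambda>m. var (Sc k) * lift v m"] lift(1)[OF v] by simp
    then show ?thesis using v by (simp add: embed_def walg_simps lift)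
  qed
qed

lemma embed_der: "v \<in> carrier V \<Longrightarrow> embed (der V v) = der walg (embed v)"
proof -
  assume v: "v \<in> carrier V"
  have "der V v = F (\<lambda>m. eval (\<partial> (lift v) m))"
    using F_deriv[OF lift_W[OF v]] v by (simp add: lift eval_dderiv[abs_def])
  then show ?thesis using embed_eqI[of "\<partial> (lift v)"] v
    by (simp add: lift homog_dderiv) (simp add: embed_def walg_simps lift)
qed

text \<open>
  The left factor has \<open>D\<close> applied to it, so the product has weight \<open>-1\<close> and its value is the \<open>n\<close>-product in \<open>V\<close>.
\<close>

lemma embed_lam:
  assumes v: "v \<in> carrier V" and u: "u \<in> carrier V"
  shows "embed (lam V v u n) = lam walg (wD (embed v)) (embed u) n"
proof -
  let ?c = "\<lambda>m. kap n * dprod n (dD (lift v)) (lift u) m"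
  have "(\<lambda>m. eval (dprod n (dD (lift v)) (lift u) m)) = nprod_dist n (\<lambda>m. eval (lift v m)) (\<lambda>m. eval (lift u m))"
    by (rule ext, rule eval_dprod) (simp add: lift v)
  then have "F (\<lambda>m. eval (?c m)) = inv_fact n \<odot>\<^bsub>V\<^esub> nprod V n v u"
    using F_sm[OF inv_fact_closed W_prod[OF lift_W[OF v] lift_W[OF u]], of n n] F_prod[OF lift_W[OF v] lift_W[OF u], of n] v u
    by (simp add: eval_scalar fun_eq_iff lift)
  also have "\<dots> = lam V v u n" using v u inv_fact_smult by (simp add: nprod_def)
  finally have F: "F (\<lambda>m. eval (?c m)) = lam V v u n" .
  have D: "homog 0 (\<D> (lift v m))" for m using homog_deriv[of "- 1" "lift v m"] v by (simp add: lift)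
  have "homog (- 1) (dprod n (dD (lift v)) (lift u) m)" for m
    using homog_dprod[of 0 "dD (lift v)" "- 1" "lift u" n m] D u by (simp add: lift)
  then have hom: "homog (- 1) (?c m)" for m using homog_mult[of 0 "kap n" "- 1"] by simp
  have "embed (lam V v u n) = wd ?c"
    using embed_eqI[of ?c] hom F u v by (simp add: lift)
  then show ?thesis using u v by (simp add: embed_def walg_simps lift)
qed

text \<open>
  This is where the ideal generated by the kernel must not have grown in weight \<open>-1\<close>.
\<close>

lemma embed_inj: "inj_on embed (carrier V)"
proof (rule inj_onI)
  fix v u assume v: "v \<in> carrier V" and u: "u \<in> carrier V" and "embed v = embed u"
  then have "lift v \<approx> lift u" by (simp add: embed_def wd_eq lift)
  then have "(\<lambda>m. eval (lift v m - lift u m)) \<in> F_kernel"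
    unfolding equiv_dist_def by (rule null_dists_eval[OF dist_ideal_F_kernel])
  then have "v \<ominus>\<^bsub>V\<^esub> u = \<zero>\<^bsub>V\<^esub>" using F_diff[OF lift_W[OF v] lift_W[OF u]] u v by (simp add: F_kernel_def lift)
  then show "v = u" using u v by (metis V.eq_minusI V.l_zero V.r_neg V.minus_eq V.a_inv_closed V.minus_equality V.minus_minus V.zero_closed V.r_zero V.a_comm)
qed

theorem special_V: "special R V"
proof -
  have nov: "novikov_conformal_algebra R V"
    by (rule novikov_of_derived_embedding[OF V.conformal_algebra_axioms walg_conformal walg_assoc walg_comm
          walg_lam_swap walg_derivation embed_linear embed_inj embed_der embed_lam])
  let ?S = "embed ` carrier V"
  let ?D = "derived_novikov walg wD"
  interpret e: linear_hom R V walg embed by unfold_locales (rule embed_linear)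
  have nprod: "nprod ?D n (embed v) (embed u) = embed (nprod V n v u)" if "v \<in> carrier V" "u \<in> carrier V" for v u n
  proof -
    have "embed ([k] \<cdot>\<^bsub>V\<^esub> x) = [k] \<cdot>\<^bsub>walg\<^esub> embed x" if "x \<in> carrier V" for x and k :: nat
      using e.hom_int_mult[OF that, of "int k"] by (simp add: add_pow_def int_pow_int)
    then show ?thesis using that embed_lam[OF that, of n]
      by (simp add: nprod_def derived_novikov_def add_pow_def)
  qed
  have sub: "submodule ?S R walg"
  proof (rule walg.submoduleI)
    show "?S \<subseteq> carrier walg" using e.hom_closed by blast
    show "\<zero>\<^bsub>walg\<^esub> \<in> ?S" using e.hom_zero V.zero_closed by (metis imageI)
    show "\<ominus>\<^bsub>walg\<^esub> a \<in> ?S" if "a \<in> ?S" for a using that by (auto simp flip: e.hom_neg)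
    show "a \<oplus>\<^bsub>walg\<^esub> b \<in> ?S" if "a \<in> ?S" "b \<in> ?S" for a b using that by (auto simp flip: e.hom_add)
    show "k \<odot>\<^bsub>walg\<^esub> a \<in> ?S" if "k \<in> carrier R" "a \<in> ?S" for k a using that by (auto simp flip: e.hom_smult)
  qed
  have "submodule ?S R ?D"
    using sub unfolding submodule_def submodule_axioms_def subgroup_def derived_novikov_def by (simp add: m_inv_def)
  then have "conf_subalgebra R ?D ?S"
    unfolding conf_subalgebra_def
    by (auto simp: nprod derived_novikov_def embed_der[symmetric] V.der_closed nprod_def[of V])
      (auto simp: nprod[unfolded derived_novikov_def] nprod_def[of V])
  moreover have "embed \<in> conf_hom R V (?D\<lparr>carrier := ?S\<rparr>)"
    unfolding conf_hom_def
  proof (intro CollectI conjI ballI allI)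
    show "linear_map R V (?D\<lparr>carrier := ?S\<rparr>) embed"
      using embed_linear by (auto simp: linear_map_def derived_novikov_def)
    fix a assume a: "a \<in> carrier V"
    show "embed (der V a) = der (?D\<lparr>carrier := ?S\<rparr>) (embed a)"
      using embed_der[OF a] by (simp add: derived_novikov_def)
    fix b n assume b: "b \<in> carrier V"
    have "nprod (?D\<lparr>carrier := ?S\<rparr>) n (embed a) (embed b) = nprod ?D n (embed a) (embed b)"
      by (simp add: nprod_def add_pow_def nat_pow_def)
    then show "embed (nprod V n a b) = nprod (?D\<lparr>carrier := ?S\<rparr>) n (embed a) (embed b)"
      by (simp only: nprod[OF a b])
  qed
  moreover have "bij_betw embed (carrier V) ?S"
    using embed_inj by (simp add: bij_betw_def)
  ultimately show ?thesis
    unfolding special_def using nov walg_commutative walg_derivation by blast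
qed

end

section \<open>Distributions with values in a Novikov algebra\<close>

lemma (in Module.module) nat_smult: "y \<in> carrier M \<Longrightarrow> ([(n::nat)] \<cdot>\<^bsub>R\<^esub> \<one>\<^bsub>R\<^esub>) \<odot>\<^bsub>M\<^esub> y = [n] \<cdot>\<^bsub>M\<^esub> y"
  by (induction n) (simp_all add: smult_l_distr)

lemma (in Module.module) inverse_factor_cancel:
  assumes R: "field R" and nz: "[(n::nat)] \<cdot>\<^bsub>R\<^esub> \<one>\<^bsub>R\<^esub> \<noteq> \<zero>\<^bsub>R\<^esub>" and y: "y \<in> carrier M"
  shows "inv\<^bsub>R\<^esub> ([n] \<cdot>\<^bsub>R\<^esub> \<one>\<^bsub>R\<^esub>) \<in> carrier R"
    and "[n] \<cdot>\<^bsub>M\<^esub> (inv\<^bsub>R\<^esub> ([n] \<cdot>\<^bsub>R\<^esub> \<one>\<^bsub>R\<^esub>) \<odot>\<^bsub>M\<^esub> y) = y"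
    and "inv\<^bsub>R\<^esub> ([n] \<cdot>\<^bsub>R\<^esub> \<one>\<^bsub>R\<^esub>) \<odot>\<^bsub>M\<^esub> ([n] \<cdot>\<^bsub>M\<^esub> y) = y"
proof -
  let ?c = "[n] \<cdot>\<^bsub>R\<^esub> \<one>\<^bsub>R\<^esub>"
  have u: "?c \<in> Units R" using nz by (simp add: field.field_Units[OF R])
  then show i: "inv\<^bsub>R\<^esub> ?c \<in> carrier R" by simp
  have c: "?c \<in> carrier R" by simp
  show "[n] \<cdot>\<^bsub>M\<^esub> (inv\<^bsub>R\<^esub> ?c \<odot>\<^bsub>M\<^esub> y) = y"
    using nat_smult[of "inv\<^bsub>R\<^esub> ?c \<odot>\<^bsub>M\<^esub> y" n] smult_assoc1[OF c i y] u y i by simp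
  show "inv\<^bsub>R\<^esub> ?c \<odot>\<^bsub>M\<^esub> ([n] \<cdot>\<^bsub>M\<^esub> y) = y"
    using nat_smult[OF y, of n] smult_assoc1[OF i c y] u y by simp
qed

text \<open>
  \<open>f0\<close> is a homomorphism from the conformal algebra generated by the series \<open>S\<close> onto \<open>V\<close>.  An index whose series does
  not belong to \<open>S\<close> is required to have series zero.
\<close>

locale distribution_image = novikov_algebra R A + V: conformal_algebra R V
  for R :: "('k, 'm) ring_scheme" and A :: "('k, 'a, 'n) module_scheme" (structure) and V :: "('k, 'v) conf_alg" +
  fixes g :: "'x \<times> int \<Rightarrow> 'a" and M :: nat and S :: "(int \<Rightarrow> 'a) set" and f0 :: "(int \<Rightarrow> 'a) \<Rightarrow> 'v"
  assumes field: "field R"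
    and char0: "n > 0 \<Longrightarrow> [(n::nat)] \<cdot>\<^bsub>R\<^esub> \<one>\<^bsub>R\<^esub> \<noteq> \<zero>\<^bsub>R\<^esub>"
    and g_closed: "g x \<in> carrier A"
    and g_local: "ev g ((nabla ^^ M) (\<lambda>p q. fn_mul (fn_gen (a, p)) (fn_gen (b, q))) i j) = \<zero>"
    and S_gens: "S \<subseteq> range (\<lambda>a i. g (a, - i - 1))"
    and gens_S: "(\<lambda>i. g (a, - i - 1)) \<in> insert (\<lambda>i. \<zero>) S"
    and f0_hom: "f0 \<in> conf_hom R ((distributions R A)\<lparr>carrier := conf_subalgebra R (distributions R A) hull S\<rparr>) V"
    and f0_surj: "f0 ` (conf_subalgebra R (distributions R A) hull S) = carrier V"
begin

abbreviation E :: "('k, int \<Rightarrow> 'a) conf_alg" where "E \<equiv> distributions R A"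
abbreviation H :: "(int \<Rightarrow> 'a) set" where "H \<equiv> conf_subalgebra R E hull S"

lemma dist_simps:
  "carrier E = {f. \<forall>i. f i \<in> carrier A}" "\<zero>\<^bsub>E\<^esub> = (\<lambda>i. \<zero>)" "f \<oplus>\<^bsub>E\<^esub> h = (\<lambda>i. f i \<oplus> h i)"
  "k \<odot>\<^bsub>E\<^esub> f = (\<lambda>i. k \<odot> f i)" "der E f = (\<lambda>i. [(i + 1)] \<cdot> f (i + 1))"
  by (simp_all add: distributions_def)

lemma dist_abelian_group: "abelian_group E"
proof (rule abelian_groupI)
  fix f assume "f \<in> carrier E"
  then have "(\<lambda>i. \<ominus> f i) \<in> carrier E" "(\<lambda>i. \<ominus> f i) \<oplus>\<^bsub>E\<^esub> f = \<zero>\<^bsub>E\<^esub>" by (simp_all add: dist_simps l_neg)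
  then show "\<exists>h\<in>carrier E. h \<oplus>\<^bsub>E\<^esub> f = \<zero>\<^bsub>E\<^esub>" by blast
qed (auto simp: dist_simps a_ac)

lemma dist_neg: "f \<in> carrier E \<Longrightarrow> \<ominus>\<^bsub>E\<^esub> f = (\<lambda>i. \<ominus> f i)"
  by (rule abelian_group.minus_equality[OF dist_abelian_group]) (simp_all add: dist_simps l_neg)

lemma dist_nat_mult: "[(k::nat)] \<cdot>\<^bsub>E\<^esub> f = (\<lambda>i. [k] \<cdot> f i)"
  by (induction k) (simp_all add: add_pow_def nat_pow_def dist_simps)

abbreviation inv_fact :: "nat \<Rightarrow> 'k" where "inv_fact n \<equiv> inv\<^bsub>R\<^esub> ([(fact n :: nat)] \<cdot>\<^bsub>R\<^esub> \<one>\<^bsub>R\<^esub>)"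

lemma fact_nonzero: "[(fact n :: nat)] \<cdot>\<^bsub>R\<^esub> \<one>\<^bsub>R\<^esub> \<noteq> \<zero>\<^bsub>R\<^esub>"
  by (rule char0) simp

lemma dist_prod_closed: "f \<in> carrier E \<Longrightarrow> h \<in> carrier E \<Longrightarrow> dist_prod A n f h i \<in> carrier A"
  unfolding dist_prod_def by (rule finsum_closed) (auto simp: dist_simps mult_closed)

lemma nprod_dist: "f \<in> carrier E \<Longrightarrow> h \<in> carrier E \<Longrightarrow> nprod E n f h = dist_prod A n f h"
  using inverse_factor_cancel(2)[OF field fact_nonzero dist_prod_closed]
  by (simp add: nprod_def dist_nat_mult) (simp add: distributions_def)

lemma conf_subalgebraD:
  assumes "conf_subalgebra R E T"
  shows "T \<subseteq> carrier E" "\<zero>\<^bsub>E\<^esub> \<in> T" "f \<in> T \<Longrightarrow> h \<in> T \<Longrightarrow> f \<oplus>\<^bsub>E\<^esub> h \<in> T" "f \<in> T \<Longrightarrow> \<ominus>\<^bsub>E\<^esub> f \<in> T"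
    "k \<in> carrier R \<Longrightarrow> f \<in> T \<Longrightarrow> k \<odot>\<^bsub>E\<^esub> f \<in> T" "f \<in> T \<Longrightarrow> der E f \<in> T" "f \<in> T \<Longrightarrow> h \<in> T \<Longrightarrow> nprod E n f h \<in> T"
proof -
  from assms have s: "submodule T R E" by (simp add: conf_subalgebra_def)
  then interpret T: subgroup T "add_monoid E" by (simp add: submodule_def)
  show "T \<subseteq> carrier E" "\<zero>\<^bsub>E\<^esub> \<in> T" "f \<in> T \<Longrightarrow> h \<in> T \<Longrightarrow> f \<oplus>\<^bsub>E\<^esub> h \<in> T" "f \<in> T \<Longrightarrow> \<ominus>\<^bsub>E\<^esub> f \<in> T"
    using T.subset T.one_closed T.m_closed T.m_inv_closed by (auto simp: a_inv_def)
  show "k \<in> carrier R \<Longrightarrow> f \<in> T \<Longrightarrow> k \<odot>\<^bsub>E\<^esub> f \<in> T"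
    using s by (simp add: submodule_def submodule_axioms_def)
  show "f \<in> T \<Longrightarrow> der E f \<in> T" "f \<in> T \<Longrightarrow> h \<in> T \<Longrightarrow> nprod E n f h \<in> T"
    using assms by (simp_all add: conf_subalgebra_def)
qed

lemma hull_closed:
  "\<zero>\<^bsub>E\<^esub> \<in> H" "f \<in> H \<Longrightarrow> h \<in> H \<Longrightarrow> f \<oplus>\<^bsub>E\<^esub> h \<in> H" "f \<in> H \<Longrightarrow> \<ominus>\<^bsub>E\<^esub> f \<in> H"
  "k \<in> carrier R \<Longrightarrow> f \<in> H \<Longrightarrow> k \<odot>\<^bsub>E\<^esub> f \<in> H" "f \<in> H \<Longrightarrow> der E f \<in> H" "f \<in> H \<Longrightarrow> h \<in> H \<Longrightarrow> nprod E n f h \<in> H"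
  unfolding hull_def using conf_subalgebraD by auto

text \<open>
  Passes from modes to powers of \<open>z\<close>: the mode \<open>m\<close> is the coefficient of \<open>z\<^sup>-\<^sup>m\<^sup>-\<^sup>1\<close>.
\<close>

definition distA :: "(int \<Rightarrow> ('k, 'x \<times> int) free_nov) \<Rightarrow> int \<Rightarrow> 'a"
  where "distA f i = ev g (f (- i - 1))"

definition W :: "(int \<Rightarrow> ('k, 'x \<times> int) free_nov) set"
  where "W = {f. distA f \<in> H}"

definition J :: "('k, 'x \<times> int) free_nov set"
  where "J = {t. ev g t = \<zero>}"

lemmas evs = ev_simps[OF g_closed]

lemma distA_closed: "distA f \<in> carrier E"
  by (simp add: dist_simps distA_def evs)

lemma distA_add: "distA (\<lambda>m. f m + h m) = distA f \<oplus>\<^bsub>E\<^esub> distA h"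
  by (simp add: fun_eq_iff distA_def dist_simps evs)

lemma distA_neg: "distA (\<lambda>m. - f m) = \<ominus>\<^bsub>E\<^esub> distA f"
  by (simp add: dist_neg distA_closed) (simp add: fun_eq_iff distA_def evs)

lemma distA_diff: "distA (\<lambda>m. f m - h m) = distA f \<oplus>\<^bsub>E\<^esub> \<ominus>\<^bsub>E\<^esub> distA h"
  using distA_add[of f "\<lambda>m. - h m"] by (simp add: distA_neg)

lemma distA_zero: "distA (\<lambda>m. 0) = \<zero>\<^bsub>E\<^esub>"
  by (simp add: fun_eq_iff distA_def dist_simps evs)

lemma distA_sm: "distA (\<lambda>m. fn_sm k (f m)) = (if k \<in> carrier R then k \<odot>\<^bsub>E\<^esub> distA f else \<zero>\<^bsub>E\<^esub>)"
  by (simp add: fun_eq_iff distA_def dist_simps evs scal_def)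

lemma distA_deriv: "distA (novikov_ops.nderiv_dist f) = der E (distA f)"
proof -
  interpret novikov_ops "fn_mul :: ('k, 'x \<times> int) free_nov \<Rightarrow> _" fn_sm by (rule fn_novikov)
  have "- intmul (- i - 1) x = intmul (i + 1) x" for i and x :: "('k, 'x \<times> int) free_nov"
    using intmul_diff[of 0 "- i - 1" x] by (simp add: add.commute)
  then show ?thesis
    by (simp add: fun_eq_iff distA_def dist_simps nderiv_dist_def ev_intmul[OF g_closed] diff_diff_eq)
qed

lemma distA_prod: "distA (novikov_ops.nprod_dist fn_mul n f h) = nprod E n (distA f) (distA h)"
proof -
  interpret novikov_ops "fn_mul :: ('k, 'x \<times> int) free_nov \<Rightarrow> _" fn_sm by (rule fn_novikov)
  show ?thesis unfolding nprod_dist[OF distA_closed distA_closed]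
    by (simp add: fun_eq_iff distA_def dist_prod_def nprod_dist_def nablas_binomial ev_sum[OF g_closed]
        ev_intmul[OF g_closed] evs algebra_simps)
qed

lemma ev_cong: "x - y \<in> J \<Longrightarrow> ev g x = ev g y"
proof -
  assume "x - y \<in> J"
  moreover have "ev g (x - y + y) = ev g (x - y) \<oplus> ev g y" by (rule evs)
  ultimately show ?thesis by (simp add: J_def evs(1))
qed

lemma distA_cong: "(\<And>m. f m - h m \<in> J) \<Longrightarrow> distA f = distA h"
  unfolding distA_def by (rule ext, rule ev_cong) simp

lemma ev_J: "ev g x = ev g y \<Longrightarrow> x - y \<in> J"
  by (simp add: J_def evs a_minus_def r_neg)

sublocale ce: conformal_eval fn_mul fn_sm fn_gen J M inv_fact W
proof (intro conformal_eval.intro local_novikov_eval.intro novikov_eval.intro fn_novikov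
    local_novikov_eval_axioms.intro conformal_eval_axioms.intro)
  interpret novikov_ops "fn_mul :: ('k, 'x \<times> int) free_nov \<Rightarrow> _" fn_sm by (rule fn_novikov)
  fix x y :: "('k, 'x \<times> int) free_nov" and k and a b :: 'x and m n and f h :: "int \<Rightarrow> ('k, 'x \<times> int) free_nov"
  show "0 \<in> J" by (simp add: J_def evs)
  show "x \<in> J \<Longrightarrow> y \<in> J \<Longrightarrow> x - y \<in> J" by (simp add: J_def evs a_minus_def r_neg)
  show "y \<in> J \<Longrightarrow> fn_mul x y \<in> J" "x \<in> J \<Longrightarrow> fn_mul x y \<in> J" by (simp_all add: J_def evs mult_zero)
  show "x \<in> J \<Longrightarrow> fn_sm k x \<in> J" by (simp add: J_def evs scal_def)
  show "(nabla ^^ M) (\<lambda>m n. fn_mul (fn_gen (a, m)) (fn_gen (b, n))) m n \<in> J" for m n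
    using g_local by (simp add: J_def)
  show "fn_sm (inv_fact n) (intmul (fact n) x) - x \<in> J" for n
  proof (rule ev_J)
    have "ev g (intmul (int (fact n)) x) = [(fact n :: nat)] \<cdot> ev g x"
      by (simp only: ev_intmul[OF g_closed] add_pow_def int_pow_int)
    then show "ev g (fn_sm (inv_fact n) (intmul (fact n) x)) = ev g x"
      using inverse_factor_cancel[OF field fact_nonzero evs(1)] by (simp add: evs scal_def)
  qed
  show "(\<lambda>n. fn_gen (a, n)) \<in> W"
  proof -
    have "distA (\<lambda>n. fn_gen (a, n)) = (\<lambda>i. g (a, - i - 1))" by (simp add: fun_eq_iff distA_def evs)
    then show ?thesis using gens_S[of a] hull_closed(1) hull_subset[of S] by (auto simp: W_def dist_simps)
  qed
  show "f \<in> W \<Longrightarrow> h \<in> W \<Longrightarrow> (\<lambda>m. f m - h m) \<in> W" by (simp add: W_def distA_diff hull_closed)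
  show "f \<in> W \<Longrightarrow> (\<lambda>m. fn_sm k (f m)) \<in> W" by (simp add: W_def distA_sm hull_closed)
  show "f \<in> W \<Longrightarrow> nderiv_dist f \<in> W" by (simp add: W_def distA_deriv hull_closed)
  show "f \<in> W \<Longrightarrow> (\<And>m. f m - h m \<in> J) \<Longrightarrow> h \<in> W" using distA_cong[of f h] by (simp add: W_def)
  show "f \<in> W \<Longrightarrow> h \<in> W \<Longrightarrow> nprod_dist n f h \<in> W" for n by (simp add: W_def distA_prod hull_closed)
qed

text \<open>
  The values of distributions of weight \<open>-1\<close> form a subalgebra containing the generating series.
\<close>

lemma hull_realized:
  assumes "h \<in> H"
  shows "\<exists>c\<in>ce.dists. (\<forall>m. homog (- 1) (c m)) \<and> distA (\<lambda>m. ce.eval (c m)) = h"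
proof -
  define T where "T = {distA (\<lambda>m. ce.eval (c m)) | c. c \<in> ce.dists \<and> (\<forall>m. homog (- 1) (c m))}"
  have TI: "h \<in> T" if "c \<in> ce.dists" "\<And>m. homog (- 1) (c m)" "distA (\<lambda>m. ce.eval (c m)) = h" for c h
    using that by (auto simp: T_def)
  have "conf_subalgebra R E T"
    unfolding conf_subalgebra_def submodule_def submodule_axioms_def
  proof (intro conjI allI impI ballI)
    show "subgroup T (add_monoid E)"
    proof (rule group.subgroupI)
      show "group (add_monoid E)" using dist_abelian_group by (rule abelian_group.a_group)
      show "T \<subseteq> carrier (add_monoid E)" using distA_closed by (auto simp: T_def)
      have "\<zero>\<^bsub>E\<^esub> \<in> T" by (rule TI[of "\<lambda>m. 0"]) (simp_all add: ce.dists.zero distA_zero)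
      then show "T \<noteq> {}" by blast
      fix a assume "a \<in> T"
      then obtain c where c: "c \<in> ce.dists" "\<And>m. homog (- 1) (c m)" "a = distA (\<lambda>m. ce.eval (c m))" by (auto simp: T_def)
      have "\<ominus>\<^bsub>E\<^esub> a \<in> T"
        by (rule TI[of "\<lambda>m. - c m"]) (use c in \<open>simp_all add: ce.dists.minus homog_minus distA_neg\<close>)
      then show "inv\<^bsub>add_monoid E\<^esub> a \<in> T" by (simp add: a_inv_def)
      fix b assume "b \<in> T"
      then obtain d where d: "d \<in> ce.dists" "\<And>m. homog (- 1) (d m)" "b = distA (\<lambda>m. ce.eval (d m))" by (auto simp: T_def)
      have "a \<oplus>\<^bsub>E\<^esub> b \<in> T"
        by (rule TI[of "\<lambda>m. c m + d m"]) (use c d in \<open>simp_all add: ce.dists.add homog_add distA_add\<close>)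
      then show "a \<otimes>\<^bsub>add_monoid E\<^esub> b \<in> T" by simp
    qed
    fix a assume "a \<in> T"
    then obtain c where c: "c \<in> ce.dists" "\<And>m. homog (- 1) (c m)" "a = distA (\<lambda>m. ce.eval (c m))" by (auto simp: T_def)
    show "der E a \<in> T"
      by (rule TI[of "\<partial> c"])
        (use c in \<open>simp_all add: ce.dists.deriv ce.homog_dderiv ce.eval_dderiv[abs_def] distA_deriv[symmetric]\<close>)
    fix b n assume "b \<in> T"
    then obtain d where d: "d \<in> ce.dists" "\<And>m. homog (- 1) (d m)" "b = distA (\<lambda>m. ce.eval (d m))" by (auto simp: T_def)
    have D: "homog 0 (\<D> (c m))" for m using homog_deriv[of "- 1" "c m"] c by simp
    show "nprod E n a b \<in> T"
    proof (rule TI[of "dprod n (ce.dD c) d"])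
      show "dprod n (ce.dD c) d \<in> ce.dists" using c d by (auto intro: ce.dists.prod ce.dists_dD)
      show "homog (- 1) (dprod n (ce.dD c) d m)" for m
        using ce.homog_dprod[of 0 "ce.dD c" "- 1" d n m] D d by simp
      have "(\<lambda>m. ce.eval (dprod n (ce.dD c) d m)) = ce.nprod_dist n (\<lambda>m. ce.eval (c m)) (\<lambda>m. ce.eval (d m))"
        by (rule ext, rule ce.eval_dprod) (rule c)
      then show "distA (\<lambda>m. ce.eval (dprod n (ce.dD c) d m)) = nprod E n a b"
        by (simp only: c(3) d(3) distA_prod)
    qed
  next
    fix k a assume k: "k \<in> carrier R" "a \<in> T"
    then obtain c where c: "c \<in> ce.dists" "\<And>m. homog (- 1) (c m)" "a = distA (\<lambda>m. ce.eval (c m))" by (auto simp: T_def)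
    have "homog (- 1) (var (Sc k) * c m)" for m using homog_mult[of 0 "var (Sc k)" "- 1" "c m"] c by simp
    then show "k \<odot>\<^bsub>E\<^esub> a \<in> T"
      by (intro TI[of "\<lambda>m. var (Sc k) * c m"]) (use c k in \<open>simp_all add: ce.dists.scale ce.eval_scalar distA_sm\<close>)
  qed
  moreover have "S \<subseteq> T"
  proof
    fix s assume "s \<in> S"
    then obtain a where a: "s = (\<lambda>i. g (a, - i - 1))" using S_gens by blast
    show "s \<in> T"
    proof (rule TI[of "ce.gdist a 0"])
      show "ce.gdist a 0 \<in> ce.dists" by (rule ce.dists.gen)
      show "homog (- 1) (ce.gdist a 0 m)" for m by (simp add: ce.gdist_def)
      show "distA (\<lambda>m. ce.eval (ce.gdist a 0 m)) = s"
        by (simp only: ce.gdist_def ce.eval_gen) (simp add: a fun_eq_iff distA_def evs)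
    qed
  qed
  ultimately have "h \<in> T" using assms by (auto simp: hull_def)
  then show ?thesis by (auto simp: T_def)
qed

theorem image_special: "special R V"
proof -
  let ?H = "E\<lparr>carrier := H\<rparr>"
  have nprod_H: "nprod ?H n x y = nprod E n x y" for n x y
    by (simp add: nprod_def add_pow_def nat_pow_def)
  have hom: "linear_map R ?H V f0" "\<And>x. x \<in> H \<Longrightarrow> f0 (der E x) = der V (f0 x)"
    "\<And>x y n. x \<in> H \<Longrightarrow> y \<in> H \<Longrightarrow> f0 (nprod E n x y) = nprod V n (f0 x) (f0 y)"
    using f0_hom by (simp_all add: conf_hom_def nprod_H)
  have lin: "\<And>x. x \<in> H \<Longrightarrow> f0 x \<in> carrier V" "\<And>x y. x \<in> H \<Longrightarrow> y \<in> H \<Longrightarrow> f0 (x \<oplus>\<^bsub>E\<^esub> y) = f0 x \<oplus>\<^bsub>V\<^esub> f0 y"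
    "\<And>k x. k \<in> carrier R \<Longrightarrow> x \<in> H \<Longrightarrow> f0 (k \<odot>\<^bsub>E\<^esub> x) = k \<odot>\<^bsub>V\<^esub> f0 x"
    using hom(1) by (auto simp: linear_map_def)
  interpret sc: special_construction fn_mul fn_sm fn_gen J M inv_fact W R V "\<lambda>f. f0 (distA f)"
  proof
    fix f h :: "int \<Rightarrow> ('k, 'x \<times> int) free_nov" and k l n and x :: "('k, 'x \<times> int) free_nov"
    show "f \<in> W \<Longrightarrow> f0 (distA f) \<in> carrier V" by (simp add: W_def lin)
    show "f \<in> W \<Longrightarrow> h \<in> W \<Longrightarrow> f0 (distA (\<lambda>m. f m + h m)) = f0 (distA f) \<oplus>\<^bsub>V\<^esub> f0 (distA h)"
      by (simp add: W_def distA_add lin)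
    show "k \<in> carrier R \<Longrightarrow> f \<in> W \<Longrightarrow> f0 (distA (\<lambda>m. fn_sm k (f m))) = k \<odot>\<^bsub>V\<^esub> f0 (distA f)"
      by (simp add: W_def distA_sm lin)
    show "f \<in> W \<Longrightarrow> f0 (distA (ce.nderiv_dist f)) = der V (f0 (distA f))"
      by (simp only: W_def mem_Collect_eq distA_deriv hom(2))
    show "f \<in> W \<Longrightarrow> h \<in> W \<Longrightarrow> f0 (distA (ce.nprod_dist n f h)) = nprod V n (f0 (distA f)) (f0 (distA h))"
      by (simp only: W_def mem_Collect_eq distA_prod hom(3))
    show "f \<in> W \<Longrightarrow> (\<And>m. f m - h m \<in> J) \<Longrightarrow> f0 (distA f) = f0 (distA h)"
      using distA_cong[of f h] by simp
    show "\<exists>c\<in>ce.dists. (\<forall>m. homog (- 1) (c m)) \<and> f0 (distA (\<lambda>m. ce.eval (c m))) = v" if v: "v \<in> carrier V" for v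
    proof -
      from v have "v \<in> f0 ` H" by (simp only: f0_surj)
      then obtain y where y: "v = f0 y" "y \<in> H" by (rule imageE)
      from hull_realized[OF y(2)] obtain c where "c \<in> ce.dists" "\<forall>m. homog (- 1) (c m)" "distA (\<lambda>m. ce.eval (c m)) = y"
        by (elim bexE conjE)
      then show ?thesis by (intro bexI[of _ c] conjI) (simp_all only: y simp_thms)
    qed
    show "k \<notin> carrier R \<Longrightarrow> fn_sm k x \<in> J" by (simp add: J_def evs scal_def)
    show "fn_sm (k \<oplus>\<^bsub>R\<^esub> l) x - (fn_sm k x + fn_sm l x) \<in> J" if "k \<in> carrier R" "l \<in> carrier R"
      by (rule ev_J) (use that in \<open>simp add: evs scal_def smult_l_distr\<close>)
    show "fn_sm (k \<otimes>\<^bsub>R\<^esub> l) x - fn_sm k (fn_sm l x) \<in> J" if "k \<in> carrier R" "l \<in> carrier R"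
      by (rule ev_J) (use that in \<open>simp add: evs scal_def smult_assoc1\<close>)
    show "fn_sm \<one>\<^bsub>R\<^esub> x - x \<in> J"
      by (rule ev_J) (simp add: evs scal_def)
    show "inv_fact n \<in> carrier R"
      by (rule inverse_factor_cancel(1)[OF field fact_nonzero zero_closed])
    show "inv_fact n \<odot>\<^bsub>V\<^esub> ([(fact n :: nat)] \<cdot>\<^bsub>V\<^esub> v) = v" if "v \<in> carrier V" for v
      by (rule V.inverse_factor_cancel(3)[OF field fact_nonzero that])
  qed
  show ?thesis by (rule sc.special_V)
qed

end

theorem theorem4p2:
  fixes R :: "('k, 'm) ring_scheme"
    and X :: "'x set"
    and N :: "'x \<Rightarrow> 'x \<Rightarrow> nat"
    and V :: "('k, 'v) conf_alg"
  assumes "field R"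
    and "\<forall>n::nat. n > 0 \<longrightarrow> [n] \<cdot>\<^bsub>R\<^esub> \<one>\<^bsub>R\<^esub> \<noteq> \<zero>\<^bsub>R\<^esub>"
    and "X \<noteq> {}"
    and "\<exists>M. \<forall>a\<in>X. \<forall>b\<in>X. N a b \<le> M"
    and "homomorphic_image R V (NovConf R X N)"
  shows "special R V"
proof -
  interpret F: field R by fact
  let ?A = "coeff_novikov R X N" and ?g = "total_gen R X N" and ?S = "gen_series R X N ` X"
  interpret A: novikov_algebra R ?A by (rule F.coeff_novikov_algebra)
  obtain M where M: "\<And>a b. a \<in> X \<Longrightarrow> b \<in> X \<Longrightarrow> N a b \<le> M" using assms(4) by blast
  interpret V: conformal_algebra R V using assms(5) by (simp add: homomorphic_image_def)
  let ?E = "distributions R ?A"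
  obtain f0 where f0: "f0 \<in> conf_hom R (?E\<lparr>carrier := conf_subalgebra R ?E hull ?S\<rparr>) V"
    "f0 ` (conf_subalgebra R ?E hull ?S) = carrier V"
    using assms(5) by (auto simp: homomorphic_image_def NovConf_def Let_def)
  have ser: "gen_series R X N a = (\<lambda>i. ?g (a, - i - 1))" if "a \<in> X" for a
    using that by (simp add: gen_series_def total_gen_def)
  interpret distribution_image R ?A V ?g M ?S f0
  proof
    show "[n] \<cdot>\<^bsub>R\<^esub> \<one>\<^bsub>R\<^esub> \<noteq> \<zero>\<^bsub>R\<^esub>" if "n > 0" for n :: nat using assms(2) that by blast
    show "?g b \<in> carrier ?A" for b by (rule F.total_gen_closed)
    show "A.ev ?g ((nabla ^^ M) (\<lambda>p q. fn_mul (fn_gen (a, p)) (fn_gen (b, q))) m n) = \<zero>\<^bsub>?A\<^esub>" for a b m n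
      by (rule F.coeff_local[OF M])
    show "?S \<subseteq> range (\<lambda>a i. ?g (a, - i - 1))" using ser by auto
    show "(\<lambda>i. ?g (a, - i - 1)) \<in> insert (\<lambda>i. \<zero>\<^bsub>?A\<^esub>) ?S" for a
      by (cases "a \<in> X") (auto simp only: ser[symmetric], simp add: total_gen_def)
    show "f0 \<in> conf_hom R (?E\<lparr>carrier := conf_subalgebra R ?E hull ?S\<rparr>) V" by (rule f0)
    show "f0 ` (conf_subalgebra R ?E hull ?S) = carrier V" by (rule f0)
  qed
  show ?thesis by (rule image_special)
qed

end
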